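(* Assume the Gaussian prior, the infinite-channel regime and the asymptotic Lipschitz condition. Then the sequence $\{(\mathbf K^{(2,n)},\dots,\mathbf K^{(L+1,n)})\}_{n\ge1}$ satisfies a large deviation principle on $\mathcal S^+_{D_2}\times\dots\times\mathcal S^+_{D_{L+1}}$ with speed $n$ and good rate function $$I_{2,\dots,L+1}(Q_2,\dots,Q_{L+1})=\alpha_1 I_1(Q_2\mid\mathbf K^{(1)})+\sum_{\ell=2}^{L}\alpha_\ell I_\ell(Q_{\ell+1}\mid Q_\ell),$$ where for $Q_1\in\mathcal S^+_{D_\ell}$, $Q_2\in\mathcal S^+_{D_{\ell+1}}$, $$I_\ell(Q_2\mid Q_1)=\sup_{Q_0\in\mathcal S_{D_{\ell+1}}}\Big\{\operatorname{tr}(Q_0^\top Q_2)-\log\int_{\mathbb R^{D_\ell}}e^{\operatorname{tr}(Q_0^\top G^{(\ell)}(z))}\,\mathcal N(dz\mid\mathbf 0,Q_1)\Big\}.$$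
   Context: Convolutional network. Fix integers $L\ge1$, $P\ge1$, channel numbers $C_0,\dots,C_{L+1}\ge1$, spatial sizes $N_0,\dots,N_{L+1}\ge1$, a measurable activation $\sigma:\mathbb R\to\mathbb R$, finite nonempty index sets $\mathcal M_\ell$ of cardinality $M_\ell$ ($\ell=0,\dots,L$), measurable "patch extractors" $R^{(i,\ell)}=(R^{(i,\ell)}_m)_{m\in\mathcal M_\ell}:\mathbb R^{N_\ell}\to\mathbb R^{M_\ell}$ ($\ell=0,\dots,L$, $i=1,\dots,N_{\ell+1}$), and constants $\lambda_\ell>0$. Gaussian prior: the weights $W^{(\ell)}_{m,c',c}$ ($\ell=0,\dots,L$, $m\in\mathcal M_\ell$, $c'=1,\dots,C_\ell$, $c=1,\dots,C_{\ell+1}$) are independent with $W^{(\ell)}_{m,c',c}\sim\mathcal N(0,\lambda_\ell^{-1})$. For an input $\mathbf x=(x_{c,i})\in\mathbb R^{C_0\times N_0}$ write $x_{c,:}=(x_{c,1},\dots,x_{c,N_0})$. The preactivations are $h^{(1)}_{c,i}(\mathbf x)=\frac{1}{\sqrt{M_0C_0}}\sum_{c'=1}^{C_0}\sum_{m\in\mathcal M_0}W^{(0)}_{m,c',c}R^{(i,0)}_m(x_{c',:})$ and, for $\ell=1,\dots,L$, $h^{(\ell+1)}_{c,i}(\mathbf x)=\frac{1}{\sqrt{M_\ell C_\ell}}\sum_{c'=1}^{C_\ell}\sum_{m\in\mathcal M_\ell}W^{(\ell)}_{m,c',c}\,\sigma\big(R^{(i,\ell)}_m(h^{(\ell)}_{c',:}(\mathbf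 x))\big)$, $c=1,\dots,C_{\ell+1}$, $i=1,\dots,N_{\ell+1}$, where $h^{(\ell)}_{c,:}=(h^{(\ell)}_{c,1},\dots,h^{(\ell)}_{c,N_\ell})$. Fix inputs $\mathbf x_1,\dots,\mathbf x_P$ with entries $x_{\mu,c,i}$ and set $H^{(\ell)}_{c,i,\mu}=h^{(\ell)}_{c,i}(\mathbf x_\mu)$. Set $D_\ell=N_\ell P$. Index pairs $(i,\mu)$ are flattened to the single index $\mu+(i-1)P$, so arrays indexed by $((i,\mu),(j,\nu))$ are identified with $D_\ell\times D_\ell$ matrices and $z=(z_{i,\mu})\in\mathbb R^{N_\ell\times P}$ with vectors of $\mathbb R^{D_\ell}$; $z_{:,\mu}=(z_{1,\mu},\dots,z_{N_\ell,\mu})$. $\mathcal S^+_D$ denotes the symmetric positive semidefinite $D\times D$ matrices and $\mathcal S_D$ the symmetric ones. For $\ell=1,\dots,L$ define $G^{(\ell)}:\mathbb R^{D_\ell}\to\mathcal S^+_{D_{\ell+1}}$ by $[G^{(\ell)}(z)]_{(i,\mu),(j,\nu)}=\frac{1}{\lambda_\ell M_\ell}\sum_{m\in\mathcal M_\ell}\sigma(R^{(i,\ell)}_m(z_{:,\mu}))\,\sigma(R^{(j,\ell)}_m(z_{:,\nu}))$. Define $\mathbf K^{(1)}_{(i,\mu),(j,\nu)}=\frac{1}{\lambda_0C_0M_0}\sum_{c=1}^{C_0}\sum_{m\in\mathcal M_0}R^{(i,0)}_m(x_{\mu,c,:})R^{(j,0)}_m(x_{\nu,c,:})$ and, for $\ell=1,\dots,L$,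 $\mathbf K^{(\ell+1,C_\ell)}=\frac1{C_\ell}\sum_{c=1}^{C_\ell}G^{(\ell)}(H^{(\ell)}_{c,:,:})$. $\mathcal N(dz\mid\mathbf 0,Q)$ is the centered Gaussian law on $\mathbb R^{D_\ell}$ with covariance $Q$. Infinite-channel regime: $L,N_0,\dots,N_{L+1},C_0,C_{L+1},P$ are fixed, while for $\ell=1,\dots,L$, $C_\ell=C_\ell(n)$ depends on $n\ge1$ with $C_\ell(n)/n\to\alpha_\ell\in(0,\infty)$; write $\mathbf K^{(\ell+1,n)}=\mathbf K^{(\ell+1,C_\ell(n))}$. Asymptotic Lipschitz condition: $\sigma$ is continuous and $|\sigma(x)-\sigma(y)|\le L_\sigma|x-y|+\rho_\sigma(x)+\rho_\sigma(y)$ for all $x,y\in\mathbb R$, with $L_\sigma\ge0$ and $\rho_\sigma$ locally bounded, $\rho_\sigma(x)=o(|x|)$ as $|x|\to\infty$; each $R^{(i,\ell)}$ ($\ell=1,\dots,L$) is continuous and $\|R^{(i,\ell)}(z)-R^{(i,\ell)}(z')\|\le L_R\|z-z'\|+\rho_R(z)+\rho_R(z')$ for all $z,z'\in\mathbb R^{N_\ell}$, with $\rho_R$ locally bounded and $\rho_R(z)=o(\|z\|)$. Large deviation principle (LDP) with speed $n$ and rate function $I$ (a lower semicontinuous map into $[0,\infty]$) for random elements $X_n$ of a metric space: $\liminf_n\frac1n\log\mathbb P(X_n\in O)\ge-\inf_O I$ for every open $O$ and $\limsup_n\frac1n\log\mathbb P(X_n\in F)\le-\inf_F I$ for every closed $F$;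 $I$ is good if its sublevel sets are compact. *)

theory Defs
  imports "HOL-Probability.Probability" "Jordan_Normal_Form.Matrix"
begin

definition mat_trace :: "real mat \<Rightarrow> real" where
  "mat_trace Q = (\<Sum>i<dim_row Q. Q $$ (i, i))"

definition sym_mats :: "nat \<Rightarrow> real mat set" where
  "sym_mats D = {Q. Q \<in> carrier_mat D D \<and> transpose_mat Q = Q}"

definition psd_mats :: "nat \<Rightarrow> real mat set" where
  "psd_mats D = {Q. Q \<in> sym_mats D \<and> (\<forall>v \<in> carrier_vec D. 0 \<le> v \<bullet> (Q *\<^sub>v v))}"

text \<open>Restriction of a vector (nat => real) to the coordinates 1..N (zero elsewhere):
  a vector of R^N with the paper's 1-based indexing.\<close>
definition vrest :: "nat \<Rightarrow> (nat \<Rightarrow> real) \<Rightarrow> nat \<Rightarrow> real" where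
  "vrest N z = (\<lambda>j. if j \<in> {1..N} then z j else 0)"

definition vnorm :: "nat \<Rightarrow> (nat \<Rightarrow> real) \<Rightarrow> real" where
  "vnorm N z = sqrt (\<Sum>j\<in>{1..N}. (z j)\<^sup>2)"

definition pnorm :: "'m set \<Rightarrow> ('m \<Rightarrow> real) \<Rightarrow> real" where
  "pnorm Ms r = sqrt (\<Sum>m\<in>Ms. (r m)\<^sup>2)"

text \<open>Flattening: the 0-based flat index a corresponds to the pair (i,mu) with
  i = a div P + 1, mu = a mod P + 1 (i.e. a + 1 = mu + (i-1) P).\<close>
definition col :: "nat \<Rightarrow> nat \<Rightarrow> (nat \<Rightarrow> real) \<Rightarrow> nat \<Rightarrow> nat \<Rightarrow> real" where
  "col N P z mu = vrest N (\<lambda>i. z (mu - 1 + (i - 1) * P))"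

text \<open>Weights: W (l, m, c', c). Patch extractors: R l i z m = R^{(i,l)}_m(z).
  Inputs: x mu c i = x_{mu,c,i}. C l = C_l, N l = N_l, Ms l = \<M>_l.\<close>
primrec preact :: "(real \<Rightarrow> real) \<Rightarrow> (nat \<Rightarrow> nat \<Rightarrow> (nat \<Rightarrow> real) \<Rightarrow> 'm \<Rightarrow> real)
    \<Rightarrow> (nat \<Rightarrow> 'm set) \<Rightarrow> (nat \<Rightarrow> nat) \<Rightarrow> (nat \<Rightarrow> nat) \<Rightarrow> (nat \<Rightarrow> nat \<Rightarrow> nat \<Rightarrow> real)
    \<Rightarrow> (nat \<times> 'm \<times> nat \<times> nat \<Rightarrow> real) \<Rightarrow> nat \<Rightarrow> nat \<Rightarrow> nat \<Rightarrow> nat \<Rightarrow> real" where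
  "preact \<sigma> R Ms C N x W 0 = (\<lambda>c i mu. 0)"
| "preact \<sigma> R Ms C N x W (Suc l) = (\<lambda>c i mu.
     if l = 0 then
       (1 / sqrt (real (card (Ms 0)) * real (C 0))) *
         (\<Sum>c'\<in>{1..C 0}. \<Sum>m\<in>Ms 0. W (0, m, c', c) * R 0 i (vrest (N 0) (x mu c')) m)
     else
       (1 / sqrt (real (card (Ms l)) * real (C l))) *
         (\<Sum>c'\<in>{1..C l}. \<Sum>m\<in>Ms l.
            W (l, m, c', c) * \<sigma> (R l i (vrest (N l) (\<lambda>j. preact \<sigma> R Ms C N x W l c' j mu)) m)))"

text \<open>H^{(l)}_{c,:,:} as a flat vector of R^{D_l}, D_l = N_l P (0-based flat index).\<close>
definition Hflat :: "(real \<Rightarrow> real) \<Rightarrow> (nat \<Rightarrow> nat \<Rightarrow> (nat \<Rightarrow> real) \<Rightarrow> 'm \<Rightarrow> real)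
    \<Rightarrow> (nat \<Rightarrow> 'm set) \<Rightarrow> (nat \<Rightarrow> nat) \<Rightarrow> (nat \<Rightarrow> nat) \<Rightarrow> nat \<Rightarrow> (nat \<Rightarrow> nat \<Rightarrow> nat \<Rightarrow> real)
    \<Rightarrow> (nat \<times> 'm \<times> nat \<times> nat \<Rightarrow> real) \<Rightarrow> nat \<Rightarrow> nat \<Rightarrow> nat \<Rightarrow> real" where
  "Hflat \<sigma> R Ms C N P x W l c = (\<lambda>a. preact \<sigma> R Ms C N x W l c (a div P + 1) (a mod P + 1))"

definition Gmap :: "(real \<Rightarrow> real) \<Rightarrow> (nat \<Rightarrow> nat \<Rightarrow> (nat \<Rightarrow> real) \<Rightarrow> 'm \<Rightarrow> real)
    \<Rightarrow> (nat \<Rightarrow> 'm set) \<Rightarrow> (nat \<Rightarrow> nat) \<Rightarrow> nat \<Rightarrow> (nat \<Rightarrow> real) \<Rightarrow> nat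
    \<Rightarrow> (nat \<Rightarrow> real) \<Rightarrow> real mat" where
  "Gmap \<sigma> R Ms N P lam l z = mat (N (Suc l) * P) (N (Suc l) * P) (\<lambda>(a, b).
     (1 / (lam l * real (card (Ms l)))) *
       (\<Sum>m\<in>Ms l. \<sigma> (R l (a div P + 1) (col (N l) P z (a mod P + 1)) m) *
                   \<sigma> (R l (b div P + 1) (col (N l) P z (b mod P + 1)) m)))"

definition K1 :: "(nat \<Rightarrow> nat \<Rightarrow> (nat \<Rightarrow> real) \<Rightarrow> 'm \<Rightarrow> real) \<Rightarrow> (nat \<Rightarrow> 'm set)
    \<Rightarrow> nat \<Rightarrow> (nat \<Rightarrow> nat) \<Rightarrow> nat \<Rightarrow> (nat \<Rightarrow> real) \<Rightarrow> (nat \<Rightarrow> nat \<Rightarrow> nat \<Rightarrow> real) \<Rightarrow> real mat" where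
  "K1 R Ms C0 N P lam x = mat (N 1 * P) (N 1 * P) (\<lambda>(a, b).
     (1 / (lam 0 * real C0 * real (card (Ms 0)))) *
       (\<Sum>c\<in>{1..C0}. \<Sum>m\<in>Ms 0.
          R 0 (a div P + 1) (vrest (N 0) (x (a mod P + 1) c)) m *
          R 0 (b div P + 1) (vrest (N 0) (x (b mod P + 1) c)) m))"

definition Kmat :: "(real \<Rightarrow> real) \<Rightarrow> (nat \<Rightarrow> nat \<Rightarrow> (nat \<Rightarrow> real) \<Rightarrow> 'm \<Rightarrow> real)
    \<Rightarrow> (nat \<Rightarrow> 'm set) \<Rightarrow> (nat \<Rightarrow> nat) \<Rightarrow> (nat \<Rightarrow> nat) \<Rightarrow> nat \<Rightarrow> (nat \<Rightarrow> real)
    \<Rightarrow> (nat \<Rightarrow> nat \<Rightarrow> nat \<Rightarrow> real) \<Rightarrow> (nat \<times> 'm \<times> nat \<times> nat \<Rightarrow> real) \<Rightarrow> nat \<Rightarrow> real mat" where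
  "Kmat \<sigma> R Ms C N P lam x W l =
     mat (N (Suc l) * P) (N (Suc l) * P) (\<lambda>(a, b).
       (1 / real (C l)) *
         (\<Sum>c\<in>{1..C l}. Gmap \<sigma> R Ms N P lam l (Hflat \<sigma> R Ms C N P x W l c) $$ (a, b)))"

definition weight_index :: "nat \<Rightarrow> (nat \<Rightarrow> 'm set) \<Rightarrow> (nat \<Rightarrow> nat) \<Rightarrow> (nat \<times> 'm \<times> nat \<times> nat) set" where
  "weight_index L Ms C = {(l, m, c', c). l \<le> L \<and> m \<in> Ms l \<and> c' \<in> {1..C l} \<and> c \<in> {1..C (Suc l)}}"

definition weight_prior :: "nat \<Rightarrow> (nat \<Rightarrow> 'm set) \<Rightarrow> (nat \<Rightarrow> nat) \<Rightarrow> (nat \<Rightarrow> real)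
    \<Rightarrow> (nat \<times> 'm \<times> nat \<times> nat \<Rightarrow> real) measure" where
  "weight_prior L Ms C lam =
     PiM (weight_index L Ms C) (\<lambda>(l, m, c', c). density lborel (normal_density 0 (1 / sqrt (lam l))))"

text \<open>N(0,Q) is the law of A xi with xi standard Gaussian in R^D and A A^T = Q;
  it does not depend on the choice of such A.  We define integrals of nonnegative
  functions against N(dz | 0, Q).\<close>
definition gauss_nn_integral :: "nat \<Rightarrow> real mat \<Rightarrow> ((nat \<Rightarrow> real) \<Rightarrow> ennreal) \<Rightarrow> ennreal" where
  "gauss_nn_integral D Q f =
     (let A = (SOME A. A \<in> carrier_mat D D \<and> A * transpose_mat A = Q) in
      \<integral>\<^sup>+ xi. f (\<lambda>k. \<Sum>j<D. A $$ (k, j) * xi j) \<partial>(PiM {..<D} (\<lambda>_. density lborel std_normal_density)))"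

definition ln_ennreal :: "ennreal \<Rightarrow> ereal" where
  "ln_ennreal x = (if x = \<infinity> then \<infinity> else if x = 0 then - \<infinity> else ereal (ln (enn2real x)))"

definition rate_l :: "(real \<Rightarrow> real) \<Rightarrow> (nat \<Rightarrow> nat \<Rightarrow> (nat \<Rightarrow> real) \<Rightarrow> 'm \<Rightarrow> real)
    \<Rightarrow> (nat \<Rightarrow> 'm set) \<Rightarrow> (nat \<Rightarrow> nat) \<Rightarrow> nat \<Rightarrow> (nat \<Rightarrow> real) \<Rightarrow> nat
    \<Rightarrow> real mat \<Rightarrow> real mat \<Rightarrow> ereal" where
  "rate_l \<sigma> R Ms N P lam l Q2 Q1 =
     (SUP Q0 \<in> sym_mats (N (Suc l) * P).
        ereal (mat_trace (transpose_mat Q0 * Q2))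
        - ln_ennreal (gauss_nn_integral (N l * P) Q1
             (\<lambda>z. ennreal (exp (mat_trace (transpose_mat Q0 * Gmap \<sigma> R Ms N P lam l z))))))"

text \<open>Tuples (Q_2, ..., Q_{L+1}) are lists Qs of length L with Qs ! k = Q_{k+2}.\<close>
definition tuple_space :: "nat \<Rightarrow> (nat \<Rightarrow> nat) \<Rightarrow> nat \<Rightarrow> real mat list set" where
  "tuple_space L N P = {Qs. length Qs = L \<and> (\<forall>k<L. Qs ! k \<in> psd_mats (N (k + 2) * P))}"

definition tuple_dist :: "nat \<Rightarrow> (nat \<Rightarrow> nat) \<Rightarrow> nat \<Rightarrow> real mat list \<Rightarrow> real mat list \<Rightarrow> real" where
  "tuple_dist L N P Qs Qs' =
     sqrt (\<Sum>k<L. \<Sum>a<N (k + 2) * P. \<Sum>b<N (k + 2) * P. (Qs ! k $$ (a, b) - Qs' ! k $$ (a, b))\<^sup>2)"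

definition tuple_topology :: "nat \<Rightarrow> (nat \<Rightarrow> nat) \<Rightarrow> nat \<Rightarrow> real mat list topology" where
  "tuple_topology L N P = Metric_space.mtopology (tuple_space L N P) (tuple_dist L N P)"

definition rate_total :: "(real \<Rightarrow> real) \<Rightarrow> (nat \<Rightarrow> nat \<Rightarrow> (nat \<Rightarrow> real) \<Rightarrow> 'm \<Rightarrow> real)
    \<Rightarrow> (nat \<Rightarrow> 'm set) \<Rightarrow> nat \<Rightarrow> (nat \<Rightarrow> nat) \<Rightarrow> nat \<Rightarrow> (nat \<Rightarrow> real) \<Rightarrow> nat \<Rightarrow> (nat \<Rightarrow> real)
    \<Rightarrow> real mat \<Rightarrow> real mat list \<Rightarrow> ereal" where
  "rate_total \<sigma> R Ms L N P lam C0 \<alpha> Kone Qs =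
     ereal (\<alpha> 1) * rate_l \<sigma> R Ms N P lam 1 (Qs ! 0) Kone
     + (\<Sum>l\<in>{2..L}. ereal (\<alpha> l) * rate_l \<sigma> R Ms N P lam l (Qs ! (l - 1)) (Qs ! (l - 2)))"

definition ln_prob :: "real \<Rightarrow> ereal" where
  "ln_prob p = (if p = 0 then - \<infinity> else ereal (ln p))"

definition good_LDP :: "'a topology \<Rightarrow> (nat \<Rightarrow> 'b measure) \<Rightarrow> (nat \<Rightarrow> 'b \<Rightarrow> 'a) \<Rightarrow> ('a \<Rightarrow> ereal) \<Rightarrow> bool" where
  "good_LDP T M X I \<longleftrightarrow>
     (\<forall>n. \<forall>w \<in> space (M n). X n w \<in> topspace T) \<and>
     (\<forall>x \<in> topspace T. 0 \<le> I x) \<and>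
     (\<forall>c::real. closedin T {x \<in> topspace T. I x \<le> ereal c}) \<and>
     (\<forall>c::real. compactin T {x \<in> topspace T. I x \<le> ereal c}) \<and>
     (\<forall>U. openin T U \<longrightarrow>
        - (INF x \<in> U. I x) \<le>
          liminf (\<lambda>n. ereal (1 / real n) * ln_prob (measure (M n) {w \<in> space (M n). X n w \<in> U}))) \<and>
     (\<forall>F. closedin T F \<longrightarrow>
        limsup (\<lambda>n. ereal (1 / real n) * ln_prob (measure (M n) {w \<in> space (M n). X n w \<in> F}))
          \<le> - (INF x \<in> F. I x))"

end

theory Submission
  imports Defs
begin

text \<open>
  Conditionally on the earlier layers the columns of preactivations of a layer are independent centred
  Gaussian vectors with the previous kernel as covariance, so that the kernels form a Markov chain: the
  next kernel is the average of \<open>C\<close> independent copies of \<open>g (A \<xi>)\<close>, with \<open>\<xi>\<close> standard Gaussian, \<open>g\<close> of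
  quadratic growth, and \<open>A A\<^sup>T\<close> the current kernel. It therefore suffices to bound, on the exponential
  scale, the probability that one average lies near a point, uniformly for \<open>A A\<^sup>T\<close> near a given matrix,
  and to multiply these bounds along the chain; with exponential tightness they give the full principle.

  The upper bound is Chernoff's. Since \<open>g\<close> is only quadratic, exponential moments need not be finite;
  replacing a tilt \<open>t\<close> by \<open>s t\<close> with \<open>s < 1\<close> makes the bound stable under perturbation of \<open>A\<close>.
  The lower bound is Cramer's, without any steepness assumption: the law is truncated to events on which
  the features are bounded and the Legendre functional is penalised by \<open>\<kappa> |t|\<^sup>2\<close>, so that a maximiser exists
  and the tilted mean misses the target by \<open>2 \<kappa> t\<close> only. Truncation is also what allows \<open>A\<close> to vary.
  Passing from \<open>A\<close> to \<open>A A\<^sup>T\<close> uses that the set of factors of a matrix is compact.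
\<close>

section \<open>Factorisation of positive semidefinite matrices\<close>

text \<open>The covariance of a layer is itself random, so a Cramer bound at one fixed covariance
  says nothing about the next kernel: it must hold with the same constants on a whole neighbourhood
  of the current kernel. Two obstacles shape the proof of this. First, kernels may be singular, so
  the Gaussian laws need not have densities and cannot be compared by likelihood ratios; all vectors
  are therefore written as \<open>A \<xi>\<close> with one fixed standard Gaussian, and only the
  argument of the feature is perturbed. Second, features grow quadratically, and an error of order
  |\<xi>|^2 with a fixed constant could turn a finite exponential moment into an infinite one. The
  asymptotic Lipschitz condition gives the error \<epsilon> (1 + |\<xi>|^2) with \<epsilon> as small
  as desired, and a standard Gaussian integrates exp (|\<xi>|^2 / 4). The first kernel is
  deterministic, which gives the chain a fixed starting point.\<close>

lemma bounded_coords_subseq: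
  fixes f :: "nat \<Rightarrow> 'i \<Rightarrow> real"
  assumes "finite I" and "\<And>i n. i \<in> I \<Longrightarrow> \<bar>f n i\<bar> \<le> B"
  shows "\<exists>l s. strict_mono s \<and> (\<forall>i\<in>I. (\<lambda>n. f (s n) i) \<longlonglongrightarrow> l i)"
  using assms
proof (induction I rule: finite_induct)
  case empty
  show ?case by (rule exI, rule exI[of _ id]) (auto simp: strict_mono_def)
next
  case (insert i I)
  then obtain l s where s: "strict_mono s" "\<forall>i\<in>I. (\<lambda>n. f (s n) i) \<longlonglongrightarrow> l i"
    by fastforce
  have "bounded (range (\<lambda>n. f (s n) i))"
    using insert.prems by (auto simp: bounded_iff)
  then obtain a r where r: "strict_mono r" "((\<lambda>n. f (s n) i) \<circ> r) \<longlonglongrightarrow> a"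
    using bounded_imp_convergent_subsequence by blast
  show ?case
  proof (intro exI conjI ballI)
    show "strict_mono (s \<circ> r)"
      using s(1) r(1) by (rule strict_mono_o)
    fix k assume "k \<in> insert i I"
    then show "(\<lambda>n. f ((s \<circ> r) n) k) \<longlonglongrightarrow> (l(i := a)) k"
      using r s(2) insert.hyps(2) LIMSEQ_subseq_LIMSEQ[OF _ r(1)]
      by (cases "k = i") (fastforce simp: o_def)+
  qed
qed

text \<open>Cholesky factorisation, eliminating the last coordinate; in the degenerate case \<open>q D D = 0\<close>
  positivity forces the whole last row to vanish.\<close>

lemma psd_factorization:
  fixes q :: "nat \<Rightarrow> nat \<Rightarrow> real"
  assumes "\<And>i j. i < D \<Longrightarrow> j < D \<Longrightarrow> q i j = q j i"
    and "\<And>v. 0 \<le> (\<Sum>i<D. \<Sum>j<D. v i * q i j * v j)"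
  shows "\<exists>a. \<forall>i<D. \<forall>j<D. (\<Sum>k<D. a i k * a j k) = q i j"
  using assms
proof (induction D arbitrary: q)
  case 0
  then show ?case by simp
next
  case (Suc D)
  have sym: "q i j = q j i" if "i \<le> D" "j \<le> D" for i j
    using Suc.prems(1)[of i j] that by simp
  have psd: "0 \<le> (\<Sum>i<D. \<Sum>j<D. v i * q i j * v j) + 2 * c * (\<Sum>i<D. v i * q i D) + c\<^sup>2 * q D D" for v c
  proof -
    have "(\<Sum>i<Suc D. \<Sum>j<Suc D. (v(D := c)) i * q i j * (v(D := c)) j)
        = (\<Sum>i<D. (\<Sum>j<D. v i * q i j * v j) + v i * q i D * c) + ((\<Sum>j<D. c * q D j * v j) + c * q D D * c)"
      by (simp cong: sum.cong_simp)
    also have "(\<Sum>j<D. c * q D j * v j) = c * (\<Sum>i<D. v i * q i D)"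
      unfolding sum_distrib_left by (rule sum.cong) (auto simp: sym algebra_simps)
    also have "(\<Sum>i<D. (\<Sum>j<D. v i * q i j * v j) + v i * q i D * c)
        = (\<Sum>i<D. \<Sum>j<D. v i * q i j * v j) + c * (\<Sum>i<D. v i * q i D)"
      unfolding sum_distrib_left sum.distrib by (simp add: algebra_simps)
    finally show ?thesis
      using Suc.prems(2)[of "v(D := c)"] by (simp add: power2_eq_square algebra_simps)
  qed
  have qDD: "0 \<le> q D D" using psd[of "\<lambda>_. 0" 1] by simp
  \<comment> \<open>The Schur complement of the last entry. If \<open>q D D = 0\<close>, division by
    zero yields zero and \<open>r\<close> is \<open>q\<close> itself, which fits because the last
    row then vanishes.\<close>
  define r where "r i j = q i j - q i D * q j D / q D D" for i j
  have zero: "q i D = 0" if "q D D = 0" "i < D" for i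
  proof (rule ccontr)
    assume ne: "q i D \<noteq> 0"
    have *: "0 \<le> q i i + 2 * c * q i D" for c
    proof -
      have \<delta>: "(\<Sum>j<D. (if j = i then 1 else 0) * g j) = g i" for g :: "nat \<Rightarrow> real"
        using that by (simp add: if_distrib[of "\<lambda>x. x * _"] cong: if_cong)
      have "(\<Sum>k<D. \<Sum>j<D. (if k = i then 1 else 0) * q k j * (if j = i then 1 else 0))
          = (\<Sum>k<D. (if k = i then 1 else 0) * (\<Sum>j<D. (if j = i then 1 else 0) * q k j))"
        by (simp only: sum_distrib_left mult_ac)
      then show ?thesis
        using psd[of "\<lambda>k. if k = i then 1 else 0" c] that by (simp only: \<delta>)
    qed
    \<comment> \<open>The value chosen for \<open>c\<close> makes the right-hand side equal to
      -1.\<close>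
    show False using *[of "- (q i i + 1) / (2 * q i D)"] ne by (simp add: field_simps)
  qed
  have "\<exists>a. \<forall>i<D. \<forall>j<D. (\<Sum>k<D. a i k * a j k) = r i j"
  proof (rule Suc.IH)
    show "r i j = r j i" if "i < D" "j < D" for i j
      using that sym[of i j] by (simp add: r_def)
    fix v :: "nat \<Rightarrow> real"
    let ?b = "\<Sum>i<D. v i * q i D"
    have "(\<Sum>i<D. \<Sum>j<D. v i * r i j * v j)
        = (\<Sum>i<D. \<Sum>j<D. v i * q i j * v j) - ?b * ?b / q D D"
      unfolding r_def sum_product sum_divide_distrib sum_subtractf[symmetric]
      by (intro sum.cong refl) (simp add: algebra_simps)
    moreover have "0 \<le> (\<Sum>i<D. \<Sum>j<D. v i * q i j * v j) - ?b * ?b / q D D"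
    proof (cases "q D D = 0")
      case True
      then show ?thesis using psd[of v 0] by simp
    next
      \<comment> \<open>The substituted last coordinate minimises the form, and the minimum is the
        form of the Schur complement.\<close>
      case False
      then show ?thesis
        using psd[of v "- ?b / q D D"] by (simp add: field_simps power2_eq_square)
    qed
    ultimately show "0 \<le> (\<Sum>i<D. \<Sum>j<D. v i * r i j * v j)" by simp
  qed
  then obtain a where a: "\<And>i j. i < D \<Longrightarrow> j < D \<Longrightarrow> (\<Sum>k<D. a i k * a j k) = r i j"
    by blast
  define a' where "a' i k = (if k = D then q i D / sqrt (q D D) else if i = D then 0 else a i k)" for i k
  have "(\<Sum>k<Suc D. a' i k * a' j k) = q i j" if ij: "i < Suc D" "j < Suc D" for i j
  proof -
    have "(\<Sum>k<Suc D. a' i k * a' j k)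
        = (if i = D \<or> j = D then 0 else r i j) + q i D * q j D / q D D"
      using a[of i j] ij qDD by (auto simp: a'_def cong: sum.cong_simp)
    also have "\<dots> = q i j"
      using ij zero[of i] zero[of j] sym[of D j] by (auto simp: r_def less_Suc_eq)
    finally show ?thesis .
  qed
  then show ?case by blast
qed

section \<open>Cramer's lower bound by truncation and penalisation\<close>

text \<open>Markov's inequality for the exponential of the sum; independence turns its expectation
  into a power. The function \<open>f\<close> already contains the tilt, the level and the centring,
  so the exponential upper bounds below are instances with a suitable \<open>f\<close>.\<close>

lemma (in prob_space) chernoff_PiM:
  fixes f :: "'a \<Rightarrow> real"
  assumes [measurable]: "f \<in> borel_measurable M"
    and z: "(\<integral>\<^sup>+\<omega>. ennreal (exp (f \<omega>)) \<partial>M) \<le> ennreal z" "0 \<le> z" and I: "finite I"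
  shows "measure (PiM I (\<lambda>_. M)) {\<omega> \<in> space (PiM I (\<lambda>_. M)). 0 \<le> (\<Sum>c\<in>I. f (\<omega> c))} \<le> z ^ card I"
proof -
  interpret P: product_prob_space "\<lambda>_. M" I by standard
  let ?A = "{\<omega> \<in> space (PiM I (\<lambda>_. M)). 0 \<le> (\<Sum>c\<in>I. f (\<omega> c))}"
  have "emeasure (PiM I (\<lambda>_. M)) ?A = (\<integral>\<^sup>+\<omega>. indicator ?A \<omega> \<partial>PiM I (\<lambda>_. M))"
    by (subst nn_integral_indicator) auto
  also have "\<dots> \<le> (\<integral>\<^sup>+\<omega>. (\<Prod>c\<in>I. ennreal (exp (f (\<omega> c)))) \<partial>PiM I (\<lambda>_. M))"
    by (intro nn_integral_mono)
       (auto simp: indicator_def prod_ennreal exp_sum[OF I, symmetric] simp flip: ennreal_1)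
  also have "\<dots> = (\<Prod>c\<in>I. (\<integral>\<^sup>+\<omega>. ennreal (exp (f \<omega>)) \<partial>M))"
    by (intro P.product_nn_integral_prod I) auto
  also have "\<dots> \<le> (\<Prod>c\<in>I. ennreal z)"
    by (intro prod_mono_ennreal z)
  also have "\<dots> = ennreal (z ^ card I)"
    using z by (simp add: ennreal_power)
  finally show ?thesis
    using z by (simp add: P.P.emeasure_eq_measure)
qed

text \<open>The change of measure for independent copies: tilting each copy multiplies the
  densities. The two measures are compared on measurable rectangles, where the integral
  factorises.\<close>

lemma (in prob_space) PiM_density:
  assumes [measurable]: "g \<in> borel_measurable M" and d: "prob_space (density M g)" and I: "finite I"
  shows "PiM I (\<lambda>_. density M g) = density (PiM I (\<lambda>_. M)) (\<lambda>\<omega>. \<Prod>c\<in>I. g (\<omega> c))"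
proof -
  interpret D: product_prob_space "\<lambda>_. density M g" I
    using d by (simp add: product_prob_space_def product_prob_space_axioms_def product_sigma_finite_def
        prob_space_imp_sigma_finite)
  interpret P: product_prob_space "\<lambda>_. M" I by standard
  show ?thesis
  proof (rule D.PiM_eqI[symmetric, OF I])
    show "sets (density (PiM I (\<lambda>_. M)) (\<lambda>\<omega>. \<Prod>c\<in>I. g (\<omega> c))) = sets (PiM I (\<lambda>_. density M g))"
      by (simp cong: sets_PiM_cong)
    fix A assume "\<And>i. i \<in> I \<Longrightarrow> A i \<in> sets (density M g)"
    then have A[measurable]: "A i \<in> sets M" if "i \<in> I" for i using that by simp
    have "emeasure (density (PiM I (\<lambda>_. M)) (\<lambda>\<omega>. \<Prod>c\<in>I. g (\<omega> c))) (Pi\<^sub>E I A)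
        = (\<integral>\<^sup>+\<omega>. (\<Prod>c\<in>I. g (\<omega> c)) * indicator (Pi\<^sub>E I A) \<omega> \<partial>PiM I (\<lambda>_. M))"
      by (subst emeasure_density) (auto intro!: sets_PiM_I_finite I A)
    also have "\<dots> = (\<integral>\<^sup>+\<omega>. (\<Prod>c\<in>I. g (\<omega> c) * indicator (A c) (\<omega> c)) \<partial>PiM I (\<lambda>_. M))"
    proof (rule nn_integral_cong)
      fix \<omega> assume "\<omega> \<in> space (PiM I (\<lambda>_. M))"
      then have "indicator (Pi\<^sub>E I A) \<omega> = (\<Prod>c\<in>I. indicator (A c) (\<omega> c) :: ennreal)"
        using I by (auto simp: indicator_def space_PiM PiE_def Pi_def extensional_def prod_zero_iff split: if_splits)
      then show "(\<Prod>c\<in>I. g (\<omega> c)) * indicator (Pi\<^sub>E I A) \<omega> = (\<Prod>c\<in>I. g (\<omega> c) * indicator (A c) (\<omega> c))"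
        by (simp add: prod.distrib)
    qed
    also have "\<dots> = (\<Prod>c\<in>I. (\<integral>\<^sup>+\<omega>. g \<omega> * indicator (A c) \<omega> \<partial>M))"
      by (intro P.product_nn_integral_prod I) auto
    also have "\<dots> = (\<Prod>c\<in>I. emeasure (density M g) (A c))"
      by (intro prod.cong refl) (auto simp: emeasure_density)
    finally show "emeasure (density (PiM I (\<lambda>_. M)) (\<lambda>\<omega>. \<Prod>c\<in>I. g (\<omega> c))) (Pi\<^sub>E I A)
        = (\<Prod>c\<in>I. emeasure (density M g) (A c))" .
  qed
qed

text \<open>Second-order bound that replaces differentiation under the integral, both in the
  first-order condition at a maximiser and in the law of large numbers. For negative
  \<open>u = - x\<close> it follows from exp (-x) \<le> 1 / (1 + x + x^2 / 2) and (1 - x + x^2) (1 +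
  x + x^2 / 2) \<ge> 1.\<close>

lemma exp_le_quadratic:
  fixes u :: real
  assumes "\<bar>u\<bar> \<le> 1" shows "exp u \<le> 1 + u + u\<^sup>2"
proof (cases "0 \<le> u")
  case True then show ?thesis using exp_bound[of u] assms by simp
next
  case False
  define x where "x = - u"
  have x: "0 \<le> x" using False by (simp add: x_def)
  have pos: "0 < 1 + x + x\<^sup>2 / 2" using x by (intro add_pos_nonneg) auto
  have "1 \<le> 1 + (x\<^sup>2 / 2 + x ^ 3 / 2 + x ^ 4 / 2)"
    using x by (intro add_increasing2 add_nonneg_nonneg) auto
  also have "\<dots> = (1 - x + x\<^sup>2) * (1 + x + x\<^sup>2 / 2)"
    by (simp add: field_simps power2_eq_square power3_eq_cube power4_eq_xxxx)
  finally have "1 / (1 + x + x\<^sup>2 / 2) \<le> 1 - x + x\<^sup>2"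
    using pos by (simp add: divide_le_eq)
  moreover have "exp (- x) \<le> 1 / (1 + x + x\<^sup>2 / 2)"
    unfolding exp_minus inverse_eq_divide
    using exp_lower_Taylor_quadratic[OF x] pos by (intro divide_left_mono) (auto intro: mult_pos_pos)
  ultimately show ?thesis by (simp add: x_def)
qed

section \<open>Truncated exponential moments and the penalised Legendre functional\<close>

locale truncated_cramer = prob_space M for M :: "'a measure" +
  fixes J :: "'j set" and Y :: "'a \<Rightarrow> 'j \<Rightarrow> real" and E :: "nat \<Rightarrow> 'a set" and b :: "nat \<Rightarrow> real"
  assumes finite_J: "finite J"
    and Y_meas[measurable]: "\<And>j. j \<in> J \<Longrightarrow> (\<lambda>\<omega>. Y \<omega> j) \<in> borel_measurable M"
    and E_sets[measurable]: "\<And>r. E r \<in> sets M"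
    and E_mono: "incseq E"
    and E_cover: "(\<Union>r. E r) = space M"
    and E_half: "1 / 2 \<le> prob (E 0)"
    and b_nonneg: "\<And>r. 0 \<le> b r"
    and Y_bdd: "\<And>r \<omega> j. \<omega> \<in> E r \<Longrightarrow> j \<in> J \<Longrightarrow> \<bar>Y \<omega> j\<bar> \<le> b r"
begin

definition ip :: "('j \<Rightarrow> real) \<Rightarrow> ('j \<Rightarrow> real) \<Rightarrow> real" where
  "ip t y = (\<Sum>j\<in>J. t j * y j)"

text \<open>The Laplace transform of the law restricted to \<open>E r\<close>, deliberately left
  unnormalised: it then increases with \<open>r\<close>, so that \<open>pen\<close> decreases with
  \<open>r\<close> and monotone convergence recovers the full exponential moment.\<close>

definition Z :: "nat \<Rightarrow> ('j \<Rightarrow> real) \<Rightarrow> real" where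
  "Z r t = (\<integral>\<omega>. indicator (E r) \<omega> * exp (ip t (Y \<omega>)) \<partial>M)"

definition pen :: "('j \<Rightarrow> real) \<Rightarrow> real \<Rightarrow> nat \<Rightarrow> ('j \<Rightarrow> real) \<Rightarrow> real" where
  "pen x \<kappa> r t = ip t x - ln (Z r t) - \<kappa> * (\<Sum>j\<in>J. (t j)\<^sup>2)"

lemma ip_meas[measurable]: "(\<lambda>\<omega>. ip t (Y \<omega>)) \<in> borel_measurable M"
  unfolding ip_def by measurable

lemma ip_abs_le:
  assumes "\<And>j. j \<in> J \<Longrightarrow> \<bar>y j\<bar> \<le> c"
  shows "\<bar>ip t y\<bar> \<le> c * (\<Sum>j\<in>J. \<bar>t j\<bar>)"
proof -
  have "\<bar>ip t y\<bar> \<le> (\<Sum>j\<in>J. \<bar>t j * y j\<bar>)" unfolding ip_def by (rule sum_abs)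
  also have "\<dots> \<le> (\<Sum>j\<in>J. \<bar>t j\<bar> * c)"
    by (intro sum_mono) (auto simp: abs_mult intro!: mult_left_mono assms)
  finally show ?thesis by (simp add: sum_distrib_left mult.commute)
qed

lemma ip_Y_bdd: "\<omega> \<in> E r \<Longrightarrow> \<bar>ip t (Y \<omega>)\<bar> \<le> b r * (\<Sum>j\<in>J. \<bar>t j\<bar>)"
  by (rule ip_abs_le) (rule Y_bdd)

lemma integrable_E:
  assumes [measurable]: "h \<in> borel_measurable M" and "\<And>\<omega>. \<omega> \<in> E r \<Longrightarrow> \<bar>h \<omega>\<bar> \<le> K"
  shows "integrable M (\<lambda>\<omega>. indicator (E r) \<omega> * h \<omega> :: real)"
proof (rule integrable_const_bound[where B = "\<bar>K\<bar>"])
  show "AE \<omega> in M. norm (indicator (E r) \<omega> * h \<omega>) \<le> \<bar>K\<bar>"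
    using assms(2) by (intro AE_I2) (force simp: indicator_def)
qed measurable

lemma exp_ip_bdd: "\<omega> \<in> E r \<Longrightarrow> \<bar>exp (ip t (Y \<omega>))\<bar> \<le> exp (b r * (\<Sum>j\<in>J. \<bar>t j\<bar>))"
  using ip_Y_bdd[of \<omega> r t] by simp

lemma integrable_Z: "integrable M (\<lambda>\<omega>. indicator (E r) \<omega> * exp (ip t (Y \<omega>)))"
  by (rule integrable_E[OF _ exp_ip_bdd]) measurable

lemma Z_mono: "r \<le> r' \<Longrightarrow> Z r t \<le> Z r' t"
  unfolding Z_def using E_mono
  by (intro integral_mono integrable_Z) (auto simp: indicator_def incseq_def)

text \<open>Only \<open>E 0\<close> enters, with its mass of at least one half, so the bound is
  uniform in \<open>r\<close> and the negative logarithm of \<open>Z\<close> grows at most linearly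
  in the tilt. This makes the coercivity below uniform in the truncation level.\<close>

lemma Z_ge: "exp (- b 0 * (\<Sum>j\<in>J. \<bar>t j\<bar>)) / 2 \<le> Z r t"
proof -
  have "exp (- b 0 * (\<Sum>j\<in>J. \<bar>t j\<bar>)) / 2 \<le> exp (- b 0 * (\<Sum>j\<in>J. \<bar>t j\<bar>)) * prob (E 0)"
    using E_half by simp
  also have "\<dots> = (\<integral>\<omega>. indicator (E 0) \<omega> * exp (- b 0 * (\<Sum>j\<in>J. \<bar>t j\<bar>)) \<partial>M)"
    by simp
  also have "\<dots> \<le> Z 0 t" unfolding Z_def
    by (intro integral_mono integrable_Z integrable_E[where K = "exp (- b 0 * (\<Sum>j\<in>J. \<bar>t j\<bar>))"])
       (auto simp: indicator_def dest!: ip_Y_bdd[of _ 0 t])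
  also have "\<dots> \<le> Z r t" by (rule Z_mono) simp
  finally show ?thesis .
qed

lemma Z_pos: "0 < Z r t"
  by (rule order.strict_trans2[OF _ Z_ge]) simp

lemma Z_zero: "Z r (\<lambda>_. 0) \<le> 1"
  by (simp add: Z_def ip_def)

lemma Z_tendsto:
  assumes "\<And>j. j \<in> J \<Longrightarrow> (\<lambda>n. t n j) \<longlonglongrightarrow> t' j"
  shows "(\<lambda>n. Z r (t n)) \<longlonglongrightarrow> Z r t'"
proof -
  have "(\<lambda>n. \<Sum>j\<in>J. \<bar>t n j\<bar>) \<longlonglongrightarrow> (\<Sum>j\<in>J. \<bar>t' j\<bar>)"
    by (intro tendsto_intros assms)
  then have "Bseq (\<lambda>n. \<Sum>j\<in>J. \<bar>t n j\<bar>)" by (auto intro: convergent_imp_Bseq convergentI)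
  then obtain K where K: "\<And>n. (\<Sum>j\<in>J. \<bar>t n j\<bar>) \<le> K"
    by (auto simp: Bseq_def)
  show ?thesis unfolding Z_def
  proof (rule integral_dominated_convergence[where w = "\<lambda>_. exp (b r * K)"])
    show "AE \<omega> in M. (\<lambda>n. indicator (E r) \<omega> * exp (ip (t n) (Y \<omega>))) \<longlonglongrightarrow> indicator (E r) \<omega> * exp (ip t' (Y \<omega>))"
      unfolding ip_def by (intro AE_I2 tendsto_intros assms)
    show "AE \<omega> in M. norm (indicator (E r) \<omega> * exp (ip (t n) (Y \<omega>))) \<le> exp (b r * K)" for n
    proof (rule AE_I2)
      fix \<omega>
      have "ip (t n) (Y \<omega>) \<le> b r * K" if "\<omega> \<in> E r"
        using ip_Y_bdd[OF that, of "t n"] mult_left_mono[OF K[of n] b_nonneg[of r]] by linarith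
      then show "norm (indicator (E r) \<omega> * exp (ip (t n) (Y \<omega>))) \<le> exp (b r * K)"
        by (auto simp: indicator_def)
    qed
  qed auto
qed

text \<open>Monotone convergence along the exhausting events. A bound uniform in \<open>r\<close>
  thus also shows that the untruncated moment is finite.\<close>

lemma nn_integral_exp_le:
  assumes "\<And>r. Z r t \<le> K"
  shows "(\<integral>\<^sup>+\<omega>. ennreal (exp (ip t (Y \<omega>))) \<partial>M) \<le> ennreal K"
proof -
  have "(\<integral>\<^sup>+\<omega>. ennreal (exp (ip t (Y \<omega>))) \<partial>M)
      = (\<integral>\<^sup>+\<omega>. (SUP r. ennreal (indicator (E r) \<omega> * exp (ip t (Y \<omega>)))) \<partial>M)"
  proof (rule nn_integral_cong)
    fix \<omega> assume "\<omega> \<in> space M"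
    then obtain r where r: "\<omega> \<in> E r" using E_cover by blast
    show "ennreal (exp (ip t (Y \<omega>))) = (SUP r. ennreal (indicator (E r) \<omega> * exp (ip t (Y \<omega>))))"
    proof (rule antisym)
      show "ennreal (exp (ip t (Y \<omega>))) \<le> (SUP r. ennreal (indicator (E r) \<omega> * exp (ip t (Y \<omega>))))"
        by (rule SUP_upper2[of r]) (use r in auto)
    qed (auto intro!: SUP_least ennreal_leI simp: indicator_def)
  qed
  also have "\<dots> = (SUP r. \<integral>\<^sup>+\<omega>. ennreal (indicator (E r) \<omega> * exp (ip t (Y \<omega>))) \<partial>M)"
    using E_mono by (intro nn_integral_monotone_convergence_SUP)
      (auto simp: incseq_def le_fun_def indicator_def intro!: ennreal_leI)
  also have "\<dots> = (SUP r. ennreal (Z r t))"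
    unfolding Z_def by (intro SUP_cong refl nn_integral_eq_integral integrable_Z) auto
  also have "\<dots> \<le> ennreal K"
    by (intro SUP_least ennreal_leI assms)
  finally show ?thesis .
qed

lemma pen_zero: "0 \<le> pen x \<kappa> r (\<lambda>_. 0)"
  using Z_zero[of r] Z_pos[of r "\<lambda>_. 0"] by (simp add: pen_def ip_def)

text \<open>Without the penalty the functional grows at most linearly, and c |t| \<le> c^2 / (2
  \<kappa>) + \<kappa> t^2 / 2 spends half of the penalty on this growth. The resulting constant
  does not depend on \<open>r\<close>.\<close>

lemma pen_le:
  assumes "0 < \<kappa>"
  obtains c where "\<And>r t. pen x \<kappa> r t \<le> c - \<kappa> / 2 * (\<Sum>j\<in>J. (t j)\<^sup>2)"
proof -
  define c where "c = (\<Sum>j\<in>J. \<bar>x j\<bar>) + b 0"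
  have "pen x \<kappa> r t \<le> (card J * (c\<^sup>2 / (2 * \<kappa>)) + ln 2) - \<kappa> / 2 * (\<Sum>j\<in>J. (t j)\<^sup>2)" for r t
  proof -
    have "\<bar>ip t x\<bar> \<le> (\<Sum>j\<in>J. \<bar>x j\<bar>) * (\<Sum>j\<in>J. \<bar>t j\<bar>)"
      using finite_J by (intro ip_abs_le member_le_sum) auto
    moreover have "ln (exp (- b 0 * (\<Sum>j\<in>J. \<bar>t j\<bar>)) / 2) \<le> ln (Z r t)"
      using Z_ge Z_pos by (subst ln_le_cancel_iff) auto
    ultimately have "ip t x - ln (Z r t) \<le> c * (\<Sum>j\<in>J. \<bar>t j\<bar>) + ln 2"
      by (simp add: ln_div c_def algebra_simps)
    also have "c * (\<Sum>j\<in>J. \<bar>t j\<bar>) = (\<Sum>j\<in>J. c * \<bar>t j\<bar>)" by (rule sum_distrib_left)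
    also have "\<dots> \<le> (\<Sum>j\<in>J. c\<^sup>2 / (2 * \<kappa>) + \<kappa> / 2 * (t j)\<^sup>2)"
    proof (rule sum_mono)
      fix j
      have "0 \<le> (c - \<kappa> * \<bar>t j\<bar>)\<^sup>2" by simp
      then have "2 * \<kappa> * (c * \<bar>t j\<bar>) \<le> c\<^sup>2 + \<kappa>\<^sup>2 * (t j)\<^sup>2"
        by (simp add: power2_diff power_mult_distrib algebra_simps)
      then show "c * \<bar>t j\<bar> \<le> c\<^sup>2 / (2 * \<kappa>) + \<kappa> / 2 * (t j)\<^sup>2"
        using assms by (simp add: field_simps power2_eq_square)
    qed
    also have "\<dots> = card J * (c\<^sup>2 / (2 * \<kappa>)) + \<kappa> / 2 * (\<Sum>j\<in>J. (t j)\<^sup>2)"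
      by (simp add: sum.distrib sum_distrib_left)
    finally show ?thesis unfolding pen_def by (simp add: algebra_simps)
  qed
  then show ?thesis using that by blast
qed

text \<open>The threshold -1 lies below the value at the zero tilt, which is nonnegative by
  \<open>pen_zero\<close>, so that near-maximisers for all \<open>r\<close> share one bounded
  box.\<close>

lemma pen_coercive:
  assumes "0 < \<kappa>"
  obtains T where "\<And>r t j. -1 \<le> pen x \<kappa> r t \<Longrightarrow> j \<in> J \<Longrightarrow> \<bar>t j\<bar> \<le> T"
proof -
  obtain c where c: "\<And>r t. pen x \<kappa> r t \<le> c - \<kappa> / 2 * (\<Sum>j\<in>J. (t j)\<^sup>2)"
    using pen_le[OF assms] by metis
  have "\<bar>t j\<bar> \<le> sqrt ((c + 1) * 2 / \<kappa>)" if "-1 \<le> pen x \<kappa> r t" "j \<in> J" for r t j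
  proof -
    have "\<kappa> / 2 * (t j)\<^sup>2 \<le> \<kappa> / 2 * (\<Sum>j\<in>J. (t j)\<^sup>2)"
      using assms finite_J that(2) by (intro mult_left_mono member_le_sum) auto
    also have "\<dots> \<le> c + 1" using c[of r t] that(1) by linarith
    finally have "(t j)\<^sup>2 \<le> (c + 1) * 2 / \<kappa>" using assms by (simp add: field_simps)
    then show ?thesis by (metis real_sqrt_abs real_sqrt_le_mono)
  qed
  then show ?thesis using that by blast
qed

lemma pen_tendsto:
  assumes "\<And>j. j \<in> J \<Longrightarrow> (\<lambda>n. t n j) \<longlonglongrightarrow> t' j"
  shows "(\<lambda>n. pen x \<kappa> r (t n)) \<longlonglongrightarrow> pen x \<kappa> r t'"
  unfolding pen_def ip_def using Z_pos[of r t']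
  by (intro tendsto_intros assms Z_tendsto) auto

lemma pen_maximiser:
  assumes "0 < \<kappa>"
  obtains t where "\<And>t'. pen x \<kappa> r t' \<le> pen x \<kappa> r t"
proof -
  obtain c where c: "\<And>r t. pen x \<kappa> r t \<le> c - \<kappa> / 2 * (\<Sum>j\<in>J. (t j)\<^sup>2)"
    using pen_le[OF assms] by metis
  have bdd: "bdd_above (range (pen x \<kappa> r))"
  proof (intro bdd_aboveI2)
    fix t show "pen x \<kappa> r t \<le> c"
      using c[of r t] mult_nonneg_nonneg[OF less_imp_le[OF half_gt_zero[OF assms]] sum_nonneg[of J "\<lambda>j. (t j)\<^sup>2"]]
      by simp
  qed
  define S where "S = (SUP t. pen x \<kappa> r t)"
  have "\<exists>t. S - 1 / Suc n < pen x \<kappa> r t" for n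
    using less_cSUP_iff[OF _ bdd, of "S - 1 / Suc n"] by (auto simp: S_def)
  then obtain t where t: "\<And>n. S - 1 / Suc n < pen x \<kappa> r (t n)" by metis
  have S: "pen x \<kappa> r t' \<le> S" for t' unfolding S_def by (rule cSUP_upper[OF _ bdd]) simp
  then have "0 \<le> S" using pen_zero order_trans by blast
  have "1 / real (Suc n) \<le> 1" for n by simp
  then have "-1 \<le> pen x \<kappa> r (t n)" for n
    using t[of n] \<open>0 \<le> S\<close> by (smt (verit))
  then obtain T where "\<And>n j. j \<in> J \<Longrightarrow> \<bar>t n j\<bar> \<le> T"
    using pen_coercive[OF assms] by metis
  then obtain l s where s: "strict_mono s" "\<And>j. j \<in> J \<Longrightarrow> (\<lambda>n. t (s n) j) \<longlonglongrightarrow> l j"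
    using bounded_coords_subseq[OF finite_J, of t T] by metis
  have "(\<lambda>n. inverse (real (Suc (s n)))) \<longlonglongrightarrow> 0"
    using LIMSEQ_subseq_LIMSEQ[OF LIMSEQ_inverse_real_of_nat s(1)] by (simp add: o_def)
  then have "(\<lambda>n. S - 1 / Suc (s n)) \<longlonglongrightarrow> S - 0"
    by (intro tendsto_intros) (simp add: inverse_eq_divide)
  moreover have "(\<lambda>n. pen x \<kappa> r (t (s n))) \<longlonglongrightarrow> pen x \<kappa> r l"
    by (rule pen_tendsto) (rule s(2))
  ultimately have "S - 0 \<le> pen x \<kappa> r l"
    by (rule LIMSEQ_le) (intro exI[of _ 0] allI impI less_imp_le t)
  then have "S \<le> pen x \<kappa> r l" by simp
  then show ?thesis using S order_trans by (intro that[of l]) blast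
qed

text \<open>Otherwise maximisers along a sequence of truncation levels converge to a tilt violating the
  bound on the Legendre functional.\<close>

lemma pen_le_rate:
  assumes a0: "\<And>t. (\<integral>\<^sup>+\<omega>. ennreal (exp (ip t (Y \<omega>))) \<partial>M) < \<infinity> \<Longrightarrow>
      ip t x - ln (enn2real (\<integral>\<^sup>+\<omega>. ennreal (exp (ip t (Y \<omega>))) \<partial>M)) \<le> a0"
    and "0 \<le> a0" "0 < \<kappa>" "0 < \<eta>"
  shows "\<exists>r. \<forall>t. pen x \<kappa> r t \<le> a0 + \<eta>"
proof (rule ccontr)
  assume "\<nexists>r. \<forall>t. pen x \<kappa> r t \<le> a0 + \<eta>"
  then obtain t where t: "\<And>r. a0 + \<eta> < pen x \<kappa> r (t r)" by (metis not_le)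
  then have "-1 \<le> pen x \<kappa> r (t r)" for r using assms by (smt (verit))
  then obtain T where "\<And>n j. j \<in> J \<Longrightarrow> \<bar>t n j\<bar> \<le> T"
    using pen_coercive[OF \<open>0 < \<kappa>\<close>] by metis
  then obtain l s where s: "strict_mono s" "\<And>j. j \<in> J \<Longrightarrow> (\<lambda>n. t (s n) j) \<longlonglongrightarrow> l j"
    using bounded_coords_subseq[OF finite_J, of t T] by metis
  let ?S = "\<Sum>j\<in>J. (l j)\<^sup>2"
  \<comment> \<open>Since \<open>pen\<close> decreases with the truncation level, the bound at level
    \<open>s n\<close> passes to each fixed level \<open>r \<le> s n\<close>, and the limiting tilt
    inherits it at all levels at once.\<close>
  have pen_l: "a0 + \<eta> \<le> pen x \<kappa> r l" for r
  proof (rule LIMSEQ_le_const)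
    show "(\<lambda>n. pen x \<kappa> r (t (s n))) \<longlonglongrightarrow> pen x \<kappa> r l"
      by (rule pen_tendsto) (rule s(2))
    have "a0 + \<eta> \<le> pen x \<kappa> r (t (s n))" if "r \<le> n" for n
    proof -
      have "r \<le> s n" using that seq_suble[OF s(1), of n] by simp
      then have "ln (Z r (t (s n))) \<le> ln (Z (s n) (t (s n)))"
        using Z_pos Z_mono by simp
      then show ?thesis using t[of "s n"] by (simp add: pen_def)
    qed
    then show "\<exists>N. \<forall>n\<ge>N. a0 + \<eta> \<le> pen x \<kappa> r (t (s n))" by blast
  qed
  \<comment> \<open>The bound \<open>pen_l\<close> solved for the truncated moment. As
    \<open>K\<close> does not depend on \<open>r\<close>, the tilt \<open>l\<close> has a finite
    untruncated moment, and the hypothesis on \<open>a0\<close> applies to it.\<close>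
  define K where "K = exp (ip l x - a0 - \<eta> - \<kappa> * ?S)"
  have "Z r l \<le> K" for r
  proof -
    have "ln (Z r l) \<le> ip l x - a0 - \<eta> - \<kappa> * ?S" using pen_l[of r] by (simp add: pen_def)
    then show ?thesis unfolding K_def using Z_pos[of r l] by (metis exp_ln exp_le_cancel_iff)
  qed
  then have le: "(\<integral>\<^sup>+\<omega>. ennreal (exp (ip l (Y \<omega>))) \<partial>M) \<le> ennreal K"
    by (rule nn_integral_exp_le)
  let ?I = "\<integral>\<^sup>+\<omega>. ennreal (exp (ip l (Y \<omega>))) \<partial>M"
  have fin: "?I < \<infinity>" using le by (auto simp: top_unique less_top[symmetric])
  have "ennreal (Z 0 l) \<le> ?I"
    unfolding Z_def
    by (subst nn_integral_eq_integral[symmetric, OF integrable_Z])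
       (auto intro!: nn_integral_mono simp: indicator_def)
  then have pos: "0 < enn2real ?I"
    using fin Z_pos[of 0 l] by (cases ?I) (auto simp: ennreal_le_iff2)
  have "enn2real ?I \<le> K"
    using enn2real_mono[OF le] by (simp add: K_def)
  then have "ln (enn2real ?I) \<le> ln K" using pos by simp
  then have "a0 + \<eta> + \<kappa> * ?S \<le> a0"
    using a0[OF fin] by (simp add: K_def)
  moreover have "0 \<le> \<kappa> * ?S" using assms by (simp add: sum_nonneg)
  ultimately show False using \<open>0 < \<eta>\<close> by simp
qed

text \<open>The first-order condition: the mean of coordinate \<open>j\<close> under the tilted
  truncated law misses \<open>x j\<close> by \<open>2 * \<kappa> * t j\<close>. Moving the tilt by
  \<open>s\<close> in coordinate \<open>j\<close> and expanding to second order bounds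
  \<open>s\<close> times the defect by a constant times the square of \<open>s\<close>, for all
  small \<open>s\<close> of either sign, and this forces the defect to vanish.\<close>

lemma pen_maximiser_mean:
  assumes max: "\<And>t'. pen x \<kappa> r t' \<le> pen x \<kappa> r t" and j: "j \<in> J" and \<kappa>: "0 < \<kappa>"
  shows "(\<integral>\<omega>. indicator (E r) \<omega> * (exp (ip t (Y \<omega>)) * Y \<omega> j) \<partial>M) = (x j - 2 * \<kappa> * t j) * Z r t"
proof -
  let ?e = "\<lambda>\<omega>. indicator (E r) \<omega> * exp (ip t (Y \<omega>))"
  define N where "N = (\<integral>\<omega>. indicator (E r) \<omega> * (exp (ip t (Y \<omega>)) * Y \<omega> j) \<partial>M)"
  define m where "m = N / Z r t"
  have intN: "integrable M (\<lambda>\<omega>. indicator (E r) \<omega> * (exp (ip t (Y \<omega>)) * Y \<omega> j))"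
  proof (rule integrable_E)
    show "(\<lambda>\<omega>. exp (ip t (Y \<omega>)) * Y \<omega> j) \<in> borel_measurable M" using j by measurable
    show "\<bar>exp (ip t (Y \<omega>)) * Y \<omega> j\<bar> \<le> exp (b r * (\<Sum>j\<in>J. \<bar>t j\<bar>)) * b r" if "\<omega> \<in> E r" for \<omega>
      using Y_bdd[OF that j] exp_ip_bdd[OF that, of t] unfolding abs_mult by (intro mult_mono) auto
  qed
  have key: "s * (x j - m - 2 * \<kappa> * t j) \<le> s\<^sup>2 * ((b r)\<^sup>2 + \<kappa>)" if s: "\<bar>s\<bar> * b r \<le> 1" for s
  proof -
    let ?t = "t(j := t j + s)"
    have upd: "(\<Sum>i\<in>J. h i (?t i)) = (\<Sum>i\<in>J. h i (t i)) + (h j (t j + s) - h j (t j))" for h :: "'j \<Rightarrow> real \<Rightarrow> real"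
      using finite_J j by (simp add: sum.remove[of J j])
    have ip: "ip ?t y = ip t y + s * y j" for y
      unfolding ip_def by (subst upd) (simp add: algebra_simps)
    have sq: "(\<Sum>i\<in>J. (?t i)\<^sup>2) = (\<Sum>i\<in>J. (t i)\<^sup>2) + (2 * s * t j + s\<^sup>2)"
      by (subst upd) (simp add: power2_eq_square algebra_simps)
    have "Z r ?t \<le> (\<integral>\<omega>. ?e \<omega> + s * (indicator (E r) \<omega> * (exp (ip t (Y \<omega>)) * Y \<omega> j)) + (s * b r)\<^sup>2 * ?e \<omega> \<partial>M)"
      unfolding Z_def
    proof (intro integral_mono integrable_Z Bochner_Integration.integrable_add integrable_mult_right intN)
      fix \<omega>
      show "indicator (E r) \<omega> * exp (ip ?t (Y \<omega>))
          \<le> ?e \<omega> + s * (indicator (E r) \<omega> * (exp (ip t (Y \<omega>)) * Y \<omega> j)) + (s * b r)\<^sup>2 * ?e \<omega>"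
      proof (cases "\<omega> \<in> E r")
        case True
        have sY: "\<bar>s * Y \<omega> j\<bar> \<le> \<bar>s * b r\<bar>"
          using Y_bdd[OF True j] b_nonneg[of r] by (simp add: abs_mult mult_left_mono)
        then have "(s * Y \<omega> j)\<^sup>2 \<le> (s * b r)\<^sup>2" by (simp only: abs_le_square_iff)
        moreover have "exp (s * Y \<omega> j) \<le> 1 + s * Y \<omega> j + (s * Y \<omega> j)\<^sup>2"
          using sY s b_nonneg[of r] by (intro exp_le_quadratic) (simp add: abs_mult)
        ultimately have "exp (s * Y \<omega> j) \<le> 1 + s * Y \<omega> j + (s * b r)\<^sup>2" by simp
        then have "exp (ip t (Y \<omega>)) * exp (s * Y \<omega> j) \<le> exp (ip t (Y \<omega>)) * (1 + s * Y \<omega> j + (s * b r)\<^sup>2)"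
          by (intro mult_left_mono) auto
        then show ?thesis using True by (simp only: ip exp_add) (simp add: algebra_simps)
      qed simp
    qed
    also have "\<dots> = Z r t + s * N + (s * b r)\<^sup>2 * Z r t"
      using intN integrable_Z[of r t] by (simp add: Z_def N_def)
    also have "\<dots> = Z r t * (1 + s * m + (s * b r)\<^sup>2)"
      using Z_pos[of r t] by (simp add: m_def field_simps)
    finally have *: "Z r ?t \<le> Z r t * (1 + s * m + (s * b r)\<^sup>2)" .
    then have pos: "0 < 1 + s * m + (s * b r)\<^sup>2"
      using Z_pos[of r t] Z_pos[of r ?t] by (smt (verit) mult_nonneg_nonpos)
    have "ln (Z r ?t) \<le> ln (Z r t) + ln (1 + (s * m + (s * b r)\<^sup>2))"
      using * pos Z_pos[of r t] Z_pos[of r ?t]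
      by (subst ln_mult_pos[symmetric]) (auto simp: add.assoc)
    also have "ln (1 + (s * m + (s * b r)\<^sup>2)) \<le> s * m + (s * b r)\<^sup>2"
      using pos by (intro ln_add_one_self_le_self2) simp
    finally have "ln (Z r ?t) \<le> ln (Z r t) + (s * m + (s * b r)\<^sup>2)" by simp
    with max[of ?t] show ?thesis
      unfolding pen_def ip sq by (simp add: algebra_simps power_mult_distrib)
  qed
  define d where "d = x j - m - 2 * \<kappa> * t j"
  have "d = 0"
  proof (rule ccontr)
    assume "d \<noteq> 0"
    define K where "K = (b r)\<^sup>2 + \<kappa>"
    \<comment> \<open>With \<open>s = d * \<tau>\<close> the left side of \<open>key\<close> is of
      first order in \<open>\<tau>\<close> and the right side of second order. The denominator makes
      both \<open>\<bar>s\<bar> * b r \<le> 1\<close> and \<open>\<tau> * K < 1\<close>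
      hold.\<close>
    define \<tau> where "\<tau> = 1 / (1 + K + \<bar>d\<bar> * b r)"
    have K: "0 < K" using \<kappa> by (simp add: K_def add_nonneg_pos)
    have den: "0 < 1 + K + \<bar>d\<bar> * b r" using K b_nonneg[of r] by (intro add_pos_nonneg) auto
    then have \<tau>: "0 < \<tau>" by (simp add: \<tau>_def)
    have "\<tau> * (1 + K + \<bar>d\<bar> * b r) = 1" using den by (simp add: \<tau>_def)
    then have eq: "\<tau> + \<tau> * K + \<tau> * \<bar>d\<bar> * b r = 1" by (simp add: algebra_simps)
    have nn: "0 \<le> \<tau> * K" "0 \<le> \<tau> * \<bar>d\<bar> * b r" using \<tau> K b_nonneg[of r] by auto
    have "\<bar>d * \<tau>\<bar> * b r \<le> 1" using eq nn \<tau> by (simp add: abs_mult mult_ac)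
    from key[OF this, folded d_def K_def] have "d\<^sup>2 * \<tau> \<le> d\<^sup>2 * \<tau> * (\<tau> * K)"
      by (simp add: power2_eq_square mult_ac)
    moreover have "0 < d\<^sup>2 * \<tau>" using \<open>d \<noteq> 0\<close> \<tau> by simp
    ultimately have "1 \<le> \<tau> * K" by (metis mult_le_cancel_left_pos mult.right_neutral)
    then show False using eq nn \<tau> by linarith
  qed
  then have "N = (x j - 2 * \<kappa> * t j) * Z r t"
    using Z_pos[of r t] by (simp add: d_def m_def field_simps)
  then show ?thesis by (simp add: N_def)
qed

end

text \<open>Chernoff's bound with an explicit small exponent. The base \<open>\<theta>\<close> is
  strictly below 1 and the bound holds for every \<open>C\<close>, as a union bound over finitely
  many coordinates requires.\<close>

lemma (in prob_space) weak_lln_PiM: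
  fixes f :: "'a \<Rightarrow> real"
  assumes [measurable]: "f \<in> borel_measurable M" and K: "AE \<omega> in M. \<bar>f \<omega>\<bar> \<le> K"
    and f0: "(\<integral>\<omega>. f \<omega> \<partial>M) = 0" and \<delta>: "0 < \<delta>"
  shows "\<exists>\<theta>. 0 \<le> \<theta> \<and> \<theta> < 1 \<and> (\<forall>C. measure (PiM {1..C} (\<lambda>_. M))
    {\<omega> \<in> space (PiM {1..C} (\<lambda>_. M)). C * \<delta> \<le> (\<Sum>c\<in>{1..C}. f (\<omega> c))} \<le> \<theta> ^ C)"
proof -
  have "AE \<omega> in M. 0 \<le> K" using K by eventually_elim simp
  then have K0: "0 \<le> K" by simp
  \<comment> \<open>The inequality \<open>s * K \<le> 1\<close> permits
    \<open>exp_le_quadratic\<close>, and \<open>(s * K)\<^sup>2 \<le> s * \<delta> / 2\<close> lets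
    half of the gain \<open>s * \<delta>\<close> survive. The summand 1 keeps the denominator
    positive when \<open>K = 0\<close>.\<close>
  define s where "s = 1 / (K + 1 + 2 * K\<^sup>2 / \<delta>)"
  have den: "0 < K + 1 + 2 * K\<^sup>2 / \<delta>" using K0 \<delta> by (simp add: add_nonneg_pos add_pos_nonneg)
  then have s: "0 < s" by (simp add: s_def)
  have "s * (K + 1 + 2 * K\<^sup>2 / \<delta>) = 1" using den by (simp add: s_def)
  then have eq: "s * K + s + s * (2 * K\<^sup>2 / \<delta>) = 1" by (simp add: algebra_simps)
  have nn: "0 \<le> s * K" "0 \<le> s * (2 * K\<^sup>2 / \<delta>)" using s K0 \<delta> by auto
  have sK: "s * K \<le> 1" using eq nn s by linarith
  have "s * (2 * K\<^sup>2 / \<delta>) \<le> 1" using eq nn s by linarith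
  then have "s * (s * (2 * K\<^sup>2)) \<le> s * \<delta>"
    using \<delta> s by (intro mult_left_mono) (auto simp: field_simps)
  then have s2: "(s * K)\<^sup>2 \<le> s * \<delta> / 2" by (simp add: power2_eq_square algebra_simps)
  have int: "integrable M f" by (rule integrable_const_bound[where B = K]) (use K in auto)
  have "(\<integral>\<^sup>+\<omega>. ennreal (exp (s * (f \<omega> - \<delta>))) \<partial>M) \<le> (\<integral>\<^sup>+\<omega>. ennreal (exp (- (s * \<delta>)) * (1 + s * f \<omega> + (s * K)\<^sup>2)) \<partial>M)"
  proof (rule nn_integral_mono_AE, use K in eventually_elim, rule ennreal_leI)
    fix \<omega> assume \<omega>: "\<bar>f \<omega>\<bar> \<le> K"
    then have sf: "\<bar>s * f \<omega>\<bar> \<le> s * K" using s by (simp add: abs_mult)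
    then have "(s * f \<omega>)\<^sup>2 \<le> (s * K)\<^sup>2" by (metis abs_ge_zero power2_abs power_mono)
    moreover have "exp (s * f \<omega>) \<le> 1 + s * f \<omega> + (s * f \<omega>)\<^sup>2"
      using sf sK by (intro exp_le_quadratic) simp
    ultimately have "exp (s * f \<omega>) \<le> 1 + s * f \<omega> + (s * K)\<^sup>2" by simp
    then have "exp (- (s * \<delta>)) * exp (s * f \<omega>) \<le> exp (- (s * \<delta>)) * (1 + s * f \<omega> + (s * K)\<^sup>2)" by simp
    then show "exp (s * (f \<omega> - \<delta>)) \<le> exp (- (s * \<delta>)) * (1 + s * f \<omega> + (s * K)\<^sup>2)"
      by (simp add: exp_add[symmetric] algebra_simps)
  qed
  also have "\<dots> = ennreal (\<integral>\<omega>. exp (- (s * \<delta>)) * (1 + s * f \<omega> + (s * K)\<^sup>2) \<partial>M)"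
  proof (rule nn_integral_eq_integral)
    show "integrable M (\<lambda>\<omega>. exp (- (s * \<delta>)) * (1 + s * f \<omega> + (s * K)\<^sup>2))" using int by simp
    show "AE \<omega> in M. 0 \<le> exp (- (s * \<delta>)) * (1 + s * f \<omega> + (s * K)\<^sup>2)"
      using K
    proof eventually_elim
      fix \<omega> assume "\<bar>f \<omega>\<bar> \<le> K"
      then have "\<bar>s * f \<omega>\<bar> \<le> s * K" using s by (simp add: abs_mult)
      then have "0 \<le> 1 + s * f \<omega>" using sK by linarith
      then show "0 \<le> exp (- (s * \<delta>)) * (1 + s * f \<omega> + (s * K)\<^sup>2)" by simp
    qed
  qed
  also have "(\<integral>\<omega>. exp (- (s * \<delta>)) * (1 + s * f \<omega> + (s * K)\<^sup>2) \<partial>M) = exp (- (s * \<delta>)) * (1 + (s * K)\<^sup>2)"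
    using int f0 by (simp add: prob_space)
  also have "\<dots> \<le> exp (- (s * \<delta>)) * exp (s * \<delta> / 2)"
  proof (rule mult_left_mono)
    have "1 + (s * K)\<^sup>2 \<le> 1 + s * \<delta> / 2" using s2 by simp
    also have "\<dots> \<le> exp (s * \<delta> / 2)" by (rule exp_ge_add_one_self)
    finally show "1 + (s * K)\<^sup>2 \<le> exp (s * \<delta> / 2)" .
  qed simp
  also have "\<dots> = exp (- (s * \<delta> / 2))" by (simp add: exp_add[symmetric])
  finally have z: "(\<integral>\<^sup>+\<omega>. ennreal (exp (s * (f \<omega> - \<delta>))) \<partial>M) \<le> ennreal (exp (- (s * \<delta> / 2)))"
    by (simp add: ennreal_leI)
  show ?thesis
  proof (intro exI[of _ "exp (- (s * \<delta> / 2))"] conjI allI)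
    fix C :: nat
    have "{\<omega> \<in> space (PiM {1..C} (\<lambda>_. M)). C * \<delta> \<le> (\<Sum>c\<in>{1..C}. f (\<omega> c))}
        = {\<omega> \<in> space (PiM {1..C} (\<lambda>_. M)). 0 \<le> (\<Sum>c\<in>{1..C}. s * (f (\<omega> c) - \<delta>))}"
      using s by (simp add: sum_distrib_left[symmetric] sum_subtractf zero_le_mult_iff)
    then show "measure (PiM {1..C} (\<lambda>_. M)) {\<omega> \<in> space (PiM {1..C} (\<lambda>_. M)). C * \<delta> \<le> (\<Sum>c\<in>{1..C}. f (\<omega> c))}
        \<le> exp (- (s * \<delta> / 2)) ^ C"
      using chernoff_PiM[OF _ z, of "{1..C}"] by simp
  qed (use s \<delta> in auto)
qed

section \<open>Exponential tilting at the maximiser and change of measure\<close>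

context truncated_cramer
begin

definition tilted :: "nat \<Rightarrow> ('j \<Rightarrow> real) \<Rightarrow> 'a measure" where
  "tilted r t = density M (\<lambda>\<omega>. ennreal (indicator (E r) \<omega> * exp (ip t (Y \<omega>)) / Z r t))"

lemma prob_space_tilted: "prob_space (tilted r t)"
proof (rule prob_spaceI)
  have "emeasure (tilted r t) (space (tilted r t))
      = (\<integral>\<^sup>+\<omega>. ennreal (indicator (E r) \<omega> * exp (ip t (Y \<omega>)) / Z r t) \<partial>M)"
    unfolding tilted_def by (subst emeasure_density) (auto intro!: nn_integral_cong)
  also have "\<dots> = ennreal (\<integral>\<omega>. indicator (E r) \<omega> * exp (ip t (Y \<omega>)) / Z r t \<partial>M)"
    using integrable_Z Z_pos[of r t]
    by (intro nn_integral_eq_integral integrable_divide) (auto intro!: AE_I2)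
  also have "\<dots> = 1" using Z_pos[of r t] by (simp add: Z_def[symmetric])
  finally show "emeasure (tilted r t) (space (tilted r t)) = 1" .
qed

text \<open>By \<open>pen_maximiser_mean\<close> the centring is the tilted mean, and the coordinate
  is bounded on the set \<open>E r\<close> that carries the tilted law. The sign \<open>s\<close>
  selects upper or lower deviations.\<close>

lemma tilted_concentrates:
  assumes max: "\<And>t'. pen x \<kappa> r t' \<le> pen x \<kappa> r t" and j: "j \<in> J" and \<kappa>: "0 < \<kappa>"
    and \<delta>: "0 < \<delta>" and s: "\<bar>s\<bar> = 1"
  shows "\<exists>\<theta>. 0 \<le> \<theta> \<and> \<theta> < 1 \<and> (\<forall>C. measure (PiM {1..C} (\<lambda>_. tilted r t))
    {\<omega> \<in> space (PiM {1..C} (\<lambda>_. tilted r t)).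
       C * \<delta> \<le> (\<Sum>c\<in>{1..C}. s * (Y (\<omega> c) j - (x j - 2 * \<kappa> * t j)))} \<le> \<theta> ^ C)"
proof -
  interpret T: prob_space "tilted r t" by (rule prob_space_tilted)
  let ?\<mu> = "x j - 2 * \<kappa> * t j"
  have meas: "(\<lambda>\<omega>. s * (Y \<omega> j - ?\<mu>)) \<in> borel_measurable M" using j by measurable
  show ?thesis
  proof (rule T.weak_lln_PiM[OF _ _ _ \<delta>])
    show "(\<lambda>\<omega>. s * (Y \<omega> j - ?\<mu>)) \<in> borel_measurable (tilted r t)"
      using meas by (simp add: tilted_def)
    show "AE \<omega> in tilted r t. \<bar>s * (Y \<omega> j - ?\<mu>)\<bar> \<le> b r + \<bar>?\<mu>\<bar>"
      unfolding tilted_def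
    proof (subst AE_density, measurable, rule AE_I2, rule impI)
      fix \<omega> assume "0 < ennreal (indicator (E r) \<omega> * exp (ip t (Y \<omega>)) / Z r t)"
      then have "\<omega> \<in> E r" by (cases "\<omega> \<in> E r") auto
      from Y_bdd[OF this j] s show "\<bar>s * (Y \<omega> j - ?\<mu>)\<bar> \<le> b r + \<bar>?\<mu>\<bar>" by (simp add: abs_mult)
    qed
    have 1: "integrable M (\<lambda>\<omega>. indicator (E r) \<omega> * (exp (ip t (Y \<omega>)) * Y \<omega> j))"
    proof (rule integrable_E)
      show "(\<lambda>\<omega>. exp (ip t (Y \<omega>)) * Y \<omega> j) \<in> borel_measurable M" using j by measurable
      show "\<bar>exp (ip t (Y \<omega>)) * Y \<omega> j\<bar> \<le> exp (b r * (\<Sum>j\<in>J. \<bar>t j\<bar>)) * b r" if "\<omega> \<in> E r" for \<omega>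
        using Y_bdd[OF that j] exp_ip_bdd[OF that, of t] unfolding abs_mult by (intro mult_mono) auto
    qed
    have "(\<integral>\<omega>. s * (Y \<omega> j - ?\<mu>) \<partial>tilted r t)
        = (\<integral>\<omega>. indicator (E r) \<omega> * exp (ip t (Y \<omega>)) / Z r t * (s * (Y \<omega> j - ?\<mu>)) \<partial>M)"
      unfolding tilted_def using Z_pos[of r t] meas
      by (subst integral_density) (auto intro!: AE_I2 divide_nonneg_pos)
    also have "\<dots> = (\<integral>\<omega>. s / Z r t * (indicator (E r) \<omega> * (exp (ip t (Y \<omega>)) * Y \<omega> j)
        - ?\<mu> * (indicator (E r) \<omega> * exp (ip t (Y \<omega>)))) \<partial>M)"
      by (intro Bochner_Integration.integral_cong refl) (simp add: field_simps)
    also have "\<dots> = s / Z r t * (?\<mu> * Z r t - ?\<mu> * Z r t)"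
      using 1 integrable_Z[of r t] by (simp add: pen_maximiser_mean[OF max j \<kappa>] Z_def)
    finally show "(\<integral>\<omega>. s * (Y \<omega> j - ?\<mu>) \<partial>tilted r t) = 0" by simp
  qed
qed

text \<open>Under the product of the tilted laws the event has mass at least one half for large
  \<open>C\<close>, while on it the density against the original product is bounded by the
  exponential in the claim. The event keeps \<open>\<omega> c \<in> E r\<close>, because later
  perturbations of the factor are controlled only on these sets.\<close>

lemma tilted_lower_bound:
  fixes x t \<mu> :: "'j \<Rightarrow> real" and \<kappa> \<delta> :: real
  assumes max: "\<And>t'. pen x \<kappa> r t' \<le> pen x \<kappa> r t" and \<kappa>: "0 < \<kappa>" and \<delta>: "0 < \<delta>"
  defines "\<mu> \<equiv> (\<lambda>j. x j - 2 * \<kappa> * t j)"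
  shows "\<exists>C0. \<forall>C::nat\<ge>C0. exp (- (C * (ip t \<mu> - ln (Z r t) + \<delta> * (\<Sum>j\<in>J. \<bar>t j\<bar>)))) / 2
    \<le> measure (PiM {1..C} (\<lambda>_. M)) {\<omega> \<in> space (PiM {1..C} (\<lambda>_. M)).
        (\<forall>c\<in>{1..C}. \<omega> c \<in> E r) \<and> (\<forall>j\<in>J. \<bar>(\<Sum>c\<in>{1..C}. Y (\<omega> c) j) - C * \<mu> j\<bar> < C * \<delta>)}"
proof -
  interpret T: prob_space "tilted r t" by (rule prob_space_tilted)
  let ?P = "\<lambda>C::nat. PiM {1..C} (\<lambda>_. M)" and ?Q = "\<lambda>C::nat. PiM {1..C} (\<lambda>_. tilted r t)"
  have spQ: "space (?Q C) = space (?P C)" and seQ: "sets (?Q C) = sets (?P C)" for C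
    by (auto simp: tilted_def space_PiM cong: sets_PiM_cong)
  define decay where "decay j s \<theta> \<longleftrightarrow> 0 \<le> \<theta> \<and> \<theta> < 1 \<and> (\<forall>C. measure (?Q C)
    {\<omega> \<in> space (?Q C). C * \<delta> \<le> (\<Sum>c\<in>{1..C}. s * (Y (\<omega> c) j - \<mu> j))} \<le> \<theta> ^ C)" for j s \<theta>
  \<comment> \<open>One base for each coordinate and sign; as there are finitely many, the sum of
    their powers is eventually below 1/2.\<close>
  define \<theta> where "\<theta> j s = (SOME \<theta>. decay j s \<theta>)" for j s
  have \<theta>: "decay j s (\<theta> j s)" if "j \<in> J" "\<bar>s\<bar> = 1" for j s
    unfolding \<theta>_def
    by (rule someI_ex) (use tilted_concentrates[OF max that(1) \<kappa> \<delta> that(2)] in \<open>simp only: decay_def \<mu>_def\<close>)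
  have \<theta>01: "0 \<le> \<theta> j s" "\<theta> j s < 1" if "j \<in> J" "\<bar>s\<bar> = 1" for j s
    using \<theta>[OF that] by (simp_all add: decay_def)
  have "(\<lambda>C. \<Sum>j\<in>J. \<theta> j 1 ^ C + \<theta> j (-1) ^ C) \<longlonglongrightarrow> (\<Sum>j\<in>J. 0 + 0)"
    using \<theta>01 by (intro tendsto_intros LIMSEQ_realpow_zero) auto
  then have "\<forall>\<^sub>F C in sequentially. (\<Sum>j\<in>J. \<theta> j 1 ^ C + \<theta> j (-1) ^ C) < 1 / 2"
    by (intro order_tendstoD) auto
  then obtain C0 where C0: "\<And>C. C \<ge> C0 \<Longrightarrow> (\<Sum>j\<in>J. \<theta> j 1 ^ C + \<theta> j (-1) ^ C) < 1 / 2"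
    by (auto simp: eventually_sequentially)
  show ?thesis
  proof (intro exI[of _ C0] allI impI)
    fix C assume C: "C0 \<le> C"
    interpret P: product_prob_space "\<lambda>_. M" "{1..C}" by standard
    interpret Q: product_prob_space "\<lambda>_. tilted r t" "{1..C}" by standard
    define A where "A = {\<omega> \<in> space (?P C). (\<forall>c\<in>{1..C}. \<omega> c \<in> E r) \<and>
      (\<forall>j\<in>J. \<bar>(\<Sum>c\<in>{1..C}. Y (\<omega> c) j) - C * \<mu> j\<bar> < C * \<delta>)}"
    define B where "B j s = {\<omega> \<in> space (?Q C). C * \<delta> \<le> (\<Sum>c\<in>{1..C}. s * (Y (\<omega> c) j - \<mu> j))}" for j s
    have Ym: "(\<lambda>\<omega>. Y (\<omega> c) j) \<in> borel_measurable (?P C)" if "c \<in> {1..C}" "j \<in> J" for c j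
      using that by measurable
    have A[measurable]: "A \<in> sets (?P C)"
      unfolding A_def using finite_J Ym by measurable
    have B: "B j s \<in> sets (?Q C)" if "j \<in> J" for j s
      unfolding B_def spQ seQ using Ym[OF _ that] by measurable
    have "AE \<omega> in tilted r t. \<omega> \<in> E r"
      unfolding tilted_def
    proof (subst AE_density, measurable, rule AE_I2, rule impI)
      fix \<omega> assume "0 < ennreal (indicator (E r) \<omega> * exp (ip t (Y \<omega>)) / Z r t)"
      then show "\<omega> \<in> E r" by (cases "\<omega> \<in> E r") auto
    qed
    then have "AE \<omega> in ?Q C. \<forall>c\<in>{1..C}. \<omega> c \<in> E r"
      by (intro AE_finite_allI AE_PiM_component prob_space_tilted) auto
    then have "Q.P.prob (space (?Q C) - A) \<le> Q.P.prob (\<Union>j\<in>J. B j 1 \<union> B j (-1))"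
    proof (intro Q.P.finite_measure_mono_AE)
      show "(\<Union>j\<in>J. B j 1 \<union> B j (-1)) \<in> Q.P.events"
        using finite_J B by (intro sets.finite_UN) auto
      show "AE \<omega> in ?Q C. \<omega> \<in> space (?Q C) - A \<longrightarrow> \<omega> \<in> (\<Union>j\<in>J. B j 1 \<union> B j (-1))"
        if "AE \<omega> in ?Q C. \<forall>c\<in>{1..C}. \<omega> c \<in> E r"
        using that
      proof (eventually_elim, intro impI)
        fix \<omega> assume E: "\<forall>c\<in>{1..C}. \<omega> c \<in> E r" and \<omega>: "\<omega> \<in> space (?Q C) - A"
        then obtain j where j: "j \<in> J" "C * \<delta> \<le> \<bar>(\<Sum>c\<in>{1..C}. Y (\<omega> c) j) - C * \<mu> j\<bar>"
          unfolding A_def spQ by (auto simp: not_less)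
        have "(\<Sum>c\<in>{1..C}. s * (Y (\<omega> c) j - \<mu> j)) = s * ((\<Sum>c\<in>{1..C}. Y (\<omega> c) j) - C * \<mu> j)" for s
          by (simp add: sum_distrib_left[symmetric] sum_subtractf)
        then have "\<omega> \<in> B j s \<longleftrightarrow> C * \<delta> \<le> s * ((\<Sum>c\<in>{1..C}. Y (\<omega> c) j) - C * \<mu> j)" for s
          using \<omega> by (simp only: B_def mem_Collect_eq) blast
        from this[of 1] this[of "-1"] have "\<omega> \<in> B j 1 \<or> \<omega> \<in> B j (-1)"
          using j(2) by (auto simp: abs_if split: if_splits)
        then show "\<omega> \<in> (\<Union>j\<in>J. B j 1 \<union> B j (-1))" using j(1) by blast
      qed
    qed
    also have "\<dots> \<le> (\<Sum>j\<in>J. Q.P.prob (B j 1 \<union> B j (-1)))"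
      using finite_J B by (intro Q.P.finite_measure_subadditive_finite) auto
    also have "\<dots> \<le> (\<Sum>j\<in>J. \<theta> j 1 ^ C + \<theta> j (-1) ^ C)"
    proof (rule sum_mono)
      fix j assume j: "j \<in> J"
      have "Q.P.prob (B j 1 \<union> B j (-1)) \<le> Q.P.prob (B j 1) + Q.P.prob (B j (-1))"
        using B[OF j] by (intro measure_Un_le) auto
      also have "\<dots> \<le> \<theta> j 1 ^ C + \<theta> j (-1) ^ C"
        using \<theta>[OF j, of 1] \<theta>[OF j, of "-1"] unfolding B_def decay_def by (intro add_mono) auto
      finally show "Q.P.prob (B j 1 \<union> B j (-1)) \<le> \<theta> j 1 ^ C + \<theta> j (-1) ^ C" .
    qed
    finally have "Q.P.prob (space (?Q C) - A) \<le> 1 / 2" using C0[OF C] by linarith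
    then have half: "1 / 2 \<le> Q.P.prob A"
      using Q.P.prob_compl[of A] A unfolding seQ by simp
    \<comment> \<open>Bound for the log-density on \<open>A\<close>: \<open>C\<close> times its
      value at the mean \<open>\<mu>\<close>, plus the cost of a deviation by less than
      \<open>C * \<delta>\<close> in each coordinate.\<close>
    define K where "K = C * (ip t \<mu> - ln (Z r t) + \<delta> * (\<Sum>j\<in>J. \<bar>t j\<bar>))"
    define g where "g \<omega> = ennreal (indicator (E r) \<omega> * exp (ip t (Y \<omega>)) / Z r t)" for \<omega>
    have g: "g \<in> borel_measurable M" unfolding g_def by measurable
    have "emeasure (?Q C) A = (\<integral>\<^sup>+\<omega>. (\<Prod>c\<in>{1..C}. g (\<omega> c)) * indicator A \<omega> \<partial>?P C)"
      using prob_space_tilted[of r t] g A unfolding tilted_def g_def[symmetric]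
      by (subst PiM_density) (auto intro!: emeasure_density)
    also have "\<dots> \<le> (\<integral>\<^sup>+\<omega>. ennreal (exp K) * indicator A \<omega> \<partial>?P C)"
    proof (rule nn_integral_mono)
      fix \<omega>
      show "(\<Prod>c\<in>{1..C}. g (\<omega> c)) * indicator A \<omega> \<le> ennreal (exp K) * indicator A \<omega>"
      proof (cases "\<omega> \<in> A")
        case True
        then have E: "\<omega> c \<in> E r" if "c \<in> {1..C}" for c using that by (auto simp: A_def)
        have "(\<Prod>c\<in>{1..C}. g (\<omega> c)) = (\<Prod>c\<in>{1..C}. ennreal (exp (ip t (Y (\<omega> c)) - ln (Z r t))))"
          using E Z_pos[of r t] by (intro prod.cong refl) (simp add: g_def exp_diff)
        also have "\<dots> = ennreal (exp ((\<Sum>c\<in>{1..C}. ip t (Y (\<omega> c))) - C * ln (Z r t)))"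
          by (subst prod_ennreal) (auto simp: exp_sum[symmetric] sum_subtractf)
        also have "(\<Sum>c\<in>{1..C}. ip t (Y (\<omega> c))) = ip t (\<lambda>j. (\<Sum>c\<in>{1..C}. Y (\<omega> c) j) - C * \<mu> j) + C * ip t \<mu>"
          unfolding ip_def sum_distrib_left
          by (subst sum.swap) (simp add: sum.distrib[symmetric] sum_distrib_left algebra_simps)
        also have "ip t (\<lambda>j. (\<Sum>c\<in>{1..C}. Y (\<omega> c) j) - C * \<mu> j) \<le> C * \<delta> * (\<Sum>j\<in>J. \<bar>t j\<bar>)"
          using True by (intro order_trans[OF abs_ge_self ip_abs_le]) (auto simp: A_def intro: less_imp_le)
        finally show ?thesis using True
          by (simp add: K_def algebra_simps)
      qed simp
    qed
    also have "\<dots> = ennreal (exp K * P.P.prob A)"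
      by (subst nn_integral_cmult_indicator[OF A])
         (simp only: P.P.emeasure_eq_measure ennreal_mult exp_ge_zero measure_nonneg)
    finally have "Q.P.prob A \<le> exp K * P.P.prob A"
      by (simp add: Q.P.emeasure_eq_measure del: One_nat_def)
    then have "exp (- K) * (1 / 2) \<le> exp (- K) * (exp K * P.P.prob A)"
      using half by (intro mult_left_mono) auto
    then show "exp (- (C * (ip t \<mu> - ln (Z r t) + \<delta> * (\<Sum>j\<in>J. \<bar>t j\<bar>)))) / 2 \<le> measure (?P C) {\<omega> \<in> space (?P C).
        (\<forall>c\<in>{1..C}. \<omega> c \<in> E r) \<and> (\<forall>j\<in>J. \<bar>(\<Sum>c\<in>{1..C}. Y (\<omega> c) j) - C * \<mu> j\<bar> < C * \<delta>)}"
      unfolding K_def[symmetric] A_def[symmetric] by (simp add: mult.assoc[symmetric] exp_add[symmetric])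
  qed
qed

theorem cramer_lower_bound:
  fixes x :: "'j \<Rightarrow> real" and a0 a \<delta> :: real
  assumes a0: "\<And>t. (\<integral>\<^sup>+\<omega>. ennreal (exp (ip t (Y \<omega>))) \<partial>M) < \<infinity> \<Longrightarrow>
      ip t x - ln (enn2real (\<integral>\<^sup>+\<omega>. ennreal (exp (ip t (Y \<omega>))) \<partial>M)) \<le> a0"
    and a: "a0 < a" and \<delta>: "0 < \<delta>"
  shows "\<exists>r C0. \<forall>C::nat\<ge>C0. exp (- (C * a)) \<le> measure (PiM {1..C} (\<lambda>_. M))
    {\<omega> \<in> space (PiM {1..C} (\<lambda>_. M)). (\<forall>c\<in>{1..C}. \<omega> c \<in> E r) \<and>
      (\<forall>j\<in>J. \<bar>(\<Sum>c\<in>{1..C}. Y (\<omega> c) j) - C * x j\<bar> < C * \<delta>)}"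
proof -
  have a0_nonneg: "0 \<le> a0"
    using a0[of "\<lambda>_. 0"] by (simp add: ip_def emeasure_space_1)
  \<comment> \<open>Of the four parts of \<open>a - a0\<close>, one is lost in
    \<open>pen_le_rate\<close>, one in the deviation term of the change of measure, and two absorb
    its factor 1/2 once \<open>C1 \<le> C\<close>.\<close>
  define \<eta> where "\<eta> = (a - a0) / 4"
  have \<eta>: "0 < \<eta>" using a by (simp add: \<eta>_def)
  \<comment> \<open>Chosen so that
    \<open>8 * \<kappa> * (a0 + \<eta>) = (\<delta> / 2)\<^sup>2\<close>; this turns the bound
    \<open>\<kappa>S\<close> on the penalty into
    \<open>\<bar>2 * \<kappa> * t j\<bar> \<le> \<delta> / 2\<close>.\<close>
  define \<kappa> where "\<kappa> = \<delta>\<^sup>2 / (32 * (a0 + \<eta>))"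
  have \<kappa>: "0 < \<kappa>" using \<delta> \<eta> a0_nonneg by (simp add: \<kappa>_def)
  \<comment> \<open>The level is taken for the penalty \<open>\<kappa> / 2\<close>, the maximiser
    for \<open>\<kappa>\<close>. The two functionals differ at \<open>t\<close> by half of the
    penalty there, and the one for \<open>\<kappa>\<close> is nonnegative at \<open>t\<close>, so
    the penalty itself is bounded.\<close>
  obtain r where r: "\<And>t. pen x (\<kappa> / 2) r t \<le> a0 + \<eta>"
    using pen_le_rate[OF a0 a0_nonneg, of "\<kappa> / 2" \<eta>] \<kappa> \<eta> by auto
  obtain t where t: "\<And>t'. pen x \<kappa> r t' \<le> pen x \<kappa> r t"
    using pen_maximiser[OF \<kappa>] by metis
  define \<mu> where "\<mu> = (\<lambda>j. x j - 2 * \<kappa> * t j)"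
  let ?S = "\<Sum>j\<in>J. (t j)\<^sup>2"
  have S: "0 \<le> ?S" by (simp add: sum_nonneg)
  have pen0: "0 \<le> pen x \<kappa> r t" using t pen_zero order_trans by blast
  have half: "pen x (\<kappa> / 2) r t = pen x \<kappa> r t + \<kappa> / 2 * ?S"
    by (simp add: pen_def algebra_simps)
  have \<kappa>S: "\<kappa> / 2 * ?S \<le> a0 + \<eta>" using half r[of t] pen0 by linarith
  have close: "\<bar>\<mu> j - x j\<bar> \<le> \<delta> / 2" if "j \<in> J" for j
  proof -
    have "(t j)\<^sup>2 \<le> ?S" using finite_J that by (intro member_le_sum) auto
    then have "\<kappa> / 2 * (t j)\<^sup>2 \<le> a0 + \<eta>" using \<kappa> \<kappa>S mult_left_mono[of "(t j)\<^sup>2" ?S "\<kappa> / 2"] by linarith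
    then have "8 * \<kappa> * (\<kappa> / 2 * (t j)\<^sup>2) \<le> 8 * \<kappa> * (a0 + \<eta>)" using \<kappa> by (intro mult_left_mono) auto
    also have "\<dots> = (\<delta> / 2)\<^sup>2" using \<eta> a0_nonneg by (simp add: \<kappa>_def field_simps power2_eq_square)
    finally have "(2 * \<kappa> * t j)\<^sup>2 \<le> (\<delta> / 2)\<^sup>2" by (simp add: power2_eq_square mult_ac)
    then have "\<bar>2 * \<kappa> * t j\<bar> \<le> \<delta> / 2" using \<delta> by (subst (asm) abs_le_square_iff[symmetric]) simp
    then show ?thesis by (simp add: \<mu>_def)
  qed
  define \<delta>' where "\<delta>' = min (\<delta> / 2) (\<eta> / ((\<Sum>j\<in>J. \<bar>t j\<bar>) + 1))"
  have T0: "0 \<le> (\<Sum>j\<in>J. \<bar>t j\<bar>)" by (simp add: sum_nonneg)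
  have "0 < \<eta> / ((\<Sum>j\<in>J. \<bar>t j\<bar>) + 1)" using \<eta> T0 by (intro divide_pos_pos) linarith+
  then have \<delta>': "0 < \<delta>'" using \<delta> by (simp add: \<delta>'_def)
  have "\<delta>' * (\<Sum>j\<in>J. \<bar>t j\<bar>) \<le> \<eta> / ((\<Sum>j\<in>J. \<bar>t j\<bar>) + 1) * (\<Sum>j\<in>J. \<bar>t j\<bar>)"
    using T0 by (intro mult_right_mono) (auto simp: \<delta>'_def)
  also have "\<dots> \<le> \<eta>"
  proof -
    have "0 < (\<Sum>j\<in>J. \<bar>t j\<bar>) + 1" using T0 by linarith
    then show ?thesis using \<eta> by (simp add: divide_le_eq algebra_simps)
  qed
  finally have \<delta>'T: "\<delta>' * (\<Sum>j\<in>J. \<bar>t j\<bar>) \<le> \<eta>" .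
  have ip\<mu>: "ip t \<mu> - ln (Z r t) = pen x \<kappa> r t - \<kappa> * ?S"
    by (simp add: pen_def ip_def \<mu>_def algebra_simps sum_subtractf sum_distrib_left power2_eq_square)
  have cost: "ip t \<mu> - ln (Z r t) + \<delta>' * (\<Sum>j\<in>J. \<bar>t j\<bar>) \<le> a - 2 * \<eta>"
  proof -
    have "0 \<le> \<kappa> * ?S" using S \<kappa> by simp
    moreover have "a0 + 2 * \<eta> = a - 2 * \<eta>" by (simp add: \<eta>_def field_simps)
    ultimately show ?thesis using \<delta>'T half r[of t] ip\<mu> by linarith
  qed
  obtain C0 :: nat where C0: "\<And>C::nat. C \<ge> C0 \<Longrightarrow> exp (- (C * (ip t \<mu> - ln (Z r t) + \<delta>' * (\<Sum>j\<in>J. \<bar>t j\<bar>)))) / 2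
    \<le> measure (PiM {1..C} (\<lambda>_. M)) {\<omega> \<in> space (PiM {1..C} (\<lambda>_. M)).
        (\<forall>c\<in>{1..C}. \<omega> c \<in> E r) \<and> (\<forall>j\<in>J. \<bar>(\<Sum>c\<in>{1..C}. Y (\<omega> c) j) - C * \<mu> j\<bar> < C * \<delta>')}"
    using tilted_lower_bound[OF t \<kappa> \<delta>'] unfolding \<mu>_def by blast
  obtain C1 :: nat where C1: "ln 2 / (2 * \<eta>) \<le> C1" using real_arch_simple by blast
  show ?thesis
  proof (rule exI[of _ r], rule exI[of _ "max C0 C1"], intro allI impI, goal_cases)
    case (1 C)
    then have C: "max C0 C1 \<le> C" .
    interpret P: product_prob_space "\<lambda>_. M" "{1..C}" by standard
    have "ln 2 / (2 * \<eta>) \<le> C" using C1 C by (auto intro: order_trans)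
    then have "ln 2 \<le> C * (2 * \<eta>)" using \<eta> by (simp add: field_simps)
    moreover have "C * (ip t \<mu> - ln (Z r t) + \<delta>' * (\<Sum>j\<in>J. \<bar>t j\<bar>)) \<le> C * (a - 2 * \<eta>)"
      by (intro mult_left_mono cost) simp
    ultimately have "- (C * a) \<le> - (C * (ip t \<mu> - ln (Z r t) + \<delta>' * (\<Sum>j\<in>J. \<bar>t j\<bar>))) - ln 2"
      by (simp add: algebra_simps)
    then have "exp (- (C * a)) \<le> exp (- (C * (ip t \<mu> - ln (Z r t) + \<delta>' * (\<Sum>j\<in>J. \<bar>t j\<bar>))) - ln 2)"
      by simp
    also have "\<dots> = exp (- (C * (ip t \<mu> - ln (Z r t) + \<delta>' * (\<Sum>j\<in>J. \<bar>t j\<bar>)))) / 2"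
      by (simp only: exp_diff exp_ln zero_less_numeral)
    also have "\<dots> \<le> P.P.prob {\<omega> \<in> space (PiM {1..C} (\<lambda>_. M)).
        (\<forall>c\<in>{1..C}. \<omega> c \<in> E r) \<and> (\<forall>j\<in>J. \<bar>(\<Sum>c\<in>{1..C}. Y (\<omega> c) j) - C * \<mu> j\<bar> < C * \<delta>')}"
      using C by (intro C0) simp
    also have "\<dots> \<le> P.P.prob {\<omega> \<in> space (PiM {1..C} (\<lambda>_. M)).
        (\<forall>c\<in>{1..C}. \<omega> c \<in> E r) \<and> (\<forall>j\<in>J. \<bar>(\<Sum>c\<in>{1..C}. Y (\<omega> c) j) - C * x j\<bar> < C * \<delta>)}"
    proof (rule P.P.finite_measure_mono)
      have Ym: "(\<lambda>\<omega>. Y (\<omega> c) j) \<in> borel_measurable (PiM {1..C} (\<lambda>_. M))" if "c \<in> {1..C}" "j \<in> J" for c j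
        using that by measurable
      show "{\<omega> \<in> space (PiM {1..C} (\<lambda>_. M)).
        (\<forall>c\<in>{1..C}. \<omega> c \<in> E r) \<and> (\<forall>j\<in>J. \<bar>(\<Sum>c\<in>{1..C}. Y (\<omega> c) j) - C * x j\<bar> < C * \<delta>)} \<in> P.P.events"
        using finite_J Ym by measurable
      have "\<bar>S - C * x j\<bar> < C * \<delta>" if "j \<in> J" "\<bar>S - C * \<mu> j\<bar> < C * \<delta>'" for j S
      proof -
        have "C * \<bar>\<mu> j - x j\<bar> \<le> C * (\<delta> / 2)"
          by (intro mult_left_mono close that(1)) simp
        then have "\<bar>C * \<mu> j - C * x j\<bar> \<le> C * (\<delta> / 2)"
          by (simp add: right_diff_distrib[symmetric] abs_mult)
        moreover have "\<delta>' \<le> \<delta> / 2" by (simp only: \<delta>'_def min.cobounded1)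
        then have "C * \<delta>' \<le> C * (\<delta> / 2)" by (intro mult_left_mono) auto
        moreover have "C * \<delta> = C * (\<delta> / 2) + C * (\<delta> / 2)" by (simp add: field_simps)
        ultimately show ?thesis using that(2) by linarith
      qed
      then show "{\<omega> \<in> space (PiM {1..C} (\<lambda>_. M)).
        (\<forall>c\<in>{1..C}. \<omega> c \<in> E r) \<and> (\<forall>j\<in>J. \<bar>(\<Sum>c\<in>{1..C}. Y (\<omega> c) j) - C * \<mu> j\<bar> < C * \<delta>')}
        \<subseteq> {\<omega> \<in> space (PiM {1..C} (\<lambda>_. M)).
        (\<forall>c\<in>{1..C}. \<omega> c \<in> E r) \<and> (\<forall>j\<in>J. \<bar>(\<Sum>c\<in>{1..C}. Y (\<omega> c) j) - C * x j\<bar> < C * \<delta>)}"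
        by blast
    qed
    finally show ?case .
  qed
qed

end

section \<open>Uniqueness of characteristic functions\<close>

text \<open>Levy's uniqueness theorem for weighted laws: \<open>t = 0\<close> shows that both
  weights have the same total mass, and dividing by it yields probability measures with equal
  characteristic functions. If the mass is zero, both weights vanish almost everywhere.\<close>

lemma weighted_char_unique:
  fixes h h' :: "_ \<Rightarrow> real"
  assumes "prob_space M" "prob_space N"
    and [measurable]: "h \<in> borel_measurable M" "X \<in> borel_measurable M"
      "h' \<in> borel_measurable N" "X' \<in> borel_measurable N"
    and h: "\<And>w. 0 \<le> h w" "\<And>w. h w \<le> c" and h': "\<And>w. 0 \<le> h' w" "\<And>w. h' w \<le> c"
    and eq: "\<And>t. (\<integral>w. h w *\<^sub>R iexp (t * X w) \<partial>M) = (\<integral>w. h' w *\<^sub>R iexp (t * X' w) \<partial>N)"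
    and B[measurable]: "B \<in> sets borel"
  shows "(\<integral>w. h w * indicator B (X w) \<partial>M) = (\<integral>w. h' w * indicator B (X' w) \<partial>N)"
proof -
  interpret M: prob_space M by fact
  interpret N: prob_space N by fact
  have int: "integrable M h" "integrable N h'"
    using h h' by (auto intro!: M.integrable_const_bound[of _ c] N.integrable_const_bound[of _ c])
  define K where "K = (\<integral>w. h w \<partial>M)"
  have "of_real K = (of_real (\<integral>w. h' w \<partial>N) :: complex)"
    using eq[of 0] int by (simp add: K_def scaleR_conv_of_real)
  then have K': "K = (\<integral>w. h' w \<partial>N)" by (simp only: of_real_eq_iff)
  show ?thesis
  proof (cases "K = 0")
    case True
    have "AE w in M. h w = 0"
      using integral_nonneg_eq_0_iff_AE[OF int(1)] h True by (simp add: K_def)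
    moreover have "AE w in N. h' w = 0"
      using integral_nonneg_eq_0_iff_AE[OF int(2)] h' K' True by simp
    ultimately have "(\<integral>w. h w * indicator B (X w) \<partial>M) = 0" "(\<integral>w. h' w * indicator B (X' w) \<partial>N) = 0"
      by (auto intro!: integral_eq_zero_AE elim: eventually_mono)
    then show ?thesis by simp
  next
    case False
    then have K: "0 < K" using h integral_nonneg_AE[of h M] by (auto simp: K_def less_le)
    define D where "D = distr (density M (\<lambda>w. ennreal (h w / K))) borel X"
    define D' where "D' = distr (density N (\<lambda>w. ennreal (h' w / K))) borel X'"
    have "prob_space (density M (\<lambda>w. ennreal (h w / K)))"
    proof (rule prob_spaceI)
      have "emeasure (density M (\<lambda>w. ennreal (h w / K))) (space (density M (\<lambda>w. ennreal (h w / K))))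
          = (\<integral>\<^sup>+w. ennreal (h w / K) \<partial>M)"
        by (subst emeasure_density) (auto intro!: nn_integral_cong)
      also have "\<dots> = ennreal (\<integral>w. h w / K \<partial>M)"
        using int h K by (intro nn_integral_eq_integral) auto
      also have "\<dots> = 1" using K by (simp add: K_def[symmetric])
      finally show "emeasure (density M (\<lambda>w. ennreal (h w / K))) (space (density M (\<lambda>w. ennreal (h w / K)))) = 1" .
    qed
    then have D: "real_distribution D"
      unfolding D_def by (intro prob_space.real_distribution_distr) auto
    have "prob_space (density N (\<lambda>w. ennreal (h' w / K)))"
    proof (rule prob_spaceI)
      have "emeasure (density N (\<lambda>w. ennreal (h' w / K))) (space (density N (\<lambda>w. ennreal (h' w / K))))
          = (\<integral>\<^sup>+w. ennreal (h' w / K) \<partial>N)"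
        by (subst emeasure_density) (auto intro!: nn_integral_cong)
      also have "\<dots> = ennreal (\<integral>w. h' w / K \<partial>N)"
        using int h' K by (intro nn_integral_eq_integral) auto
      also have "\<dots> = 1" using K by (simp add: K'[symmetric])
      finally show "emeasure (density N (\<lambda>w. ennreal (h' w / K))) (space (density N (\<lambda>w. ennreal (h' w / K)))) = 1" .
    qed
    then have D': "real_distribution D'"
      unfolding D'_def by (intro prob_space.real_distribution_distr) auto
    have "char D t = (\<integral>w. (h w / K) *\<^sub>R iexp (t * X w) \<partial>M)" for t
      unfolding D_def char_def using h K
      by (subst integral_distr, simp, simp) (subst integral_density, auto)
    moreover have "char D' t = (\<integral>w. (h' w / K) *\<^sub>R iexp (t * X' w) \<partial>N)" for t
      unfolding D'_def char_def using h' K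
      by (subst integral_distr, simp, simp) (subst integral_density, auto)
    moreover have "(\<integral>w. (h w / K) *\<^sub>R iexp (t * X w) \<partial>M) = (1 / K) *\<^sub>R (\<integral>w. h w *\<^sub>R iexp (t * X w) \<partial>M)" for t
      by (subst integral_scaleR_right[symmetric]) (simp add: mult_ac)
    moreover have "(\<integral>w. (h' w / K) *\<^sub>R iexp (t * X' w) \<partial>N) = (1 / K) *\<^sub>R (\<integral>w. h' w *\<^sub>R iexp (t * X' w) \<partial>N)" for t
      by (subst integral_scaleR_right[symmetric]) (simp add: mult_ac)
    ultimately have "char D t = char D' t" for t by (simp only: eq)
    then have "char D = char D'" by (rule ext)
    then have DD: "D = D'" by (rule Levy_uniqueness[OF D D'])
    have "(\<integral>x. indicator B x \<partial>D) = (\<integral>w. (h w / K) * indicator B (X w) \<partial>M)"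
      unfolding D_def using h K by (subst integral_distr, simp, simp) (subst integral_density, auto)
    moreover have "(\<integral>x. indicator B x \<partial>D') = (\<integral>w. (h' w / K) * indicator B (X' w) \<partial>N)"
      unfolding D'_def using h' K by (subst integral_distr, simp, simp) (subst integral_density, auto)
    ultimately have "(\<integral>w. (1 / K) * (h w * indicator B (X w)) \<partial>M) = (\<integral>w. (1 / K) * (h' w * indicator B (X' w)) \<partial>N)"
      using DD by (simp add: mult_ac)
    then show ?thesis using K by simp
  qed
qed

text \<open>Cramer--Wold in the form used for Gaussian vectors: one coordinate at a time, the exponential
  of that coordinate is traded for an indicator, the exponentials of the remaining coordinates being
  kept as the nonnegative weights \<open>1 + cos\<close> and \<open>1 + sin\<close>.\<close>

lemma PiM_char_unique:
  fixes \<mu> \<nu> :: "('k \<Rightarrow> real) measure"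
  assumes K: "finite K" and "prob_space \<mu>" "prob_space \<nu>"
    and s\<mu>[measurable_cong]: "sets \<mu> = sets (PiM K (\<lambda>_. borel))"
    and s\<nu>[measurable_cong]: "sets \<nu> = sets (PiM K (\<lambda>_. borel))"
    and eq: "\<And>s. (\<integral>x. iexp (\<Sum>k\<in>K. s k * x k) \<partial>\<mu>) = (\<integral>x. iexp (\<Sum>k\<in>K. s k * x k) \<partial>\<nu>)"
  shows "\<mu> = \<nu>"
proof -
  interpret M: prob_space \<mu> by fact
  interpret N: prob_space \<nu> by fact
  \<comment> \<open>The set \<open>S\<close> collects the coordinates already turned into
    indicators. With \<open>S = K\<close> the claim says that both measures agree on measurable
    rectangles.\<close>
  have claim: "(\<integral>x. (\<Prod>k\<in>S. indicator (A k) (x k)) *\<^sub>R iexp (\<Sum>k\<in>K - S. s k * x k) \<partial>\<mu>)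
      = (\<integral>x. (\<Prod>k\<in>S. indicator (A k) (x k)) *\<^sub>R iexp (\<Sum>k\<in>K - S. s k * x k) \<partial>\<nu>)"
    if "S \<subseteq> K" "\<And>k. k \<in> S \<Longrightarrow> A k \<in> sets borel" for S A s
  proof -
    have "finite S" using that(1) K by (rule finite_subset)
    then show ?thesis using that
    proof (induction S arbitrary: s)
      case empty
      then show ?case using eq by simp
    next
      case (insert j S)
      have S: "S \<subseteq> K" "j \<in> K" "j \<notin> S" "finite S" using insert by auto
      have A: "A k \<in> sets borel" if "k \<in> insert j S" for k using insert.prems(2) that by blast
      define w where "w x = (\<Prod>k\<in>S. indicator (A k) (x k) :: real)" for x
      define \<theta> where "\<theta> x = (\<Sum>k\<in>K - insert j S. s k * x k)" for x
      have comp: "(\<lambda>x. x k) \<in> borel_measurable \<mu>" "(\<lambda>x. x k) \<in> borel_measurable \<nu>" if "k \<in> K" for k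
        using that by measurable
      have ind: "(\<lambda>x. indicator (A k) (x k) :: real) \<in> borel_measurable \<mu>"
          "(\<lambda>x. indicator (A k) (x k) :: real) \<in> borel_measurable \<nu>" if "k \<in> K" "A k \<in> sets borel" for k
        using measurable_compose[OF comp(1)[OF that(1)] borel_measurable_indicator[OF that(2)]]
          measurable_compose[OF comp(2)[OF that(1)] borel_measurable_indicator[OF that(2)]] by auto
      have wm: "w \<in> borel_measurable \<mu>" "w \<in> borel_measurable \<nu>"
        unfolding w_def using S A ind by (intro borel_measurable_prod; blast)+
      have \<theta>m: "\<theta> \<in> borel_measurable \<mu>" "\<theta> \<in> borel_measurable \<nu>"
        unfolding \<theta>_def using comp by (auto intro!: borel_measurable_sum borel_measurable_times)
      have xm: "(\<lambda>x. x j) \<in> borel_measurable \<mu>" "(\<lambda>x. x j) \<in> borel_measurable \<nu>"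
        using comp S by auto
      note [measurable] = wm \<theta>m xm
      have w01: "0 \<le> w x" "w x \<le> 1" for x
        unfolding w_def by (auto intro!: prod_nonneg prod_le_1 simp: indicator_def)
      have KS: "K - S = insert j (K - insert j S)" using S by auto
      have 1: "(\<integral>x. w x *\<^sub>R iexp (t * x j + c * \<theta> x) \<partial>\<mu>) = (\<integral>x. w x *\<^sub>R iexp (t * x j + c * \<theta> x) \<partial>\<nu>)" for t c :: real
      proof -
        have "(\<Sum>k\<in>K - S. (if k = j then t else c * s k) * x k) = t * x j + c * \<theta> x" for x
          unfolding KS \<theta>_def sum_distrib_left using K
          by (subst sum.insert) (auto intro!: sum.cong)
        then show ?thesis
          using insert.IH[OF S(1), of "\<lambda>k. if k = j then t else c * s k"] A by (simp add: w_def)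
      qed
      have inte: "integrable \<mu> (\<lambda>x. w x *\<^sub>R iexp (t * x j + c * \<theta> x))"
          "integrable \<nu> (\<lambda>x. w x *\<^sub>R iexp (t * x j + c * \<theta> x))" for t c :: real
        using w01 by (auto intro!: M.integrable_const_bound[of _ 1] N.integrable_const_bound[of _ 1])
      \<comment> \<open>Cosine and sine are combinations of the frequencies 1 and -1, and the
        constant 1 is the frequency 0, so the induction hypothesis with rescaled \<open>s\<close>
        covers both real weights.\<close>
      have cosE: "(w x * (1 + cos (\<theta> x))) *\<^sub>R iexp (t * x j)
          = w x *\<^sub>R iexp (t * x j + 0 * \<theta> x) + (1/2) *\<^sub>R (w x *\<^sub>R iexp (t * x j + 1 * \<theta> x))
            + (1/2) *\<^sub>R (w x *\<^sub>R iexp (t * x j + (-1) * \<theta> x))" for x t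
        by (rule complex_eqI) (simp_all add: exp_add ring_distribs Re_exp Im_exp cos_add sin_add cos_diff sin_diff field_simps)
      have sinE: "(w x * (1 + sin (\<theta> x))) *\<^sub>R iexp (t * x j)
          = w x *\<^sub>R iexp (t * x j + 0 * \<theta> x) + (-\<i>/2) * (w x *\<^sub>R iexp (t * x j + 1 * \<theta> x))
            + (\<i>/2) * (w x *\<^sub>R iexp (t * x j + (-1) * \<theta> x))" for x t
        by (rule complex_eqI) (simp_all add: exp_add ring_distribs Re_exp Im_exp cos_add sin_add cos_diff sin_diff field_simps)
      have Aj: "A j \<in> sets borel" using A by simp
      have b0: "(\<integral>x. w x * indicator (A j) (x j) \<partial>\<mu>) = (\<integral>x. w x * indicator (A j) (x j) \<partial>\<nu>)"
        by (rule weighted_char_unique[where c = 1]) (use w01 1[of _ 0] Aj in \<open>auto intro: M.prob_space_axioms N.prob_space_axioms\<close>)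
      have c01: "0 \<le> 1 + cos (\<theta> x)" "1 + cos (\<theta> x) \<le> 2" "0 \<le> 1 + sin (\<theta> x)" "1 + sin (\<theta> x) \<le> 2" for x
        using cos_ge_minus_one[of "\<theta> x"] cos_le_one[of "\<theta> x"] sin_ge_minus_one[of "\<theta> x"] sin_le_one[of "\<theta> x"] by linarith+
      have w2: "w x * y \<le> 2" if "0 \<le> y" "y \<le> 2" for x y
        using mult_mono[OF w01(2)[of x] that(2)] that(1) by simp
      have b1: "(\<integral>x. w x * (1 + cos (\<theta> x)) * indicator (A j) (x j) \<partial>\<mu>) = (\<integral>x. w x * (1 + cos (\<theta> x)) * indicator (A j) (x j) \<partial>\<nu>)"
      proof (rule weighted_char_unique[where c = 2])
        show "(\<integral>x. (w x * (1 + cos (\<theta> x))) *\<^sub>R iexp (t * x j) \<partial>\<mu>) = (\<integral>x. (w x * (1 + cos (\<theta> x))) *\<^sub>R iexp (t * x j) \<partial>\<nu>)" for t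
          unfolding cosE
          by (simp only: Bochner_Integration.integral_add integral_scaleR_right inte integrable_scaleR_right Bochner_Integration.integrable_add 1)
      qed (use w01 c01 w2 Aj in \<open>auto intro: M.prob_space_axioms N.prob_space_axioms\<close>)
      have b2: "(\<integral>x. w x * (1 + sin (\<theta> x)) * indicator (A j) (x j) \<partial>\<mu>) = (\<integral>x. w x * (1 + sin (\<theta> x)) * indicator (A j) (x j) \<partial>\<nu>)"
      proof (rule weighted_char_unique[where c = 2])
        show "(\<integral>x. (w x * (1 + sin (\<theta> x))) *\<^sub>R iexp (t * x j) \<partial>\<mu>) = (\<integral>x. (w x * (1 + sin (\<theta> x))) *\<^sub>R iexp (t * x j) \<partial>\<nu>)" for t
          unfolding sinE
          by (simp only: Bochner_Integration.integral_add integral_mult_right_zero inte integrable_mult_right Bochner_Integration.integrable_add 1)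
      qed (use w01 c01 w2 Aj in \<open>auto intro: M.prob_space_axioms N.prob_space_axioms\<close>)
      let ?B = "\<lambda>x. indicator (A j) (x j) :: real"
      have Bm: "?B \<in> borel_measurable \<mu>" "?B \<in> borel_measurable \<nu>"
        using ind[OF S(2) Aj] by auto
      note [measurable] = Bm
      have bd: "\<bar>w x * ?B x\<bar> \<le> 1" "\<bar>w x * (1 + cos (\<theta> x)) * ?B x\<bar> \<le> 2" "\<bar>w x * (1 + sin (\<theta> x)) * ?B x\<bar> \<le> 2" for x
        using w01[of x] w2[OF c01(1,2)[of x], of x] w2[OF c01(3,4)[of x], of x] c01[of x] by (auto simp: indicator_def abs_mult)
      have ib: "integrable \<mu> (\<lambda>x. w x * ?B x)" "integrable \<nu> (\<lambda>x. w x * ?B x)"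
        "integrable \<mu> (\<lambda>x. w x * (1 + cos (\<theta> x)) * ?B x)" "integrable \<nu> (\<lambda>x. w x * (1 + cos (\<theta> x)) * ?B x)"
        "integrable \<mu> (\<lambda>x. w x * (1 + sin (\<theta> x)) * ?B x)" "integrable \<nu> (\<lambda>x. w x * (1 + sin (\<theta> x)) * ?B x)"
        using bd by (auto intro!: M.integrable_const_bound[of _ 2] N.integrable_const_bound[of _ 2] AE_I2 intro: order_trans[OF _ one_le_numeral])
      \<comment> \<open>Recovers the complex exponential from the two nonnegative weights by
        subtracting the constant 1 from each.\<close>
      have split: "(w x * ?B x) *\<^sub>R iexp (\<theta> x)
          = complex_of_real (w x * (1 + cos (\<theta> x)) * ?B x - w x * ?B x)
            + \<i> * complex_of_real (w x * (1 + sin (\<theta> x)) * ?B x - w x * ?B x)" for x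
        by (rule complex_eqI) (simp_all add: Re_exp Im_exp algebra_simps)
      have "(\<integral>x. (w x * ?B x) *\<^sub>R iexp (\<theta> x) \<partial>\<mu>) = (\<integral>x. (w x * ?B x) *\<^sub>R iexp (\<theta> x) \<partial>\<nu>)"
        unfolding split
        by (simp only: Bochner_Integration.integral_add integral_mult_right_zero integral_complex_of_real
            Bochner_Integration.integral_diff integrable_of_real ib integrable_mult_right Bochner_Integration.integrable_add
            Bochner_Integration.integrable_diff b0 b1 b2)
      moreover have "(\<Prod>k\<in>insert j S. indicator (A k) (x k)) = w x * ?B x" for x
        using S by (simp add: w_def mult.commute)
      ultimately show ?case by (simp add: \<theta>_def)
    qed
  qed
  show ?thesis
  proof (rule measure_eqI_PiM_finite[OF K s\<mu> s\<nu>])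
    fix A assume A: "\<And>i. i \<in> K \<Longrightarrow> A i \<in> sets (borel :: real measure)"
    have "(\<integral>x. complex_of_real (\<Prod>k\<in>K. indicator (A k) (x k)) \<partial>\<mu>)
        = (\<integral>x. complex_of_real (\<Prod>k\<in>K. indicator (A k) (x k)) \<partial>\<nu>)"
      using claim[of K A "\<lambda>_. 0"] A by (simp add: scaleR_conv_of_real)
    then have "(\<integral>x. (\<Prod>k\<in>K. indicator (A k) (x k) :: real) \<partial>\<mu>) = (\<integral>x. (\<Prod>k\<in>K. indicator (A k) (x k)) \<partial>\<nu>)"
      by (simp only: integral_complex_of_real of_real_eq_iff)
    moreover have ind: "(\<Prod>k\<in>K. indicator (A k) (x k) :: real) = indicator (Pi\<^sub>E K A) x"
      if "x \<in> space (PiM K (\<lambda>_. borel :: real measure))" for x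
      using that K by (auto simp: indicator_def space_PiM PiE_def Pi_def extensional_def prod_zero_iff split: if_splits)
    have sp: "space \<mu> = space (PiM K (\<lambda>_. borel :: real measure))" "space \<nu> = space (PiM K (\<lambda>_. borel :: real measure))"
      using s\<mu> s\<nu> sets_eq_imp_space_eq by blast+
    have se: "Pi\<^sub>E K A \<in> sets \<mu>" "Pi\<^sub>E K A \<in> sets \<nu>"
      unfolding s\<mu> s\<nu> using A K by (auto intro!: sets_PiM_I_finite)
    have "(\<integral>x. (\<Prod>k\<in>K. indicator (A k) (x k) :: real) \<partial>\<mu>) = (\<integral>x. indicator (Pi\<^sub>E K A) x \<partial>\<mu>)"
        "(\<integral>x. (\<Prod>k\<in>K. indicator (A k) (x k) :: real) \<partial>\<nu>) = (\<integral>x. indicator (Pi\<^sub>E K A) x \<partial>\<nu>)"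
      by (rule Bochner_Integration.integral_cong[OF refl], rule ind, simp only: sp)+
    ultimately have "measure \<mu> (Pi\<^sub>E K A) = measure \<nu> (Pi\<^sub>E K A)"
      using se[THEN sets.sets_into_space] by (simp add: Int_absorb2)
    then show "emeasure \<mu> (Pi\<^sub>E K A) = emeasure \<nu> (Pi\<^sub>E K A)"
      by (simp add: M.emeasure_eq_measure N.emeasure_eq_measure)
  next
    show "range (\<lambda>_::nat. Pi\<^sub>E K (\<lambda>_. UNIV)) \<subseteq> prod_algebra K (\<lambda>_. borel :: real measure)"
      using K by (auto intro!: prod_algebraI_finite)
    show "(\<Union>i::nat. Pi\<^sub>E K (\<lambda>_. UNIV)) = space (PiM K (\<lambda>_. borel :: real measure))"
      by (simp add: space_PiM)
  qed (simp add: M.emeasure_eq_measure)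
qed

lemma distr_char_unique:
  fixes X :: "'a \<Rightarrow> 'k \<Rightarrow> real" and X' :: "'b \<Rightarrow> 'k \<Rightarrow> real"
  assumes K: "finite K" and M: "prob_space M" and N: "prob_space N"
    and X[measurable]: "\<And>k. k \<in> K \<Longrightarrow> (\<lambda>w. X w k) \<in> borel_measurable M"
    and X'[measurable]: "\<And>k. k \<in> K \<Longrightarrow> (\<lambda>w. X' w k) \<in> borel_measurable N"
    and eq: "\<And>s. (\<integral>w. iexp (\<Sum>k\<in>K. s k * X w k) \<partial>M) = (\<integral>w. iexp (\<Sum>k\<in>K. s k * X' w k) \<partial>N)"
  shows "distr M (PiM K (\<lambda>_. borel)) (\<lambda>w. restrict (X w) K) = distr N (PiM K (\<lambda>_. borel)) (\<lambda>w. restrict (X' w) K)"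
proof (rule PiM_char_unique[OF K])
  have [measurable]: "(\<lambda>w. restrict (X w) K) \<in> measurable M (PiM K (\<lambda>_. borel))"
    "(\<lambda>w. restrict (X' w) K) \<in> measurable N (PiM K (\<lambda>_. borel))"
    by (rule measurable_restrict, simp)+
  show "prob_space (distr M (PiM K (\<lambda>_. borel)) (\<lambda>w. restrict (X w) K))"
    "prob_space (distr N (PiM K (\<lambda>_. borel)) (\<lambda>w. restrict (X' w) K))"
    using M N by (auto intro: prob_space.prob_space_distr)
  have meas: "(\<lambda>x. iexp (\<Sum>k\<in>K. s k * x k)) \<in> borel_measurable (PiM K (\<lambda>_. borel))" for s :: "'k \<Rightarrow> real"
    by measurable
  have r: "(\<Sum>k\<in>K. s k * restrict y K k) = (\<Sum>k\<in>K. s k * y k)" for s y :: "'k \<Rightarrow> real"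
    by (rule sum.cong) auto
  fix s
  show "(\<integral>x. iexp (\<Sum>k\<in>K. s k * x k) \<partial>distr M (PiM K (\<lambda>_. borel)) (\<lambda>w. restrict (X w) K))
      = (\<integral>x. iexp (\<Sum>k\<in>K. s k * x k) \<partial>distr N (PiM K (\<lambda>_. borel)) (\<lambda>w. restrict (X' w) K))"
    by (simp only: integral_distr[OF _ meas] \<open>(\<lambda>w. restrict (X w) K) \<in> _\<close> \<open>(\<lambda>w. restrict (X' w) K) \<in> _\<close> r eq)
qed simp_all

section \<open>Characteristic functions of Gaussian product measures\<close>

lemma char_normal:
  assumes "0 < \<tau>"
  shows "(\<integral>x. iexp (u * x) \<partial>density lborel (normal_density 0 \<tau>)) = of_real (exp (- (\<tau>\<^sup>2 * u\<^sup>2) / 2))"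
proof -
  interpret S: real_distribution std_normal_distribution by (rule real_dist_normal_dist)
  have "distributed std_normal_distribution lborel (\<lambda>x. x) std_normal_density"
    by (auto simp: distributed_def distr_id2)
  from S.normal_density_affine[OF this, of \<tau> 0] assms
  have "density lborel (normal_density 0 \<tau>) = distr std_normal_distribution lborel (\<lambda>x. \<tau> * x)"
    by (simp add: distributed_def)
  then have "(\<integral>x. iexp (u * x) \<partial>density lborel (normal_density 0 \<tau>)) = char std_normal_distribution (\<tau> * u)"
    by (simp add: integral_distr char_def mult_ac)
  then show ?thesis by (simp add: char_std_normal_distribution power_mult_distrib)
qed

lemma char_PiM_normal:
  assumes I: "finite I" and \<tau>: "\<And>i. 0 < \<tau> i"
  shows "(\<integral>w. iexp (\<Sum>i\<in>I. a i * w i) \<partial>PiM I (\<lambda>i. density lborel (normal_density 0 (\<tau> i))))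
    = of_real (exp (- (\<Sum>i\<in>I. (\<tau> i)\<^sup>2 * (a i)\<^sup>2) / 2))"
proof -
  interpret P: product_prob_space "\<lambda>i. density lborel (normal_density 0 (\<tau> i))" I
    by (intro product_prob_spaceI prob_space_normal_density \<tau>)
  have "(\<integral>w. iexp (\<Sum>i\<in>I. a i * w i) \<partial>PiM I (\<lambda>i. density lborel (normal_density 0 (\<tau> i))))
      = (\<integral>w. (\<Prod>i\<in>I. iexp (a i * w i)) \<partial>PiM I (\<lambda>i. density lborel (normal_density 0 (\<tau> i))))"
    using I by (intro Bochner_Integration.integral_cong refl)
      (simp only: of_real_sum sum_distrib_left exp_sum)
  also have "\<dots> = (\<Prod>i\<in>I. \<integral>x. iexp (a i * x) \<partial>density lborel (normal_density 0 (\<tau> i)))"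
  proof (rule P.product_integral_prod[OF I])
    fix i
    have p: "finite_measure (density lborel (normal_density 0 (\<tau> i)))"
      by (intro prob_space.finite_measure prob_space_normal_density \<tau>)
    show "integrable (density lborel (normal_density 0 (\<tau> i))) (\<lambda>x. iexp (a i * x))"
      by (rule finite_measure.integrable_const_bound[OF p, of _ 1]) auto
  qed
  also have "\<dots> = of_real (exp (\<Sum>i\<in>I. - ((\<tau> i)\<^sup>2 * (a i)\<^sup>2) / 2))"
    unfolding exp_sum[OF I] of_real_prod by (intro prod.cong refl char_normal \<tau>)
  finally show ?thesis by (simp add: sum_negf sum_divide_distrib)
qed

definition std_gauss :: "nat \<Rightarrow> (nat \<Rightarrow> real) measure" where
  "std_gauss D = PiM {..<D} (\<lambda>_. density lborel std_normal_density)"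

lemma prob_space_std_gauss: "prob_space (std_gauss D)"
  unfolding std_gauss_def by (intro prob_space_PiM prob_space_normal_density) simp

lemma sets_std_gauss[measurable_cong]: "sets (std_gauss D) = sets (PiM {..<D} (\<lambda>_. borel))"
  unfolding std_gauss_def by (intro sets_PiM_cong) auto

lemma char_std_gauss:
  "(\<integral>w. iexp (\<Sum>j<D. a j * w j) \<partial>std_gauss D) = of_real (exp (- (\<Sum>j<D. (a j)\<^sup>2) / 2))"
  unfolding std_gauss_def using char_PiM_normal[of "{..<D}" "\<lambda>_. 1" a] by simp

lemma char_PiM_std_gauss:
  assumes C: "finite C"
  shows "(\<integral>w. iexp (\<Sum>c\<in>C. \<Sum>j<D. a c j * w c j) \<partial>PiM C (\<lambda>_. std_gauss D))
    = of_real (exp (- (\<Sum>c\<in>C. \<Sum>j<D. (a c j)\<^sup>2) / 2))"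
proof -
  interpret p: prob_space "std_gauss D" by (rule prob_space_std_gauss)
  interpret P: product_prob_space "\<lambda>_. std_gauss D" C by standard
  have "(\<integral>w. iexp (\<Sum>c\<in>C. \<Sum>j<D. a c j * w c j) \<partial>PiM C (\<lambda>_. std_gauss D))
      = (\<integral>w. (\<Prod>c\<in>C. iexp (\<Sum>j<D. a c j * w c j)) \<partial>PiM C (\<lambda>_. std_gauss D))"
    using C by (intro Bochner_Integration.integral_cong refl)
      (simp only: of_real_sum[of _ C] sum_distrib_left exp_sum)
  also have "\<dots> = (\<Prod>c\<in>C. \<integral>x. iexp (\<Sum>j<D. a c j * x j) \<partial>std_gauss D)"
    by (rule P.product_integral_prod[OF C]) (rule p.integrable_const_bound[of _ 1], auto)
  also have "\<dots> = of_real (exp (\<Sum>c\<in>C. - (\<Sum>j<D. (a c j)\<^sup>2) / 2))"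
    unfolding exp_sum[OF C] of_real_prod by (intro prod.cong refl char_std_gauss)
  finally show ?thesis by (simp add: sum_negf sum_divide_distrib)
qed

section \<open>Averages of features of Gaussian vectors\<close>

lemma tendsto_fun_coordinatewise:
  fixes f :: "'a \<Rightarrow> 'i \<Rightarrow> 'b::topological_space"
  assumes "\<And>i. ((\<lambda>n. f n i) \<longlongrightarrow> l i) F"
  shows "(f \<longlongrightarrow> l) F"
proof -
  have "limitin (product_topology (\<lambda>_. euclidean) UNIV) f l F"
    unfolding limitin_componentwise using assms by (auto simp: limitin_canonical_iff)
  then show ?thesis by (simp add: euclidean_product_topology limitin_canonical_iff)
qed

definition lin :: "nat \<Rightarrow> (nat \<Rightarrow> nat \<Rightarrow> real) \<Rightarrow> (nat \<Rightarrow> real) \<Rightarrow> nat \<Rightarrow> real" where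
  "lin D A \<xi> = (\<lambda>i. \<Sum>k<D. A i k * \<xi> k)"

text \<open>The standard density times exp (x^2 / 4) is sqrt 2 times the density of variance 2. This
  moment carries both the domination in the upper bound and exponential tightness.\<close>

lemma nn_integral_exp_quarter_std_gauss:
  "(\<integral>\<^sup>+\<xi>. ennreal (exp ((\<Sum>k<D. (\<xi> k)\<^sup>2) / 4)) \<partial>std_gauss D) = ennreal (sqrt 2 ^ D)"
proof -
  have 1: "(\<integral>\<^sup>+x. ennreal (exp (x\<^sup>2 / 4)) \<partial>density lborel std_normal_density) = ennreal (sqrt 2)"
  proof -
    interpret n: prob_space "density lborel (normal_density 0 (sqrt 2))"
      by (rule prob_space_normal_density) simp
    have "std_normal_density x * exp (x\<^sup>2 / 4) = sqrt 2 * normal_density 0 (sqrt 2) x" for x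
      by (simp add: normal_density_def real_sqrt_mult field_simps exp_add[symmetric])
    then have "(\<integral>\<^sup>+x. ennreal (exp (x\<^sup>2 / 4)) \<partial>density lborel std_normal_density)
        = (\<integral>\<^sup>+x. ennreal (sqrt 2) * (ennreal (normal_density 0 (sqrt 2) x) * 1) \<partial>lborel)"
      by (subst nn_integral_density) (auto intro!: nn_integral_cong simp: ennreal_mult[symmetric])
    also have "\<dots> = ennreal (sqrt 2) * (\<integral>\<^sup>+x. 1 \<partial>density lborel (normal_density 0 (sqrt 2)))"
      by (subst nn_integral_cmult, simp) (subst nn_integral_density, auto)
    also have "\<dots> = ennreal (sqrt 2)" using n.emeasure_space_1 by simp
    finally show ?thesis .
  qed
  interpret P: product_prob_space "\<lambda>_. density lborel std_normal_density" "{..<D}"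
    by (intro product_prob_spaceI prob_space_normal_density) simp
  have "(\<integral>\<^sup>+\<xi>. ennreal (exp ((\<Sum>k<D. (\<xi> k)\<^sup>2) / 4)) \<partial>std_gauss D)
      = (\<integral>\<^sup>+\<xi>. (\<Prod>k<D. ennreal (exp ((\<xi> k)\<^sup>2 / 4))) \<partial>PiM {..<D} (\<lambda>_. density lborel std_normal_density))"
    unfolding std_gauss_def by (simp add: prod_ennreal exp_sum[symmetric] sum_divide_distrib)
  also have "\<dots> = ennreal (sqrt 2 ^ D)"
    by (subst P.product_nn_integral_prod) (auto simp: 1 ennreal_power)
  finally show ?thesis .
qed

text \<open>The hypothesis \<open>g_lip\<close> is the form that the asymptotic Lipschitz condition
  takes for products of two features: the increment of one factor times the linear growth of the
  other, with \<open>\<eta>\<close> arbitrarily small at the price of a constant. Vectors are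
  functions on all naturals, so \<open>g_local\<close> records that only the first \<open>D\<close>
  coordinates count, and continuity refers to the product topology.\<close>

locale feature_map =
  fixes D :: nat and J :: "'j set" and g :: "(nat \<Rightarrow> real) \<Rightarrow> 'j \<Rightarrow> real" and \<Lambda> :: real
  assumes finite_J: "finite J"
    and g_cont: "\<And>j. j \<in> J \<Longrightarrow> continuous_on UNIV (\<lambda>z. g z j)"
    and g_local: "\<And>z z' j. (\<And>k. k < D \<Longrightarrow> z k = z' k) \<Longrightarrow> j \<in> J \<Longrightarrow> g z j = g z' j"
    and \<Lambda>_nonneg: "0 \<le> \<Lambda>"
    and g_lip: "\<And>\<eta>. 0 < \<eta> \<Longrightarrow> \<exists>c. \<forall>z z'. \<forall>j\<in>J. \<bar>g z j - g z' j\<bar> \<le>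
        (\<Lambda> * L2_set (\<lambda>k. z k - z' k) {..<D} + \<eta> * (L2_set z {..<D} + L2_set z' {..<D}) + c)
          * (1 + L2_set z {..<D} + L2_set z' {..<D})"
begin

abbreviation nrm :: "(nat \<Rightarrow> real) \<Rightarrow> real" where "nrm z \<equiv> L2_set z {..<D}"

abbreviation \<Omega> :: "nat \<Rightarrow> (nat \<Rightarrow> nat \<Rightarrow> real) measure" where
  "\<Omega> C \<equiv> PiM {1..C} (\<lambda>_. std_gauss D)"

lemma nrm_sq: "(nrm z)\<^sup>2 = (\<Sum>k<D. (z k)\<^sup>2)"
  by (simp add: L2_set_def sum_nonneg)

lemma abs_le_nrm:
  assumes "k < D" shows "\<bar>z k\<bar> \<le> nrm z"
proof -
  have "(z k)\<^sup>2 \<le> (\<Sum>k<D. (z k)\<^sup>2)" using assms by (intro member_le_sum) auto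
  then have "sqrt ((z k)\<^sup>2) \<le> nrm z" unfolding L2_set_def by (rule real_sqrt_le_mono)
  then show ?thesis by simp
qed

lemma nrm_lin_le:
  assumes "\<And>i k. i < D \<Longrightarrow> k < D \<Longrightarrow> \<bar>A i k\<bar> \<le> r" "0 \<le> r"
  shows "nrm (lin D A \<xi>) \<le> (real D)\<^sup>2 * r * nrm \<xi>"
proof -
  have "nrm (lin D A \<xi>) \<le> (\<Sum>i<D. \<bar>lin D A \<xi> i\<bar>)" by (rule L2_set_le_sum_abs)
  also have "\<dots> \<le> (\<Sum>i<D. \<Sum>k<D. \<bar>A i k * \<xi> k\<bar>)"
    unfolding lin_def by (intro sum_mono sum_abs)
  also have "\<dots> \<le> (\<Sum>i<D. \<Sum>k<D. r * nrm \<xi>)"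
    using assms by (intro sum_mono) (auto simp: abs_mult intro!: mult_mono abs_le_nrm)
  also have "\<dots> = (real D)\<^sup>2 * r * nrm \<xi>" by (simp add: power2_eq_square)
  finally show ?thesis .
qed

lemma lin_diff: "lin D A \<xi> i - lin D A' \<xi> i = lin D (\<lambda>i k. A i k - A' i k) \<xi> i"
  by (simp add: lin_def sum_subtractf algebra_simps)

lemma g_meas:
  assumes "j \<in> J" shows "(\<lambda>z. g z j) \<in> borel_measurable borel"
  using g_cont[OF assms] by (rule borel_measurable_continuous_onI)

lemma lin_meas: "lin D A \<in> borel_measurable (std_gauss D)"
  unfolding lin_def by (rule measurable_coordinatewise_then_product) measurable

lemma g_lin_meas[measurable]: "j \<in> J \<Longrightarrow> (\<lambda>\<xi>. g (lin D A \<xi>) j) \<in> borel_measurable (std_gauss D)"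
  by (rule measurable_compose[OF lin_meas g_meas])

text \<open>The increment bound with \<open>\<eta> = 1\<close> against the zero vector: both of its
  factors are then linear in the norm.\<close>

lemma g_growth:
  obtains \<kappa> where "0 < \<kappa>" "\<And>z j. j \<in> J \<Longrightarrow> \<bar>g z j\<bar> \<le> \<kappa> * (1 + (nrm z)\<^sup>2)"
proof -
  have "\<exists>c. \<forall>z z'. \<forall>j\<in>J. \<bar>g z j - g z' j\<bar> \<le>
        (\<Lambda> * nrm (\<lambda>k. z k - z' k) + 1 * (nrm z + nrm z') + c) * (1 + nrm z + nrm z')"
    by (rule g_lip) simp
  then obtain c where "\<forall>z z'. \<forall>j\<in>J. \<bar>g z j - g z' j\<bar> \<le>
        (\<Lambda> * nrm (\<lambda>k. z k - z' k) + 1 * (nrm z + nrm z') + c) * (1 + nrm z + nrm z')"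
    by blast
  then have c: "\<bar>g z j - g z' j\<bar> \<le>
        (\<Lambda> * nrm (\<lambda>k. z k - z' k) + 1 * (nrm z + nrm z') + c) * (1 + nrm z + nrm z')" if "j \<in> J" for z z' j
    using that by blast
  define G where "G = (\<Sum>j\<in>J. \<bar>g (\<lambda>_. 0) j\<bar>)"
  have G: "0 \<le> G" by (simp add: G_def sum_nonneg)
  define \<kappa> where "\<kappa> = 2 * (\<Lambda> + 1 + \<bar>c\<bar>) + G"
  show ?thesis
  proof
    show "0 < \<kappa>" using \<Lambda>_nonneg G by (simp add: \<kappa>_def)
    fix z j assume j: "j \<in> J"
    let ?n = "nrm z"
    have n: "0 \<le> ?n" by (rule L2_set_nonneg)
    have n0: "nrm (\<lambda>_. 0) = 0" by (simp add: L2_set_def)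
    have "\<bar>g z j - g (\<lambda>_. 0) j\<bar> \<le> (\<Lambda> * ?n + ?n + c) * (1 + ?n)"
      using c[OF j, of z "\<lambda>_. 0"] by (simp add: n0)
    also have "\<dots> \<le> ((\<Lambda> + 1 + \<bar>c\<bar>) * (1 + ?n)) * (1 + ?n)"
    proof (rule mult_right_mono)
      have "0 \<le> \<bar>c\<bar> * ?n" using n by simp
      then show "\<Lambda> * ?n + ?n + c \<le> (\<Lambda> + 1 + \<bar>c\<bar>) * (1 + ?n)"
        using \<Lambda>_nonneg unfolding ring_distribs by linarith
    qed (use n in simp)
    also have "\<dots> = (\<Lambda> + 1 + \<bar>c\<bar>) * (1 + ?n)\<^sup>2" by (simp add: power2_eq_square)
    also have "\<dots> \<le> (\<Lambda> + 1 + \<bar>c\<bar>) * (2 * (1 + ?n\<^sup>2))"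
    proof (rule mult_left_mono)
      have "0 \<le> (1 - ?n)\<^sup>2" by simp
      then show "(1 + ?n)\<^sup>2 \<le> 2 * (1 + ?n\<^sup>2)" by (simp add: power2_eq_square algebra_simps)
    qed (use \<Lambda>_nonneg in auto)
    finally have 1: "\<bar>g z j - g (\<lambda>_. 0) j\<bar> \<le> 2 * (\<Lambda> + 1 + \<bar>c\<bar>) * (1 + ?n\<^sup>2)"
      by (simp only: mult.assoc mult.left_commute[of _ 2])
    have "\<bar>g (\<lambda>_. 0) j\<bar> \<le> G" unfolding G_def using j finite_J by (intro member_le_sum) auto
    also have "G \<le> G * (1 + ?n\<^sup>2)" using G by (simp add: algebra_simps)
    finally show "\<bar>g z j\<bar> \<le> \<kappa> * (1 + ?n\<^sup>2)" using 1 unfolding \<kappa>_def ring_distribs(2) by linarith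
  qed
qed

lemma g_unif_cont:
  assumes j: "j \<in> J" and e: "0 < e"
  shows "\<exists>d>0. \<forall>z z'. (\<forall>k<D. \<bar>z k\<bar> \<le> r \<and> \<bar>z k - z' k\<bar> \<le> d) \<longrightarrow> \<bar>g z j - g z' j\<bar> \<le> e"
proof (rule ccontr)
  assume neg: "\<not> ?thesis"
  have "\<exists>z z'. (\<forall>k<D. \<bar>z k\<bar> \<le> r \<and> \<bar>z k - z' k\<bar> \<le> inverse (real (Suc n))) \<and> e < \<bar>g z j - g z' j\<bar>" for n
  proof -
    have "0 < inverse (real (Suc n))" by simp
    with neg show ?thesis by (meson not_le)
  qed
  then obtain z z' where z: "\<And>n k. k < D \<Longrightarrow> \<bar>z n k\<bar> \<le> r" "\<And>n k. k < D \<Longrightarrow> \<bar>z n k - z' n k\<bar> \<le> inverse (real (Suc n))"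
      "\<And>n. e < \<bar>g (z n) j - g (z' n) j\<bar>"
    by metis
  obtain l s where s: "strict_mono s" "\<And>k. k < D \<Longrightarrow> (\<lambda>n. z (s n) k) \<longlonglongrightarrow> l k"
    using bounded_coords_subseq[of "{..<D}" z r] z(1) by (metis finite_lessThan lessThan_iff)
  \<comment> \<open>Setting the coordinates from \<open>D\<close> on to zero turns convergence of
    the first \<open>D\<close> coordinates into convergence of functions, to which continuity of
    \<open>g\<close> applies; by \<open>g_local\<close> the values of \<open>g\<close> are
    unaffected.\<close>
  define R where "R y = (\<lambda>k. if k < D then y k else 0 :: real)" for y
  have gR: "g (R y) j = g y j" for y by (rule g_local) (auto simp: R_def j)
  have lim0: "(\<lambda>n. inverse (real (Suc (s n)))) \<longlonglongrightarrow> 0"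
    using LIMSEQ_subseq_LIMSEQ[OF LIMSEQ_inverse_real_of_nat s(1)] by (simp add: o_def)
  have s': "(\<lambda>n. z' (s n) k) \<longlonglongrightarrow> l k" if "k < D" for k
  proof -
    have "(\<lambda>n. z (s n) k - z' (s n) k) \<longlonglongrightarrow> 0"
      by (rule Lim_null_comparison[OF _ lim0]) (use z(2)[OF that] in auto)
    from tendsto_diff[OF s(2)[OF that] this] show ?thesis by simp
  qed
  have "(\<lambda>n. R (z (s n))) \<longlonglongrightarrow> R l" "(\<lambda>n. R (z' (s n))) \<longlonglongrightarrow> R l"
    using s(2) s' by (auto intro!: tendsto_fun_coordinatewise simp: R_def)
  then have "(\<lambda>n. g (R (z (s n))) j) \<longlonglongrightarrow> g (R l) j" "(\<lambda>n. g (R (z' (s n))) j) \<longlonglongrightarrow> g (R l) j"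
    by (auto intro: continuous_on_tendsto_compose[OF g_cont[OF j]])
  then have "(\<lambda>n. \<bar>g (z (s n)) j - g (z' (s n)) j\<bar>) \<longlonglongrightarrow> \<bar>g l j - g l j\<bar>"
    unfolding gR by (intro tendsto_intros)
  then have "\<forall>\<^sub>F n in sequentially. \<bar>g (z (s n)) j - g (z' (s n)) j\<bar> < e"
    using e by (intro order_tendstoD) auto
  then obtain n where "\<bar>g (z (s n)) j - g (z' (s n)) j\<bar> < e" by (auto simp: eventually_sequentially)
  then show False using z(3)[of "s n"] by simp
qed

lemma g_unif_cont_all:
  assumes e: "0 < e"
  obtains d where "0 < d" "\<And>z z' j. j \<in> J \<Longrightarrow> (\<And>k. k < D \<Longrightarrow> \<bar>z k\<bar> \<le> r) \<Longrightarrow> (\<And>k. k < D \<Longrightarrow> \<bar>z k - z' k\<bar> \<le> d)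
      \<Longrightarrow> \<bar>g z j - g z' j\<bar> \<le> e"
proof -
  define P where "P j d \<longleftrightarrow> 0 < d \<and> (\<forall>z z'. (\<forall>k<D. \<bar>z k\<bar> \<le> r \<and> \<bar>z k - z' k\<bar> \<le> d) \<longrightarrow> \<bar>g z j - g z' j\<bar> \<le> e)" for j d
  have "\<forall>j\<in>J. \<exists>d. P j d" using g_unif_cont[OF _ e, of _ r] by (simp add: P_def)
  then obtain d where d: "\<And>j. j \<in> J \<Longrightarrow> P j (d j)" by metis
  define d0 where "d0 = Min (insert 1 (d ` J))"
  have "0 < d0" unfolding d0_def using finite_J d by (subst Min_gr_iff) (auto simp: P_def)
  moreover have "d0 \<le> d j" if "j \<in> J" for j unfolding d0_def using finite_J that by (intro Min_le) auto
  ultimately show ?thesis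
    using d by (intro that[of d0]) (unfold P_def, assumption, meson order_trans)
qed

text \<open>The estimate behind all uniformity in \<open>A\<close>. For short \<xi> it is uniform
  continuity on a box; for long \<xi> the increment bound \<open>g_lip\<close> applies, and its
  constant is small against the norm.\<close>

lemma g_perturb:
  assumes e: "0 < e" and r: "0 \<le> r"
  obtains d where "0 < d" "\<And>A A' \<xi> j. (\<And>i k. i < D \<Longrightarrow> k < D \<Longrightarrow> \<bar>A' i k\<bar> \<le> r) \<Longrightarrow>
      (\<And>i k. i < D \<Longrightarrow> k < D \<Longrightarrow> \<bar>A i k - A' i k\<bar> \<le> d) \<Longrightarrow> j \<in> J \<Longrightarrow>
      \<bar>g (lin D A \<xi>) j - g (lin D A' \<xi>) j\<bar> \<le> e * (1 + (nrm \<xi>)\<^sup>2)"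
proof -
  define N where "N = (real D)\<^sup>2 + 1"
  define \<rho> where "\<rho> = N * (r + 1)"
  have N: "1 \<le> N" by (simp add: N_def)
  have \<rho>: "0 < \<rho>" using r N by (simp add: \<rho>_def)
  \<comment> \<open>The parameters \<open>\<eta>\<close>, \<open>T\<close> and \<open>d\<close> are
    chosen so that the \<open>\<eta>\<close> term and the Lipschitz term contribute at most
    \<open>e / 8\<close> each and the constant at most \<open>e / 4\<close>, all relative to the
    square of \<open>1 + nrm \<xi>\<close>, which is at most twice
    \<open>1 + (nrm \<xi>)\<^sup>2\<close>.\<close>
  define \<eta> where "\<eta> = e / (8 * (2 * \<rho> * (1 + 2 * \<rho>)))"
  have \<eta>: "0 < \<eta>" using e \<rho> by (simp add: \<eta>_def)
  obtain c0 where c0: "\<And>z z' j. j \<in> J \<Longrightarrow> \<bar>g z j - g z' j\<bar> \<le>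
        (\<Lambda> * nrm (\<lambda>k. z k - z' k) + \<eta> * (nrm z + nrm z') + c0) * (1 + nrm z + nrm z')"
    using g_lip[OF \<eta>] by blast
  define c where "c = \<bar>c0\<bar>"
  define T where "T = 4 * c * (1 + 2 * \<rho>) / e"
  have T: "0 \<le> T" using \<rho> e by (simp add: T_def c_def)
  obtain d1 where d1: "0 < d1" "\<And>z z' j. j \<in> J \<Longrightarrow> (\<And>k. k < D \<Longrightarrow> \<bar>z k\<bar> \<le> \<rho> * T) \<Longrightarrow> (\<And>k. k < D \<Longrightarrow> \<bar>z k - z' k\<bar> \<le> d1)
      \<Longrightarrow> \<bar>g z j - g z' j\<bar> \<le> e"
    using g_unif_cont_all[OF e, of "\<rho> * T"] by metis
  define d where "d = min 1 (min (d1 / (N * (T + 1))) (e / (8 * (\<Lambda> + 1) * N * (1 + 2 * \<rho>))))"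
  have d: "0 < d" "d \<le> 1" "d \<le> d1 / (N * (T + 1))" "d \<le> e / (8 * (\<Lambda> + 1) * N * (1 + 2 * \<rho>))"
    using d1(1) N T e \<Lambda>_nonneg \<rho> by (auto simp: d_def intro!: divide_pos_pos mult_pos_pos)
  have dN: "N * d * T \<le> d1"
  proof -
    have "N * d * T \<le> d * (N * (T + 1))" using N d(1) T by (simp add: algebra_simps)
    also have "\<dots> \<le> d1 / (N * (T + 1)) * (N * (T + 1))" using d(3) N T by (intro mult_right_mono) auto
    also have "\<dots> = d1" using N T by simp
    finally show ?thesis .
  qed
  have \<Lambda>d: "\<Lambda> * (N * d) * (1 + 2 * \<rho>) \<le> e / 8"
  proof -
    have "\<Lambda> * (N * d) * (1 + 2 * \<rho>) \<le> d * ((\<Lambda> + 1) * N * (1 + 2 * \<rho>))"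
      using N d(1) \<rho> \<Lambda>_nonneg by (simp add: algebra_simps)
    also have "\<dots> \<le> e / (8 * (\<Lambda> + 1) * N * (1 + 2 * \<rho>)) * ((\<Lambda> + 1) * N * (1 + 2 * \<rho>))"
      using d(4) N \<rho> \<Lambda>_nonneg by (intro mult_right_mono) auto
    also have "\<dots> = e / 8"
    proof -
      have "(\<Lambda> + 1) * N * (1 + 2 * \<rho>) \<noteq> 0" using N \<rho> \<Lambda>_nonneg by auto
      moreover have "e / (8 * X) * X = e / 8" if "X \<noteq> 0" for X :: real using that by simp
      ultimately show ?thesis by (simp only: mult.assoc)
    qed
    finally show ?thesis .
  qed
  have \<eta>\<rho>: "\<eta> * (2 * \<rho>) * (1 + 2 * \<rho>) = e / 8"
  proof -
    have "2 * \<rho> * (1 + 2 * \<rho>) \<noteq> 0" using \<rho> by auto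
    moreover have "e / (8 * X) * X = e / 8" if "X \<noteq> 0" for X :: real using that by simp
    ultimately show ?thesis unfolding \<eta>_def by (simp only: mult.assoc)
  qed
  show ?thesis
  proof (rule that[OF d(1)])
    fix A A' :: "nat \<Rightarrow> nat \<Rightarrow> real" and \<xi> j
    assume A': "\<And>i k. i < D \<Longrightarrow> k < D \<Longrightarrow> \<bar>A' i k\<bar> \<le> r"
      and AA: "\<And>i k. i < D \<Longrightarrow> k < D \<Longrightarrow> \<bar>A i k - A' i k\<bar> \<le> d" and j: "j \<in> J"
    let ?n = "nrm \<xi>" and ?z = "lin D A \<xi>" and ?z' = "lin D A' \<xi>"
    have n: "0 \<le> ?n" by (rule L2_set_nonneg)
    have A: "\<bar>A i k\<bar> \<le> r + 1" if "i < D" "k < D" for i k using A'[OF that] AA[OF that] d(2) by linarith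
    have DN: "(real D)\<^sup>2 * b * ?n \<le> N * b * ?n" if "0 \<le> b" for b
      using n that by (intro mult_right_mono) (auto simp: N_def)
    have A'1: "\<bar>A' i k\<bar> \<le> r + 1" if "i < D" "k < D" for i k using A'[OF that] by linarith
    have nz: "nrm ?z \<le> \<rho> * ?n"
      unfolding \<rho>_def by (rule order_trans[OF nrm_lin_le DN]) (use A r in auto)
    have nz': "nrm ?z' \<le> \<rho> * ?n"
      unfolding \<rho>_def by (rule order_trans[OF nrm_lin_le DN]) (use A'1 r in auto)
    have nd: "nrm (\<lambda>k. ?z k - ?z' k) \<le> N * d * ?n"
      unfolding lin_diff by (rule order_trans[OF nrm_lin_le DN]) (use AA d(1) in auto)
    show "\<bar>g ?z j - g ?z' j\<bar> \<le> e * (1 + ?n\<^sup>2)"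
    proof (cases "?n \<le> T")
      case True
      have "\<bar>g ?z j - g ?z' j\<bar> \<le> e"
      proof (rule d1(2)[OF j])
        fix k assume k: "k < D"
        have "\<rho> * ?n \<le> \<rho> * T" using True \<rho> by simp
        then show "\<bar>?z k\<bar> \<le> \<rho> * T" using abs_le_nrm[OF k, of ?z] nz by linarith
        have "N * d * ?n \<le> N * d * T" using True N d(1) by (intro mult_left_mono) auto
        then show "\<bar>?z k - ?z' k\<bar> \<le> d1" using abs_le_nrm[OF k, of "\<lambda>k. ?z k - ?z' k"] nd dN by linarith
      qed
      then show ?thesis using e by (simp add: algebra_simps) (smt (verit) mult_nonneg_nonneg zero_le_power2)
    next
      case False
      let ?s = "1 + ?n"
      have cs: "c * (1 + 2 * \<rho>) \<le> e / 4 * ?s"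
      proof -
        have "e * T \<le> e * ?s" using False e by (intro mult_left_mono) auto
        then show ?thesis using e by (simp add: T_def)
      qed
      have "\<bar>g ?z j - g ?z' j\<bar> \<le> (\<Lambda> * nrm (\<lambda>k. ?z k - ?z' k) + \<eta> * (nrm ?z + nrm ?z') + c0) * (1 + nrm ?z + nrm ?z')"
        by (rule c0[OF j])
      also have "\<dots> \<le> (\<Lambda> * (N * d * ?s) + \<eta> * (\<rho> * ?s + \<rho> * ?s) + c) * (?s + \<rho> * ?s + \<rho> * ?s)"
      proof (rule mult_mono)
        have 1: "\<rho> * ?n \<le> \<rho> * ?s" using \<rho> by simp
        have 2: "N * d * ?n \<le> N * d * ?s" using N d(1) by (intro mult_left_mono) auto
        have "\<Lambda> * nrm (\<lambda>k. ?z k - ?z' k) \<le> \<Lambda> * (N * d * ?s)"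
          using nd 2 \<Lambda>_nonneg by (intro mult_left_mono) auto
        moreover have "\<eta> * (nrm ?z + nrm ?z') \<le> \<eta> * (\<rho> * ?s + \<rho> * ?s)"
          using nz nz' 1 \<eta> by (intro mult_left_mono add_mono) auto
        ultimately show "\<Lambda> * nrm (\<lambda>k. ?z k - ?z' k) + \<eta> * (nrm ?z + nrm ?z') + c0
            \<le> \<Lambda> * (N * d * ?s) + \<eta> * (\<rho> * ?s + \<rho> * ?s) + c" by (simp add: c_def)
        show "1 + nrm ?z + nrm ?z' \<le> ?s + \<rho> * ?s + \<rho> * ?s" using nz nz' 1 n by linarith
        show "0 \<le> \<Lambda> * (N * d * ?s) + \<eta> * (\<rho> * ?s + \<rho> * ?s) + c"
          using \<Lambda>_nonneg N d(1) n \<eta> \<rho> by (intro add_nonneg_nonneg mult_nonneg_nonneg) (auto simp: c_def)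
      qed (auto intro!: add_nonneg_nonneg L2_set_nonneg)
      also have "\<dots> = (\<Lambda> * (N * d) * (1 + 2 * \<rho>) + \<eta> * (2 * \<rho>) * (1 + 2 * \<rho>)) * ?s\<^sup>2 + c * (1 + 2 * \<rho>) * ?s"
        by (simp add: power2_eq_square algebra_simps)
      also have "\<dots> \<le> (e / 8 + e / 8) * ?s\<^sup>2 + e / 4 * ?s * ?s"
        using \<Lambda>d \<eta>\<rho> cs n by (intro add_mono mult_right_mono) auto
      also have "\<dots> = e / 2 * ?s\<^sup>2"
      proof -
        have "(e / 8 + e / 8) * (q * q) + e / 4 * q * q = e / 2 * (q * q)" for q by (simp add: field_simps)
        then show ?thesis unfolding power2_eq_square .
      qed
      also have "\<dots> \<le> e / 2 * (2 * (1 + ?n\<^sup>2))"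
      proof (rule mult_left_mono)
        have "0 \<le> (1 - ?n)\<^sup>2" by simp
        then show "(1 + ?n)\<^sup>2 \<le> 2 * (1 + ?n\<^sup>2)" by (simp add: power2_eq_square algebra_simps)
      qed (use e in auto)
      finally show ?thesis by (simp add: algebra_simps)
    qed
  qed
qed

end

section \<open>Exponential estimates for one average near a fixed factor\<close>

context feature_map
begin

definition ip :: "('j \<Rightarrow> real) \<Rightarrow> ('j \<Rightarrow> real) \<Rightarrow> real" where
  "ip t y = (\<Sum>j\<in>J. t j * y j)"

definition mgf :: "(nat \<Rightarrow> nat \<Rightarrow> real) \<Rightarrow> ('j \<Rightarrow> real) \<Rightarrow> ennreal" where
  "mgf A t = (\<integral>\<^sup>+\<xi>. ennreal (exp (ip t (g (lin D A \<xi>)))) \<partial>std_gauss D)"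

definition near :: "nat \<Rightarrow> (nat \<Rightarrow> nat \<Rightarrow> real) \<Rightarrow> ('j \<Rightarrow> real) \<Rightarrow> real \<Rightarrow> (nat \<Rightarrow> nat \<Rightarrow> real) set" where
  "near C A x \<delta> = {\<omega> \<in> space (\<Omega> C). \<forall>j\<in>J. \<bar>(\<Sum>c\<in>{1..C}. g (lin D A (\<omega> c)) j) - C * x j\<bar> < C * \<delta>}"

lemma prob_space_\<Omega>: "prob_space (\<Omega> C)"
  by (intro prob_space_PiM prob_space_std_gauss)

lemma ip_meas[measurable]: "(\<lambda>\<xi>. ip t (g (lin D A \<xi>))) \<in> borel_measurable (std_gauss D)"
  unfolding ip_def by measurable

lemma g_\<omega>_meas: "j \<in> J \<Longrightarrow> c \<in> {1..C} \<Longrightarrow> (\<lambda>\<omega>. g (lin D A (\<omega> c)) j) \<in> borel_measurable (\<Omega> C)"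
  using measurable_compose[OF measurable_component_singleton[of c "{1..C}" "\<lambda>_. std_gauss D"] g_lin_meas[of j A]]
  by simp

lemma near_meas: "near C A x \<delta> \<in> sets (\<Omega> C)"
  unfolding near_def using finite_J g_\<omega>_meas by measurable

lemma nrm_meas[measurable]: "(\<lambda>\<xi>. nrm \<xi>) \<in> borel_measurable (std_gauss D)"
  unfolding L2_set_def by measurable

lemma mgf_quarter: "(\<integral>\<^sup>+\<xi>. ennreal (exp ((nrm \<xi>)\<^sup>2 / 4)) \<partial>std_gauss D) = ennreal (sqrt 2 ^ D)"
  unfolding nrm_sq by (rule nn_integral_exp_quarter_std_gauss)

text \<open>Shrinking the tilt to \<open>s t\<close> with \<open>s < 1\<close> leaves room for the quadratic error
  \<open>\<epsilon> (1 + |\<xi>|\<^sup>2)\<close> made when \<open>A\<close> is perturbed; both disappear together as \<open>s\<close> tends to 1.\<close>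

lemma mgf_upper_semicontinuous:
  assumes fin: "mgf A0 t < \<infinity>" and a: "a < ip t x - ln (enn2real (mgf A0 t))"
  obtains s d where "0 < s" "s < 1" "0 < d"
    "\<And>A. (\<And>i k. i < D \<Longrightarrow> k < D \<Longrightarrow> \<bar>A i k - A0 i k\<bar> \<le> d) \<Longrightarrow>
      mgf A (\<lambda>j. s * t j) \<le> ennreal (exp (s * ip t x - a))"
proof -
  interpret G: prob_space "std_gauss D" by (rule prob_space_std_gauss)
  let ?u = "\<lambda>\<xi>. ip t (g (lin D A0 \<xi>))"
  define s where "s n = 1 - inverse (real (Suc n)) / 2" for n
  \<comment> \<open>By convexity, \<open>s n\<close> times the exponent plus
    \<open>e n * (1 + (nrm \<xi>)\<^sup>2)\<close> is at most the maximum of the exponent and a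
    quarter of \<open>1 + (nrm \<xi>)\<^sup>2\<close>. Both have integrable exponentials, which
    gives one dominating function for all \<open>n\<close>.\<close>
  define e where "e n = (1 - s n) / 4" for n
  have s: "0 < s n" "s n < 1" for n
  proof -
    have "inverse (real (Suc n)) \<le> 1" by (simp add: inverse_le_1_iff)
    then show "0 < s n" by (simp add: s_def)
    show "s n < 1" by (simp add: s_def)
  qed
  have e: "0 < e n" for n using s[of n] by (simp add: e_def)
  have "(\<lambda>n. 1 - inverse (real (Suc n)) / 2) \<longlonglongrightarrow> 1 - 0 / 2"
    by (intro tendsto_intros LIMSEQ_inverse_real_of_nat) simp
  then have slim: "s \<longlonglongrightarrow> 1" unfolding s_def[abs_def] by simp
  then have elim: "e \<longlonglongrightarrow> 0"
    unfolding e_def[abs_def] by (auto intro!: tendsto_eq_intros)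
  define Z where "Z = enn2real (mgf A0 t)"
  have Z: "mgf A0 t = ennreal Z" using fin by (simp add: Z_def)
  have Z0: "0 < Z"
  proof (rule ccontr)
    assume "\<not> 0 < Z"
    then have "mgf A0 t = 0" using Z by (simp add: ennreal_neg)
    then have "AE \<xi> in std_gauss D. ennreal (exp (?u \<xi>)) = 0"
      unfolding mgf_def by (subst (asm) nn_integral_0_iff_AE) auto
    then have "AE \<xi> in std_gauss D. False" by eventually_elim simp
    then show False by simp
  qed
  have lim1: "(\<lambda>n. \<integral>\<^sup>+\<xi>. ennreal (exp (s n * ?u \<xi> + e n * (1 + (nrm \<xi>)\<^sup>2))) \<partial>std_gauss D)
      \<longlonglongrightarrow> (\<integral>\<^sup>+\<xi>. ennreal (exp (1 * ?u \<xi> + 0 * (1 + (nrm \<xi>)\<^sup>2))) \<partial>std_gauss D)"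
  proof (rule nn_integral_dominated_convergence[where w = "\<lambda>\<xi>. ennreal (exp (?u \<xi>)) + ennreal (exp (1 / 4)) * ennreal (exp ((nrm \<xi>)\<^sup>2 / 4))"])
    show "AE \<xi> in std_gauss D. (\<lambda>n. ennreal (exp (s n * ?u \<xi> + e n * (1 + (nrm \<xi>)\<^sup>2)))) \<longlonglongrightarrow> ennreal (exp (1 * ?u \<xi> + 0 * (1 + (nrm \<xi>)\<^sup>2)))"
      by (intro AE_I2 tendsto_ennrealI tendsto_intros slim elim)
    show "(\<integral>\<^sup>+\<xi>. ennreal (exp (?u \<xi>)) + ennreal (exp (1 / 4)) * ennreal (exp ((nrm \<xi>)\<^sup>2 / 4)) \<partial>std_gauss D) < \<infinity>"
      using fin unfolding mgf_def
      by (subst nn_integral_add, simp, simp, subst nn_integral_cmult, simp)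
         (auto simp: mgf_quarter ennreal_mult_less_top)
    show "AE \<xi> in std_gauss D. ennreal (exp (s n * ?u \<xi> + e n * (1 + (nrm \<xi>)\<^sup>2)))
        \<le> ennreal (exp (?u \<xi>)) + ennreal (exp (1 / 4)) * ennreal (exp ((nrm \<xi>)\<^sup>2 / 4))" for n
    proof (rule AE_I2)
      fix \<xi>
      let ?v = "(1 + (nrm \<xi>)\<^sup>2) / 4"
      have "s n * ?u \<xi> + e n * (1 + (nrm \<xi>)\<^sup>2) = s n * ?u \<xi> + (1 - s n) * ?v" by (simp add: e_def)
      also have "\<dots> \<le> s n * max (?u \<xi>) ?v + (1 - s n) * max (?u \<xi>) ?v"
        using s[of n] by (intro add_mono mult_left_mono) auto
      also have "\<dots> = max (?u \<xi>) ?v" by (simp add: algebra_simps)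
      finally have "exp (s n * ?u \<xi> + e n * (1 + (nrm \<xi>)\<^sup>2)) \<le> exp (max (?u \<xi>) ?v)" by simp
      also have "\<dots> \<le> exp (?u \<xi>) + exp ?v" by (auto simp: max_def)
      also have "exp ?v = exp (1 / 4) * exp ((nrm \<xi>)\<^sup>2 / 4)" by (simp add: exp_add[symmetric] add_divide_distrib)
      finally show "ennreal (exp (s n * ?u \<xi> + e n * (1 + (nrm \<xi>)\<^sup>2)))
        \<le> ennreal (exp (?u \<xi>)) + ennreal (exp (1 / 4)) * ennreal (exp ((nrm \<xi>)\<^sup>2 / 4))"
        by (simp add: ennreal_mult[symmetric] ennreal_plus[symmetric] del: ennreal_plus)
    qed
  qed measurable
  have lim2: "(\<lambda>n. ennreal (exp (s n * ip t x - a))) \<longlonglongrightarrow> ennreal (exp (1 * ip t x - a))"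
    by (intro tendsto_ennrealI tendsto_intros slim)
  have "(\<integral>\<^sup>+\<xi>. ennreal (exp (1 * ?u \<xi> + 0 * (1 + (nrm \<xi>)\<^sup>2))) \<partial>std_gauss D) < ennreal (exp (1 * ip t x - a))"
  proof -
    have "ln Z < ip t x - a" using a by (simp add: Z_def)
    then have "Z < exp (ip t x - a)" using Z0 by (metis exp_less_cancel_iff exp_ln)
    then show ?thesis using Z Z0 by (simp add: mgf_def[symmetric] ennreal_lessI)
  qed
  from dense[OF this] obtain z where z: "(\<integral>\<^sup>+\<xi>. ennreal (exp (1 * ?u \<xi> + 0 * (1 + (nrm \<xi>)\<^sup>2))) \<partial>std_gauss D) < z"
      "z < ennreal (exp (1 * ip t x - a))"
    by (elim exE conjE)
  have "\<forall>\<^sub>F n in sequentially. (\<integral>\<^sup>+\<xi>. ennreal (exp (s n * ?u \<xi> + e n * (1 + (nrm \<xi>)\<^sup>2))) \<partial>std_gauss D)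
      < ennreal (exp (s n * ip t x - a))"
    using eventually_conj[OF order_tendstoD(2)[OF lim1 z(1)] order_tendstoD(1)[OF lim2 z(2)]]
    by (rule eventually_mono) (elim conjE, rule less_trans)
  then obtain n where n: "(\<integral>\<^sup>+\<xi>. ennreal (exp (s n * ?u \<xi> + e n * (1 + (nrm \<xi>)\<^sup>2))) \<partial>std_gauss D)
      < ennreal (exp (s n * ip t x - a))"
    by (auto simp: eventually_sequentially)
  define T where "T = (\<Sum>j\<in>J. \<bar>t j\<bar>)"
  have T: "0 \<le> T" by (simp add: T_def sum_nonneg)
  define r where "r = (\<Sum>i<D. \<Sum>k<D. \<bar>A0 i k\<bar>)"
  have r: "0 \<le> r" by (simp add: r_def sum_nonneg)
  have A0: "\<bar>A0 i k\<bar> \<le> r" if "i < D" "k < D" for i k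
  proof -
    have "\<bar>A0 i k\<bar> \<le> (\<Sum>k<D. \<bar>A0 i k\<bar>)" using that by (intro member_le_sum) auto
    also have "\<dots> \<le> r" unfolding r_def using that
      by (intro member_le_sum[of i _ "\<lambda>i. \<Sum>k<D. \<bar>A0 i k\<bar>"]) (auto intro!: sum_nonneg)
    finally show ?thesis .
  qed
  \<comment> \<open>The tolerance per feature is the total tolerance divided by the weight of the
    tilt; the summand 1 covers the zero tilt.\<close>
  have "0 < e n / (T + 1)" using e[of n] T by simp
  from g_perturb[OF this r] obtain d where d: "0 < d" "\<And>A A' \<xi> j. (\<And>i k. i < D \<Longrightarrow> k < D \<Longrightarrow> \<bar>A' i k\<bar> \<le> r) \<Longrightarrow>
      (\<And>i k. i < D \<Longrightarrow> k < D \<Longrightarrow> \<bar>A i k - A' i k\<bar> \<le> d) \<Longrightarrow> j \<in> J \<Longrightarrow>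
      \<bar>g (lin D A \<xi>) j - g (lin D A' \<xi>) j\<bar> \<le> e n / (T + 1) * (1 + (nrm \<xi>)\<^sup>2)"
    by blast
  show ?thesis
  proof (rule that[OF s(1)[of n] s(2)[of n] d(1)])
    fix A assume A: "\<And>i k. i < D \<Longrightarrow> k < D \<Longrightarrow> \<bar>A i k - A0 i k\<bar> \<le> d"
    have "mgf A (\<lambda>j. s n * t j) \<le> (\<integral>\<^sup>+\<xi>. ennreal (exp (s n * ?u \<xi> + e n * (1 + (nrm \<xi>)\<^sup>2))) \<partial>std_gauss D)"
      unfolding mgf_def
    proof (rule nn_integral_mono, rule ennreal_leI)
      fix \<xi>
      let ?q = "1 + (nrm \<xi>)\<^sup>2"
      have "ip (\<lambda>j. s n * t j) (g (lin D A \<xi>)) - s n * ?u \<xi> = s n * (\<Sum>j\<in>J. t j * (g (lin D A \<xi>) j - g (lin D A0 \<xi>) j))"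
        by (simp add: ip_def sum_distrib_left sum_subtractf algebra_simps)
      also have "\<dots> \<le> s n * (\<Sum>j\<in>J. \<bar>t j\<bar> * (e n / (T + 1) * ?q))"
      proof (intro mult_left_mono sum_mono)
        fix j assume "j \<in> J"
        then have "\<bar>g (lin D A \<xi>) j - g (lin D A0 \<xi>) j\<bar> \<le> e n / (T + 1) * ?q"
          by (intro d(2)[OF A0 A])
        then have "\<bar>t j\<bar> * \<bar>g (lin D A \<xi>) j - g (lin D A0 \<xi>) j\<bar> \<le> \<bar>t j\<bar> * (e n / (T + 1) * ?q)"
          by (intro mult_left_mono) auto
        then show "t j * (g (lin D A \<xi>) j - g (lin D A0 \<xi>) j) \<le> \<bar>t j\<bar> * (e n / (T + 1) * ?q)"
          by (metis abs_ge_self abs_mult order_trans)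
      qed (use s[of n] in simp)
      also have "\<dots> = s n * (T * (e n / (T + 1) * ?q))" by (simp only: T_def sum_distrib_right)
      also have "\<dots> \<le> 1 * (e n * ?q)"
      proof (rule mult_mono)
        have "T * (e n / (T + 1)) \<le> e n" using T e[of n] by (simp add: field_simps)
        then have "T * (e n / (T + 1)) * ?q \<le> e n * ?q" by (intro mult_right_mono) auto
        then show "T * (e n / (T + 1) * ?q) \<le> e n * ?q" by (simp only: mult.assoc)
      qed (use s[of n] T e[of n] in auto)
      finally show "exp (ip (\<lambda>j. s n * t j) (g (lin D A \<xi>))) \<le> exp (s n * ?u \<xi> + e n * ?q)" by simp
    qed
    with n show "mgf A (\<lambda>j. s n * t j) \<le> ennreal (exp (s n * ip t x - a))" by simp
  qed
qed

text \<open>Chernoff with the shrunken tilt: on \<open>near\<close> every coordinate sum is within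
  \<open>C * \<delta>\<close> of its target, so adding \<open>T * \<delta>\<close> per copy makes
  the total exponent nonnegative. The level \<open>a'\<close>, midway between \<open>a\<close> and
  the value of the functional, pays for this addition.\<close>

lemma local_upper_bound:
  assumes fin: "mgf A0 t < \<infinity>" and a: "a < ip t x - ln (enn2real (mgf A0 t))"
  shows "\<exists>\<delta>>0. \<forall>C A. (\<forall>i<D. \<forall>k<D. \<bar>A i k - A0 i k\<bar> \<le> \<delta>) \<longrightarrow> measure (\<Omega> C) (near C A x \<delta>) \<le> exp (- (C * a))"
proof -
  interpret G: prob_space "std_gauss D" by (rule prob_space_std_gauss)
  define a' where "a' = (a + (ip t x - ln (enn2real (mgf A0 t)))) / 2"
  have a': "a < a'" "a' < ip t x - ln (enn2real (mgf A0 t))" using a by (auto simp: a'_def)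
  obtain s d where s: "0 < s" "s < 1" and d: "0 < d"
    "\<And>A. (\<And>i k. i < D \<Longrightarrow> k < D \<Longrightarrow> \<bar>A i k - A0 i k\<bar> \<le> d) \<Longrightarrow> mgf A (\<lambda>j. s * t j) \<le> ennreal (exp (s * ip t x - a'))"
    using mgf_upper_semicontinuous[OF fin a'(2)] by blast
  define T where "T = (\<Sum>j\<in>J. \<bar>t j\<bar>)"
  have T: "0 \<le> T" by (simp add: T_def sum_nonneg)
  define \<delta> where "\<delta> = min d ((a' - a) / (T + 1))"
  have "0 < (a' - a) / (T + 1)" using T a'(1) by (intro divide_pos_pos) auto
  then have \<delta>: "0 < \<delta>" using d(1) by (simp add: \<delta>_def)
  have "T * \<delta> \<le> T * ((a' - a) / (T + 1))" using T by (intro mult_left_mono) (auto simp: \<delta>_def)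
  also have "\<dots> \<le> a' - a" using T a'(1) by (simp add: field_simps)
  finally have T\<delta>: "T * \<delta> \<le> a' - a" .
  show ?thesis
  proof (intro exI[of _ \<delta>] conjI \<delta> allI impI)
    fix C :: nat and A assume A: "\<forall>i<D. \<forall>k<D. \<bar>A i k - A0 i k\<bar> \<le> \<delta>"
    interpret O: prob_space "\<Omega> C" by (rule prob_space_\<Omega>)
    let ?f = "\<lambda>\<xi>. ip (\<lambda>j. s * t j) (g (lin D A \<xi>)) - s * ip t x + T * \<delta>"
    have "(\<integral>\<^sup>+\<xi>. ennreal (exp (?f \<xi>)) \<partial>std_gauss D)
        = (\<integral>\<^sup>+\<xi>. ennreal (exp (T * \<delta> - s * ip t x)) * ennreal (exp (ip (\<lambda>j. s * t j) (g (lin D A \<xi>)))) \<partial>std_gauss D)"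
      by (intro nn_integral_cong) (simp add: ennreal_mult[symmetric] exp_add[symmetric] algebra_simps)
    also have "\<dots> = ennreal (exp (T * \<delta> - s * ip t x)) * mgf A (\<lambda>j. s * t j)"
      unfolding mgf_def by (rule nn_integral_cmult) measurable
    also have "\<dots> \<le> ennreal (exp (T * \<delta> - s * ip t x)) * ennreal (exp (s * ip t x - a'))"
      using A by (intro mult_left_mono d(2)) (auto simp: \<delta>_def)
    also have "\<dots> = ennreal (exp (T * \<delta> - a'))"
      by (simp add: ennreal_mult[symmetric] exp_add[symmetric])
    also have "\<dots> \<le> ennreal (exp (- a))" using T\<delta> by (intro ennreal_leI) simp
    finally have z: "(\<integral>\<^sup>+\<xi>. ennreal (exp (?f \<xi>)) \<partial>std_gauss D) \<le> ennreal (exp (- a))" .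
    have "measure (\<Omega> C) (near C A x \<delta>) \<le> measure (\<Omega> C) {\<omega> \<in> space (\<Omega> C). 0 \<le> (\<Sum>c\<in>{1..C}. ?f (\<omega> c))}"
    proof (rule O.finite_measure_mono)
      show "near C A x \<delta> \<subseteq> {\<omega> \<in> space (\<Omega> C). 0 \<le> (\<Sum>c\<in>{1..C}. ?f (\<omega> c))}"
      proof
        fix \<omega> assume \<omega>: "\<omega> \<in> near C A x \<delta>"
        let ?S = "\<lambda>j. \<Sum>c\<in>{1..C}. g (lin D A (\<omega> c)) j"
        have "(\<Sum>c\<in>{1..C}. ?f (\<omega> c)) = s * (\<Sum>j\<in>J. t j * (?S j - C * x j)) + C * (T * \<delta>)"
        proof -
          have "(\<Sum>c\<in>{1..C}. ip (\<lambda>j. s * t j) (g (lin D A (\<omega> c)))) = s * (\<Sum>j\<in>J. t j * ?S j)"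
            unfolding ip_def sum_distrib_left by (subst sum.swap) (simp add: mult.assoc)
          moreover have "(\<Sum>j\<in>J. t j * (?S j - C * x j)) = (\<Sum>j\<in>J. t j * ?S j) - C * ip t x"
            by (simp add: ip_def sum_distrib_left sum_subtractf algebra_simps)
          ultimately show ?thesis by (simp add: sum.distrib sum_subtractf algebra_simps)
        qed
        moreover have "- (C * (T * \<delta>)) \<le> s * (\<Sum>j\<in>J. t j * (?S j - C * x j))"
        proof -
          have "\<bar>\<Sum>j\<in>J. t j * (?S j - C * x j)\<bar> \<le> (\<Sum>j\<in>J. \<bar>t j\<bar> * (C * \<delta>))"
          proof (rule order_trans[OF sum_abs], rule sum_mono)
            fix j assume "j \<in> J"
            then have "\<bar>?S j - C * x j\<bar> \<le> C * \<delta>" using \<omega> by (auto simp: near_def intro: less_imp_le)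
            then show "\<bar>t j * (?S j - C * x j)\<bar> \<le> \<bar>t j\<bar> * (C * \<delta>)"
              unfolding abs_mult by (intro mult_left_mono) auto
          qed
          also have "\<dots> = C * (T * \<delta>)" by (simp add: T_def sum_distrib_left sum_distrib_right mult_ac)
          finally have 1: "\<bar>\<Sum>j\<in>J. t j * (?S j - C * x j)\<bar> \<le> C * (T * \<delta>)" .
          have "\<bar>s * (\<Sum>j\<in>J. t j * (?S j - C * x j))\<bar> \<le> 1 * \<bar>\<Sum>j\<in>J. t j * (?S j - C * x j)\<bar>"
            unfolding abs_mult using s by (intro mult_right_mono) auto
          with 1 show ?thesis by linarith
        qed
        ultimately show "\<omega> \<in> {\<omega> \<in> space (\<Omega> C). 0 \<le> (\<Sum>c\<in>{1..C}. ?f (\<omega> c))}"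
          using \<omega> by (simp add: near_def)
      qed
      have "(\<lambda>\<omega>. ?f (\<omega> c)) \<in> borel_measurable (\<Omega> C)" if "c \<in> {1..C}" for c
        unfolding ip_def using that g_\<omega>_meas by measurable
      then show "{\<omega> \<in> space (\<Omega> C). 0 \<le> (\<Sum>c\<in>{1..C}. ?f (\<omega> c))} \<in> O.events" by measurable
    qed
    also have "\<dots> \<le> exp (- a) ^ card {1..C}"
      by (rule G.chernoff_PiM[OF _ z]) auto
    also have "\<dots> = exp (- (C * a))" by (simp add: exp_of_nat_mult[symmetric])
    finally show "measure (\<Omega> C) (near C A x \<delta>) \<le> exp (- (C * a))" .
  qed
qed

text \<open>The bound \<open>cramer_lower_bound\<close> at \<open>A0\<close> with half the radius.
  Its event confines each \<xi> to a ball, where changing the factor moves each feature by at most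
  \<open>\<delta> / 2\<close>.\<close>

lemma local_lower_bound:
  assumes a0: "\<And>t. mgf A0 t < \<infinity> \<Longrightarrow> ip t x - ln (enn2real (mgf A0 t)) \<le> a0"
    and a: "a0 < a" and \<delta>: "0 < \<delta>"
  shows "\<exists>d>0. \<exists>C0. \<forall>C\<ge>C0. \<forall>A. (\<forall>i<D. \<forall>k<D. \<bar>A i k - A0 i k\<bar> \<le> d) \<longrightarrow>
    exp (- (C * a)) \<le> measure (\<Omega> C) (near C A x \<delta>)"
proof -
  interpret G: prob_space "std_gauss D" by (rule prob_space_std_gauss)
  \<comment> \<open>Balls exhaust the space; shifting the index by \<open>R0\<close> makes the first
    of them carry half of the mass, as \<open>truncated_cramer\<close> demands.\<close>
  define F where "F r = {\<xi> \<in> space (std_gauss D). nrm \<xi> \<le> real r}" for r :: nat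
  have F[measurable]: "F r \<in> sets (std_gauss D)" for r unfolding F_def by measurable
  have incF: "incseq F" by (auto simp: F_def incseq_def intro: order_trans)
  have covF: "(\<Union>r. F r) = space (std_gauss D)"
    using real_arch_simple by (auto simp: F_def)
  have "(\<lambda>r. G.prob (F r)) \<longlonglongrightarrow> G.prob (\<Union>r. F r)"
    using incF by (intro G.finite_Lim_measure_incseq) auto
  then have "(\<lambda>r. G.prob (F r)) \<longlonglongrightarrow> 1" unfolding covF G.prob_space .
  then have "\<forall>\<^sub>F r in sequentially. 1 / 2 < G.prob (F r)" by (intro order_tendstoD) auto
  then obtain R0 where R0: "1 / 2 \<le> G.prob (F R0)" by (auto simp: eventually_sequentially intro: less_imp_le)
  obtain \<kappa> where \<kappa>: "0 < \<kappa>" "\<And>z j. j \<in> J \<Longrightarrow> \<bar>g z j\<bar> \<le> \<kappa> * (1 + (nrm z)\<^sup>2)" using g_growth by blast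
  define R where "R = (\<Sum>i<D. \<Sum>k<D. \<bar>A0 i k\<bar>)"
  have R: "0 \<le> R" by (simp add: R_def sum_nonneg)
  have A0: "\<bar>A0 i k\<bar> \<le> R" if "i < D" "k < D" for i k
  proof -
    have "\<bar>A0 i k\<bar> \<le> (\<Sum>k<D. \<bar>A0 i k\<bar>)" using that by (intro member_le_sum) auto
    also have "\<dots> \<le> R" unfolding R_def using that
      by (intro member_le_sum[of i _ "\<lambda>i. \<Sum>k<D. \<bar>A0 i k\<bar>"]) (auto intro!: sum_nonneg)
    finally show ?thesis .
  qed
  define b where "b r = \<kappa> * (1 + ((real D)\<^sup>2 * R * real (r + R0))\<^sup>2)" for r :: nat
  interpret T: truncated_cramer "std_gauss D" J "\<lambda>\<xi>. g (lin D A0 \<xi>)" "\<lambda>r. F (r + R0)" b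
  proof unfold_locales
    show "incseq (\<lambda>r. F (r + R0))" using incF by (auto simp: incseq_def)
    show "(\<Union>r. F (r + R0)) = space (std_gauss D)"
    proof -
      have "(\<Union>r. F (r + R0)) = (\<Union>r. F r)"
        using incF by (auto simp: incseq_def) (metis le_add1 subsetD)
      then show ?thesis using covF by simp
    qed
    show "1 / 2 \<le> G.prob (F (0 + R0))" using R0 by simp
    show "0 \<le> b r" for r using \<kappa>(1) by (simp add: b_def)
    show "\<bar>g (lin D A0 \<xi>) j\<bar> \<le> b r" if "\<xi> \<in> F (r + R0)" "j \<in> J" for r \<xi> j
    proof -
      have "nrm (lin D A0 \<xi>) \<le> (real D)\<^sup>2 * R * nrm \<xi>" by (rule nrm_lin_le[OF A0 R])
      also have "\<dots> \<le> (real D)\<^sup>2 * R * real (r + R0)"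
        using that(1) R by (intro mult_left_mono) (auto simp: F_def)
      finally have "(nrm (lin D A0 \<xi>))\<^sup>2 \<le> ((real D)\<^sup>2 * R * real (r + R0))\<^sup>2"
        by (intro power_mono L2_set_nonneg)
      then have "\<kappa> * (1 + (nrm (lin D A0 \<xi>))\<^sup>2) \<le> b r" unfolding b_def using \<kappa>(1) by (intro mult_left_mono) auto
      with \<kappa>(2)[OF that(2)] show ?thesis by (rule order_trans)
    qed
  qed (use finite_J in auto)
  have ipeq: "T.ip = ip" by (simp add: T.ip_def ip_def fun_eq_iff)
  obtain r C0 where C0: "\<And>C. C \<ge> C0 \<Longrightarrow> exp (- (real C * a)) \<le> measure (\<Omega> C)
    {\<omega> \<in> space (\<Omega> C). (\<forall>c\<in>{1..C}. \<omega> c \<in> F (r + R0)) \<and>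
      (\<forall>j\<in>J. \<bar>(\<Sum>c\<in>{1..C}. g (lin D A0 (\<omega> c)) j) - C * x j\<bar> < C * (\<delta> / 2))}"
    using T.cramer_lower_bound[of x a0 a "\<delta> / 2"] a0 a \<delta> unfolding ipeq mgf_def[symmetric] by fastforce
  define Q where "Q = 1 + (real (r + R0))\<^sup>2"
  have Q: "0 < Q" by (auto simp: Q_def intro: add_pos_nonneg)
  have "0 < \<delta> / (2 * Q)" using \<delta> Q by simp
  from g_perturb[OF this R] obtain d where d: "0 < d" "\<And>A A' \<xi> j. (\<And>i k. i < D \<Longrightarrow> k < D \<Longrightarrow> \<bar>A' i k\<bar> \<le> R) \<Longrightarrow>
      (\<And>i k. i < D \<Longrightarrow> k < D \<Longrightarrow> \<bar>A i k - A' i k\<bar> \<le> d) \<Longrightarrow> j \<in> J \<Longrightarrow>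
      \<bar>g (lin D A \<xi>) j - g (lin D A' \<xi>) j\<bar> \<le> \<delta> / (2 * Q) * (1 + (nrm \<xi>)\<^sup>2)"
    by blast
  show ?thesis
  proof (rule exI[of _ d], intro conjI d(1), rule exI[of _ C0], intro allI impI)
    fix C :: nat and A :: "nat \<Rightarrow> nat \<Rightarrow> real" assume C: "C0 \<le> C" and A: "\<forall>i<D. \<forall>k<D. \<bar>A i k - A0 i k\<bar> \<le> d"
    interpret O: prob_space "\<Omega> C" by (rule prob_space_\<Omega>)
    have "{\<omega> \<in> space (\<Omega> C). (\<forall>c\<in>{1..C}. \<omega> c \<in> F (r + R0)) \<and>
      (\<forall>j\<in>J. \<bar>(\<Sum>c\<in>{1..C}. g (lin D A0 (\<omega> c)) j) - C * x j\<bar> < C * (\<delta> / 2))} \<subseteq> near C A x \<delta>"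
    proof (intro subsetI, elim CollectE conjE)
      fix \<omega> assume \<omega>: "\<omega> \<in> space (\<Omega> C)" "\<forall>c\<in>{1..C}. \<omega> c \<in> F (r + R0)"
        and close: "\<forall>j\<in>J. \<bar>(\<Sum>c\<in>{1..C}. g (lin D A0 (\<omega> c)) j) - C * x j\<bar> < C * (\<delta> / 2)"
      have "\<bar>(\<Sum>c\<in>{1..C}. g (lin D A (\<omega> c)) j) - C * x j\<bar> < C * \<delta>" if j: "j \<in> J" for j
      proof -
        have "\<bar>(\<Sum>c\<in>{1..C}. g (lin D A (\<omega> c)) j) - (\<Sum>c\<in>{1..C}. g (lin D A0 (\<omega> c)) j)\<bar>
            \<le> (\<Sum>c\<in>{1..C}. \<bar>g (lin D A (\<omega> c)) j - g (lin D A0 (\<omega> c)) j\<bar>)"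
          unfolding sum_subtractf[symmetric] by (rule sum_abs)
        also have "\<dots> \<le> (\<Sum>c\<in>{1..C}. \<delta> / 2)"
        proof (rule sum_mono)
          fix c assume "c \<in> {1..C}"
          then have "nrm (\<omega> c) \<le> real (r + R0)" using \<omega>(2) by (auto simp: F_def)
          then have "1 + (nrm (\<omega> c))\<^sup>2 \<le> Q" unfolding Q_def by (intro add_left_mono power_mono L2_set_nonneg)
          then have "\<delta> / (2 * Q) * (1 + (nrm (\<omega> c))\<^sup>2) \<le> \<delta> / (2 * Q) * Q"
            using \<delta> Q by (intro mult_left_mono) auto
          also have "\<dots> = \<delta> / 2" using Q by simp
          finally show "\<bar>g (lin D A (\<omega> c)) j - g (lin D A0 (\<omega> c)) j\<bar> \<le> \<delta> / 2"
            by (intro order_trans[OF d(2)[OF A0 _ j]]) (use A in auto)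
        qed
        also have "\<dots> = C * (\<delta> / 2)" by simp
        finally have "\<bar>(\<Sum>c\<in>{1..C}. g (lin D A (\<omega> c)) j) - (\<Sum>c\<in>{1..C}. g (lin D A0 (\<omega> c)) j)\<bar> \<le> C * (\<delta> / 2)" .
        moreover have "C * \<delta> = C * (\<delta> / 2) + C * (\<delta> / 2)" by simp
        ultimately show ?thesis using close[rule_format, OF j] by linarith
      qed
      then show "\<omega> \<in> near C A x \<delta>" using \<omega>(1) by (simp add: near_def)
    qed
    with C0[OF C] show "exp (- (C * a)) \<le> measure (\<Omega> C) (near C A x \<delta>)"
      by (intro order_trans[OF _ O.finite_measure_mono[OF _ near_meas]]) auto
  qed
qed

text \<open>The bound is uniform over factors with bounded rows, that is, over covariances with
  bounded diagonal. As \<open>g\<close> grows at most quadratically, a large sum of features forces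
  a large sum of squared norms of the Gaussian vectors, and the latter has an exponential moment of
  order 1/4.\<close>

lemma exponential_tightness:
  shows "\<exists>r. \<forall>C A. (\<forall>i<D. (\<Sum>k<D. (A i k)\<^sup>2) \<le> \<rho>) \<longrightarrow>
    measure (\<Omega> C) {\<omega> \<in> space (\<Omega> C). \<exists>j\<in>J. C * r < \<bar>\<Sum>c\<in>{1..C}. g (lin D A (\<omega> c)) j\<bar>} \<le> exp (- (C * a))"
proof -
  interpret G: prob_space "std_gauss D" by (rule prob_space_std_gauss)
  obtain \<kappa> where \<kappa>: "0 < \<kappa>" "\<And>z j. j \<in> J \<Longrightarrow> \<bar>g z j\<bar> \<le> \<kappa> * (1 + (nrm z)\<^sup>2)" using g_growth by blast
  define K where "K = real D * \<bar>\<rho>\<bar> + 1"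
  have K: "0 < K" by (simp add: K_def add_nonneg_pos)
  define Z where "Z = sqrt 2 ^ D"
  have Z: "0 < Z" by (simp add: Z_def)
  \<comment> \<open>Makes \<open>exp (- u / 4) * Z\<close> equal to
    \<open>exp (- a)\<close>.\<close>
  define u where "u = 4 * (a + ln Z)"
  show ?thesis
  proof (intro exI[of _ "\<kappa> * (1 + K * u)"] allI impI)
    fix C :: nat and A :: "nat \<Rightarrow> nat \<Rightarrow> real" assume A: "\<forall>i<D. (\<Sum>k<D. (A i k)\<^sup>2) \<le> \<rho>"
    interpret O: prob_space "\<Omega> C" by (rule prob_space_\<Omega>)
    have lin: "(nrm (lin D A \<xi>))\<^sup>2 \<le> K * (nrm \<xi>)\<^sup>2" for \<xi>
    proof -
      have "(nrm (lin D A \<xi>))\<^sup>2 \<le> (\<Sum>i<D. \<bar>\<rho>\<bar> * (nrm \<xi>)\<^sup>2)"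
        unfolding nrm_sq[of "lin D A \<xi>"]
      proof (rule sum_mono)
        fix i assume i: "i \<in> {..<D}"
        have "(lin D A \<xi> i)\<^sup>2 \<le> (\<Sum>k<D. (A i k)\<^sup>2) * (\<Sum>k<D. (\<xi> k)\<^sup>2)"
          unfolding lin_def by (rule Cauchy_Schwarz_ineq_sum)
        also have "\<dots> \<le> \<bar>\<rho>\<bar> * (nrm \<xi>)\<^sup>2"
          unfolding nrm_sq using A i by (intro mult_right_mono sum_nonneg) force+
        finally show "(lin D A \<xi> i)\<^sup>2 \<le> \<bar>\<rho>\<bar> * (nrm \<xi>)\<^sup>2" .
      qed
      also have "\<dots> \<le> K * (nrm \<xi>)\<^sup>2" by (simp add: K_def algebra_simps)
      finally show ?thesis .
    qed
    let ?f = "\<lambda>\<xi>. (nrm \<xi>)\<^sup>2 / 4 - u / 4"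
    have "(\<integral>\<^sup>+\<xi>. ennreal (exp (?f \<xi>)) \<partial>std_gauss D) = (\<integral>\<^sup>+\<xi>. ennreal (exp (- u / 4)) * ennreal (exp ((nrm \<xi>)\<^sup>2 / 4)) \<partial>std_gauss D)"
      by (intro nn_integral_cong) (simp add: ennreal_mult[symmetric] exp_add[symmetric])
    also have "\<dots> = ennreal (exp (- u / 4)) * ennreal Z"
      by (subst nn_integral_cmult, simp) (simp add: mgf_quarter Z_def)
    also have "\<dots> = ennreal (exp (- u / 4) * exp (ln Z))" using Z by (simp add: ennreal_mult)
    also have "exp (- u / 4) * exp (ln Z) = exp (- a)" unfolding exp_add[symmetric] by (simp add: u_def field_simps)
    finally have z: "(\<integral>\<^sup>+\<xi>. ennreal (exp (?f \<xi>)) \<partial>std_gauss D) \<le> ennreal (exp (- a))" by simp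
    have "measure (\<Omega> C) {\<omega> \<in> space (\<Omega> C). \<exists>j\<in>J. C * (\<kappa> * (1 + K * u)) < \<bar>\<Sum>c\<in>{1..C}. g (lin D A (\<omega> c)) j\<bar>}
        \<le> measure (\<Omega> C) {\<omega> \<in> space (\<Omega> C). 0 \<le> (\<Sum>c\<in>{1..C}. ?f (\<omega> c))}"
    proof (rule O.finite_measure_mono)
      have "(\<lambda>\<omega>. ?f (\<omega> c)) \<in> borel_measurable (\<Omega> C)" if "c \<in> {1..C}" for c
        using that by measurable
      then show "{\<omega> \<in> space (\<Omega> C). 0 \<le> (\<Sum>c\<in>{1..C}. ?f (\<omega> c))} \<in> O.events" by measurable
      show "{\<omega> \<in> space (\<Omega> C). \<exists>j\<in>J. C * (\<kappa> * (1 + K * u)) < \<bar>\<Sum>c\<in>{1..C}. g (lin D A (\<omega> c)) j\<bar>}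
        \<subseteq> {\<omega> \<in> space (\<Omega> C). 0 \<le> (\<Sum>c\<in>{1..C}. ?f (\<omega> c))}"
      proof (intro subsetI, elim CollectE conjE bexE, intro CollectI conjI)
        fix \<omega> j assume j: "j \<in> J" and gt: "C * (\<kappa> * (1 + K * u)) < \<bar>\<Sum>c\<in>{1..C}. g (lin D A (\<omega> c)) j\<bar>"
        let ?S = "\<Sum>c\<in>{1..C}. (nrm (\<omega> c))\<^sup>2"
        note gt
        also have "\<bar>\<Sum>c\<in>{1..C}. g (lin D A (\<omega> c)) j\<bar> \<le> (\<Sum>c\<in>{1..C}. \<kappa> * (1 + K * (nrm (\<omega> c))\<^sup>2))"
        proof (rule order_trans[OF sum_abs], rule sum_mono)
          fix c
          have "\<bar>g (lin D A (\<omega> c)) j\<bar> \<le> \<kappa> * (1 + (nrm (lin D A (\<omega> c)))\<^sup>2)" by (rule \<kappa>(2)[OF j])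
          also have "\<dots> \<le> \<kappa> * (1 + K * (nrm (\<omega> c))\<^sup>2)"
            using lin[of "\<omega> c"] \<kappa>(1) by (intro mult_left_mono) auto
          finally show "\<bar>g (lin D A (\<omega> c)) j\<bar> \<le> \<kappa> * (1 + K * (nrm (\<omega> c))\<^sup>2)" .
        qed
        also have "\<dots> = \<kappa> * (C + K * ?S)"
          by (simp add: sum_distrib_left[symmetric] sum.distrib)
        finally have "\<kappa> * (C * (1 + K * u)) < \<kappa> * (C + K * ?S)" by (simp add: mult_ac)
        then have "C * (1 + K * u) < C + K * ?S" using \<kappa>(1) by simp
        then have "K * (C * u) < K * ?S" by (simp add: algebra_simps)
        then have "C * u < ?S" using K by simp
        then show "0 \<le> (\<Sum>c\<in>{1..C}. ?f (\<omega> c))"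
          by (simp add: sum_subtractf sum_divide_distrib[symmetric])
      qed
    qed
    also have "\<dots> \<le> exp (- a) ^ card {1..C}"
      by (rule G.chernoff_PiM[OF _ z]) auto
    also have "\<dots> = exp (- (C * a))" by (simp add: exp_of_nat_mult[symmetric])
    finally show "measure (\<Omega> C) {\<omega> \<in> space (\<Omega> C). \<exists>j\<in>J. C * (\<kappa> * (1 + K * u)) < \<bar>\<Sum>c\<in>{1..C}. g (lin D A (\<omega> c)) j\<bar>}
        \<le> exp (- (C * a))" .
  qed
qed

end

section \<open>Uniformity in the covariance\<close>

definition cov :: "nat \<Rightarrow> (nat \<Rightarrow> nat \<Rightarrow> real) \<Rightarrow> nat \<Rightarrow> nat \<Rightarrow> real" where
  "cov D A i j = (\<Sum>k<D. A i k * A j k)"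

lemma sum_square_cov:
  "(\<Sum>k<D. (\<Sum>i<m. s i * A i k)\<^sup>2) = (\<Sum>i<m. \<Sum>j<m. s i * s j * cov D A i j)"
proof -
  have "(\<Sum>k<D. (\<Sum>i<m. s i * A i k)\<^sup>2) = (\<Sum>k<D. \<Sum>i<m. \<Sum>j<m. s i * s j * (A i k * A j k))"
    unfolding power2_eq_square sum_product by (intro sum.cong refl) (simp add: mult_ac)
  also have "\<dots> = (\<Sum>i<m. \<Sum>k<D. \<Sum>j<m. s i * s j * (A i k * A j k))" by (rule sum.swap)
  also have "\<dots> = (\<Sum>i<m. \<Sum>j<m. \<Sum>k<D. s i * s j * (A i k * A j k))"
    by (intro sum.cong refl sum.swap)
  finally show ?thesis by (simp add: cov_def sum_distrib_left)
qed

lemma char_lin: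
  "(\<integral>\<xi>. iexp (\<Sum>i<D. s i * lin D A \<xi> i) \<partial>std_gauss D)
    = of_real (exp (- (\<Sum>i<D. \<Sum>j<D. s i * s j * cov D A i j) / 2))"
proof -
  have "(\<Sum>i<D. s i * lin D A \<xi> i) = (\<Sum>k<D. (\<Sum>i<D. s i * A i k) * \<xi> k)" for \<xi>
    unfolding lin_def sum_distrib_left sum_distrib_right by (subst sum.swap) (simp add: mult_ac)
  then show ?thesis by (simp only: char_std_gauss sum_square_cov)
qed

text \<open>The characteristic function of \<open>A \<xi>\<close> depends on \<open>A\<close> only
  through the covariance. Hence any factor may replace the arbitrary one chosen in
  \<open>gauss_nn_integral\<close>.\<close>

lemma lin_law_cong:
  assumes "\<And>i j. i < D \<Longrightarrow> j < D \<Longrightarrow> cov D A i j = cov D B i j"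
  shows "distr (std_gauss D) (PiM {..<D} (\<lambda>_. borel)) (\<lambda>\<xi>. restrict (lin D A \<xi>) {..<D})
    = distr (std_gauss D) (PiM {..<D} (\<lambda>_. borel)) (\<lambda>\<xi>. restrict (lin D B \<xi>) {..<D})"
proof (rule distr_char_unique)
  show "(\<integral>\<xi>. iexp (\<Sum>i<D. s i * lin D A \<xi> i) \<partial>std_gauss D) = (\<integral>\<xi>. iexp (\<Sum>i<D. s i * lin D B \<xi> i) \<partial>std_gauss D)" for s
    unfolding char_lin using assms by simp
  show "(\<lambda>\<xi>. lin D A \<xi> k) \<in> borel_measurable (std_gauss D)" "(\<lambda>\<xi>. lin D B \<xi> k) \<in> borel_measurable (std_gauss D)" for k
    unfolding lin_def by measurable
qed (auto intro: prob_space_std_gauss)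

text \<open>By contradiction: factors with covariances converging to \<open>q\<close> are bounded, and a subsequential
  limit factors \<open>q\<close>.\<close>

lemma near_covariance_compactness:
  assumes loc: "\<And>A0. (\<And>i j. i < D \<Longrightarrow> j < D \<Longrightarrow> cov D A0 i j = q i j) \<Longrightarrow>
      \<exists>\<delta>>0. \<forall>A. (\<forall>i<D. \<forall>k<D. \<bar>A i k - A0 i k\<bar> \<le> \<delta>) \<longrightarrow> \<Phi> \<delta> A"
    and anti: "\<And>\<delta> \<delta>' A. \<Phi> \<delta> A \<Longrightarrow> 0 < \<delta>' \<Longrightarrow> \<delta>' \<le> \<delta> \<Longrightarrow> \<Phi> \<delta>' A"
  shows "\<exists>\<delta>>0. \<forall>A. (\<forall>i<D. \<forall>j<D. \<bar>cov D A i j - q i j\<bar> \<le> \<delta>) \<longrightarrow> \<Phi> \<delta> A"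
proof (rule ccontr)
  assume neg: "\<not> ?thesis"
  have "\<exists>A. (\<forall>i<D. \<forall>j<D. \<bar>cov D A i j - q i j\<bar> \<le> inverse (real (Suc n))) \<and> \<not> \<Phi> (inverse (real (Suc n))) A" for n
  proof -
    have "0 < inverse (real (Suc n))" by simp
    with neg show ?thesis by blast
  qed
  then obtain A where A: "\<And>n i j. i < D \<Longrightarrow> j < D \<Longrightarrow> \<bar>cov D (A n) i j - q i j\<bar> \<le> inverse (real (Suc n))"
      "\<And>n. \<not> \<Phi> (inverse (real (Suc n))) (A n)"
    by metis
  \<comment> \<open>The squared entries of row \<open>i\<close> sum to the diagonal entry
    \<open>cov D (A n) i i\<close>, which is within 1 of \<open>q i i\<close>.\<close>
  define K where "K = (\<Sum>i<D. \<bar>q i i\<bar>) + 1"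
  have bd: "\<bar>A n i k\<bar> \<le> sqrt K" if "i < D" "k < D" for n i k
  proof -
    have "(A n i k)\<^sup>2 \<le> (\<Sum>k<D. (A n i k)\<^sup>2)" using that by (intro member_le_sum) auto
    also have "\<dots> = cov D (A n) i i" by (simp add: cov_def power2_eq_square)
    also have "\<dots> \<le> \<bar>q i i\<bar> + 1"
    proof -
      have "inverse (real (Suc n)) \<le> 1" by (simp add: inverse_le_1_iff)
      then show ?thesis using A(1)[OF that(1,1), of n] by linarith
    qed
    also have "\<bar>q i i\<bar> \<le> (\<Sum>i<D. \<bar>q i i\<bar>)" using that by (intro member_le_sum[of i _ "\<lambda>i. \<bar>q i i\<bar>"]) auto
    finally have "(A n i k)\<^sup>2 \<le> K" by (simp add: K_def)
    then show ?thesis by (metis real_sqrt_abs real_sqrt_le_mono)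
  qed
  have "\<exists>l s. strict_mono s \<and> (\<forall>p\<in>{..<D} \<times> {..<D}. (\<lambda>n. A (s n) (fst p) (snd p)) \<longlonglongrightarrow> l p)"
    using bounded_coords_subseq[of "{..<D} \<times> {..<D}" "\<lambda>n p. A n (fst p) (snd p)" "sqrt K"] bd by auto
  then obtain l s where s: "strict_mono s" "\<And>i k. i < D \<Longrightarrow> k < D \<Longrightarrow> (\<lambda>n. A (s n) i k) \<longlonglongrightarrow> l (i, k)"
    by fastforce
  have lim0: "(\<lambda>n. inverse (real (Suc (s n)))) \<longlonglongrightarrow> 0"
    using LIMSEQ_subseq_LIMSEQ[OF LIMSEQ_inverse_real_of_nat s(1)] by (simp add: o_def)
  let ?A0 = "\<lambda>i k. l (i, k)"
  have "cov D ?A0 i j = q i j" if ij: "i < D" "j < D" for i j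
  proof (rule LIMSEQ_unique)
    show "(\<lambda>n. cov D (A (s n)) i j) \<longlonglongrightarrow> cov D ?A0 i j"
      unfolding cov_def using s(2) ij by (intro tendsto_intros) auto
    have "(\<lambda>n. cov D (A (s n)) i j - q i j) \<longlonglongrightarrow> 0"
      by (rule Lim_null_comparison[OF _ lim0]) (use A(1)[OF ij] in auto)
    from tendsto_add[OF this tendsto_const[of "q i j"]] show "(\<lambda>n. cov D (A (s n)) i j) \<longlonglongrightarrow> q i j" by simp
  qed
  from loc[OF this] obtain \<delta> where \<delta>: "0 < \<delta>" "\<And>A. (\<forall>i<D. \<forall>k<D. \<bar>A i k - ?A0 i k\<bar> \<le> \<delta>) \<Longrightarrow> \<Phi> \<delta> A" by blast
  have "\<forall>\<^sub>F n in sequentially. \<forall>i\<in>{..<D}. \<forall>k\<in>{..<D}. \<bar>A (s n) i k - ?A0 i k\<bar> \<le> \<delta>"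
  proof (intro eventually_ball_finite ballI finite_lessThan)
    fix i k assume "i \<in> {..<D}" "k \<in> {..<D}"
    then have "(\<lambda>n. A (s n) i k - ?A0 i k) \<longlonglongrightarrow> ?A0 i k - ?A0 i k" using s(2) by (intro tendsto_intros) auto
    then have "(\<lambda>n. \<bar>A (s n) i k - ?A0 i k\<bar>) \<longlonglongrightarrow> 0" by (auto intro: tendsto_rabs_zero)
    from order_tendstoD(2)[OF this \<delta>(1)] show "\<forall>\<^sub>F n in sequentially. \<bar>A (s n) i k - ?A0 i k\<bar> \<le> \<delta>"
      by (rule eventually_mono) simp
  qed
  moreover have "\<forall>\<^sub>F n in sequentially. inverse (real (Suc (s n))) < \<delta>"
    by (rule order_tendstoD(2)[OF lim0 \<delta>(1)])
  ultimately have "\<forall>\<^sub>F n in sequentially. \<Phi> (inverse (real (Suc (s n)))) (A (s n))"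
  proof eventually_elim
    case (elim n)
    then have "\<Phi> \<delta> (A (s n))" by (intro \<delta>(2)) auto
    then show ?case by (rule anti) (use elim in auto)
  qed
  then show False using A(2) eventually_happens'[OF sequentially_bot] by blast
qed

section \<open>The one-layer estimates near a fixed covariance\<close>

context feature_map
begin

lemma mgf_cong_cov:
  assumes "\<And>i j. i < D \<Longrightarrow> j < D \<Longrightarrow> cov D A i j = cov D B i j"
  shows "mgf A t = mgf B t"
proof -
  \<comment> \<open>Carries a point of the finite product to a function on all naturals, the type on
    which \<open>g\<close> is defined, without affecting the coordinates that \<open>g\<close>
    sees.\<close>
  define ext where "ext y = (\<lambda>k. if k < D then y k else 0 :: real)" for y
  have [measurable]: "ext \<in> borel_measurable (PiM {..<D} (\<lambda>_. borel))"
  proof (rule measurable_coordinatewise_then_product)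
    fix i show "(\<lambda>y. ext y i) \<in> borel_measurable (PiM {..<D} (\<lambda>_. borel))"
      by (cases "i < D") (auto simp: ext_def)
  qed
  have F: "(\<lambda>z. ip t (g z)) \<in> borel_measurable borel"
    unfolding ip_def using g_meas by measurable
  have m: "(\<lambda>y. ennreal (exp (ip t (g (ext y))))) \<in> borel_measurable (PiM {..<D} (\<lambda>_. borel))"
    using measurable_compose[OF \<open>ext \<in> _\<close> F] by measurable
  have r: "(\<lambda>\<xi>. restrict (lin D A \<xi>) {..<D}) \<in> measurable (std_gauss D) (PiM {..<D} (\<lambda>_. borel))" for A
    unfolding lin_def by (rule measurable_restrict) measurable
  have "mgf A t = (\<integral>\<^sup>+y. ennreal (exp (ip t (g (ext y)))) \<partial>distr (std_gauss D) (PiM {..<D} (\<lambda>_. borel)) (\<lambda>\<xi>. restrict (lin D A \<xi>) {..<D}))" for A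
  proof -
    have "g (ext (restrict (lin D A \<xi>) {..<D})) j = g (lin D A \<xi>) j" if "j \<in> J" for \<xi> j
      by (rule g_local) (use that in \<open>auto simp: ext_def\<close>)
    then have "ip t (g (ext (restrict (lin D A \<xi>) {..<D}))) = ip t (g (lin D A \<xi>))" for \<xi>
      unfolding ip_def by (intro sum.cong) auto
    then show ?thesis unfolding mgf_def using m by (subst nn_integral_distr[OF r]) simp_all
  qed
  then show ?thesis using lin_law_cong[OF assms] by simp
qed

lemma near_mono: "\<delta> \<le> \<delta>' \<Longrightarrow> near C A x \<delta> \<subseteq> near C A x \<delta>'"
  using mult_left_mono[of \<delta> \<delta>' "real C"] by (force simp: near_def)

lemma upper_bound_near_covariance:
  assumes fin: "mgf A0 t < \<infinity>" and a: "a < ip t x - ln (enn2real (mgf A0 t))"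
  shows "\<exists>\<delta>>0. \<forall>A. (\<forall>i<D. \<forall>j<D. \<bar>cov D A i j - cov D A0 i j\<bar> \<le> \<delta>) \<longrightarrow>
    (\<forall>C. measure (\<Omega> C) (near C A x \<delta>) \<le> exp (- (C * a)))"
proof (rule near_covariance_compactness)
  fix B assume "\<And>i j. i < D \<Longrightarrow> j < D \<Longrightarrow> cov D B i j = cov D A0 i j"
  then have "mgf B t = mgf A0 t" by (rule mgf_cong_cov)
  with local_upper_bound[of B t a x] fin a
  show "\<exists>\<delta>>0. \<forall>A. (\<forall>i<D. \<forall>k<D. \<bar>A i k - B i k\<bar> \<le> \<delta>) \<longrightarrow> (\<forall>C. measure (\<Omega> C) (near C A x \<delta>) \<le> exp (- (C * a)))"
    by fastforce
next
  fix \<delta> \<delta>' :: real and A assume "\<forall>C. measure (\<Omega> C) (near C A x \<delta>) \<le> exp (- (C * a))" "0 < \<delta>'" "\<delta>' \<le> \<delta>"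
  moreover have "measure (\<Omega> C) (near C A x \<delta>') \<le> measure (\<Omega> C) (near C A x \<delta>)" for C
  proof -
    interpret prob_space "\<Omega> C" by (rule prob_space_\<Omega>)
    show ?thesis by (rule finite_measure_mono[OF near_mono near_meas]) fact
  qed
  ultimately show "\<forall>C. measure (\<Omega> C) (near C A x \<delta>') \<le> exp (- (C * a))" by (meson order_trans)
qed

lemma lower_bound_near_covariance:
  assumes a0: "\<And>t. mgf A0 t < \<infinity> \<Longrightarrow> ip t x - ln (enn2real (mgf A0 t)) \<le> a0"
    and a: "a0 < a" and \<delta>: "0 < \<delta>"
  shows "\<exists>d>0. \<exists>C0. \<forall>C\<ge>C0. \<forall>A. (\<forall>i<D. \<forall>j<D. \<bar>cov D A i j - cov D A0 i j\<bar> \<le> d) \<longrightarrow>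
    exp (- (C * a)) \<le> measure (\<Omega> C) (near C A x \<delta>)"
proof -
  \<comment> \<open>the threshold for \<open>C\<close> is tied to \<open>d\<close> to make the property antimonotone in \<open>d\<close>\<close>
  have "\<exists>d>0. \<forall>A. (\<forall>i<D. \<forall>j<D. \<bar>cov D A i j - cov D A0 i j\<bar> \<le> d) \<longrightarrow>
    (\<forall>C::nat. 1 / d \<le> C \<longrightarrow> exp (- (C * a)) \<le> measure (\<Omega> C) (near C A x \<delta>))"
  proof (rule near_covariance_compactness)
    fix B assume "\<And>i j. i < D \<Longrightarrow> j < D \<Longrightarrow> cov D B i j = cov D A0 i j"
    then have "mgf B t = mgf A0 t" for t by (rule mgf_cong_cov)
    with local_lower_bound[of B x a0 a \<delta>] a0 a \<delta> obtain d and C0 :: nat where d: "0 < d"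
      "\<And>C A. C0 \<le> C \<Longrightarrow> (\<forall>i<D. \<forall>k<D. \<bar>A i k - B i k\<bar> \<le> d) \<Longrightarrow> exp (- (real C * a)) \<le> measure (\<Omega> C) (near C A x \<delta>)"
      by (metis (no_types, lifting))
    define d' where "d' = min d (1 / (real C0 + 1))"
    have "0 < d'" "d' \<le> d" using d(1) by (auto simp: d'_def)
    moreover have "C0 \<le> C" if "1 / d' \<le> real C" for C
    proof -
      have "d' \<le> 1 / (real C0 + 1)" by (simp add: d'_def)
      then have "real C0 + 1 \<le> 1 / d'" using \<open>0 < d'\<close> by (simp add: field_simps)
      then show ?thesis using that by linarith
    qed
    ultimately show "\<exists>d>0. \<forall>A. (\<forall>i<D. \<forall>k<D. \<bar>A i k - B i k\<bar> \<le> d) \<longrightarrow>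
      (\<forall>C::nat. 1 / d \<le> C \<longrightarrow> exp (- (C * a)) \<le> measure (\<Omega> C) (near C A x \<delta>))"
      by (intro exI[of _ d'] conjI allI impI d(2)) (auto intro: order_trans)
  next
    fix d d' :: real and A
    assume *: "\<forall>C::nat. 1 / d \<le> C \<longrightarrow> exp (- (C * a)) \<le> measure (\<Omega> C) (near C A x \<delta>)" "0 < d'" "d' \<le> d"
    then have "1 / d \<le> 1 / d'" by (intro divide_left_mono) (auto intro: mult_pos_pos less_le_trans)
    with * show "\<forall>C::nat. 1 / d' \<le> C \<longrightarrow> exp (- (C * a)) \<le> measure (\<Omega> C) (near C A x \<delta>)"
      by (meson order_trans)
  qed
  then obtain d where d: "0 < d" "\<And>A C. (\<forall>i<D. \<forall>j<D. \<bar>cov D A i j - cov D A0 i j\<bar> \<le> d) \<Longrightarrow>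
      1 / d \<le> real C \<Longrightarrow> exp (- (real C * a)) \<le> measure (\<Omega> C) (near C A x \<delta>)"
    by blast
  obtain C0 :: nat where "1 / d \<le> C0" using real_arch_simple by blast
  then have "1 / d \<le> real C" if "C0 \<le> C" for C using that by (meson of_nat_le_iff order_trans)
  with d show ?thesis by blast
qed

end

text \<open>Given the features \<open>\<beta>\<close>, the preactivations are linear in Gaussian
  weights, so comparing covariances suffices. Distinct channels \<open>c\<close> use disjoint
  weights through the bijection \<open>e\<close>, which gives independence, and within a channel the
  covariance is the scaled Gram matrix of the features.\<close>

lemma layer_law:
  fixes \<beta> :: "'u \<Rightarrow> nat \<Rightarrow> real" and e :: "'u \<times> nat \<Rightarrow> 'i" and \<tau> :: "'i \<Rightarrow> real"
  assumes U: "finite U" and e: "bij_betw e (U \<times> {1..C}) I" and \<tau>: "\<And>i. 0 < \<tau> i"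
    and \<tau>0: "\<And>i. i \<in> I \<Longrightarrow> \<tau> i = \<tau>0"
    and A: "\<And>a b. a < D \<Longrightarrow> b < D \<Longrightarrow> \<tau>0\<^sup>2 * (\<Sum>u\<in>U. \<beta> u a * \<beta> u b) = cov D A a b"
  shows "distr (PiM I (\<lambda>i. density lborel (normal_density 0 (\<tau> i)))) (PiM ({1..C} \<times> {..<D}) (\<lambda>_. borel))
      (\<lambda>y. restrict (\<lambda>(c, a). \<Sum>u\<in>U. y (e (u, c)) * \<beta> u a) ({1..C} \<times> {..<D}))
    = distr (PiM {1..C} (\<lambda>_. std_gauss D)) (PiM ({1..C} \<times> {..<D}) (\<lambda>_. borel))
      (\<lambda>\<omega>. restrict (\<lambda>(c, a). lin D A (\<omega> c) a) ({1..C} \<times> {..<D}))"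
proof (rule distr_char_unique)
  have I: "finite I" using U bij_betw_finite[OF e] by simp
  show "prob_space (PiM I (\<lambda>i. density lborel (normal_density 0 (\<tau> i))))"
    by (intro prob_space_PiM prob_space_normal_density \<tau>)
  show "prob_space (PiM {1..C} (\<lambda>_. std_gauss D))"
    by (intro prob_space_PiM prob_space_std_gauss)
  have eI: "e (u, c) \<in> I" if "u \<in> U" "c \<in> {1..C}" for u c
    using e that by (auto simp: bij_betw_def)
  fix k assume k: "k \<in> {1..C} \<times> {..<D}"
  obtain c a where ca: "k = (c, a)" "c \<in> {1..C}" "a < D" using k by auto
  have "(\<lambda>y. y (e (u, c))) \<in> borel_measurable (PiM I (\<lambda>i. density lborel (normal_density 0 (\<tau> i))))" if "u \<in> U" for u
    using measurable_component_singleton[OF eI[OF that ca(2)], of "\<lambda>i. density lborel (normal_density 0 (\<tau> i))"] by simp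
  then show "(\<lambda>y. case k of (c, a) \<Rightarrow> \<Sum>u\<in>U. y (e (u, c)) * \<beta> u a)
      \<in> borel_measurable (PiM I (\<lambda>i. density lborel (normal_density 0 (\<tau> i))))"
    unfolding ca(1) by simp
  have "(\<lambda>\<xi>. lin D A \<xi> a) \<in> borel_measurable (std_gauss D)" unfolding lin_def by measurable
  from measurable_compose[OF measurable_component_singleton[OF ca(2), of "\<lambda>_. std_gauss D"] this]
  show "(\<lambda>\<omega>. case k of (c, a) \<Rightarrow> lin D A (\<omega> c) a) \<in> borel_measurable (PiM {1..C} (\<lambda>_. std_gauss D))"
    unfolding ca(1) by simp
next
  fix s :: "nat \<times> nat \<Rightarrow> real"
  have I: "finite I" using U bij_betw_finite[OF e] by simp
  let ?V = "\<Sum>c\<in>{1..C}. \<Sum>a<D. \<Sum>b<D. s (c, a) * s (c, b) * cov D A a b"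
  \<comment> \<open>Inverts the labelling, so that \<open>f i\<close> is the coefficient of the
    single weight \<open>i\<close> in the linear form.\<close>
  define d where "d = inv_into (U \<times> {1..C}) e"
  have de: "d (e p) = p" if "p \<in> U \<times> {1..C}" for p
    unfolding d_def using e that by (auto simp: bij_betw_def)
  define f where "f i = (case d i of (u, c) \<Rightarrow> \<Sum>a<D. s (c, a) * \<beta> u a)" for i
  have reindex: "(\<Sum>i\<in>I. h i) = (\<Sum>c\<in>{1..C}. \<Sum>u\<in>U. h (e (u, c)))" for h :: "'i \<Rightarrow> real"
    unfolding sum.reindex_bij_betw[OF e, symmetric] by (subst sum.swap) (simp add: sum.cartesian_product)
  have lhs: "(\<Sum>k\<in>{1..C} \<times> {..<D}. s k * (case k of (c, a) \<Rightarrow> \<Sum>u\<in>U. y (e (u, c)) * \<beta> u a)) = (\<Sum>i\<in>I. f i * y i)" for y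
  proof -
    have "(\<Sum>k\<in>{1..C} \<times> {..<D}. s k * (case k of (c, a) \<Rightarrow> \<Sum>u\<in>U. y (e (u, c)) * \<beta> u a))
        = (\<Sum>c\<in>{1..C}. \<Sum>a<D. \<Sum>u\<in>U. s (c, a) * (y (e (u, c)) * \<beta> u a))"
      by (simp only: sum.cartesian_product' prod.case sum_distrib_left)
    also have "\<dots> = (\<Sum>c\<in>{1..C}. \<Sum>u\<in>U. \<Sum>a<D. s (c, a) * (y (e (u, c)) * \<beta> u a))"
      by (intro sum.cong refl sum.swap)
    also have "\<dots> = (\<Sum>c\<in>{1..C}. \<Sum>u\<in>U. f (e (u, c)) * y (e (u, c)))"
      by (intro sum.cong refl) (simp add: f_def de sum_distrib_right sum_distrib_left mult_ac)
    finally show ?thesis unfolding reindex .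
  qed
  have "(\<integral>y. iexp (\<Sum>k\<in>{1..C} \<times> {..<D}. s k * (case k of (c, a) \<Rightarrow> \<Sum>u\<in>U. y (e (u, c)) * \<beta> u a))
        \<partial>PiM I (\<lambda>i. density lborel (normal_density 0 (\<tau> i))))
      = of_real (exp (- (\<Sum>i\<in>I. (\<tau> i)\<^sup>2 * (f i)\<^sup>2) / 2))"
    unfolding lhs by (rule char_PiM_normal[OF I \<tau>])
  also have "(\<Sum>i\<in>I. (\<tau> i)\<^sup>2 * (f i)\<^sup>2) = (\<Sum>i\<in>I. \<tau>0\<^sup>2 * (f i)\<^sup>2)"
    using \<tau>0 by (intro sum.cong) auto
  also have "\<dots> = ?V" unfolding reindex
  proof (rule sum.cong[OF refl])
    fix c assume c: "c \<in> {1..C}"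
    have "(\<Sum>u\<in>U. \<tau>0\<^sup>2 * (f (e (u, c)))\<^sup>2) = (\<Sum>u\<in>U. \<Sum>a<D. \<Sum>b<D. s (c, a) * s (c, b) * (\<tau>0\<^sup>2 * (\<beta> u a * \<beta> u b)))"
      using c by (intro sum.cong refl)
        (simp add: f_def de power2_eq_square sum_product sum_distrib_left mult_ac)
    also have "\<dots> = (\<Sum>a<D. \<Sum>u\<in>U. \<Sum>b<D. s (c, a) * s (c, b) * (\<tau>0\<^sup>2 * (\<beta> u a * \<beta> u b)))"
      by (rule sum.swap)
    also have "\<dots> = (\<Sum>a<D. \<Sum>b<D. \<Sum>u\<in>U. s (c, a) * s (c, b) * (\<tau>0\<^sup>2 * (\<beta> u a * \<beta> u b)))"
      by (intro sum.cong refl sum.swap)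
    also have "\<dots> = (\<Sum>a<D. \<Sum>b<D. s (c, a) * s (c, b) * cov D A a b)"
      by (intro sum.cong refl) (simp add: A[symmetric] sum_distrib_left)
    finally show "(\<Sum>u\<in>U. \<tau>0\<^sup>2 * (f (e (u, c)))\<^sup>2) = (\<Sum>a<D. \<Sum>b<D. s (c, a) * s (c, b) * cov D A a b)" .
  qed
  also have "of_real (exp (- ?V / 2)) = (\<integral>\<omega>. iexp (\<Sum>k\<in>{1..C} \<times> {..<D}. s k * (case k of (c, a) \<Rightarrow> lin D A (\<omega> c) a)) \<partial>PiM {1..C} (\<lambda>_. std_gauss D))"
  proof -
    have "(\<Sum>k\<in>{1..C} \<times> {..<D}. s k * (case k of (c, a) \<Rightarrow> lin D A (\<omega> c) a))
        = (\<Sum>c\<in>{1..C}. \<Sum>j<D. (\<Sum>a<D. s (c, a) * A a j) * \<omega> c j)" for \<omega>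
    proof -
      have "(\<Sum>k\<in>{1..C} \<times> {..<D}. s k * (case k of (c, a) \<Rightarrow> lin D A (\<omega> c) a))
          = (\<Sum>c\<in>{1..C}. \<Sum>a<D. \<Sum>j<D. s (c, a) * (A a j * \<omega> c j))"
        by (simp only: sum.cartesian_product' prod.case lin_def sum_distrib_left)
      also have "\<dots> = (\<Sum>c\<in>{1..C}. \<Sum>j<D. \<Sum>a<D. s (c, a) * (A a j * \<omega> c j))"
        by (intro sum.cong refl sum.swap)
      finally show ?thesis by (simp add: sum_distrib_right mult.assoc)
    qed
    then show ?thesis
      by (simp only: char_PiM_std_gauss[OF finite_atLeastAtMost] sum_square_cov)
  qed
  finally show "(\<integral>y. iexp (\<Sum>k\<in>{1..C} \<times> {..<D}. s k * (case k of (c, a) \<Rightarrow> \<Sum>u\<in>U. y (e (u, c)) * \<beta> u a))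
        \<partial>PiM I (\<lambda>i. density lborel (normal_density 0 (\<tau> i))))
      = (\<integral>\<omega>. iexp (\<Sum>k\<in>{1..C} \<times> {..<D}. s k * (case k of (c, a) \<Rightarrow> lin D A (\<omega> c) a)) \<partial>PiM {1..C} (\<lambda>_. std_gauss D))" .
qed (use U in auto)

text \<open>The quadratic form is \<open>v\<close> times a sum of squares over the units. A factor
  indexed by the units, whose number grows with the width, is traded for a square one of fixed size
  \<open>D\<close>.\<close>

lemma gram_factorization:
  fixes \<beta> :: "'u \<Rightarrow> nat \<Rightarrow> real"
  assumes "0 \<le> v"
  obtains A where "\<And>a b. a < D \<Longrightarrow> b < D \<Longrightarrow> cov D A a b = v * (\<Sum>u\<in>U. \<beta> u a * \<beta> u b)"
proof -
  have "\<exists>a. \<forall>i<D. \<forall>j<D. (\<Sum>k<D. a i k * a j k) = v * (\<Sum>u\<in>U. \<beta> u i * \<beta> u j)"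
  proof (rule psd_factorization)
    fix y :: "nat \<Rightarrow> real"
    have "(\<Sum>i<D. \<Sum>j<D. y i * (v * (\<Sum>u\<in>U. \<beta> u i * \<beta> u j)) * y j)
        = (\<Sum>i<D. \<Sum>j<D. \<Sum>u\<in>U. v * ((y i * \<beta> u i) * (y j * \<beta> u j)))"
      by (simp add: sum_distrib_left sum_distrib_right mult_ac)
    also have "\<dots> = (\<Sum>i<D. \<Sum>u\<in>U. \<Sum>j<D. v * ((y i * \<beta> u i) * (y j * \<beta> u j)))"
      by (intro sum.cong refl sum.swap)
    also have "\<dots> = (\<Sum>u\<in>U. \<Sum>i<D. \<Sum>j<D. v * ((y i * \<beta> u i) * (y j * \<beta> u j)))"
      by (rule sum.swap)
    also have "\<dots> = (\<Sum>u\<in>U. v * (\<Sum>i<D. y i * \<beta> u i)\<^sup>2)"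
      unfolding power2_eq_square sum_product by (simp only: sum_distrib_left)
    finally show "0 \<le> (\<Sum>i<D. \<Sum>j<D. y i * (v * (\<Sum>u\<in>U. \<beta> u i * \<beta> u j)) * y j)"
      using assms by (simp add: sum_nonneg)
  qed (simp add: mult.commute)
  then show ?thesis using that unfolding cov_def by blast
qed

section \<open>From local estimates to a large deviation principle\<close>

lemma scaled_ln_prob_ge:
  assumes "1 \<le> n" "exp (- (real n * a)) \<le> p"
  shows "ereal (- a) \<le> ereal (1 / real n) * ln_prob p"
proof -
  have p: "0 < p" using assms(2) by (rule less_le_trans[rotated]) simp
  then have "- (real n * a) \<le> ln p" using assms(2) by (simp add: ln_ge_iff)
  then have "- a \<le> 1 / real n * ln p" using assms(1) by (simp add: field_simps)
  then show ?thesis using p by (simp add: ln_prob_def)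
qed

lemma scaled_ln_prob_le:
  assumes "1 \<le> n" "0 < K" "0 \<le> p" "p \<le> K * exp (- (real n * a))"
  shows "ereal (1 / real n) * ln_prob p \<le> ereal (ln K / real n - a)"
proof (cases "p = 0")
  case True
  then show ?thesis using assms(1) by (simp add: ln_prob_def)
next
  case False
  then have p: "0 < p" using assms by simp
  have "ln p \<le> ln (K * exp (- (real n * a)))" using p assms by simp
  also have "\<dots> = ln K - real n * a" using assms(2) by (subst ln_mult_pos) auto
  finally have "1 / real n * ln p \<le> ln K / real n - a" using assms(1) by (simp add: field_simps)
  then show ?thesis using p by (simp add: ln_prob_def)
qed

text \<open>The tool by which probability estimates constrain the rate: the inclusion of two events,
  read on the exponential scale at one large \<open>n\<close>.\<close>

lemma rate_comparison:
  fixes p q :: "nat \<Rightarrow> real"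
  assumes "\<forall>\<^sub>F n in sequentially. exp (- (real n * b)) \<le> p n" "\<forall>\<^sub>F n in sequentially. q n \<le> exp (- (real n * a))"
    and "\<And>n. p n \<le> q n"
  shows "a \<le> b"
proof -
  have "\<forall>\<^sub>F n in sequentially. exp (- (real n * b)) \<le> p n \<and> q n \<le> exp (- (real n * a)) \<and> 1 \<le> n"
    using assms(1,2) eventually_ge_at_top by eventually_elim auto
  then obtain n where n: "exp (- (real n * b)) \<le> p n" "q n \<le> exp (- (real n * a))" "1 \<le> n"
    using eventually_happens'[OF sequentially_bot] by blast
  then have "exp (- (real n * b)) \<le> exp (- (real n * a))" using assms(3)[of n] by linarith
  then show ?thesis using n(3) by simp
qed

text \<open>Exponential estimates for small balls together with exponential tightness yield the full LDP;
  nonnegativity, lower semicontinuity and goodness of the rate are forced by the estimates.\<close>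

locale local_estimates = Metric_space +
  fixes Q :: "nat \<Rightarrow> 'b measure" and X :: "nat \<Rightarrow> 'b \<Rightarrow> 'a" and I :: "'a \<Rightarrow> ereal"
  assumes prob: "\<And>n. prob_space (Q n)"
    and X_in: "\<And>n w. w \<in> space (Q n) \<Longrightarrow> X n w \<in> M"
    and X_meas: "\<And>n U. openin mtopology U \<Longrightarrow> {w \<in> space (Q n). X n w \<in> U} \<in> sets (Q n)"
    and upper: "\<And>x a. x \<in> M \<Longrightarrow> ereal a < I x \<Longrightarrow>
      \<exists>\<delta>>0. \<forall>\<^sub>F n in sequentially. measure (Q n) {w \<in> space (Q n). X n w \<in> mball x \<delta>} \<le> exp (- (real n * a))"
    and lower: "\<And>x \<delta> a. x \<in> M \<Longrightarrow> 0 < \<delta> \<Longrightarrow> I x < ereal a \<Longrightarrow>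
      \<forall>\<^sub>F n in sequentially. exp (- (real n * a)) \<le> measure (Q n) {w \<in> space (Q n). X n w \<in> mball x \<delta>}"
    and tight: "\<And>a. \<exists>K. compactin mtopology K \<and>
      (\<forall>\<^sub>F n in sequentially. measure (Q n) {w \<in> space (Q n). X n w \<notin> K} \<le> exp (- (real n * a)))"
begin

lemma closed_meas:
  assumes "closedin mtopology F"
  shows "{w \<in> space (Q n). X n w \<in> F} \<in> sets (Q n)"
proof -
  have "{w \<in> space (Q n). X n w \<in> F} = space (Q n) - {w \<in> space (Q n). X n w \<in> M - F}"
    using X_in by auto
  moreover have "openin mtopology (M - F)" using assms by (auto simp: closedin_def)
  ultimately show ?thesis by (simp only: X_meas sets.compl_sets)
qed

lemma preimage_mono:
  assumes "A \<subseteq> B" "{w \<in> space (Q n). X n w \<in> B} \<in> sets (Q n)"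
  shows "measure (Q n) {w \<in> space (Q n). X n w \<in> A} \<le> measure (Q n) {w \<in> space (Q n). X n w \<in> B}"
  using assms prob[of n] by (intro finite_measure.finite_measure_mono prob_space.finite_measure) auto

text \<open>A negative rate would make the probability of a ball exceed 1.\<close>

lemma rate_nonneg:
  assumes x: "x \<in> M"
  shows "0 \<le> I x"
proof (rule ccontr)
  assume "\<not> 0 \<le> I x"
  then obtain a where a: "I x < ereal a" "ereal a < 0" using ereal_dense2[of "I x" 0] by (auto simp: not_le)
  have "0 < (1 :: real)" by simp
  have "0 \<le> a"
  proof (rule rate_comparison[OF lower[OF x \<open>0 < (1 :: real)\<close> a(1)], where q = "\<lambda>_. 1"])
    show "measure (Q n) {w \<in> space (Q n). X n w \<in> mball x 1} \<le> 1" for n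
      by (rule prob_space.prob_le_1[OF prob])
  qed simp
  then show False using a(2) by simp
qed

text \<open>The upper bound in a ball around \<open>x\<close> meets the lower bound in a smaller
  ball around \<open>y\<close> inside it: the rate at \<open>y\<close> cannot fall below the level
  certified at \<open>x\<close>. Strict superlevel sets are therefore open.\<close>

lemma closedin_sublevel:
  shows "closedin mtopology {x \<in> M. I x \<le> ereal c}"
proof -
  have "openin mtopology {x \<in> M. ereal c < I x}"
    unfolding openin_mtopology
  proof (intro conjI allI impI)
    fix x assume "x \<in> {x \<in> M. ereal c < I x}"
    then have x: "x \<in> M" "ereal c < I x" by auto
    then obtain a where a: "ereal c < ereal a" "ereal a < I x" using ereal_dense2 by blast
    from upper[OF x(1) a(2)] obtain \<delta> where \<delta>: "0 < \<delta>"
      "\<forall>\<^sub>F n in sequentially. measure (Q n) {w \<in> space (Q n). X n w \<in> mball x \<delta>} \<le> exp (- (real n * a))" by blast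
    have "ereal c < I y" if y: "y \<in> mball x \<delta>" for y
    proof (rule ccontr)
      assume "\<not> ereal c < I y"
      then have "I y \<le> ereal c" by simp
      also have "ereal c < ereal ((c + a) / 2)" using a(1) by simp
      finally have Iy: "I y < ereal ((c + a) / 2)" .
      obtain \<epsilon> where \<epsilon>: "0 < \<epsilon>" "mball y \<epsilon> \<subseteq> mball x \<delta>"
        using openin_mball[of x \<delta>] y unfolding openin_mtopology by blast
      have "y \<in> M" using y by simp
      have "measure (Q n) {w \<in> space (Q n). X n w \<in> mball y \<epsilon>} \<le> measure (Q n) {w \<in> space (Q n). X n w \<in> mball x \<delta>}" for n
        by (rule preimage_mono[OF \<epsilon>(2)]) (rule X_meas[OF openin_mball])
      with lower[OF \<open>y \<in> M\<close> \<epsilon>(1) Iy] \<delta>(2) have "a \<le> (c + a) / 2"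
        by (rule rate_comparison)
      then show False using a(1) by simp
    qed
    then show "\<exists>r>0. mball x r \<subseteq> {x \<in> M. ereal c < I x}"
      using \<delta>(1) by (intro exI[of _ \<delta>]) auto
  qed auto
  moreover have "{x \<in> M. I x \<le> ereal c} = M - {x \<in> M. ereal c < I x}" by auto
  ultimately show ?thesis by (metis closedin_diff closedin_topspace topspace_mtopology)
qed

text \<open>Points of rate at most \<open>c\<close> lie in the compact set that tightness provides
  at level \<open>c + 1\<close>: elsewhere a ball around the point would carry more mass than the
  complement of that set.\<close>

lemma compactin_sublevel:
  shows "compactin mtopology {x \<in> M. I x \<le> ereal c}"
proof -
  obtain K where K: "compactin mtopology K"
    "\<forall>\<^sub>F n in sequentially. measure (Q n) {w \<in> space (Q n). X n w \<notin> K} \<le> exp (- (real n * (c + 1)))"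
    using tight by blast
  have clK: "closedin mtopology K" using K(1) by (rule compactin_imp_closedin[OF Hausdorff_space_mtopology])
  have "{x \<in> M. I x \<le> ereal c} \<subseteq> K"
  proof (rule ccontr)
    assume "\<not> {x \<in> M. I x \<le> ereal c} \<subseteq> K"
    then obtain x where x: "x \<in> M" "I x \<le> ereal c" "x \<notin> K" by auto
    have "openin mtopology (M - K)" using clK by (auto simp: closedin_def)
    then obtain \<epsilon> where \<epsilon>: "0 < \<epsilon>" "mball x \<epsilon> \<subseteq> M - K"
      using x unfolding openin_mtopology by blast
    have "I x < ereal (c + 1 / 2)" using x(2) by (rule le_less_trans) simp
    then have "c + 1 \<le> c + 1 / 2"
    proof (rule rate_comparison[OF lower[OF x(1) \<epsilon>(1)] K(2)])
      fix n
      have "{w \<in> space (Q n). X n w \<notin> K} = {w \<in> space (Q n). X n w \<in> M - K}" using X_in by auto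
      then show "measure (Q n) {w \<in> space (Q n). X n w \<in> mball x \<epsilon>} \<le> measure (Q n) {w \<in> space (Q n). X n w \<notin> K}"
        using preimage_mono[OF \<epsilon>(2) X_meas[OF \<open>openin mtopology (M - K)\<close>]] by (simp only:)
    qed
    then show False by simp
  qed
  then show ?thesis using closed_compactin[OF K(1) _ closedin_sublevel] by blast
qed

lemma open_lower_bound:
  assumes U: "openin mtopology U"
  shows "- (INF x \<in> U. I x) \<le> liminf (\<lambda>n. ereal (1 / real n) * ln_prob (measure (Q n) {w \<in> space (Q n). X n w \<in> U}))"
proof (rule dense_le)
  fix y assume y: "y < - (INF x \<in> U. I x)"
  show "y \<le> liminf (\<lambda>n. ereal (1 / real n) * ln_prob (measure (Q n) {w \<in> space (Q n). X n w \<in> U}))"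
  proof (cases y)
    case (real b)
    have "(INF x \<in> U. I x) < ereal (- b)" using y unfolding real by (subst (asm) ereal_less_uminus_reorder) simp
    then obtain x where x: "x \<in> U" "I x < ereal (- b)" by (auto simp: INF_less_iff)
    obtain \<epsilon> where \<epsilon>: "0 < \<epsilon>" "mball x \<epsilon> \<subseteq> U" and xM: "x \<in> M"
      using U x(1) unfolding openin_mtopology by blast
    have "\<forall>\<^sub>F n in sequentially. y \<le> ereal (1 / real n) * ln_prob (measure (Q n) {w \<in> space (Q n). X n w \<in> U})"
      using lower[OF xM \<epsilon>(1) x(2)] eventually_ge_at_top[of 1]
    proof eventually_elim
      case (elim n)
      then have "exp (- (real n * - b)) \<le> measure (Q n) {w \<in> space (Q n). X n w \<in> U}"
        using preimage_mono[OF \<epsilon>(2) X_meas[OF U]] order_trans by blast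
      from scaled_ln_prob_ge[OF elim(2) this] show ?case using real by simp
    qed
    then show ?thesis by (rule Liminf_bounded)
  qed (use y in auto)
qed

text \<open>Finitely many balls with the right decay cover the part of \<open>F\<close> inside a
  compact set, and tightness bounds the rest. Their number only adds the logarithm of a constant
  divided by \<open>n\<close>.\<close>

lemma closed_upper_bound:
  assumes F: "closedin mtopology F"
  shows "limsup (\<lambda>n. ereal (1 / real n) * ln_prob (measure (Q n) {w \<in> space (Q n). X n w \<in> F})) \<le> - (INF x \<in> F. I x)"
proof (rule dense_ge)
  fix y assume y: "- (INF x \<in> F. I x) < y"
  show "limsup (\<lambda>n. ereal (1 / real n) * ln_prob (measure (Q n) {w \<in> space (Q n). X n w \<in> F})) \<le> y"
  proof (cases y)
    case (real b)
    have "ereal (- b) < (INF x \<in> F. I x)" using y unfolding real by (subst (asm) ereal_uminus_less_reorder) simp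
    then have Ia: "ereal (- b) < I x" if "x \<in> F" for x using that by (rule less_INF_D)
    have FM: "F \<subseteq> M" using closedin_subset[OF F] by simp
    define good where "good x \<delta> \<longleftrightarrow> 0 < \<delta> \<and>
      (\<forall>\<^sub>F n in sequentially. measure (Q n) {w \<in> space (Q n). X n w \<in> mball x \<delta>} \<le> exp (- (real n * - b)))" for x \<delta>
    define rad where "rad x = (SOME \<delta>. good x \<delta>)" for x
    have rad: "good x (rad x)" if "x \<in> F" for x
      unfolding rad_def by (rule someI_ex) (use upper[OF _ Ia[OF that]] FM that in \<open>auto simp: good_def\<close>)
    obtain K where K: "compactin mtopology K"
      "\<forall>\<^sub>F n in sequentially. measure (Q n) {w \<in> space (Q n). X n w \<notin> K} \<le> exp (- (real n * - b))"
      using tight by blast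
    have clK: "closedin mtopology K" using K(1) by (rule compactin_imp_closedin[OF Hausdorff_space_mtopology])
    have "compactin mtopology (K \<inter> F)" using K(1) F by (rule compact_Int_closedin)
    then have "\<exists>\<F>. finite \<F> \<and> \<F> \<subseteq> (\<lambda>x. mball x (rad x)) ` F \<and> K \<inter> F \<subseteq> \<Union>\<F>"
    proof (rule compactinD)
      show "K \<inter> F \<subseteq> \<Union>((\<lambda>x. mball x (rad x)) ` F)"
      proof
        fix x assume "x \<in> K \<inter> F"
        then have "x \<in> F" by simp
        then have "x \<in> mball x (rad x)" using rad FM by (auto simp: good_def)
        then show "x \<in> \<Union>((\<lambda>x. mball x (rad x)) ` F)" using \<open>x \<in> F\<close> by blast
      qed
    qed auto
    then obtain \<F> where \<F>: "finite \<F>" "\<F> \<subseteq> (\<lambda>x. mball x (rad x)) ` F" "K \<inter> F \<subseteq> \<Union>\<F>" by blast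
    from finite_subset_image[OF \<F>(1,2)] obtain T where "T \<subseteq> F" "finite T" "\<F> = (\<lambda>x. mball x (rad x)) ` T" by blast
    then have T: "finite T" "T \<subseteq> F" "K \<inter> F \<subseteq> (\<Union>x\<in>T. mball x (rad x))" using \<F>(3) by auto
    have "\<forall>\<^sub>F n in sequentially. \<forall>x\<in>T. measure (Q n) {w \<in> space (Q n). X n w \<in> mball x (rad x)} \<le> exp (- (real n * - b))"
      using T rad by (intro eventually_ball_finite) (auto simp: good_def)
    then have "\<forall>\<^sub>F n in sequentially. ereal (1 / real n) * ln_prob (measure (Q n) {w \<in> space (Q n). X n w \<in> F})
        \<le> ereal (ln (1 + real (card T)) / real n - - b)"
      using K(2) eventually_ge_at_top[of 1]
    proof eventually_elim
      case (elim n)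
      interpret prob_space "Q n" by (rule prob)
      let ?B = "\<lambda>A. {w \<in> space (Q n). X n w \<in> A}"
      have Kc: "?B (- K) \<in> sets (Q n)"
      proof -
        have "?B (- K) = space (Q n) - ?B K" by auto
        then show ?thesis using closed_meas[OF clK] by auto
      qed
      have Bs: "?B (mball x (rad x)) \<in> sets (Q n)" for x by (intro X_meas openin_mball)
      have "prob (?B F) \<le> prob (?B (- K) \<union> (\<Union>x\<in>T. ?B (mball x (rad x))))"
      proof (rule finite_measure_mono)
        show "?B F \<subseteq> ?B (- K) \<union> (\<Union>x\<in>T. ?B (mball x (rad x)))"
          using T(3) by (auto simp del: in_mball)
        show "?B (- K) \<union> (\<Union>x\<in>T. ?B (mball x (rad x))) \<in> events"
          using T(1) Kc Bs by (intro sets.Un sets.finite_UN)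
      qed
      also have "\<dots> \<le> prob (?B (- K)) + prob (\<Union>x\<in>T. ?B (mball x (rad x)))"
        using T(1) Kc Bs by (intro measure_Un_le sets.finite_UN)
      also have "prob (\<Union>x\<in>T. ?B (mball x (rad x))) \<le> (\<Sum>x\<in>T. prob (?B (mball x (rad x))))"
        using T(1) Bs by (intro measure_UNION_le)
      also have "\<dots> \<le> (\<Sum>x\<in>T. exp (- (real n * - b)))" using elim(1) by (intro sum_mono) (simp del: in_mball)
      also have "prob (?B (- K)) \<le> exp (- (real n * - b))" using elim(2) by simp
      finally have "prob (?B F) \<le> (1 + real (card T)) * exp (- (real n * - b))"
        by (simp add: algebra_simps)
      then show ?case using elim(3) by (intro scaled_ln_prob_le) auto
    qed
    then have "limsup (\<lambda>n. ereal (1 / real n) * ln_prob (measure (Q n) {w \<in> space (Q n). X n w \<in> F}))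
        \<le> limsup (\<lambda>n. ereal (ln (1 + real (card T)) / real n - - b))"
      by (rule Limsup_mono)
    also have "\<dots> = y"
    proof (rule lim_imp_Limsup)
      have "(\<lambda>n. ln (1 + real (card T)) / real n - - b) \<longlonglongrightarrow> 0 - - b"
        by (intro tendsto_intros tendsto_divide_0[OF tendsto_const] filterlim_real_sequentially
            filterlim_at_top_imp_at_infinity)
      then show "(\<lambda>n. ereal (ln (1 + real (card T)) / real n - - b)) \<longlonglongrightarrow> y"
        using real by simp
    qed simp
    finally show ?thesis .
  qed (use y in auto)
qed

theorem good_LDP_from_local_estimates: "good_LDP mtopology Q X I"
  unfolding good_LDP_def topspace_mtopology
  using X_in rate_nonneg closedin_sublevel compactin_sublevel open_lower_bound closed_upper_bound by blast

end

section \<open>The space of kernel tuples\<close>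

definition tuple_index :: "nat \<Rightarrow> (nat \<Rightarrow> nat) \<Rightarrow> nat \<Rightarrow> (nat \<times> nat \<times> nat) set" where
  "tuple_index L N P = Sigma {..<L} (\<lambda>k. {..<N (k + 2) * P} \<times> {..<N (k + 2) * P})"

definition entry :: "real mat list \<Rightarrow> nat \<times> nat \<times> nat \<Rightarrow> real" where
  "entry Qs = (\<lambda>(k, a, b). Qs ! k $$ (a, b))"

lemma finite_tuple_index: "finite (tuple_index L N P)"
  by (simp add: tuple_index_def)

lemma tuple_dist_L2: "tuple_dist L N P Qs Qs' = L2_set (\<lambda>p. entry Qs p - entry Qs' p) (tuple_index L N P)"
proof -
  have "(\<Sum>k<L. \<Sum>a<N (k + 2) * P. \<Sum>b<N (k + 2) * P. (Qs ! k $$ (a, b) - Qs' ! k $$ (a, b))\<^sup>2)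
      = (\<Sum>k<L. \<Sum>q\<in>{..<N (k + 2) * P} \<times> {..<N (k + 2) * P}. (entry Qs (k, q) - entry Qs' (k, q))\<^sup>2)"
    by (simp only: sum.cartesian_product' entry_def prod.case)
  also have "\<dots> = (\<Sum>p\<in>tuple_index L N P. (entry Qs p - entry Qs' p)\<^sup>2)"
    unfolding tuple_index_def by (subst sum.Sigma) (auto intro!: sum.cong)
  finally show ?thesis unfolding tuple_dist_def L2_set_def by simp
qed

lemma quadratic_form_mat:
  fixes Q :: "real mat"
  assumes "Q \<in> carrier_mat D D" "v \<in> carrier_vec D"
  shows "v \<bullet> (Q *\<^sub>v v) = (\<Sum>a<D. \<Sum>b<D. v $ a * Q $$ (a, b) * v $ b)"
proof -
  have "v \<bullet> (Q *\<^sub>v v) = (\<Sum>a<D. v $ a * (\<Sum>b<D. Q $$ (a, b) * v $ b))"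
    using assms by (auto simp: scalar_prod_def atLeast0LessThan intro!: sum.cong)
  then show ?thesis by (simp add: sum_distrib_left mult.assoc)
qed

lemma psd_mats_iff:
  "Q \<in> psd_mats D \<longleftrightarrow> Q \<in> carrier_mat D D \<and> (\<forall>a<D. \<forall>b<D. Q $$ (a, b) = Q $$ (b, a)) \<and>
    (\<forall>v. 0 \<le> (\<Sum>a<D. \<Sum>b<D. v a * Q $$ (a, b) * v b))"
proof (cases "Q \<in> carrier_mat D D")
  case True
  have sym: "transpose_mat Q = Q \<longleftrightarrow> (\<forall>a<D. \<forall>b<D. Q $$ (a, b) = Q $$ (b, a))"
  proof
    assume t: "transpose_mat Q = Q"
    show "\<forall>a<D. \<forall>b<D. Q $$ (a, b) = Q $$ (b, a)"
    proof (intro allI impI)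
      fix a b assume "a < D" "b < D"
      then have "transpose_mat Q $$ (a, b) = Q $$ (b, a)" using True by simp
      then show "Q $$ (a, b) = Q $$ (b, a)" using t by simp
    qed
  qed (use True in \<open>auto intro!: eq_matI\<close>)
  have psd: "(\<forall>v \<in> carrier_vec D. 0 \<le> v \<bullet> (Q *\<^sub>v v)) \<longleftrightarrow> (\<forall>v. 0 \<le> (\<Sum>a<D. \<Sum>b<D. v a * Q $$ (a, b) * v b))"
  proof (intro iffI allI ballI)
    fix v assume "\<forall>v \<in> carrier_vec D. 0 \<le> v \<bullet> (Q *\<^sub>v v)"
    then have "0 \<le> vec D v \<bullet> (Q *\<^sub>v vec D v)" by simp
    then show "0 \<le> (\<Sum>a<D. \<Sum>b<D. v a * Q $$ (a, b) * v b)"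
      using quadratic_form_mat[OF True, of "vec D v"] by simp
  qed (use quadratic_form_mat[OF True] in simp)
  show ?thesis using True sym psd by (auto simp: psd_mats_def sym_mats_def)
qed (auto simp: psd_mats_def sym_mats_def)

lemma tuple_space_ext:
  assumes "Qs \<in> tuple_space L N P" "Qs' \<in> tuple_space L N P"
    and "\<And>p. p \<in> tuple_index L N P \<Longrightarrow> entry Qs p = entry Qs' p"
  shows "Qs = Qs'"
proof (rule nth_equalityI)
  show "length Qs = length Qs'" using assms(1,2) by (simp add: tuple_space_def)
  fix k assume "k < length Qs"
  then have k: "k < L" using assms(1) by (simp add: tuple_space_def)
  then have "Qs ! k \<in> carrier_mat (N (k + 2) * P) (N (k + 2) * P)" "Qs' ! k \<in> carrier_mat (N (k + 2) * P) (N (k + 2) * P)"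
    using assms(1,2) by (auto simp: tuple_space_def psd_mats_iff)
  moreover have "Qs ! k $$ (a, b) = Qs' ! k $$ (a, b)" if "a < N (k + 2) * P" "b < N (k + 2) * P" for a b
    using assms(3)[of "(k, a, b)"] that k by (simp add: tuple_index_def entry_def)
  ultimately show "Qs ! k = Qs' ! k" by (intro eq_matI) auto
qed

interpretation tuples: Metric_space "tuple_space L N P" "tuple_dist L N P" for L N P
proof
  show "0 \<le> tuple_dist L N P x y" for x y by (simp add: tuple_dist_L2 L2_set_nonneg)
  show "tuple_dist L N P x y = tuple_dist L N P y x" for x y
    unfolding tuple_dist_L2 L2_set_def by (simp add: power2_commute)
  show "tuple_dist L N P x y = 0 \<longleftrightarrow> x = y" if "x \<in> tuple_space L N P" "y \<in> tuple_space L N P" for x y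
    using tuple_space_ext[OF that] by (auto simp: tuple_dist_L2 L2_set_eq_0_iff finite_tuple_index)
  show "tuple_dist L N P x z \<le> tuple_dist L N P x y + tuple_dist L N P y z" for x y z
  proof -
    have "tuple_dist L N P x z = L2_set (\<lambda>p. (entry x p - entry y p) + (entry y p - entry z p)) (tuple_index L N P)"
      by (simp add: tuple_dist_L2)
    then show ?thesis unfolding tuple_dist_L2 using L2_set_triangle_ineq by metis
  qed
qed

lemma entry_diff_le_tuple_dist: "p \<in> tuple_index L N P \<Longrightarrow> \<bar>entry Qs p - entry Qs' p\<bar> \<le> tuple_dist L N P Qs Qs'"
proof -
  assume p: "p \<in> tuple_index L N P"
  have "(entry Qs p - entry Qs' p)\<^sup>2 \<le> (\<Sum>p\<in>tuple_index L N P. (entry Qs p - entry Qs' p)\<^sup>2)"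
    using p finite_tuple_index[of L N P] by (intro member_le_sum[of p _ "\<lambda>p. (entry Qs p - entry Qs' p)\<^sup>2"]) auto
  then have "sqrt ((entry Qs p - entry Qs' p)\<^sup>2) \<le> tuple_dist L N P Qs Qs'"
    unfolding tuple_dist_L2 L2_set_def by (rule real_sqrt_le_mono)
  then show ?thesis by simp
qed

lemma tuple_dist_less:
  assumes "0 < \<delta>" "\<And>p. p \<in> tuple_index L N P \<Longrightarrow> \<bar>entry Qs p - entry Qs' p\<bar> \<le> \<delta> / (real (card (tuple_index L N P)) + 1)"
  shows "tuple_dist L N P Qs Qs' < \<delta>"
proof -
  let ?c = "real (card (tuple_index L N P))"
  have "tuple_dist L N P Qs Qs' \<le> (\<Sum>p\<in>tuple_index L N P. \<bar>entry Qs p - entry Qs' p\<bar>)"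
    unfolding tuple_dist_L2 by (rule L2_set_le_sum_abs)
  also have "\<dots> \<le> (\<Sum>p\<in>tuple_index L N P. \<delta> / (?c + 1))" using assms(2) by (intro sum_mono) auto
  also have "\<dots> = ?c * (\<delta> / (?c + 1))" by simp
  also have "\<dots> < \<delta>" using assms(1) by (simp add: field_simps)
  finally show ?thesis .
qed

text \<open>Bolzano-Weierstrass on the entries; symmetry and nonnegativity of the quadratic forms
  pass to entrywise limits, so the limit is again a tuple of positive semidefinite matrices.\<close>

lemma compact_tuple_box:
  "compactin (Metric_space.mtopology (tuple_space L N P) (tuple_dist L N P))
    {Qs \<in> tuple_space L N P. \<forall>p\<in>tuple_index L N P. \<bar>entry Qs p\<bar> \<le> r}"
  unfolding tuples.compactin_sequentially
proof (intro conjI allI impI)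
  fix q :: "nat \<Rightarrow> real mat list"
  assume "range q \<subseteq> {Qs \<in> tuple_space L N P. \<forall>p\<in>tuple_index L N P. \<bar>entry Qs p\<bar> \<le> r}"
  then have q: "\<And>n. q n \<in> tuple_space L N P" "\<And>n p. p \<in> tuple_index L N P \<Longrightarrow> \<bar>entry (q n) p\<bar> \<le> r" by auto
  then obtain l s where s: "strict_mono s" "\<And>p. p \<in> tuple_index L N P \<Longrightarrow> (\<lambda>n. entry (q (s n)) p) \<longlonglongrightarrow> l p"
    using bounded_coords_subseq[OF finite_tuple_index, of L N P "\<lambda>n. entry (q n)" r] by metis
  define Q where "Q = map (\<lambda>k. mat (N (k + 2) * P) (N (k + 2) * P) (\<lambda>(a, b). l (k, a, b))) [0..<L]"
  have entryQ: "entry Q p = l p" if "p \<in> tuple_index L N P" for p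
    using that by (auto simp: entry_def Q_def tuple_index_def)
  have lim: "(\<lambda>n. q (s n) ! k $$ (a, b)) \<longlonglongrightarrow> l (k, a, b)" if "k < L" "a < N (k + 2) * P" "b < N (k + 2) * P" for k a b
    using s(2)[of "(k, a, b)"] that by (simp add: tuple_index_def entry_def)
  have qk: "q (s n) ! k \<in> psd_mats (N (k + 2) * P)" if "k < L" for n k
    using q(1)[of "s n"] that by (simp add: tuple_space_def)
  have "Q \<in> tuple_space L N P"
    unfolding tuple_space_def mem_Collect_eq
  proof (intro conjI allI impI)
    fix k assume k: "k < L"
    let ?D = "N (k + 2) * P"
    have Qk: "Q ! k = mat ?D ?D (\<lambda>(a, b). l (k, a, b))" using k by (simp add: Q_def)
    show "Q ! k \<in> psd_mats ?D"
      unfolding psd_mats_iff Qk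
    proof (intro conjI allI impI)
      fix a b assume ab: "a < ?D" "b < ?D"
      have "q (s n) ! k $$ (a, b) = q (s n) ! k $$ (b, a)" for n using qk[OF k, of n] ab by (simp add: psd_mats_iff)
      then have "l (k, a, b) = l (k, b, a)" using LIMSEQ_unique[OF lim[OF k ab]] lim[OF k ab(2,1)] by simp
      then show "mat ?D ?D (\<lambda>(a, b). l (k, a, b)) $$ (a, b) = mat ?D ?D (\<lambda>(a, b). l (k, a, b)) $$ (b, a)"
        using ab by simp
    next
      fix v :: "nat \<Rightarrow> real"
      have "(\<lambda>n. \<Sum>a<?D. \<Sum>b<?D. v a * q (s n) ! k $$ (a, b) * v b) \<longlonglongrightarrow> (\<Sum>a<?D. \<Sum>b<?D. v a * l (k, a, b) * v b)"
        using k by (intro tendsto_intros lim) auto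
      moreover have "0 \<le> (\<Sum>a<?D. \<Sum>b<?D. v a * q (s n) ! k $$ (a, b) * v b)" for n
        using qk[OF k, of n] by (simp add: psd_mats_iff)
      ultimately have "0 \<le> (\<Sum>a<?D. \<Sum>b<?D. v a * l (k, a, b) * v b)" by (intro LIMSEQ_le_const[of _ _ 0]) auto
      then show "0 \<le> (\<Sum>a<?D. \<Sum>b<?D. v a * mat ?D ?D (\<lambda>(a, b). l (k, a, b)) $$ (a, b) * v b)" by simp
    qed simp
  qed (simp add: Q_def)
  moreover have "\<bar>entry Q p\<bar> \<le> r" if p: "p \<in> tuple_index L N P" for p
  proof (rule LIMSEQ_le_const2)
    show "(\<lambda>n. \<bar>entry (q (s n)) p\<bar>) \<longlonglongrightarrow> \<bar>entry Q p\<bar>" unfolding entryQ[OF p] by (intro tendsto_intros s(2) p)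
  qed (use q(2)[OF p] in auto)
  moreover have "limitin (tuples.mtopology L N P) (q \<circ> s) Q sequentially"
    unfolding tuples.limitin_metric
  proof (intro conjI allI impI)
    fix \<epsilon> :: real assume \<epsilon>: "0 < \<epsilon>"
    have c0: "0 < \<epsilon> / (real (card (tuple_index L N P)) + 1)" using \<epsilon> by (intro divide_pos_pos) auto
    have "\<forall>\<^sub>F n in sequentially. \<forall>p\<in>tuple_index L N P. \<bar>entry (q (s n)) p - l p\<bar> < \<epsilon> / (real (card (tuple_index L N P)) + 1)"
    proof (intro eventually_ball_finite finite_tuple_index ballI)
      fix p assume "p \<in> tuple_index L N P"
      from tendsto_rabs_zero[OF LIM_zero[OF s(2)[OF this]]]
      show "\<forall>\<^sub>F n in sequentially. \<bar>entry (q (s n)) p - l p\<bar> < \<epsilon> / (real (card (tuple_index L N P)) + 1)"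
        using c0 by (rule order_tendstoD(2))
    qed
    then show "\<forall>\<^sub>F n in sequentially. (q \<circ> s) n \<in> tuple_space L N P \<and> tuple_dist L N P ((q \<circ> s) n) Q < \<epsilon>"
    proof eventually_elim
      case (elim n)
      then have "tuple_dist L N P (q (s n)) Q < \<epsilon>"
        by (intro tuple_dist_less[OF \<epsilon>]) (auto simp: entryQ intro: less_imp_le)
      then show ?case using q(1) by simp
    qed
  qed fact
  ultimately show "\<exists>l' r'. l' \<in> {Qs \<in> tuple_space L N P. \<forall>p\<in>tuple_index L N P. \<bar>entry Qs p\<bar> \<le> r} \<and>
      strict_mono r' \<and> limitin (tuples.mtopology L N P) (q \<circ> r') l' sequentially"
    using s(1) by blast
qed auto

text \<open>Every open set of tuples is described by an open set in the space of entry functions,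
  built as an arbitrary union of balls. Measurability of the single entries thus suffices.\<close>

lemma tuple_open_measurable:
  assumes X: "\<And>w. w \<in> space M \<Longrightarrow> X w \<in> tuple_space L N P"
    and meas: "\<And>p. p \<in> tuple_index L N P \<Longrightarrow> (\<lambda>w. entry (X w) p) \<in> borel_measurable M"
    and U: "openin (Metric_space.mtopology (tuple_space L N P) (tuple_dist L N P)) U"
  shows "{w \<in> space M. X w \<in> U} \<in> sets M"
proof -
  define I where "I = tuple_index L N P"
  have "\<forall>Qs\<in>U. \<exists>r>0. tuples.mball L N P Qs r \<subseteq> U"
    using U unfolding tuples.openin_mtopology by blast
  then obtain r where r: "\<And>Qs. Qs \<in> U \<Longrightarrow> 0 < r Qs \<and> tuples.mball L N P Qs (r Qs) \<subseteq> U" by metis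
  have US: "U \<subseteq> tuple_space L N P" using U unfolding tuples.openin_mtopology by blast
  define f where "f w = (\<lambda>p. if p \<in> I then entry (X w) p else 0)" for w
  define V where "V = (\<Union>Qs\<in>U. {y. L2_set (\<lambda>p. y p - entry Qs p) I < r Qs})"
  have "open V"
    unfolding V_def
  proof (intro open_UN ballI)
    fix Qs
    have "continuous_on UNIV (\<lambda>y. L2_set (\<lambda>p. y p - entry Qs p) I)"
      unfolding L2_set_def by (intro continuous_intros) auto
    then show "open {y. L2_set (\<lambda>p. y p - entry Qs p) I < r Qs}"
      by (intro open_Collect_less continuous_on_const)
  qed
  moreover have "f \<in> borel_measurable M"
  proof (rule measurable_coordinatewise_then_product)
    fix p show "(\<lambda>w. f w p) \<in> borel_measurable M"
      using meas by (cases "p \<in> I") (auto simp: f_def I_def)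
  qed
  ultimately have fV: "f -` V \<inter> space M \<in> sets M" by (intro measurable_sets) auto
  have "X w \<in> U \<longleftrightarrow> f w \<in> V" if w: "w \<in> space M" for w
  proof -
    have L2: "L2_set (\<lambda>p. f w p - entry Qs p) I = tuple_dist L N P (X w) Qs" for Qs
      unfolding tuple_dist_L2 I_def[symmetric] by (intro L2_set_cong) (auto simp: f_def)
    show ?thesis
    proof
      assume "X w \<in> U"
      moreover have "tuple_dist L N P (X w) (X w) = 0" by (simp add: tuple_dist_L2 L2_set_def)
      ultimately show "f w \<in> V" unfolding V_def using r[of "X w"] by (auto simp: L2 intro!: bexI[of _ "X w"])
    next
      assume "f w \<in> V"
      then obtain Qs where "Qs \<in> U" "tuple_dist L N P (X w) Qs < r Qs" by (auto simp: V_def L2)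
      then have "X w \<in> tuples.mball L N P Qs (r Qs)"
        using US X[OF w] by (auto simp: tuples.commute)
      then show "X w \<in> U" using r[OF \<open>Qs \<in> U\<close>] by blast
    qed
  qed
  then have "{w \<in> space M. X w \<in> U} = f -` V \<inter> space M" by blast
  with fV show ?thesis by (simp only:)
qed

section \<open>The Markov chain of kernels\<close>

text \<open>The channel counts \<open>C\<close> and the inputs \<open>x\<close> enter only through
  the definitions, so one verification of the assumptions serves every \<open>n\<close>. Regularity
  is asked of the layers 1 to \<open>L\<close>; layer 0 acts on fixed inputs and produces a
  deterministic kernel.\<close>

locale conv_net =
  fixes L P :: nat and N :: "nat \<Rightarrow> nat" and C :: "nat \<Rightarrow> nat" and \<sigma> :: "real \<Rightarrow> real"
    and Ms :: "nat \<Rightarrow> 'm set" and R :: "nat \<Rightarrow> nat \<Rightarrow> (nat \<Rightarrow> real) \<Rightarrow> 'm \<Rightarrow> real"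
    and lam :: "nat \<Rightarrow> real" and x :: "nat \<Rightarrow> nat \<Rightarrow> nat \<Rightarrow> real" and \<Lambda> :: "nat \<Rightarrow> real"
  assumes P_pos: "1 \<le> P"
    and Ms_fin: "\<And>l. l \<le> L \<Longrightarrow> finite (Ms l) \<and> Ms l \<noteq> {}"
    and lam_pos: "\<And>l. l \<le> L \<Longrightarrow> 0 < lam l"
    and feature_meas: "\<And>l i m. l \<in> {1..L} \<Longrightarrow> i \<in> {1..N (Suc l)} \<Longrightarrow> m \<in> Ms l \<Longrightarrow>
      (\<lambda>z. \<sigma> (R l i (vrest (N l) z) m)) \<in> borel_measurable borel"
    and feature: "\<And>l. l \<in> {1..L} \<Longrightarrow> feature_map (N l * P) ({..<N (Suc l) * P} \<times> {..<N (Suc l) * P})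
      (\<lambda>z (a, b). Gmap \<sigma> R Ms N P lam l z $$ (a, b)) (\<Lambda> l)"
begin

abbreviation pre :: "(nat \<times> 'm \<times> nat \<times> nat \<Rightarrow> real) \<Rightarrow> nat \<Rightarrow> nat \<Rightarrow> nat \<Rightarrow> nat \<Rightarrow> real" where
  "pre W \<equiv> preact \<sigma> R Ms C N x W"

abbreviation H :: "(nat \<times> 'm \<times> nat \<times> nat \<Rightarrow> real) \<Rightarrow> nat \<Rightarrow> nat \<Rightarrow> nat \<Rightarrow> real" where
  "H W l c \<equiv> Hflat \<sigma> R Ms C N P x W l c"

abbreviation D :: "nat \<Rightarrow> nat" where "D l \<equiv> N l * P"

abbreviation J :: "nat \<Rightarrow> (nat \<times> nat) set" where "J l \<equiv> {..<D (Suc l)} \<times> {..<D (Suc l)}"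

abbreviation gm :: "nat \<Rightarrow> (nat \<Rightarrow> real) \<Rightarrow> nat \<times> nat \<Rightarrow> real" where
  "gm l \<equiv> \<lambda>z (a, b). Gmap \<sigma> R Ms N P lam l z $$ (a, b)"

definition \<phi> :: "(nat \<times> 'm \<times> nat \<times> nat \<Rightarrow> real) \<Rightarrow> nat \<Rightarrow> 'm \<times> nat \<Rightarrow> nat \<Rightarrow> nat \<Rightarrow> real" where
  "\<phi> W l u i mu = (if l = 0 then R 0 i (vrest (N 0) (x mu (snd u))) (fst u)
     else \<sigma> (R l i (vrest (N l) (\<lambda>j. pre W l (snd u) j mu)) (fst u)))"

definition \<beta> :: "(nat \<times> 'm \<times> nat \<times> nat \<Rightarrow> real) \<Rightarrow> nat \<Rightarrow> 'm \<times> nat \<Rightarrow> nat \<Rightarrow> real" where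
  "\<beta> W l u a = 1 / sqrt (real (card (Ms l)) * real (C l)) * \<phi> W l u (a div P + 1) (a mod P + 1)"

definition units :: "nat \<Rightarrow> ('m \<times> nat) set" where "units l = Ms l \<times> {1..C l}"

text \<open>Conditional covariance of one channel of the preactivations \<open>Suc l\<close> given
  the weights of layer index below \<open>l\<close>. On valid indices it coincides with
  \<open>K1\<close> for \<open>l = 0\<close> and with \<open>Kmat\<close> for \<open>l\<close> from
  1 to \<open>L\<close>.\<close>

definition gram :: "(nat \<times> 'm \<times> nat \<times> nat \<Rightarrow> real) \<Rightarrow> nat \<Rightarrow> nat \<Rightarrow> nat \<Rightarrow> real" where
  "gram W l a b = 1 / lam l * (\<Sum>u\<in>units l. \<beta> W l u a * \<beta> W l u b)"

text \<open>The index is shifted: \<open>Kf l\<close> is the kernel of layer l + 1. The restriction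
  makes it a point of the product space over \<open>J l\<close>.\<close>

definition Kf :: "nat \<Rightarrow> (nat \<times> 'm \<times> nat \<times> nat \<Rightarrow> real) \<Rightarrow> nat \<times> nat \<Rightarrow> real" where
  "Kf l W = restrict (\<lambda>(a, b). gram W l a b) (J l)"

lemma sum_units: "(\<Sum>u\<in>units l. h u) = (\<Sum>c'\<in>{1..C l}. \<Sum>m\<in>Ms l. h (m, c'))"
  unfolding units_def by (subst sum.swap) (simp add: sum.cartesian_product)

lemma pre_Suc:
  "pre W (Suc l) c i mu = (\<Sum>u\<in>units l. W (l, fst u, snd u, c) * (1 / sqrt (real (card (Ms l)) * real (C l)) * \<phi> W l u i mu))"
  unfolding sum_units by (cases "l = 0") (simp_all add: \<phi>_def sum_distrib_left mult_ac)

lemma H_Suc: "H W (Suc l) c a = (\<Sum>u\<in>units l. W (l, fst u, snd u, c) * \<beta> W l u a)"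
  unfolding Hflat_def pre_Suc \<beta>_def ..

text \<open>Adaptedness to the layers, on which the Markov property rests: weights of layer index
  \<open>l\<close> first enter at the preactivations \<open>Suc l\<close>.\<close>

lemma pre_cong:
  assumes "\<And>i. fst i < l \<Longrightarrow> W i = W' i"
  shows "pre W l = pre W' l"
  using assms
proof (induction l)
  case (Suc l)
  then have "pre W l = pre W' l" by simp
  then have "\<phi> W l = \<phi> W' l" by (intro ext) (simp add: \<phi>_def)
  then show ?case using Suc.prems by (intro ext) (simp add: pre_Suc del: preact.simps)
qed simp

lemma \<beta>_cong:
  assumes "\<And>i. fst i < l \<Longrightarrow> W i = W' i"
  shows "\<beta> W l = \<beta> W' l"
  using pre_cong[OF assms] by (intro ext) (simp add: \<beta>_def \<phi>_def)

lemma gram_cong: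
  assumes "\<And>i. fst i < l \<Longrightarrow> W i = W' i"
  shows "gram W l = gram W' l"
  using \<beta>_cong[OF assms] by (intro ext) (simp add: gram_def)

lemma Kf_cong:
  assumes "\<And>i. fst i < l \<Longrightarrow> W i = W' i"
  shows "Kf l W = Kf l W'"
  using gram_cong[OF assms] by (simp add: Kf_def)

lemma index_bounds:
  assumes "a < D l" shows "a div P + 1 \<in> {1..N l}" "a mod P + 1 \<in> {1..P}"
  using assms P_pos by (auto simp: div_less_iff_less_mult Suc_le_eq)

lemma \<beta>_\<beta>: "\<beta> W l u a * \<beta> W l u b = 1 / (real (card (Ms l)) * real (C l)) *
    (\<phi> W l u (a div P + 1) (a mod P + 1) * \<phi> W l u (b div P + 1) (b mod P + 1))"
proof -
  have "sqrt (real (card (Ms l)) * real (C l)) * sqrt (real (card (Ms l)) * real (C l)) = real (card (Ms l)) * real (C l)"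
    by simp
  then show ?thesis by (simp add: \<beta>_def)
qed

lemma gram_0:
  assumes "a < D 1" "b < D 1"
  shows "gram W 0 a b = K1 R Ms (C 0) N P lam x $$ (a, b)"
  using assms by (simp add: gram_def sum_units \<beta>_\<beta> \<phi>_def K1_def sum_distrib_left mult_ac)

lemma col_H:
  assumes "mu \<in> {1..P}"
  shows "col (N l) P (H W l c) mu = vrest (N l) (\<lambda>j. pre W l c j mu)"
proof
  fix j
  \<comment> \<open>Here \<open>mu\<close> and \<open>j\<close> count from 1 and the flat index from
    0, hence the shifts; division and remainder recover both because \<open>mu - 1\<close> is below
    \<open>P\<close>.\<close>
  have "(mu - 1 + (j - 1) * P) div P + 1 = j" "(mu - 1 + (j - 1) * P) mod P + 1 = mu" if "j \<in> {1..N l}"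
    using assms that by (cases mu; cases j; auto)+
  then show "col (N l) P (H W l c) mu j = vrest (N l) (\<lambda>j. pre W l c j mu) j"
    by (simp add: col_def vrest_def Hflat_def)
qed

lemma Kmat_avg:
  assumes "(a, b) \<in> J l"
  shows "Kmat \<sigma> R Ms C N P lam x W l $$ (a, b) = (\<Sum>c\<in>{1..C l}. gm l (H W l c) (a, b)) / C l"
  using assms by (simp add: Kmat_def)

lemma gram_Kmat:
  assumes l: "l \<in> {1..L}" and ab: "(a, b) \<in> J l"
  shows "gram W l a b = Kmat \<sigma> R Ms C N P lam x W l $$ (a, b)"
proof -
  have mod: "a mod P + 1 \<in> {1..P}" "b mod P + 1 \<in> {1..P}" using ab index_bounds[of _ "Suc l"] by auto
  have "gm l (H W l c) (a, b) = 1 / (lam l * real (card (Ms l))) *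
      (\<Sum>m\<in>Ms l. \<phi> W l (m, c) (a div P + 1) (a mod P + 1) * \<phi> W l (m, c) (b div P + 1) (b mod P + 1))" for c
    using ab l by (auto simp: Gmap_def \<phi>_def col_H[OF mod(1), simplified] col_H[OF mod(2), simplified] simp del: preact.simps)
  then show ?thesis unfolding Kmat_avg[OF ab] gram_def sum_units \<beta>_\<beta>
    by (simp add: sum_distrib_left sum_divide_distrib mult_ac)
qed

section \<open>Gaussian weights and measurability of the kernels\<close>

definition WI :: "(nat \<times> 'm \<times> nat \<times> nat) set" where "WI = weight_index L Ms C"

text \<open>The value 1 above layer \<open>L\<close> is a default that keeps the standard deviation
  positive for every index, so that products over arbitrary index sets are probability
  spaces.\<close>

definition \<tau> :: "nat \<times> 'm \<times> nat \<times> nat \<Rightarrow> real" where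
  "\<tau> i = (if fst i \<le> L then 1 / sqrt (lam (fst i)) else 1)"

abbreviation gauss :: "nat \<times> 'm \<times> nat \<times> nat \<Rightarrow> real measure" where
  "gauss \<equiv> \<lambda>i. density lborel (normal_density 0 (\<tau> i))"

lemma \<tau>_pos: "0 < \<tau> i"
  using lam_pos by (simp add: \<tau>_def)

lemma weight_prior_eq: "weight_prior L Ms C lam = PiM WI gauss"
  unfolding weight_prior_def WI_def
  by (rule PiM_cong) (auto simp: weight_index_def \<tau>_def)

lemma finite_WI: "finite WI"
proof (rule finite_subset)
  show "WI \<subseteq> Sigma {..L} (\<lambda>l. Ms l \<times> {1..C l} \<times> {1..C (Suc l)})"
    by (auto simp: WI_def weight_index_def)
  show "finite (Sigma {..L} (\<lambda>l. Ms l \<times> {1..C l} \<times> {1..C (Suc l)}))"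
    using Ms_fin by (intro finite_SigmaI) auto
qed

sublocale W: product_prob_space gauss I for I
  by (intro product_prob_spaceI prob_space_normal_density \<tau>_pos)

lemma space_PiM_gauss: "space (PiM I gauss) = extensional I"
  by (auto simp: space_PiM PiE_def)

lemma pre_meas:
  assumes "Suc l \<le> L" "c \<in> {1..C (Suc l)}" "i \<in> {1..N (Suc l)}"
  shows "(\<lambda>W. pre W (Suc l) c i mu) \<in> borel_measurable (PiM WI gauss)"
  using assms
proof (induction l arbitrary: c i)
  case 0
  have "(\<lambda>W. W (0, fst u, snd u, c)) \<in> borel_measurable (PiM WI gauss)" if "u \<in> units 0" for u
  proof -
    have "(0, fst u, snd u, c) \<in> WI" using that 0 by (auto simp: WI_def weight_index_def units_def)
    from measurable_component_singleton[OF this, of gauss] show ?thesis by simp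
  qed
  then show ?case unfolding pre_Suc by (simp add: \<phi>_def)
next
  case (Suc l)
  have W: "(\<lambda>W. W (Suc l, fst u, snd u, c)) \<in> borel_measurable (PiM WI gauss)" if "u \<in> units (Suc l)" for u
  proof -
    have "(Suc l, fst u, snd u, c) \<in> WI" using that Suc.prems by (auto simp: WI_def weight_index_def units_def)
    from measurable_component_singleton[OF this, of gauss] show ?thesis by simp
  qed
  have \<phi>: "(\<lambda>W. \<phi> W (Suc l) u i mu) \<in> borel_measurable (PiM WI gauss)" if u: "u \<in> units (Suc l)" for u
  proof -
    have "(\<lambda>W. vrest (N (Suc l)) (\<lambda>j. pre W (Suc l) (snd u) j mu)) \<in> borel_measurable (PiM WI gauss)"
    proof (rule measurable_coordinatewise_then_product)
      fix j
      show "(\<lambda>W. vrest (N (Suc l)) (\<lambda>j. pre W (Suc l) (snd u) j mu) j) \<in> borel_measurable (PiM WI gauss)"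
        using Suc.IH[of "snd u" j] Suc.prems u by (cases "j \<in> {1..N (Suc l)}") (auto simp: vrest_def units_def simp del: preact.simps)
    qed
    moreover have "(\<lambda>z. \<sigma> (R (Suc l) i (vrest (N (Suc l)) z) (fst u))) \<in> borel_measurable borel"
      using Suc.prems u by (intro feature_meas) (auto simp: units_def)
    ultimately have "(\<lambda>W. \<sigma> (R (Suc l) i (vrest (N (Suc l)) (vrest (N (Suc l)) (\<lambda>j. pre W (Suc l) (snd u) j mu))) (fst u)))
        \<in> borel_measurable (PiM WI gauss)"
      by (rule measurable_compose)
    moreover have "vrest n (vrest n z) = vrest n z" for n z by (auto simp: vrest_def)
    ultimately show ?thesis by (simp add: \<phi>_def del: preact.simps)
  qed
  show ?case unfolding pre_Suc using W \<phi> by measurable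
qed

lemma H_meas:
  assumes "l \<in> {1..L}" "c \<in> {1..C l}" "a < D l"
  shows "(\<lambda>W. H W l c a) \<in> borel_measurable (PiM WI gauss)"
  using pre_meas[of "l - 1" c "a div P + 1" "a mod P + 1"] index_bounds(1)[OF assms(3)] assms
  by (simp add: Hflat_def del: preact.simps)

text \<open>Measurability of the preactivations is established for the flat indices below
  \<open>d\<close>; the remaining coordinates, which the features ignore, are set to zero before the
  features are applied.\<close>

definition ext :: "nat \<Rightarrow> (nat \<Rightarrow> real) \<Rightarrow> nat \<Rightarrow> real" where
  "ext d h = (\<lambda>a. if a < d then h a else 0)"

lemma gm_ext: "l \<in> {1..L} \<Longrightarrow> p \<in> J l \<Longrightarrow> gm l (ext (D l) h) p = gm l h p"
  by (rule feature_map.g_local[OF feature]) (auto simp: ext_def)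

definition avg :: "nat \<Rightarrow> (nat \<Rightarrow> nat \<Rightarrow> real) \<Rightarrow> nat \<times> nat \<Rightarrow> real" where
  "avg l h = restrict (\<lambda>p. (\<Sum>c\<in>{1..C l}. gm l (h c) p) / C l) (J l)"

lemma avg_meas:
  assumes l: "l \<in> {1..L}" and h: "\<And>c a. c \<in> {1..C l} \<Longrightarrow> a < D l \<Longrightarrow> (\<lambda>w. h w c a) \<in> borel_measurable Q"
  shows "(\<lambda>w. avg l (h w)) \<in> measurable Q (PiM (J l) (\<lambda>_. borel))"
  unfolding avg_def
proof (rule measurable_restrict)
  fix p assume p: "p \<in> J l"
  have "(\<lambda>w. gm l (h w c) p) \<in> borel_measurable Q" if c: "c \<in> {1..C l}" for c
  proof -
    have "(\<lambda>w. ext (D l) (h w c)) \<in> borel_measurable Q"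
    proof (rule measurable_coordinatewise_then_product)
      fix a show "(\<lambda>w. ext (D l) (h w c) a) \<in> borel_measurable Q"
        using h[OF c, of a] by (cases "a < D l") (auto simp: ext_def)
    qed
    from measurable_compose[OF this feature_map.g_meas[OF feature[OF l] p]]
    show ?thesis unfolding gm_ext[OF l p] .
  qed
  then show "(\<lambda>w. (\<Sum>c\<in>{1..C l}. gm l (h w c) p) / C l) \<in> borel_measurable Q" by measurable
qed

lemma Kf_avg: "l \<in> {1..L} \<Longrightarrow> Kf l W = avg l (H W l)"
  unfolding Kf_def avg_def
  by (rule restrict_ext) (auto simp: gram_Kmat Kmat_avg simp del: Hflat_def)

lemma Kf_meas:
  assumes "l \<le> L" shows "Kf l \<in> measurable (PiM WI gauss) (PiM (J l) (\<lambda>_. borel))"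
proof (cases "l = 0")
  case True
  have "Kf 0 W = Kf 0 (\<lambda>_. 0)" for W by (rule Kf_cong) simp
  then have "Kf 0 = (\<lambda>_. Kf 0 (\<lambda>_. 0))" by blast
  moreover have "(\<lambda>_. Kf 0 (\<lambda>_. 0)) \<in> measurable (PiM WI gauss) (PiM (J 0) (\<lambda>_. borel))"
    by (rule measurable_const) (auto simp: Kf_def space_PiM)
  ultimately show ?thesis using True by simp
next
  case False
  then have l: "l \<in> {1..L}" using assms by simp
  then show ?thesis using avg_meas[OF l, of "\<lambda>W. H W l", OF H_meas[OF l]] by (simp add: Kf_avg cong: measurable_cong)
qed

text \<open>The transition probability of the kernel chain into \<open>B\<close> from the state
  whose covariance has the factor \<open>A\<close>.\<close>

definition trans :: "nat \<Rightarrow> (nat \<Rightarrow> nat \<Rightarrow> real) \<Rightarrow> (nat \<times> nat \<Rightarrow> real) set \<Rightarrow> real" where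
  "trans l A B = measure (PiM {1..C l} (\<lambda>_. std_gauss (D l)))
     {\<omega> \<in> space (PiM {1..C l} (\<lambda>_. std_gauss (D l))). avg l (\<lambda>c. lin (D l) A (\<omega> c)) \<in> B}"

text \<open>The complement of layer \<open>k\<close>, later layers included; the events considered
  do not depend on the later weights, which integrate out.\<close>

definition early :: "nat \<Rightarrow> (nat \<times> 'm \<times> nat \<times> nat) set" where "early k = {i \<in> WI. fst i \<noteq> k}"

definition layer :: "nat \<Rightarrow> (nat \<times> 'm \<times> nat \<times> nat) set" where "layer k = {i \<in> WI. fst i = k}"

lemma layer_bij:
  assumes "k < L"
  shows "bij_betw (\<lambda>(u, c). (k, fst u, snd u, c)) (units k \<times> {1..C (Suc k)}) (layer k)"
  using assms by (auto simp: bij_betw_def inj_on_def units_def layer_def WI_def weight_index_def image_iff)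

text \<open>With \<open>w\<close> fixed, the features that the weights of layer \<open>k\<close>
  multiply do not involve these weights, so any \<open>y0\<close> may be used to name their Gram
  matrix. By \<open>layer_law\<close> the weights of the layer can then be replaced by Gaussian
  vectors \<open>A \<xi>\<close>.\<close>

lemma conditional_law:
  assumes k: "k < L" and y0: "y0 \<in> space (PiM (layer k) gauss)" and B: "B \<in> sets (PiM (J (Suc k)) (\<lambda>_. borel))"
    and A: "\<And>a b. a < D (Suc k) \<Longrightarrow> b < D (Suc k) \<Longrightarrow> cov (D (Suc k)) A a b = gram (merge (early k) (layer k) (w, y0)) k a b"
  shows "emeasure (PiM (layer k) gauss) {y \<in> space (PiM (layer k) gauss). Kf (Suc k) (merge (early k) (layer k) (w, y)) \<in> B}
    = ennreal (trans (Suc k) A B)"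
proof -
  let ?l = "Suc k" and ?K = "{1..C (Suc k)} \<times> {..<D (Suc k)}"
  let ?m = "\<lambda>y. merge (early k) (layer k) (w, y)"
  let ?\<Omega> = "PiM {1..C ?l} (\<lambda>_. std_gauss (D ?l))"
  have l: "?l \<in> {1..L}" using k by simp
  define b where "b = \<beta> (?m y0) k"
  have agree: "?m y i = ?m y0 i" if "fst i < k" for y i
    using that by (auto simp: merge_def layer_def)
  have bb: "\<beta> (?m y) k = b" for y unfolding b_def by (rule \<beta>_cong) (rule agree)
  define X where "X y = (\<lambda>(c, a). \<Sum>u\<in>units k. y (k, fst u, snd u, c) * b u a)" for y :: "nat \<times> 'm \<times> nat \<times> nat \<Rightarrow> real"
  have units: "finite (units k)" using Ms_fin[of k] k by (simp add: units_def)
  have \<tau>: "\<tau> i = 1 / sqrt (lam k)" if "i \<in> layer k" for i using that k by (auto simp: \<tau>_def layer_def)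
  have law: "distr (PiM (layer k) gauss) (PiM ?K (\<lambda>_. borel)) (\<lambda>y. restrict (X y) ?K)
      = distr ?\<Omega> (PiM ?K (\<lambda>_. borel)) (\<lambda>\<omega>. restrict (\<lambda>(c, a). lin (D ?l) A (\<omega> c) a) ?K)"
  proof -
    have "(1 / sqrt (lam k))\<^sup>2 * (\<Sum>u\<in>units k. b u a * b u a') = cov (D ?l) A a a'" if "a < D ?l" "a' < D ?l" for a a'
      using that A lam_pos[of k] k by (simp add: gram_def b_def power_divide)
    from layer_law[OF units layer_bij[OF k] \<tau>_pos \<tau> this] show ?thesis
      unfolding X_def by simp
  qed
  \<comment> \<open>The next kernel as a function of the flattened preactivations, so that equality
    of their laws transfers to it.\<close>
  define \<psi> where "\<psi> h = avg ?l (\<lambda>c a. h (c, a))" for h :: "nat \<times> nat \<Rightarrow> real"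
  have "\<psi> \<in> measurable (PiM ?K (\<lambda>_. borel)) (PiM (J ?l) (\<lambda>_. borel))"
    unfolding \<psi>_def by (rule avg_meas[OF l]) (auto intro: measurable_component_singleton)
  then have S: "{h \<in> space (PiM ?K (\<lambda>_. borel)). \<psi> h \<in> B} \<in> sets (PiM ?K (\<lambda>_. borel :: real measure))"
    using B by measurable
  have \<psi>_restrict: "\<psi> (restrict (\<lambda>(c, a). h c a) ?K) = avg ?l h" for h
    unfolding \<psi>_def avg_def
  proof (rule restrict_ext, intro arg_cong[where f = "\<lambda>s. s / _"] sum.cong refl)
    fix p c assume p: "p \<in> J ?l" and c: "c \<in> {1..C ?l}"
    show "gm ?l (\<lambda>a. restrict (\<lambda>(c, a). h c a) ?K (c, a)) p = gm ?l (h c) p"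
      by (rule feature_map.g_local[OF feature[OF l]]) (use p c in auto)
  qed
  have XH: "H (?m y) ?l c a = X y (c, a)" if "c \<in> {1..C ?l}" for y c a
  proof -
    have "?m y (k, fst u, snd u, c) = y (k, fst u, snd u, c)" if "u \<in> units k" for u
      using layer_bij[OF k] that \<open>c \<in> {1..C ?l}\<close> by (force simp: merge_def bij_betw_def early_def)
    then show ?thesis unfolding H_Suc bb X_def by simp
  qed
  have 1: "Kf ?l (?m y) = \<psi> (restrict (X y) ?K)" for y
  proof -
    have "Kf ?l (?m y) = avg ?l (\<lambda>c a. X y (c, a))"
      unfolding Kf_avg[OF l] avg_def
      by (rule restrict_ext, intro arg_cong[where f = "\<lambda>s. s / _"] sum.cong refl feature_map.g_local[OF feature[OF l]])
         (auto simp: XH)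
    also have "\<dots> = \<psi> (restrict (X y) ?K)" using \<psi>_restrict[of "\<lambda>c a. X y (c, a)"] by simp
    finally show ?thesis .
  qed
  have mX: "(\<lambda>y. restrict (X y) ?K) \<in> measurable (PiM (layer k) gauss) (PiM ?K (\<lambda>_. borel))"
  proof (rule measurable_restrict)
    fix p assume "p \<in> ?K"
    then obtain c a where p: "p = (c, a)" "c \<in> {1..C ?l}" by auto
    have "(\<lambda>y. y (k, fst u, snd u, c)) \<in> borel_measurable (PiM (layer k) gauss)" if "u \<in> units k" for u
    proof -
      have "(k, fst u, snd u, c) \<in> layer k" using layer_bij[OF k] that p(2) by (force simp: bij_betw_def)
      from measurable_component_singleton[OF this, of gauss] show ?thesis by simp
    qed
    then show "(\<lambda>y. X y p) \<in> borel_measurable (PiM (layer k) gauss)" unfolding X_def p(1) by simp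
  qed
  have mL: "(\<lambda>\<omega>. restrict (\<lambda>(c, a). lin (D ?l) A (\<omega> c) a) ?K) \<in> measurable ?\<Omega> (PiM ?K (\<lambda>_. borel))"
  proof (rule measurable_restrict)
    fix p assume "p \<in> ?K"
    then obtain c a where p: "p = (c, a)" "c \<in> {1..C ?l}" by auto
    have "(\<lambda>\<xi>. lin (D ?l) A \<xi> a) \<in> borel_measurable (std_gauss (D ?l))" unfolding lin_def by measurable
    from measurable_compose[OF measurable_component_singleton[OF p(2), of "\<lambda>_. std_gauss (D ?l)"] this]
    show "(\<lambda>\<omega>. (\<lambda>(c, a). lin (D ?l) A (\<omega> c) a) p) \<in> borel_measurable ?\<Omega>" unfolding p(1) by simp
  qed
  interpret \<Omega>: prob_space ?\<Omega> by (intro prob_space_PiM prob_space_std_gauss)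
  let ?S = "{h \<in> space (PiM ?K (\<lambda>_. borel)). \<psi> h \<in> B}"
  have "emeasure (PiM (layer k) gauss) {y \<in> space (PiM (layer k) gauss). Kf ?l (?m y) \<in> B}
      = emeasure (distr (PiM (layer k) gauss) (PiM ?K (\<lambda>_. borel)) (\<lambda>y. restrict (X y) ?K)) ?S"
    unfolding emeasure_distr[OF mX S] 1 using measurable_space[OF mX] by (intro arg_cong2[where f = emeasure]) auto
  also have "\<dots> = emeasure ?\<Omega> {\<omega> \<in> space ?\<Omega>. avg ?l (\<lambda>c. lin (D ?l) A (\<omega> c)) \<in> B}"
    unfolding law emeasure_distr[OF mL S] using measurable_space[OF mL]
    by (intro arg_cong2[where f = emeasure]) (auto simp: \<psi>_restrict simp del: One_nat_def)
  finally show ?thesis by (simp only: trans_def \<Omega>.emeasure_eq_measure)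
qed

lemma gram_factor:
  assumes "k \<le> L"
  obtains A where "\<And>a b. a < d \<Longrightarrow> b < d \<Longrightarrow> cov d A a b = gram W k a b"
proof -
  have "0 \<le> 1 / lam k" using lam_pos[OF assms] by simp
  from gram_factorization[OF this, where D = d and U = "units k" and \<beta> = "\<beta> W k"]
  obtain A where "\<And>a b. a < d \<Longrightarrow> b < d \<Longrightarrow> cov d A a b = 1 / lam k * (\<Sum>u\<in>units k. \<beta> W k u a * \<beta> W k u b)"
    by blast
  then show ?thesis by (intro that[of A]) (simp only: gram_def)
qed

text \<open>Fubini's theorem for the independent blocks \<open>early k\<close> and
  \<open>layer k\<close>.\<close>

lemma emeasure_layer_split:
  assumes k: "k < L" and E: "{W \<in> space (PiM WI gauss). E W} \<in> sets (PiM WI gauss)"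
  shows "emeasure (PiM WI gauss) {W \<in> space (PiM WI gauss). E W}
    = (\<integral>\<^sup>+w. emeasure (PiM (layer k) gauss) {y \<in> space (PiM (layer k) gauss). E (merge (early k) (layer k) (w, y))} \<partial>PiM (early k) gauss)"
proof -
  have I: "early k \<inter> layer k = {}" "finite (early k)" "finite (layer k)" "early k \<union> layer k = WI"
    using finite_WI by (auto simp: early_def layer_def)
  let ?S = "{W \<in> space (PiM WI gauss). E W}"
  have "emeasure (PiM WI gauss) ?S = (\<integral>\<^sup>+W. indicator ?S W \<partial>PiM (early k \<union> layer k) gauss)"
    using E by (simp add: I(4))
  also have "\<dots> = (\<integral>\<^sup>+w. \<integral>\<^sup>+y. indicator ?S (merge (early k) (layer k) (w, y)) \<partial>PiM (layer k) gauss \<partial>PiM (early k) gauss)"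
    using E by (intro W.product_nn_integral_fold I) (simp_all add: I(4))
  also have "\<dots> = (\<integral>\<^sup>+w. emeasure (PiM (layer k) gauss) {y \<in> space (PiM (layer k) gauss). E (merge (early k) (layer k) (w, y))} \<partial>PiM (early k) gauss)"
  proof (rule nn_integral_cong)
    fix w assume w: "w \<in> space (PiM (early k) gauss)"
    have ms: "(\<lambda>y. merge (early k) (layer k) (w, y)) \<in> measurable (PiM (layer k) gauss) (PiM WI gauss)"
      using measurable_Pair1'[OF w, of "PiM (layer k) gauss"] measurable_merge[of "early k" "layer k" gauss] unfolding I(4)
      by (rule measurable_compose)
    have "(\<integral>\<^sup>+y. indicator ?S (merge (early k) (layer k) (w, y)) \<partial>PiM (layer k) gauss)
        = (\<integral>\<^sup>+y. indicator {y \<in> space (PiM (layer k) gauss). E (merge (early k) (layer k) (w, y))} y \<partial>PiM (layer k) gauss)"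
      using measurable_space[OF ms] by (intro nn_integral_cong) (auto simp: indicator_def)
    also have "\<dots> = emeasure (PiM (layer k) gauss) {y \<in> space (PiM (layer k) gauss). E (merge (early k) (layer k) (w, y))}"
    proof (rule nn_integral_indicator)
      have "{y \<in> space (PiM (layer k) gauss). E (merge (early k) (layer k) (w, y))}
          = (\<lambda>y. merge (early k) (layer k) (w, y)) -` ?S \<inter> space (PiM (layer k) gauss)"
        using measurable_space[OF ms] by auto
      then show "{y \<in> space (PiM (layer k) gauss). E (merge (early k) (layer k) (w, y))} \<in> sets (PiM (layer k) gauss)"
        using measurable_sets[OF ms E] by simp
    qed
    finally show "(\<integral>\<^sup>+y. indicator ?S (merge (early k) (layer k) (w, y)) \<partial>PiM (layer k) gauss)
        = emeasure (PiM (layer k) gauss) {y \<in> space (PiM (layer k) gauss). E (merge (early k) (layer k) (w, y))}" .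
  qed
  finally show ?thesis .
qed

text \<open>Markov property: conditionally on the weights of the earlier layers, the next kernel is an
  average of independent features driven by a Gaussian vector with the current kernel as covariance.\<close>

lemma markov_step:
  assumes k: "k < L" and E: "{W \<in> space (PiM WI gauss). E W} \<in> sets (PiM WI gauss)"
    and E_dep: "\<And>W W'. (\<And>i. fst i < k \<Longrightarrow> W i = W' i) \<Longrightarrow> E W = E W'"
    and B: "B \<in> sets (PiM (J (Suc k)) (\<lambda>_. borel))"
    and \<theta>: "0 \<le> \<theta>"
  shows "(\<And>W A. E W \<Longrightarrow> (\<And>a b. a < D (Suc k) \<Longrightarrow> b < D (Suc k) \<Longrightarrow> cov (D (Suc k)) A a b = gram W k a b) \<Longrightarrow> trans (Suc k) A B \<le> \<theta>)
      \<Longrightarrow> measure (PiM WI gauss) {W \<in> space (PiM WI gauss). E W \<and> Kf (Suc k) W \<in> B} \<le> \<theta> * measure (PiM WI gauss) {W \<in> space (PiM WI gauss). E W}"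
    and "(\<And>W A. E W \<Longrightarrow> (\<And>a b. a < D (Suc k) \<Longrightarrow> b < D (Suc k) \<Longrightarrow> cov (D (Suc k)) A a b = gram W k a b) \<Longrightarrow> \<theta> \<le> trans (Suc k) A B)
      \<Longrightarrow> \<theta> * measure (PiM WI gauss) {W \<in> space (PiM WI gauss). E W} \<le> measure (PiM WI gauss) {W \<in> space (PiM WI gauss). E W \<and> Kf (Suc k) W \<in> B}"
proof -
  let ?M = "PiM WI gauss" and ?I = "early k" and ?J = "layer k"
  let ?m = "\<lambda>w y. merge ?I ?J (w, y)"
  have EB: "{W \<in> space ?M. E W \<and> Kf (Suc k) W \<in> B} \<in> sets ?M"
  proof -
    have "{W \<in> space ?M. E W \<and> Kf (Suc k) W \<in> B} = {W \<in> space ?M. E W} \<inter> (Kf (Suc k) -` B \<inter> space ?M)" by auto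
    then show ?thesis using E measurable_sets[OF Kf_meas B] k by auto
  qed
  \<comment> \<open>A dummy value for the weights of layer \<open>k\<close>, on which neither
    \<open>E\<close> nor the current kernel depends.\<close>
  define y0 :: "nat \<times> 'm \<times> nat \<times> nat \<Rightarrow> real" where "y0 = restrict (\<lambda>_. 0) ?J"
  have y0: "y0 \<in> space (PiM ?J gauss)" by (simp add: space_PiM_gauss y0_def)
  define e where "e w \<longleftrightarrow> E (?m w y0)" for w
  have Ee: "E (?m w y) = e w" for w y
    unfolding e_def by (rule E_dep) (auto simp: merge_def layer_def)
  have "\<forall>w. \<exists>A. \<forall>a<D (Suc k). \<forall>b<D (Suc k). cov (D (Suc k)) A a b = gram (?m w y0) k a b"
  proof
    fix w
    show "\<exists>A. \<forall>a<D (Suc k). \<forall>b<D (Suc k). cov (D (Suc k)) A a b = gram (?m w y0) k a b"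
      by (rule gram_factor[OF less_imp_le[OF k], of "D (Suc k)" "?m w y0"]) blast
  qed
  \<comment> \<open>The choice may fail to be measurable in \<open>w\<close>; the integrands are
    compared pointwise only.\<close>
  from choice[OF this] obtain A where A: "\<And>w a b. a < D (Suc k) \<Longrightarrow> b < D (Suc k) \<Longrightarrow> cov (D (Suc k)) (A w) a b = gram (?m w y0) k a b"
    by blast
  have full: "emeasure ?M {W \<in> space ?M. E W} = (\<integral>\<^sup>+w. indicator {w. e w} w \<partial>PiM ?I gauss)"
    unfolding emeasure_layer_split[OF k E] Ee
    by (intro nn_integral_cong) (auto simp: indicator_def W.P.emeasure_space_1)
  have part: "emeasure ?M {W \<in> space ?M. E W \<and> Kf (Suc k) W \<in> B} = (\<integral>\<^sup>+w. ennreal (trans (Suc k) (A w) B) * indicator {w. e w} w \<partial>PiM ?I gauss)"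
    unfolding emeasure_layer_split[OF k EB] Ee
    by (intro nn_integral_cong) (auto simp: indicator_def conditional_law[OF k y0 B A])
  have em: "{w \<in> space (PiM ?I gauss). e w} \<in> sets (PiM ?I gauss)"
  proof -
    have I4: "?I \<union> ?J = WI" by (auto simp: early_def layer_def)
    have ms: "(\<lambda>w. ?m w y0) \<in> measurable (PiM ?I gauss) ?M"
      using measurable_Pair2'[OF y0, of "PiM ?I gauss"] measurable_merge[of ?I ?J gauss] unfolding I4
      by (rule measurable_compose)
    have "{w \<in> space (PiM ?I gauss). e w} = (\<lambda>w. ?m w y0) -` {W \<in> space ?M. E W} \<inter> space (PiM ?I gauss)"
      using measurable_space[OF ms] by (auto simp: e_def)
    then show ?thesis using measurable_sets[OF ms E] by simp
  qed
  have em': "(\<lambda>w. indicator {w. e w} w :: ennreal) \<in> borel_measurable (PiM ?I gauss)"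
    using em by (subst borel_measurable_indicator_iff) (simp add: Int_def conj_commute)
  have scaled: "ennreal (\<theta> * measure ?M {W \<in> space ?M. E W}) = (\<integral>\<^sup>+w. ennreal \<theta> * indicator {w. e w} w \<partial>PiM ?I gauss)"
    unfolding nn_integral_cmult[OF em'] full[symmetric] using \<theta> by (simp add: W.P.emeasure_eq_measure ennreal_mult)
  {
    assume *: "\<And>W A. E W \<Longrightarrow> (\<And>a b. a < D (Suc k) \<Longrightarrow> b < D (Suc k) \<Longrightarrow> cov (D (Suc k)) A a b = gram W k a b) \<Longrightarrow> trans (Suc k) A B \<le> \<theta>"
    have "ennreal (measure ?M {W \<in> space ?M. E W \<and> Kf (Suc k) W \<in> B}) \<le> ennreal (\<theta> * measure ?M {W \<in> space ?M. E W})"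
      unfolding scaled W.P.emeasure_eq_measure[symmetric] part
    proof (intro nn_integral_mono)
      fix w
      have "e w \<Longrightarrow> trans (Suc k) (A w) B \<le> \<theta>" using *[OF _ A] by (simp add: e_def)
      then show "ennreal (trans (Suc k) (A w) B) * indicator {w. e w} w \<le> ennreal \<theta> * indicator {w. e w} w"
        by (auto simp: indicator_def ennreal_leI)
    qed
    then show "measure ?M {W \<in> space ?M. E W \<and> Kf (Suc k) W \<in> B} \<le> \<theta> * measure ?M {W \<in> space ?M. E W}"
      using \<theta> by simp
  next
    assume *: "\<And>W A. E W \<Longrightarrow> (\<And>a b. a < D (Suc k) \<Longrightarrow> b < D (Suc k) \<Longrightarrow> cov (D (Suc k)) A a b = gram W k a b) \<Longrightarrow> \<theta> \<le> trans (Suc k) A B"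
    have "ennreal (\<theta> * measure ?M {W \<in> space ?M. E W}) \<le> ennreal (measure ?M {W \<in> space ?M. E W \<and> Kf (Suc k) W \<in> B})"
      unfolding scaled W.P.emeasure_eq_measure[symmetric] part
    proof (intro nn_integral_mono)
      fix w
      have "e w \<Longrightarrow> \<theta> \<le> trans (Suc k) (A w) B" using *[OF _ A] by (simp add: e_def)
      then show "ennreal \<theta> * indicator {w. e w} w \<le> ennreal (trans (Suc k) (A w) B) * indicator {w. e w} w"
        by (auto simp: indicator_def ennreal_leI)
    qed
    then show "\<theta> * measure ?M {W \<in> space ?M. E W} \<le> measure ?M {W \<in> space ?M. E W \<and> Kf (Suc k) W \<in> B}" by simp
  }
qed

end

section \<open>Combining one-step bounds along the chain\<close>

context conv_net
begin

definition box :: "nat \<Rightarrow> (nat \<times> nat \<Rightarrow> real) \<Rightarrow> real \<Rightarrow> (nat \<times> nat \<Rightarrow> real) set" where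
  "box k q \<delta> = {y \<in> space (PiM (J k) (\<lambda>_. borel)). \<forall>p\<in>J k. \<bar>y p - q p\<bar> < \<delta>}"

definition all_in :: "nat \<Rightarrow> (nat \<Rightarrow> (nat \<times> nat \<Rightarrow> real) set) \<Rightarrow> (nat \<times> 'm \<times> nat \<times> nat \<Rightarrow> real) \<Rightarrow> bool" where
  "all_in l B W \<longleftrightarrow> (\<forall>k\<le>l. Kf k W \<in> B k)"

abbreviation pr :: "((nat \<times> 'm \<times> nat \<times> nat \<Rightarrow> real) \<Rightarrow> bool) \<Rightarrow> real" where
  "pr E \<equiv> measure (PiM WI gauss) {W \<in> space (PiM WI gauss). E W}"

lemma box_sets: "box k q \<delta> \<in> sets (PiM (J k) (\<lambda>_. borel))"
  unfolding box_def by measurable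

lemma cbox_sets: "{y \<in> space (PiM (J k) (\<lambda>_. borel)). \<forall>p\<in>J k. \<bar>y p\<bar> \<le> r} \<in> sets (PiM (J k) (\<lambda>_. borel :: real measure))"
  by measurable

lemma all_in_sets:
  assumes "l \<le> L" "\<And>k. k \<le> l \<Longrightarrow> B k \<in> sets (PiM (J k) (\<lambda>_. borel))"
  shows "{W \<in> space (PiM WI gauss). all_in l B W} \<in> sets (PiM WI gauss)"
proof -
  have "Kf k -` B k \<inter> space (PiM WI gauss) \<in> sets (PiM WI gauss)" if "k \<le> l" for k
    using measurable_sets[OF Kf_meas assms(2)[OF that]] that assms(1) by simp
  then have "(\<Inter>k\<in>{..l}. Kf k -` B k \<inter> space (PiM WI gauss)) \<in> sets (PiM WI gauss)"
    by (intro sets.finite_INT) auto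
  moreover have "{W \<in> space (PiM WI gauss). all_in l B W} = (\<Inter>k\<in>{..l}. Kf k -` B k \<inter> space (PiM WI gauss))"
    by (auto simp: all_in_def)
  ultimately show ?thesis by simp
qed

lemma all_in_dep:
  assumes "\<And>i. fst i < l \<Longrightarrow> W i = W' i"
  shows "all_in l B W = all_in l B W'"
proof -
  have "Kf k W = Kf k W'" if "k \<le> l" for k using assms that by (intro Kf_cong) auto
  then show ?thesis by (simp add: all_in_def)
qed

lemma Kf_cov:
  assumes "\<And>a b. a < D (Suc k) \<Longrightarrow> b < D (Suc k) \<Longrightarrow> cov (D (Suc k)) A a b = gram W k a b"
  shows "Kf k W = restrict (\<lambda>(a, b). cov (D (Suc k)) A a b) (J k)"
  unfolding Kf_def using assms by (intro restrict_ext) auto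

lemma chain_step_upper:
  assumes l: "l < L" and B: "\<And>k. k \<le> l \<Longrightarrow> B k \<in> sets (PiM (J k) (\<lambda>_. borel))"
    and S: "S \<in> sets (PiM (J (Suc l)) (\<lambda>_. borel))" and \<theta>: "0 \<le> \<theta>"
    and bound: "\<And>A. restrict (\<lambda>(a, b). cov (D (Suc l)) A a b) (J l) \<in> B l \<Longrightarrow> trans (Suc l) A S \<le> \<theta>"
  shows "pr (\<lambda>W. all_in l B W \<and> Kf (Suc l) W \<in> S) \<le> \<theta> * pr (all_in l B)"
proof (rule markov_step(1)[OF l _ _ S \<theta>])
  show "{W \<in> space (PiM WI gauss). all_in l B W} \<in> sets (PiM WI gauss)"
    using l B by (intro all_in_sets) auto
  show "all_in l B W = all_in l B W'" if "\<And>i. fst i < l \<Longrightarrow> W i = W' i" for W W'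
    by (rule all_in_dep) (rule that)
  fix W A assume E: "all_in l B W"
    and "\<And>a b. a < D (Suc l) \<Longrightarrow> b < D (Suc l) \<Longrightarrow> cov (D (Suc l)) A a b = gram W l a b"
  from Kf_cov[OF this(2)] E show "trans (Suc l) A S \<le> \<theta>" by (intro bound) (auto simp: all_in_def)
qed

lemma chain_step_lower:
  assumes l: "l < L" and B: "\<And>k. k \<le> l \<Longrightarrow> B k \<in> sets (PiM (J k) (\<lambda>_. borel))"
    and S: "S \<in> sets (PiM (J (Suc l)) (\<lambda>_. borel))" and \<theta>: "0 \<le> \<theta>"
    and bound: "\<And>A. restrict (\<lambda>(a, b). cov (D (Suc l)) A a b) (J l) \<in> B l \<Longrightarrow> \<theta> \<le> trans (Suc l) A S"
  shows "\<theta> * pr (all_in l B) \<le> pr (\<lambda>W. all_in l B W \<and> Kf (Suc l) W \<in> S)"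
proof (rule markov_step(2)[OF l _ _ S \<theta>])
  show "{W \<in> space (PiM WI gauss). all_in l B W} \<in> sets (PiM WI gauss)"
    using l B by (intro all_in_sets) auto
  show "all_in l B W = all_in l B W'" if "\<And>i. fst i < l \<Longrightarrow> W i = W' i" for W W'
    by (rule all_in_dep) (rule that)
  fix W A assume E: "all_in l B W"
    and "\<And>a b. a < D (Suc l) \<Longrightarrow> b < D (Suc l) \<Longrightarrow> cov (D (Suc l)) A a b = gram W l a b"
  from Kf_cov[OF this(2)] E show "\<theta> \<le> trans (Suc l) A S" by (intro bound) (auto simp: all_in_def)
qed

lemma all_in_Suc: "all_in (Suc l) B W \<longleftrightarrow> all_in l B W \<and> Kf (Suc l) W \<in> B (Suc l)"
  by (auto simp: all_in_def le_Suc_eq)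

text \<open>One-step bounds multiply by the Markov property. The sum starts at 1 because the kernel
  of index 0 is deterministic; its event is bounded by probability 1.\<close>

lemma chain_upper:
  assumes "l \<le> L" and B: "\<And>k. k \<le> l \<Longrightarrow> B k \<in> sets (PiM (J k) (\<lambda>_. borel))"
    and bound: "\<And>k A. k < l \<Longrightarrow> restrict (\<lambda>(a, b). cov (D (Suc k)) A a b) (J k) \<in> B k \<Longrightarrow>
      trans (Suc k) A (B (Suc k)) \<le> exp (- b (Suc k))"
  shows "pr (all_in l B) \<le> exp (- (\<Sum>k\<in>{1..l}. b k))"
  using assms
proof (induction l)
  case 0
  show ?case using W.P.prob_le_1 by simp
next
  case (Suc l)
  have "pr (all_in (Suc l) B) \<le> exp (- b (Suc l)) * pr (all_in l B)"
    unfolding all_in_Suc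
  proof (rule chain_step_upper)
    fix A assume "restrict (\<lambda>(a, b). cov (D (Suc l)) A a b) (J l) \<in> B l"
    then show "trans (Suc l) A (B (Suc l)) \<le> exp (- b (Suc l))" by (rule Suc.prems(3)[OF lessI])
  qed (use Suc.prems in auto)
  also have "\<dots> \<le> exp (- b (Suc l)) * exp (- (\<Sum>k\<in>{1..l}. b k))"
    using Suc.prems by (intro mult_left_mono Suc.IH) auto
  finally show ?case by (simp add: exp_add[symmetric] algebra_simps)
qed

text \<open>A single step that starts from sets \<open>B\<close> smaller than the targets
  \<open>B'\<close>: the neighbourhood of the current kernel in which the one-step bound holds may
  be smaller than the radius finally wanted.\<close>

lemma chain_lower:
  assumes l: "l < L" and B: "\<And>k. k \<le> l \<Longrightarrow> B k \<in> sets (PiM (J k) (\<lambda>_. borel))"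
    and B': "\<And>k. k \<le> Suc l \<Longrightarrow> B' k \<in> sets (PiM (J k) (\<lambda>_. borel))" and sub: "\<And>k. k \<le> l \<Longrightarrow> B k \<subseteq> B' k"
    and bound: "\<And>A. restrict (\<lambda>(a, b). cov (D (Suc l)) A a b) (J l) \<in> B l \<Longrightarrow> \<theta> \<le> trans (Suc l) A (B' (Suc l))"
    and \<theta>: "0 \<le> \<theta>"
  shows "\<theta> * pr (all_in l B) \<le> pr (all_in (Suc l) B')"
proof -
  have "\<theta> * pr (all_in l B) \<le> pr (\<lambda>W. all_in l B W \<and> Kf (Suc l) W \<in> B' (Suc l))"
    using assms by (intro chain_step_lower) auto
  also have "\<dots> \<le> pr (all_in (Suc l) B')"
  proof (rule W.P.finite_measure_mono)
    show "{W \<in> space (PiM WI gauss). all_in (Suc l) B' W} \<in> sets (PiM WI gauss)"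
      using l B' by (intro all_in_sets) auto
    show "{W \<in> space (PiM WI gauss). all_in l B W \<and> Kf (Suc l) W \<in> B' (Suc l)} \<subseteq> {W \<in> space (PiM WI gauss). all_in (Suc l) B' W}"
      unfolding all_in_Suc by (auto simp: all_in_def dest: subsetD[OF sub])
  qed
  finally show ?thesis .
qed

definition bdd :: "real \<Rightarrow> nat \<Rightarrow> (nat \<times> nat \<Rightarrow> real) set" where
  "bdd r k = {y \<in> space (PiM (J k) (\<lambda>_. borel)). \<forall>p\<in>J k. \<bar>y p\<bar> \<le> r}"

text \<open>Either one of the kernels up to \<open>l\<close> has already left its box of size
  \<open>r\<close>, or the new kernel leaves its own box of size \<open>r'\<close>, an event
  controlled by one transition.\<close>

lemma chain_tight:
  assumes l: "l < L" and r: "r \<le> r'" and \<theta>: "0 \<le> \<theta>"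
    and bound: "\<And>A. (\<And>a b. (a, b) \<in> J l \<Longrightarrow> \<bar>cov (D (Suc l)) A a b\<bar> \<le> r) \<Longrightarrow>
      trans (Suc l) A (space (PiM (J (Suc l)) (\<lambda>_. borel)) - bdd r' (Suc l)) \<le> \<theta>"
  shows "pr (\<lambda>W. \<not> all_in (Suc l) (bdd r') W) \<le> pr (\<lambda>W. \<not> all_in l (bdd r) W) + \<theta>"
proof -
  let ?M = "PiM WI gauss"
  have bs: "bdd r k \<in> sets (PiM (J k) (\<lambda>_. borel))" for r k unfolding bdd_def by (rule cbox_sets)
  let ?S = "space (PiM (J (Suc l)) (\<lambda>_. borel)) - bdd r' (Suc l)"
  have S: "?S \<in> sets (PiM (J (Suc l)) (\<lambda>_. borel))" using bs by auto
  have m1: "{W \<in> space ?M. \<not> all_in l (bdd r) W} \<in> sets ?M"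
  proof -
    have "{W \<in> space ?M. \<not> all_in l (bdd r) W} = space ?M - {W \<in> space ?M. all_in l (bdd r) W}" by auto
    moreover have "{W \<in> space ?M. all_in l (bdd r) W} \<in> sets ?M" using l bs by (intro all_in_sets) auto
    ultimately show ?thesis by (simp only: sets.compl_sets)
  qed
  have m2: "{W \<in> space ?M. all_in l (bdd r) W \<and> Kf (Suc l) W \<in> ?S} \<in> sets ?M"
  proof -
    have "{W \<in> space ?M. all_in l (bdd r) W \<and> Kf (Suc l) W \<in> ?S}
        = {W \<in> space ?M. all_in l (bdd r) W} \<inter> (Kf (Suc l) -` ?S \<inter> space ?M)" by auto
    moreover have "{W \<in> space ?M. all_in l (bdd r) W} \<in> sets ?M" using l bs by (intro all_in_sets) auto
    ultimately show ?thesis using measurable_sets[OF Kf_meas S] l by (simp only: sets.Int Suc_le_eq)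
  qed
  have "{W \<in> space ?M. \<not> all_in (Suc l) (bdd r') W}
      \<subseteq> {W \<in> space ?M. \<not> all_in l (bdd r) W} \<union> {W \<in> space ?M. all_in l (bdd r) W \<and> Kf (Suc l) W \<in> ?S}"
  proof
    fix W assume W: "W \<in> {W \<in> space ?M. \<not> all_in (Suc l) (bdd r') W}"
    have "all_in l (bdd r) W \<Longrightarrow> all_in l (bdd r') W"
      using r by (force simp: all_in_def bdd_def)
    moreover have "Kf (Suc l) W \<in> space (PiM (J (Suc l)) (\<lambda>_. borel))"
      using measurable_space[OF Kf_meas[of "Suc l"]] l W by auto
    ultimately show "W \<in> {W \<in> space ?M. \<not> all_in l (bdd r) W} \<union> {W \<in> space ?M. all_in l (bdd r) W \<and> Kf (Suc l) W \<in> ?S}"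
      using W by (auto simp: all_in_Suc)
  qed
  then have "pr (\<lambda>W. \<not> all_in (Suc l) (bdd r') W)
      \<le> measure ?M ({W \<in> space ?M. \<not> all_in l (bdd r) W} \<union> {W \<in> space ?M. all_in l (bdd r) W \<and> Kf (Suc l) W \<in> ?S})"
    using m1 m2 by (intro W.P.finite_measure_mono) auto
  also have "\<dots> \<le> pr (\<lambda>W. \<not> all_in l (bdd r) W) + pr (\<lambda>W. all_in l (bdd r) W \<and> Kf (Suc l) W \<in> ?S)"
    using m1 m2 by (intro measure_Un_le)
  also have "pr (\<lambda>W. all_in l (bdd r) W \<and> Kf (Suc l) W \<in> ?S) \<le> \<theta> * pr (all_in l (bdd r))"
  proof (rule chain_step_upper[OF l bs S \<theta>])
    fix A assume *: "restrict (\<lambda>(a, b). cov (D (Suc l)) A a b) (J l) \<in> bdd r l"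
    show "trans (Suc l) A ?S \<le> \<theta>"
    proof (rule bound)
      fix a b assume ab: "(a, b) \<in> J l"
      then have "\<bar>restrict (\<lambda>(a, b). cov (D (Suc l)) A a b) (J l) (a, b)\<bar> \<le> r" using * unfolding bdd_def by blast
      then show "\<bar>cov (D (Suc l)) A a b\<bar> \<le> r" using ab by simp
    qed
  qed
  also have "\<theta> * pr (all_in l (bdd r)) \<le> \<theta> * 1" using \<theta> W.P.prob_le_1 by (intro mult_left_mono) auto
  finally show ?thesis by simp
qed

lemma avg_space: "avg l h \<in> space (PiM (J l) (\<lambda>_. borel))"
  by (simp add: avg_def space_PiM)

lemma trans_box:
  assumes l: "l \<in> {1..L}" and C: "1 \<le> C l"
  shows "trans l A (box l q \<delta>) = measure (PiM {1..C l} (\<lambda>_. std_gauss (D l))) (feature_map.near (D l) (J l) (gm l) (C l) A q \<delta>)"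
proof -
  have "\<bar>S / C l - t\<bar> < \<delta> \<longleftrightarrow> \<bar>S - C l * t\<bar> < C l * \<delta>" for S t :: real
  proof -
    have c: "0 < real (C l)" using C by simp
    have "S - C l * t = C l * (S / C l - t)" using c by (simp add: algebra_simps)
    then have "\<bar>S - C l * t\<bar> = C l * \<bar>S / C l - t\<bar>" by (simp add: abs_mult)
    then show ?thesis using c by simp
  qed
  then have "avg l h \<in> box l q \<delta> \<longleftrightarrow> (\<forall>p\<in>J l. \<bar>(\<Sum>c\<in>{1..C l}. gm l (h c) p) - C l * q p\<bar> < C l * \<delta>)" for h
    using avg_space[of l h] unfolding box_def by (auto simp: avg_def simp del: One_nat_def)
  then show ?thesis unfolding trans_def feature_map.near_def[OF feature[OF l]] by simp
qed

lemma trans_unbounded: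
  fixes r :: real
  assumes l: "l \<in> {1..L}" and C: "1 \<le> C l"
  shows "trans l A (space (PiM (J l) (\<lambda>_. borel)) - bdd r l) = measure (PiM {1..C l} (\<lambda>_. std_gauss (D l)))
    {\<omega> \<in> space (PiM {1..C l} (\<lambda>_. std_gauss (D l))). \<exists>p\<in>J l. C l * r < \<bar>\<Sum>c\<in>{1..C l}. gm l (lin (D l) A (\<omega> c)) p\<bar>}"
proof -
  have "\<not> \<bar>S / C l\<bar> \<le> r \<longleftrightarrow> C l * r < \<bar>S\<bar>" for S :: real
    using C by (simp add: not_le field_simps)
  then have "avg l h \<in> space (PiM (J l) (\<lambda>_. borel)) - bdd r l \<longleftrightarrow> (\<exists>p\<in>J l. C l * r < \<bar>\<Sum>c\<in>{1..C l}. gm l (h c) p\<bar>)" for h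
    using avg_space[of l h] unfolding bdd_def by (auto simp: avg_def simp del: One_nat_def)
  then show ?thesis unfolding trans_def by simp
qed

lemma Kmat_psd:
  assumes l: "l \<in> {1..L}"
  shows "Kmat \<sigma> R Ms C N P lam x W l \<in> psd_mats (D (Suc l))"
proof -
  obtain A where A: "\<And>a b. a < D (Suc l) \<Longrightarrow> b < D (Suc l) \<Longrightarrow> cov (D (Suc l)) A a b = gram W l a b"
    using gram_factor[of l "D (Suc l)" W] l by auto
  have K: "Kmat \<sigma> R Ms C N P lam x W l $$ (a, b) = cov (D (Suc l)) A a b" if "a < D (Suc l)" "b < D (Suc l)" for a b
    using that by (subst A) (auto intro: gram_Kmat[OF l, symmetric])
  show ?thesis
    unfolding psd_mats_iff
  proof (intro conjI allI impI)
    show "Kmat \<sigma> R Ms C N P lam x W l \<in> carrier_mat (D (Suc l)) (D (Suc l))" by (simp add: Kmat_def)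
    show "Kmat \<sigma> R Ms C N P lam x W l $$ (a, b) = Kmat \<sigma> R Ms C N P lam x W l $$ (b, a)"
      if "a < D (Suc l)" "b < D (Suc l)" for a b
      using that by (simp add: K cov_def mult.commute)
    fix v :: "nat \<Rightarrow> real"
    have "(\<Sum>a<D (Suc l). \<Sum>b<D (Suc l). v a * Kmat \<sigma> R Ms C N P lam x W l $$ (a, b) * v b)
        = (\<Sum>a<D (Suc l). \<Sum>b<D (Suc l). v a * v b * cov (D (Suc l)) A a b)"
      by (intro sum.cong refl) (simp add: K)
    also have "\<dots> = (\<Sum>k<D (Suc l). (\<Sum>a<D (Suc l). v a * A a k)\<^sup>2)" by (rule sum_square_cov[symmetric])
    finally show "0 \<le> (\<Sum>a<D (Suc l). \<Sum>b<D (Suc l). v a * Kmat \<sigma> R Ms C N P lam x W l $$ (a, b) * v b)"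
      by (simp add: sum_nonneg)
  qed
qed

end

section \<open>Regularity of the feature maps\<close>

lemma vnorm_L2: "vnorm n z = L2_set z {1..n}"
  by (simp add: vnorm_def L2_set_def)

lemma pnorm_L2: "pnorm S r = L2_set r S"
  by (simp add: pnorm_def L2_set_def)

lemma abs_le_L2_set:
  assumes "finite S" "k \<in> S" shows "\<bar>z k\<bar> \<le> L2_set z S"
proof -
  have "(z k)\<^sup>2 \<le> (\<Sum>k\<in>S. (z k)\<^sup>2)" using assms by (intro member_le_sum) auto
  then have "sqrt ((z k)\<^sup>2) \<le> L2_set z S" unfolding L2_set_def by (rule real_sqrt_le_mono)
  then show ?thesis by simp
qed

text \<open>The entries of one column occupy distinct positions of the flat vector.\<close>

lemma vnorm_col_le:
  assumes "mu \<in> {1..P}"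
  shows "vnorm n (\<lambda>i. z (mu - 1 + (i - 1) * P)) \<le> L2_set z {..<n * P}"
proof -
  let ?f = "\<lambda>i. mu - 1 + (i - 1) * P"
  have inj: "inj_on ?f {1..n}"
  proof (rule inj_onI)
    fix i i' assume i: "i \<in> {1..n}" "i' \<in> {1..n}" "?f i = ?f i'"
    then have "(i - 1) * P = (i' - 1) * P" by simp
    then have "i - 1 = i' - 1" using assms by auto
    then show "i = i'" using i(1,2) unfolding atLeastAtMost_iff by linarith
  qed
  have "?f ` {1..n} \<subseteq> {..<n * P}"
  proof
    fix k assume "k \<in> ?f ` {1..n}"
    then obtain i where i: "i \<in> {1..n}" "k = mu - 1 + (i - 1) * P" by auto
    have "k < P + (i - 1) * P" using assms i(2) by auto
    also have "\<dots> = i * P" using i(1) by (cases i) auto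
    also have "\<dots> \<le> n * P" using i(1) by simp
    finally show "k \<in> {..<n * P}" by simp
  qed
  then have "(\<Sum>k\<in>?f ` {1..n}. (z k)\<^sup>2) \<le> (\<Sum>k<n * P. (z k)\<^sup>2)"
    by (intro sum_mono2) auto
  then show ?thesis unfolding vnorm_def L2_set_def sum.reindex[OF inj] by simp
qed

text \<open>Local boundedness handles small \<open>m z\<close>, the little-o condition large
  \<open>m z\<close>. The size function \<open>m\<close> is abstract to cover both the real argument
  of the activation and the vector argument of the patch extractors.\<close>

lemma sublinear_bound:
  fixes \<rho> :: "'a \<Rightarrow> real" and m :: "'a \<Rightarrow> real"
  assumes m: "\<And>z. 0 \<le> m z" and bdd: "\<And>r. \<exists>B. \<forall>z. m z \<le> r \<longrightarrow> \<bar>\<rho> z\<bar> \<le> B"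
    and small: "\<And>e. 0 < e \<Longrightarrow> \<exists>r. \<forall>z. r \<le> m z \<longrightarrow> \<bar>\<rho> z\<bar> \<le> e * m z" and e: "0 < e"
  shows "\<exists>c\<ge>0. \<forall>z. \<rho> z \<le> e * m z + c"
proof -
  obtain r where r: "\<And>z. r \<le> m z \<Longrightarrow> \<bar>\<rho> z\<bar> \<le> e * m z" using small[OF e] by blast
  obtain B where B: "\<And>z. m z \<le> r \<Longrightarrow> \<bar>\<rho> z\<bar> \<le> B" using bdd by blast
  have "\<rho> z \<le> e * m z + \<bar>B\<bar>" for z
  proof (cases "m z \<le> r")
    case True
    have "0 \<le> e * m z" using e m by simp
    then show ?thesis using B[OF True] by linarith
  next
    case False
    then show ?thesis using r[of z] by linarith
  qed
  then show ?thesis by (intro exI[of _ "\<bar>B\<bar>"]) auto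
qed

lemma abs_mult_diff_le:
  fixes a b c d :: real
  assumes "\<bar>a - c\<bar> \<le> \<Delta>" "\<bar>b - d\<bar> \<le> \<Delta>" "\<bar>b\<bar> \<le> K" "\<bar>c\<bar> \<le> K"
  shows "\<bar>a * b - c * d\<bar> \<le> 2 * K * \<Delta>"
proof -
  have "a * b - c * d = (a - c) * b + c * (b - d)" by (simp add: algebra_simps)
  then have "\<bar>a * b - c * d\<bar> \<le> \<bar>a - c\<bar> * \<bar>b\<bar> + \<bar>c\<bar> * \<bar>b - d\<bar>"
    by (metis abs_mult abs_triangle_ineq)
  also have "\<dots> \<le> \<Delta> * K + K * \<Delta>" using assms by (intro add_mono mult_mono) auto
  finally show ?thesis by simp
qed

section \<open>Asymptotic Lipschitz estimates for the features of one layer\<close>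

locale layer_map =
  fixes P :: nat and N :: "nat \<Rightarrow> nat" and \<sigma> :: "real \<Rightarrow> real"
    and Ms :: "nat \<Rightarrow> 'm set" and R :: "nat \<Rightarrow> nat \<Rightarrow> (nat \<Rightarrow> real) \<Rightarrow> 'm \<Rightarrow> real"
    and lam :: "nat \<Rightarrow> real" and L\<sigma> LR :: real and \<rho>\<sigma> :: "real \<Rightarrow> real" and \<rho>R :: "nat \<Rightarrow> (nat \<Rightarrow> real) \<Rightarrow> real"
    and l :: nat
  assumes P_pos: "1 \<le> P" and Ms_fin: "finite (Ms l)" and Ms_ne: "Ms l \<noteq> {}" and lam_pos: "0 < lam l"
    and \<sigma>_cont: "continuous_on UNIV \<sigma>"
    and \<sigma>_lip: "\<bar>\<sigma> s - \<sigma> t\<bar> \<le> L\<sigma> * \<bar>s - t\<bar> + \<rho>\<sigma> s + \<rho>\<sigma> t"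
    and L\<sigma>_nonneg: "0 \<le> L\<sigma>"
    and \<rho>\<sigma>_locbdd: "\<exists>B. \<forall>s. \<bar>s\<bar> \<le> r \<longrightarrow> \<bar>\<rho>\<sigma> s\<bar> \<le> B"
    and \<rho>\<sigma>_small: "\<rho>\<sigma> \<in> o[at_infinity](\<lambda>s. s)"
    and R_cont: "i \<in> {1..N (Suc l)} \<Longrightarrow> 0 < e \<Longrightarrow> \<exists>d>0. \<forall>z'.
         vnorm (N l) (\<lambda>j. z' j - z j) < d \<longrightarrow>
         pnorm (Ms l) (\<lambda>m. R l i (vrest (N l) z') m - R l i (vrest (N l) z) m) < e"
    and R_lip: "i \<in> {1..N (Suc l)} \<Longrightarrow> pnorm (Ms l) (\<lambda>m. R l i (vrest (N l) z) m - R l i (vrest (N l) z') m)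
           \<le> LR * vnorm (N l) (\<lambda>j. z j - z' j) + \<rho>R l (vrest (N l) z) + \<rho>R l (vrest (N l) z')"
    and LR_nonneg: "0 \<le> LR"
    and \<rho>R_locbdd: "\<exists>B. \<forall>z. vnorm (N l) z \<le> r \<longrightarrow> \<bar>\<rho>R l (vrest (N l) z)\<bar> \<le> B"
    and \<rho>R_small: "0 < e \<Longrightarrow> \<exists>r. \<forall>z. r \<le> vnorm (N l) z \<longrightarrow> \<bar>\<rho>R l (vrest (N l) z)\<bar> \<le> e * vnorm (N l) z"
begin

lemma \<rho>\<sigma>_bound: "0 < e \<Longrightarrow> \<exists>c\<ge>0. \<forall>s. \<rho>\<sigma> s \<le> e * \<bar>s\<bar> + c"
proof (rule sublinear_bound)
  fix e :: real assume "0 < e"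
  from landau_o.smallD[OF \<rho>\<sigma>_small this] obtain b where "\<forall>s. b \<le> norm s \<longrightarrow> norm (\<rho>\<sigma> s) \<le> e * norm s"
    unfolding eventually_at_infinity by blast
  then show "\<exists>r. \<forall>z. r \<le> \<bar>z\<bar> \<longrightarrow> \<bar>\<rho>\<sigma> z\<bar> \<le> e * \<bar>z\<bar>" by auto
qed (use \<rho>\<sigma>_locbdd in auto)

lemma \<rho>R_bound: "0 < e \<Longrightarrow> \<exists>c\<ge>0. \<forall>z. \<rho>R l (vrest (N l) z) \<le> e * vnorm (N l) z + c"
  using \<rho>R_locbdd \<rho>R_small by (intro sublinear_bound[where m = "vnorm (N l)"]) (auto simp: vnorm_L2 L2_set_nonneg)

text \<open>The hypothesis is continuity in the Euclidean seminorm of the coordinates 1 to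
  \<open>N l\<close>; its balls are open in the product topology, which gives continuity in the
  sense of \<open>feature_map\<close>.\<close>

lemma patch_continuous:
  assumes i: "i \<in> {1..N (Suc l)}" and m: "m \<in> Ms l"
  shows "continuous_on UNIV (\<lambda>z. R l i (vrest (N l) z) m)"
  unfolding continuous_on_def
proof (intro ballI tendstoI)
  fix z :: "nat \<Rightarrow> real" and e :: real assume e: "0 < e"
  obtain d where d: "0 < d" "\<And>z'. vnorm (N l) (\<lambda>j. z' j - z j) < d \<Longrightarrow>
      pnorm (Ms l) (\<lambda>m. R l i (vrest (N l) z') m - R l i (vrest (N l) z) m) < e"
    using R_cont[OF i e] by blast
  have "continuous_on UNIV (\<lambda>z'. vnorm (N l) (\<lambda>j. z' j - z j))"
    unfolding vnorm_def by (intro continuous_intros) auto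
  then have "open {z'. vnorm (N l) (\<lambda>j. z' j - z j) < d}"
    by (intro open_Collect_less continuous_on_const)
  moreover have "vnorm (N l) (\<lambda>j. z j - z j) < d" using d(1) by (simp add: vnorm_def)
  ultimately have "\<forall>\<^sub>F z' in at z. vnorm (N l) (\<lambda>j. z' j - z j) < d"
    unfolding eventually_at_topological by blast
  then show "\<forall>\<^sub>F z' in at z within UNIV. dist (R l i (vrest (N l) z') m) (R l i (vrest (N l) z) m) < e"
  proof eventually_elim
    case (elim z')
    have "\<bar>R l i (vrest (N l) z') m - R l i (vrest (N l) z) m\<bar>
        \<le> pnorm (Ms l) (\<lambda>m. R l i (vrest (N l) z') m - R l i (vrest (N l) z) m)"
      unfolding pnorm_L2 by (rule abs_le_L2_set[OF Ms_fin m])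
    then show ?case using d(2)[OF elim] by (simp add: dist_real_def)
  qed
qed

lemma feature_continuous:
  assumes i: "i \<in> {1..N (Suc l)}" and m: "m \<in> Ms l"
  shows "continuous_on UNIV (\<lambda>z. \<sigma> (R l i (vrest (N l) z) m))"
  by (rule continuous_on_compose2[OF \<sigma>_cont patch_continuous[OF i m]]) auto

abbreviation nrm :: "(nat \<Rightarrow> real) \<Rightarrow> real" where "nrm z \<equiv> L2_set z {..<N l * P}"

definition \<psi> :: "nat \<Rightarrow> 'm \<Rightarrow> (nat \<Rightarrow> real) \<Rightarrow> real" where
  "\<psi> a m z = \<sigma> (R l (a div P + 1) (col (N l) P z (a mod P + 1)) m)"

lemma index:
  assumes "a < N (Suc l) * P" shows "a div P + 1 \<in> {1..N (Suc l)}" "a mod P + 1 \<in> {1..P}"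
  using assms P_pos by (auto simp: div_less_iff_less_mult Suc_le_eq)

lemma \<psi>_continuous:
  assumes a: "a < N (Suc l) * P" and m: "m \<in> Ms l"
  shows "continuous_on UNIV (\<psi> a m)"
  unfolding \<psi>_def col_def
  by (rule continuous_on_compose2[OF feature_continuous[OF index(1)[OF a] m]]) (auto intro!: continuous_intros)

lemma \<psi>_local:
  assumes a: "a < N (Suc l) * P" and z: "\<And>k. k < N l * P \<Longrightarrow> z k = z' k"
  shows "\<psi> a m z = \<psi> a m z'"
proof -
  have "col (N l) P z (a mod P + 1) = col (N l) P z' (a mod P + 1)"
  proof
    fix j
    have "a mod P + 1 - 1 + (j - 1) * P < N l * P" if "j \<in> {1..N l}"
    proof -
      have "a mod P < P" using P_pos by simp
      then have "a mod P + 1 - 1 + (j - 1) * P < P + (j - 1) * P" by simp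
      also have "\<dots> = j * P" using that by (cases j) auto
      also have "\<dots> \<le> N l * P" using that by simp
      finally show ?thesis .
    qed
    then show "col (N l) P z (a mod P + 1) j = col (N l) P z' (a mod P + 1) j"
      using z by (simp add: col_def vrest_def)
  qed
  then show ?thesis by (simp add: \<psi>_def)
qed

lemma patch_diff:
  assumes a: "a < N (Suc l) * P" and m: "m \<in> Ms l" and c: "\<And>z. \<rho>R l (vrest (N l) z) \<le> e * vnorm (N l) z + c" and e: "0 \<le> e"
  shows "\<bar>R l (a div P + 1) (col (N l) P z (a mod P + 1)) m - R l (a div P + 1) (col (N l) P z' (a mod P + 1)) m\<bar>
    \<le> LR * nrm (\<lambda>k. z k - z' k) + e * (nrm z + nrm z') + 2 * c"
proof -
  let ?y = "\<lambda>z i. z (a mod P + 1 - 1 + (i - 1) * P) :: real"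
  have le: "vnorm (N l) (?y z) \<le> nrm z" for z by (rule vnorm_col_le[OF index(2)[OF a]])
  have "\<bar>R l (a div P + 1) (vrest (N l) (?y z)) m - R l (a div P + 1) (vrest (N l) (?y z')) m\<bar>
      \<le> pnorm (Ms l) (\<lambda>m. R l (a div P + 1) (vrest (N l) (?y z)) m - R l (a div P + 1) (vrest (N l) (?y z')) m)"
    unfolding pnorm_L2 by (rule abs_le_L2_set[OF Ms_fin m])
  also have "\<dots> \<le> LR * vnorm (N l) (\<lambda>j. ?y z j - ?y z' j) + \<rho>R l (vrest (N l) (?y z)) + \<rho>R l (vrest (N l) (?y z'))"
    by (rule R_lip[OF index(1)[OF a]])
  also have "\<dots> \<le> LR * nrm (\<lambda>k. z k - z' k) + (e * nrm z + c) + (e * nrm z' + c)"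
  proof (intro add_mono)
    show "LR * vnorm (N l) (\<lambda>j. ?y z j - ?y z' j) \<le> LR * nrm (\<lambda>k. z k - z' k)"
      using le[of "\<lambda>k. z k - z' k"] LR_nonneg by (rule mult_left_mono)
    show "\<rho>R l (vrest (N l) (?y z)) \<le> e * nrm z + c"
      using c[of "?y z"] mult_left_mono[OF le[of z] e] by linarith
    show "\<rho>R l (vrest (N l) (?y z')) \<le> e * nrm z' + c"
      using c[of "?y z'"] mult_left_mono[OF le[of z'] e] by linarith
  qed
  finally show ?thesis by (simp add: col_def algebra_simps)
qed

lemma patch_growth:
  obtains B where "0 < B" "\<And>a m z. a < N (Suc l) * P \<Longrightarrow> m \<in> Ms l \<Longrightarrow>
    \<bar>R l (a div P + 1) (col (N l) P z (a mod P + 1)) m\<bar> \<le> B * (1 + nrm z)"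
proof -
  obtain c where c: "0 \<le> c" "\<And>z. \<rho>R l (vrest (N l) z) \<le> 1 * vnorm (N l) z + c" using \<rho>R_bound[of 1] by auto
  define B0 where "B0 = (\<Sum>a<N (Suc l) * P. \<Sum>m\<in>Ms l. \<bar>R l (a div P + 1) (col (N l) P (\<lambda>_. 0) (a mod P + 1)) m\<bar>)"
  have B0: "0 \<le> B0" by (simp add: B0_def sum_nonneg)
  show ?thesis
  proof (rule that[of "B0 + LR + 1 + 2 * c"])
    show "0 < B0 + LR + 1 + 2 * c" using B0 LR_nonneg c(1) by linarith
    fix a m z assume a: "a < N (Suc l) * P" and m: "m \<in> Ms l"
    let ?r = "\<lambda>z. R l (a div P + 1) (col (N l) P z (a mod P + 1)) m"
    have n: "0 \<le> nrm z" by (rule L2_set_nonneg)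
    have "nrm (\<lambda>_. 0) = 0" by (simp add: L2_set_def)
    then have "\<bar>?r z - ?r (\<lambda>_. 0)\<bar> \<le> LR * nrm z + 1 * nrm z + 2 * c"
      using patch_diff[OF a m c(2), of z "\<lambda>_. 0"] by simp
    moreover have "\<bar>?r (\<lambda>_. 0)\<bar> \<le> B0"
    proof -
      have "\<bar>?r (\<lambda>_. 0)\<bar> \<le> (\<Sum>m\<in>Ms l. \<bar>R l (a div P + 1) (col (N l) P (\<lambda>_. 0) (a mod P + 1)) m\<bar>)"
        using m Ms_fin by (intro member_le_sum[of m _ "\<lambda>m. \<bar>R l (a div P + 1) (col (N l) P (\<lambda>_. 0) (a mod P + 1)) m\<bar>"]) auto
      also have "\<dots> \<le> B0" unfolding B0_def
        using a by (intro member_le_sum[of a _ "\<lambda>a. \<Sum>m\<in>Ms l. \<bar>R l (a div P + 1) (col (N l) P (\<lambda>_. 0) (a mod P + 1)) m\<bar>"])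
          (auto intro!: sum_nonneg)
      finally show ?thesis .
    qed
    moreover have "0 \<le> B0 * nrm z" "0 \<le> c * nrm z" using B0 c(1) n by simp_all
    moreover have "(B0 + LR + 1 + 2 * c) * (1 + nrm z) = B0 + LR + 1 + 2 * c + (B0 * nrm z + LR * nrm z + nrm z + 2 * (c * nrm z))"
      by (simp add: algebra_simps)
    ultimately show "\<bar>?r z\<bar> \<le> (B0 + LR + 1 + 2 * c) * (1 + nrm z)" using LR_nonneg c(1) by linarith
  qed
qed

lemma \<psi>_diff:
  assumes \<eta>: "0 < \<eta>"
  shows "\<exists>c\<ge>0. \<forall>a<N (Suc l) * P. \<forall>m\<in>Ms l. \<forall>z z'.
    \<bar>\<psi> a m z - \<psi> a m z'\<bar> \<le> L\<sigma> * LR * nrm (\<lambda>k. z k - z' k) + \<eta> * (nrm z + nrm z') + c"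
proof -
  obtain B where B: "0 < B" "\<And>a m z. a < N (Suc l) * P \<Longrightarrow> m \<in> Ms l \<Longrightarrow>
    \<bar>R l (a div P + 1) (col (N l) P z (a mod P + 1)) m\<bar> \<le> B * (1 + nrm z)"
    using patch_growth by blast
  \<comment> \<open>The budget \<open>\<eta>\<close> is split in two: the remainder of the patch
    extractor is multiplied by \<open>L\<sigma>\<close>, and that of the activation is evaluated at
    a patch of size at most \<open>B * (1 + nrm z)\<close>. Each share is at most
    \<open>\<eta> / 2\<close>.\<close>
  define e1 where "e1 = \<eta> / (2 * (L\<sigma> + 1))"
  define e2 where "e2 = \<eta> / (2 * B)"
  have e1: "0 < e1" and e2: "0 < e2" using \<eta> L\<sigma>_nonneg B(1) by (auto simp: e1_def e2_def intro: divide_pos_pos)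
  obtain c1 where c1: "0 \<le> c1" "\<And>z. \<rho>R l (vrest (N l) z) \<le> e1 * vnorm (N l) z + c1" using \<rho>R_bound[OF e1] by auto
  obtain c2 where c2: "0 \<le> c2" "\<And>s. \<rho>\<sigma> s \<le> e2 * \<bar>s\<bar> + c2" using \<rho>\<sigma>_bound[OF e2] by auto
  have Le1: "L\<sigma> * e1 \<le> \<eta> / 2"
  proof -
    have "L\<sigma> * e1 \<le> (L\<sigma> + 1) * e1" using e1 by (intro mult_right_mono) auto
    also have "\<dots> = \<eta> / 2"
    proof -
      have "X * (\<eta> / (2 * X)) = \<eta> / 2" if "X \<noteq> 0" for X using that by simp
      from this[of "L\<sigma> + 1"] show ?thesis using L\<sigma>_nonneg unfolding e1_def by linarith
    qed
    finally show ?thesis .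
  qed
  have e2B: "e2 * B = \<eta> / 2" using B(1) by (simp add: e2_def)
  show ?thesis
  proof (intro exI[of _ "2 * (L\<sigma> * c1) + 2 * c2 + \<eta>"] conjI allI impI ballI)
    show "0 \<le> 2 * (L\<sigma> * c1) + 2 * c2 + \<eta>" using c1(1) c2(1) \<eta> L\<sigma>_nonneg by simp
    fix a m z z' assume a: "a < N (Suc l) * P" and m: "m \<in> Ms l"
    let ?r = "\<lambda>z. R l (a div P + 1) (col (N l) P z (a mod P + 1)) m"
    have n: "0 \<le> nrm z" "0 \<le> nrm z'" by (rule L2_set_nonneg)+
    have "\<bar>\<psi> a m z - \<psi> a m z'\<bar> \<le> L\<sigma> * \<bar>?r z - ?r z'\<bar> + \<rho>\<sigma> (?r z) + \<rho>\<sigma> (?r z')"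
      unfolding \<psi>_def by (rule \<sigma>_lip)
    moreover have "L\<sigma> * \<bar>?r z - ?r z'\<bar> \<le> L\<sigma> * (LR * nrm (\<lambda>k. z k - z' k) + e1 * (nrm z + nrm z') + 2 * c1)"
      using patch_diff[OF a m c1(2)] e1 L\<sigma>_nonneg by (intro mult_left_mono) auto
    moreover have "L\<sigma> * (LR * nrm (\<lambda>k. z k - z' k) + e1 * (nrm z + nrm z') + 2 * c1)
        = L\<sigma> * LR * nrm (\<lambda>k. z k - z' k) + L\<sigma> * e1 * (nrm z + nrm z') + 2 * (L\<sigma> * c1)"
      by (simp add: algebra_simps)
    moreover have "L\<sigma> * e1 * (nrm z + nrm z') \<le> \<eta> / 2 * (nrm z + nrm z')"
      using Le1 n by (intro mult_right_mono) auto
    moreover have "\<rho>\<sigma> (?r z) \<le> \<eta> / 2 * (1 + nrm z) + c2" for z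
    proof -
      have "e2 * \<bar>?r z\<bar> \<le> e2 * (B * (1 + nrm z))" using B(2)[OF a m] e2 by (intro mult_left_mono) auto
      then show ?thesis using c2(2)[of "?r z"] e2B by (simp add: mult.assoc[symmetric])
    qed
    from add_mono[OF this[of z] this[of z']]
    have "\<rho>\<sigma> (?r z) + \<rho>\<sigma> (?r z') \<le> \<eta> / 2 * (nrm z + nrm z') + \<eta> + 2 * c2" by (simp add: algebra_simps)
    moreover have "\<eta> * (nrm z + nrm z') = \<eta> / 2 * (nrm z + nrm z') + \<eta> / 2 * (nrm z + nrm z')" by (simp add: algebra_simps)
    ultimately show "\<bar>\<psi> a m z - \<psi> a m z'\<bar>
        \<le> L\<sigma> * LR * nrm (\<lambda>k. z k - z' k) + \<eta> * (nrm z + nrm z') + (2 * (L\<sigma> * c1) + 2 * c2 + \<eta>)"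
      by linarith
  qed
qed

lemma \<psi>_growth:
  obtains B where "0 < B" "\<And>a m z. a < N (Suc l) * P \<Longrightarrow> m \<in> Ms l \<Longrightarrow> \<bar>\<psi> a m z\<bar> \<le> B * (1 + nrm z)"
proof -
  obtain c where c: "0 \<le> c" "\<And>a m z z'. a < N (Suc l) * P \<Longrightarrow> m \<in> Ms l \<Longrightarrow>
    \<bar>\<psi> a m z - \<psi> a m z'\<bar> \<le> L\<sigma> * LR * nrm (\<lambda>k. z k - z' k) + 1 * (nrm z + nrm z') + c"
    using \<psi>_diff[of 1] by auto
  define B0 where "B0 = (\<Sum>a<N (Suc l) * P. \<Sum>m\<in>Ms l. \<bar>\<psi> a m (\<lambda>_. 0)\<bar>)"
  have B0: "0 \<le> B0" by (simp add: B0_def sum_nonneg)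
  have LL: "0 \<le> L\<sigma> * LR" using L\<sigma>_nonneg LR_nonneg by simp
  show ?thesis
  proof (rule that[of "B0 + L\<sigma> * LR + 1 + c"])
    show "0 < B0 + L\<sigma> * LR + 1 + c" using B0 LL c(1) by linarith
    fix a m z assume a: "a < N (Suc l) * P" and m: "m \<in> Ms l"
    have n: "0 \<le> nrm z" by (rule L2_set_nonneg)
    have "nrm (\<lambda>_. 0) = 0" by (simp add: L2_set_def)
    then have "\<bar>\<psi> a m z - \<psi> a m (\<lambda>_. 0)\<bar> \<le> L\<sigma> * LR * nrm z + nrm z + c"
      using c(2)[OF a m, of z "\<lambda>_. 0"] by simp
    moreover have "\<bar>\<psi> a m (\<lambda>_. 0)\<bar> \<le> B0"
    proof -
      have "\<bar>\<psi> a m (\<lambda>_. 0)\<bar> \<le> (\<Sum>m\<in>Ms l. \<bar>\<psi> a m (\<lambda>_. 0)\<bar>)"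
        using m Ms_fin by (intro member_le_sum[of m _ "\<lambda>m. \<bar>\<psi> a m (\<lambda>_. 0)\<bar>"]) auto
      also have "\<dots> \<le> B0" unfolding B0_def
        using a by (intro member_le_sum[of a _ "\<lambda>a. \<Sum>m\<in>Ms l. \<bar>\<psi> a m (\<lambda>_. 0)\<bar>"]) (auto intro!: sum_nonneg)
      finally show ?thesis .
    qed
    moreover have "0 \<le> B0 * nrm z" "0 \<le> c * nrm z" using B0 c(1) n by simp_all
    moreover have "(B0 + L\<sigma> * LR + 1 + c) * (1 + nrm z) = B0 + L\<sigma> * LR + 1 + c + (B0 * nrm z + L\<sigma> * LR * nrm z + nrm z + c * nrm z)"
      by (simp add: algebra_simps)
    ultimately show "\<bar>\<psi> a m z\<bar> \<le> (B0 + L\<sigma> * LR + 1 + c) * (1 + nrm z)" using LL c(1) by linarith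
  qed
qed

lemma Gmap_\<psi>:
  assumes "a < N (Suc l) * P" "b < N (Suc l) * P"
  shows "Gmap \<sigma> R Ms N P lam l z $$ (a, b) = 1 / (lam l * real (card (Ms l))) * (\<Sum>m\<in>Ms l. \<psi> a m z * \<psi> b m z)"
  using assms by (simp add: Gmap_def \<psi>_def)

text \<open>Each entry is a sum of products of two features, so its increment is an increment of one
  factor times the size of the other. This is where the product form of \<open>g_lip\<close>
  originates and where the growth constant enters the Lipschitz constant.\<close>

lemma feature_map_Gmap:
  "\<exists>\<Lambda>. feature_map (N l * P) ({..<N (Suc l) * P} \<times> {..<N (Suc l) * P}) (\<lambda>z (a, b). Gmap \<sigma> R Ms N P lam l z $$ (a, b)) \<Lambda>"
proof -
  obtain B where B: "0 < B" "\<And>a m z. a < N (Suc l) * P \<Longrightarrow> m \<in> Ms l \<Longrightarrow> \<bar>\<psi> a m z\<bar> \<le> B * (1 + nrm z)"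
    using \<psi>_growth by blast
  \<comment> \<open>Collects the factor 2 of \<open>abs_mult_diff_le\<close>, the growth constant
    and the prefactor of \<open>Gmap\<close>; the number of patch positions cancels.\<close>
  define s where "s = 2 * B / lam l"
  have s: "0 < s" using B(1) lam_pos by (simp add: s_def)
  have card: "0 < real (card (Ms l))" using Ms_fin Ms_ne by (simp add: card_gt_0_iff)
  show ?thesis
  proof (rule exI[of _ "s * (L\<sigma> * LR)"], unfold_locales)
    fix j assume "j \<in> {..<N (Suc l) * P} \<times> {..<N (Suc l) * P}"
    then obtain a b where j: "j = (a, b)" "a < N (Suc l) * P" "b < N (Suc l) * P" by auto
    show "continuous_on UNIV (\<lambda>z. (\<lambda>(a, b). Gmap \<sigma> R Ms N P lam l z $$ (a, b)) j)"
      unfolding j(1) prod.case Gmap_\<psi>[OF j(2,3)] using \<psi>_continuous[OF j(2)] \<psi>_continuous[OF j(3)]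
      by (intro continuous_intros)
    fix z z' :: "nat \<Rightarrow> real" assume "\<And>k. k < N l * P \<Longrightarrow> z k = z' k"
    then have "\<psi> a m z = \<psi> a m z'" "\<psi> b m z = \<psi> b m z'" for m using \<psi>_local j by blast+
    then show "(\<lambda>(a, b). Gmap \<sigma> R Ms N P lam l z $$ (a, b)) j = (\<lambda>(a, b). Gmap \<sigma> R Ms N P lam l z' $$ (a, b)) j"
      unfolding j(1) prod.case Gmap_\<psi>[OF j(2,3)] by simp
  next
    show "0 \<le> s * (L\<sigma> * LR)" using s L\<sigma>_nonneg LR_nonneg by simp
  next
    fix \<eta> :: real assume \<eta>: "0 < \<eta>"
    then have "0 < \<eta> / s" using s by simp
    from \<psi>_diff[OF this] obtain c where c: "0 \<le> c" "\<And>a m z z'. a < N (Suc l) * P \<Longrightarrow> m \<in> Ms l \<Longrightarrow>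
      \<bar>\<psi> a m z - \<psi> a m z'\<bar> \<le> L\<sigma> * LR * nrm (\<lambda>k. z k - z' k) + \<eta> / s * (nrm z + nrm z') + c"
      by blast
    show "\<exists>c. \<forall>z z'. \<forall>j\<in>{..<N (Suc l) * P} \<times> {..<N (Suc l) * P}.
      \<bar>(\<lambda>(a, b). Gmap \<sigma> R Ms N P lam l z $$ (a, b)) j - (\<lambda>(a, b). Gmap \<sigma> R Ms N P lam l z' $$ (a, b)) j\<bar>
      \<le> (s * (L\<sigma> * LR) * nrm (\<lambda>k. z k - z' k) + \<eta> * (nrm z + nrm z') + c) * (1 + nrm z + nrm z')"
    proof (intro exI[of _ "s * c"] allI ballI)
      fix z z' j assume "j \<in> {..<N (Suc l) * P} \<times> {..<N (Suc l) * P}"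
      then obtain a b where j: "j = (a, b)" "a < N (Suc l) * P" "b < N (Suc l) * P" by auto
      let ?\<Delta> = "L\<sigma> * LR * nrm (\<lambda>k. z k - z' k) + \<eta> / s * (nrm z + nrm z') + c"
      let ?q = "1 + nrm z + nrm z'"
      have n: "0 \<le> nrm z" "0 \<le> nrm z'" by (rule L2_set_nonneg)+
      have K: "B * (1 + nrm z) \<le> B * ?q" "B * (1 + nrm z') \<le> B * ?q" using B(1) n by (auto intro!: mult_left_mono)
      have "\<bar>\<psi> a m z * \<psi> b m z - \<psi> a m z' * \<psi> b m z'\<bar> \<le> 2 * (B * ?q) * ?\<Delta>" if m: "m \<in> Ms l" for m
        using B(2)[OF j(3) m, of z] B(2)[OF j(2) m, of z'] K
        by (intro abs_mult_diff_le c(2) j m) auto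
      then have "\<bar>\<Sum>m\<in>Ms l. \<psi> a m z * \<psi> b m z - \<psi> a m z' * \<psi> b m z'\<bar> \<le> (\<Sum>m\<in>Ms l. 2 * (B * ?q) * ?\<Delta>)"
        by (intro order_trans[OF sum_abs] sum_mono)
      also have "\<dots> = real (card (Ms l)) * (2 * (B * ?q) * ?\<Delta>)" by simp
      finally have "1 / (lam l * real (card (Ms l))) * \<bar>\<Sum>m\<in>Ms l. \<psi> a m z * \<psi> b m z - \<psi> a m z' * \<psi> b m z'\<bar>
          \<le> 1 / (lam l * real (card (Ms l))) * (real (card (Ms l)) * (2 * (B * ?q) * ?\<Delta>))"
        using lam_pos card by (intro mult_left_mono) auto
      also have "\<dots> = s * ?\<Delta> * ?q" using card lam_pos by (simp add: s_def field_simps)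
      also have "s * ?\<Delta> = s * (L\<sigma> * LR) * nrm (\<lambda>k. z k - z' k) + \<eta> * (nrm z + nrm z') + s * c"
        using s by (simp add: field_simps)
      finally have *: "1 / (lam l * real (card (Ms l))) * \<bar>\<Sum>m\<in>Ms l. \<psi> a m z * \<psi> b m z - \<psi> a m z' * \<psi> b m z'\<bar>
          \<le> (s * (L\<sigma> * LR) * nrm (\<lambda>k. z k - z' k) + \<eta> * (nrm z + nrm z') + s * c) * ?q" .
      have "Gmap \<sigma> R Ms N P lam l z $$ (a, b) - Gmap \<sigma> R Ms N P lam l z' $$ (a, b)
          = 1 / (lam l * real (card (Ms l))) * (\<Sum>m\<in>Ms l. \<psi> a m z * \<psi> b m z - \<psi> a m z' * \<psi> b m z')"
        by (simp only: Gmap_\<psi>[OF j(2,3)] sum_subtractf right_diff_distrib)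
      then have "\<bar>Gmap \<sigma> R Ms N P lam l z $$ (a, b) - Gmap \<sigma> R Ms N P lam l z' $$ (a, b)\<bar>
          = 1 / (lam l * real (card (Ms l))) * \<bar>\<Sum>m\<in>Ms l. \<psi> a m z * \<psi> b m z - \<psi> a m z' * \<psi> b m z'\<bar>"
        using lam_pos card by (simp add: abs_mult)
      with * show "\<bar>(\<lambda>(a, b). Gmap \<sigma> R Ms N P lam l z $$ (a, b)) j - (\<lambda>(a, b). Gmap \<sigma> R Ms N P lam l z' $$ (a, b)) j\<bar>
          \<le> (s * (L\<sigma> * LR) * nrm (\<lambda>k. z k - z' k) + \<eta> * (nrm z + nrm z') + s * c) * (1 + nrm z + nrm z')"
        by (simp only: j(1) prod.case)
    qed
  qed simp
qed

end

section \<open>The large deviation principle for the kernels\<close>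

text \<open>Distributes a level below the total cost over the layers. If some layer has infinite
  cost, it takes the whole burden and the others get -1, which is below any cost; otherwise every
  cost is lowered by the same amount.\<close>

lemma ereal_weighted_sum_less_obtain:
  fixes f :: "'l \<Rightarrow> ereal" and w :: "'l \<Rightarrow> real"
  assumes S: "finite S" and w: "\<And>l. l \<in> S \<Longrightarrow> 0 < w l" and f: "\<And>l. l \<in> S \<Longrightarrow> 0 \<le> f l"
    and a: "ereal a < (\<Sum>l\<in>S. ereal (w l) * f l)"
  obtains b where "\<And>l. l \<in> S \<Longrightarrow> ereal (b l) < f l" "a < (\<Sum>l\<in>S. w l * b l)"
proof (cases "\<exists>l0\<in>S. f l0 = \<infinity>")
  case True
  then obtain l0 where l0: "l0 \<in> S" "f l0 = \<infinity>" by blast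
  define T where "T = (\<Sum>l\<in>S - {l0}. w l)"
  define b where "b l = (if l = l0 then (\<bar>a\<bar> + 1 + T) / w l0 else -1)" for l
  have "(\<Sum>l\<in>S. w l * b l) = w l0 * b l0 + (\<Sum>l\<in>S - {l0}. w l * b l)"
    using S l0(1) by (rule sum.remove)
  also have "(\<Sum>l\<in>S - {l0}. w l * b l) = - T"
    unfolding T_def sum_negf[symmetric] by (intro sum.cong) (auto simp: b_def)
  also have "w l0 * b l0 = \<bar>a\<bar> + 1 + T" using w[OF l0(1)] by (simp add: b_def)
  finally have "a < (\<Sum>l\<in>S. w l * b l)" by simp
  moreover have "ereal (b l) < f l" if "l \<in> S" for l
  proof (cases "l = l0")
    case False
    have "ereal (-1) < 0" by simp
    then have "ereal (-1) < f l" using f[OF that] by (rule less_le_trans)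
    then show ?thesis using False by (simp add: b_def)
  qed (use l0 in simp)
  ultimately show ?thesis using that by blast
next
  case False
  define c where "c l = real_of_ereal (f l)" for l
  have c: "f l = ereal (c l)" if "l \<in> S" for l
    using f[OF that] False that unfolding c_def by (cases "f l") auto
  then have "(\<Sum>l\<in>S. ereal (w l) * f l) = ereal (\<Sum>l\<in>S. w l * c l)" by simp
  then have ac: "a < (\<Sum>l\<in>S. w l * c l)" using a by simp
  define T where "T = (\<Sum>l\<in>S. w l)"
  have T: "0 \<le> T" unfolding T_def by (intro sum_nonneg) (use w in \<open>force intro: less_imp_le\<close>)
  define e where "e = ((\<Sum>l\<in>S. w l * c l) - a) / (T + 1)"
  have e: "0 < e" using ac T by (simp add: e_def)
  have eT: "e * (T + 1) = (\<Sum>l\<in>S. w l * c l) - a" using T by (simp add: e_def)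
  have "(\<Sum>l\<in>S. w l * (c l - e)) = (\<Sum>l\<in>S. w l * c l) - e * T"
    by (simp add: T_def algebra_simps sum_subtractf sum_distrib_left)
  also have "\<dots> = a + e" using eT by (simp add: algebra_simps)
  finally have "a < (\<Sum>l\<in>S. w l * (c l - e))" using e by simp
  then show ?thesis using c e by (intro that[of "\<lambda>l. c l - e"]) auto
qed

text \<open>A finite total forces all costs to be finite, and each is raised by the same amount. The
  real values \<open>c\<close> are returned as well, since the one-layer lower bound is stated for
  real levels.\<close>

lemma ereal_weighted_sum_greater_obtain:
  fixes f :: "'l \<Rightarrow> ereal" and w :: "'l \<Rightarrow> real"
  assumes S: "finite S" and w: "\<And>l. l \<in> S \<Longrightarrow> 0 < w l" and f: "\<And>l. l \<in> S \<Longrightarrow> 0 \<le> f l"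
    and a: "(\<Sum>l\<in>S. ereal (w l) * f l) < ereal a"
  obtains c b where "\<And>l. l \<in> S \<Longrightarrow> f l = ereal (c l)" "\<And>l. l \<in> S \<Longrightarrow> c l < b l" "(\<Sum>l\<in>S. w l * b l) < a"
proof -
  have fin: "f l \<noteq> \<infinity>" if "l \<in> S" for l
  proof
    assume "f l = \<infinity>"
    then have "ereal (w l) * f l = \<infinity>" using w[OF that] by simp
    then have "(\<Sum>l\<in>S. ereal (w l) * f l) = \<infinity>" using S that by (subst sum_Pinfty) blast
    then show False using a by simp
  qed
  define c where "c l = real_of_ereal (f l)" for l
  have c: "f l = ereal (c l)" if "l \<in> S" for l
    using f[OF that] fin[OF that] unfolding c_def by (cases "f l") auto
  then have "(\<Sum>l\<in>S. ereal (w l) * f l) = ereal (\<Sum>l\<in>S. w l * c l)" by simp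
  then have ac: "(\<Sum>l\<in>S. w l * c l) < a" using a by simp
  define T where "T = (\<Sum>l\<in>S. w l)"
  have T: "0 \<le> T" unfolding T_def by (intro sum_nonneg) (use w in \<open>force intro: less_imp_le\<close>)
  define e where "e = (a - (\<Sum>l\<in>S. w l * c l)) / (T + 1)"
  have e: "0 < e" using ac T by (simp add: e_def)
  have eT: "e * (T + 1) = a - (\<Sum>l\<in>S. w l * c l)" using T by (simp add: e_def)
  have "(\<Sum>l\<in>S. w l * (c l + e)) = (\<Sum>l\<in>S. w l * c l) + e * T"
    by (simp add: T_def algebra_simps sum.distrib sum_distrib_left)
  also have "\<dots> = a - e" using eT by (simp add: algebra_simps)
  finally have "(\<Sum>l\<in>S. w l * (c l + e)) < a" using e by simp
  then show ?thesis using c e by (intro that[of c "\<lambda>l. c l + e"]) auto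
qed

text \<open>The same Hilbert choice as in \<open>gauss_nn_integral\<close>, so that the rate
  function is evaluated at exactly this factor.\<close>

definition some_factor :: "nat \<Rightarrow> real mat \<Rightarrow> nat \<Rightarrow> nat \<Rightarrow> real" where
  "some_factor d Q = (\<lambda>k j. (SOME A. A \<in> carrier_mat d d \<and> A * transpose_mat A = Q) $$ (k, j))"

lemma cov_some_factor:
  assumes Q: "Q \<in> psd_mats d" and ab: "a < d" "b < d"
  shows "cov d (some_factor d Q) a b = Q $$ (a, b)"
proof -
  have "\<exists>f. \<forall>i<d. \<forall>j<d. (\<Sum>k<d. f i k * f j k) = Q $$ (i, j)"
    using Q unfolding psd_mats_iff by (intro psd_factorization) auto
  then obtain f where f: "\<And>i j. i < d \<Longrightarrow> j < d \<Longrightarrow> (\<Sum>k<d. f i k * f j k) = Q $$ (i, j)" by blast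
  have Qc: "Q \<in> carrier_mat d d" using Q by (simp add: psd_mats_iff)
  have entry: "(A * transpose_mat A) $$ (i, j) = (\<Sum>k<d. A $$ (i, k) * A $$ (j, k))"
    if "A \<in> carrier_mat d d" "i < d" "j < d" for A :: "real mat" and i j
    using that by (auto simp: scalar_prod_def atLeast0LessThan intro!: sum.cong)
  let ?A = "mat d d (\<lambda>(i, j). f i j)"
  have "?A * transpose_mat ?A = Q"
    using Qc f by (intro eq_matI) (auto simp: entry[of ?A] simp del: index_mult_mat(1))
  then have "\<exists>A. A \<in> carrier_mat d d \<and> A * transpose_mat A = Q" by (intro exI[of _ ?A]) simp
  then have "(SOME A. A \<in> carrier_mat d d \<and> A * transpose_mat A = Q) \<in> carrier_mat d d \<and>
      (SOME A. A \<in> carrier_mat d d \<and> A * transpose_mat A = Q) * transpose_mat (SOME A. A \<in> carrier_mat d d \<and> A * transpose_mat A = Q) = Q"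
    by (rule someI_ex)
  then show ?thesis using entry[of "SOME A. A \<in> carrier_mat d d \<and> A * transpose_mat A = Q" a b] ab
    by (simp add: cov_def some_factor_def)
qed

lemma gauss_nn_integral_lin: "gauss_nn_integral d Q f = (\<integral>\<^sup>+\<xi>. f (lin d (some_factor d Q) \<xi>) \<partial>std_gauss d)"
  by (simp add: gauss_nn_integral_def Let_def lin_def[abs_def] some_factor_def std_gauss_def)

lemma mat_trace_mult:
  assumes "A \<in> carrier_mat d d" "B \<in> carrier_mat d d"
  shows "mat_trace (transpose_mat A * B) = (\<Sum>(a, b)\<in>{..<d} \<times> {..<d}. A $$ (a, b) * B $$ (a, b))"
proof -
  have "mat_trace (transpose_mat A * B) = (\<Sum>b<d. \<Sum>a<d. A $$ (a, b) * B $$ (a, b))"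
    using assms by (auto simp: mat_trace_def scalar_prod_def atLeast0LessThan intro!: sum.cong)
  also have "\<dots> = (\<Sum>a<d. \<Sum>b<d. A $$ (a, b) * B $$ (a, b))" by (rule sum.swap)
  finally show ?thesis by (simp add: sum.cartesian_product)
qed

context feature_map
begin

lemma mgf_pos: "0 < mgf A t"
proof (rule ccontr)
  interpret G: prob_space "std_gauss D" by (rule prob_space_std_gauss)
  assume "\<not> 0 < mgf A t"
  then have "mgf A t = 0" by simp
  then have "AE \<xi> in std_gauss D. ennreal (exp (ip t (g (lin D A \<xi>)))) = 0"
    unfolding mgf_def by (subst (asm) nn_integral_0_iff_AE) auto
  then have "AE \<xi> in std_gauss D. False" by eventually_elim simp
  then show False by simp
qed

lemma mgf_zero: "mgf A (\<lambda>_. 0) = 1"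
  using prob_space.emeasure_space_1[OF prob_space_std_gauss, of D] by (simp add: mgf_def ip_def)

end

section \<open>The one-layer rate as a Legendre transform of the exponential moment\<close>

locale layer_rate =
  fixes \<sigma> :: "real \<Rightarrow> real" and R :: "nat \<Rightarrow> nat \<Rightarrow> (nat \<Rightarrow> real) \<Rightarrow> 'm \<Rightarrow> real" and Ms :: "nat \<Rightarrow> 'm set"
    and N :: "nat \<Rightarrow> nat" and P :: nat and lam :: "nat \<Rightarrow> real" and l :: nat and \<Lambda> :: real
  assumes feature: "feature_map (N l * P) ({..<N (Suc l) * P} \<times> {..<N (Suc l) * P})
      (\<lambda>z (a, b). Gmap \<sigma> R Ms N P lam l z $$ (a, b)) \<Lambda>"
begin

abbreviation "d \<equiv> N l * P"
abbreviation "d' \<equiv> N (Suc l) * P"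
abbreviation "Jl \<equiv> {..<d'} \<times> {..<d'}"
abbreviation "gl \<equiv> \<lambda>z (a, b). Gmap \<sigma> R Ms N P lam l z $$ (a, b)"

sublocale F: feature_map d Jl gl \<Lambda> by (rule feature)

lemma rate_l_mgf:
  assumes "Q2 \<in> carrier_mat d' d'"
  shows "rate_l \<sigma> R Ms N P lam l Q2 Q1 =
    (SUP Q0 \<in> sym_mats d'. ereal (F.ip (\<lambda>(a, b). Q0 $$ (a, b)) (\<lambda>(a, b). Q2 $$ (a, b)))
      - ln_ennreal (F.mgf (some_factor d Q1) (\<lambda>(a, b). Q0 $$ (a, b))))"
  unfolding rate_l_def
proof (rule SUP_cong[OF refl])
  fix Q0 assume "Q0 \<in> sym_mats d'"
  then have Q0: "Q0 \<in> carrier_mat d' d'" by (simp add: sym_mats_def)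
  have ip: "mat_trace (transpose_mat Q0 * B) = F.ip (\<lambda>(a, b). Q0 $$ (a, b)) (\<lambda>(a, b). B $$ (a, b))"
    if "B \<in> carrier_mat d' d'" for B
    unfolding mat_trace_mult[OF Q0 that] F.ip_def by (intro sum.cong) auto
  have G: "Gmap \<sigma> R Ms N P lam l z \<in> carrier_mat d' d'" for z by (simp add: Gmap_def)
  show "ereal (mat_trace (transpose_mat Q0 * Q2))
        - ln_ennreal (gauss_nn_integral d Q1 (\<lambda>z. ennreal (exp (mat_trace (transpose_mat Q0 * Gmap \<sigma> R Ms N P lam l z)))))
      = ereal (F.ip (\<lambda>(a, b). Q0 $$ (a, b)) (\<lambda>(a, b). Q2 $$ (a, b)))
        - ln_ennreal (F.mgf (some_factor d Q1) (\<lambda>(a, b). Q0 $$ (a, b)))"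
    unfolding ip[OF assms] ip[OF G] gauss_nn_integral_lin F.mgf_def ..
qed

lemma ln_ennreal_real: "0 < z \<Longrightarrow> z < \<infinity> \<Longrightarrow> ln_ennreal z = ereal (ln (enn2real z))"
  by (auto simp: ln_ennreal_def)

lemma rate_l_nonneg:
  assumes "Q2 \<in> carrier_mat d' d'"
  shows "0 \<le> rate_l \<sigma> R Ms N P lam l Q2 Q1"
  unfolding rate_l_mgf[OF assms]
proof (rule SUP_upper2)
  show "0\<^sub>m d' d' \<in> sym_mats d'" by (auto simp: sym_mats_def intro!: eq_matI)
  have z: "F.ip (\<lambda>(a, b). 0\<^sub>m d' d' $$ (a, b)) y = F.ip (\<lambda>_. 0) y" for y
    unfolding F.ip_def by (intro sum.cong) auto
  have "F.mgf A (\<lambda>(a, b). 0\<^sub>m d' d' $$ (a, b)) = 1" for A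
    using F.mgf_zero[of A] unfolding F.mgf_def z .
  then show "0 \<le> ereal (F.ip (\<lambda>(a, b). 0\<^sub>m d' d' $$ (a, b)) (\<lambda>(a, b). Q2 $$ (a, b)))
      - ln_ennreal (F.mgf (some_factor d Q1) (\<lambda>(a, b). 0\<^sub>m d' d' $$ (a, b)))"
    unfolding z by (simp add: F.ip_def ln_ennreal_def)
qed

text \<open>A tilt with infinite exponential moment contributes minus infinity to the supremum, so a
  tilt that beats a real level has a finite one.\<close>

lemma rate_l_greaterD:
  assumes "Q2 \<in> carrier_mat d' d'" and a: "ereal a < rate_l \<sigma> R Ms N P lam l Q2 Q1"
  obtains t where "F.mgf (some_factor d Q1) t < \<infinity>"
    "a < F.ip t (\<lambda>(a, b). Q2 $$ (a, b)) - ln (enn2real (F.mgf (some_factor d Q1) t))"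
proof -
  let ?A = "some_factor d Q1"
  obtain Q0 where Q0: "ereal a < ereal (F.ip (\<lambda>(a, b). Q0 $$ (a, b)) (\<lambda>(a, b). Q2 $$ (a, b)))
      - ln_ennreal (F.mgf ?A (\<lambda>(a, b). Q0 $$ (a, b)))"
    using a unfolding rate_l_mgf[OF assms(1)] less_SUP_iff by blast
  let ?t = "\<lambda>(a, b). Q0 $$ (a, b)"
  have fin: "F.mgf ?A ?t < \<infinity>"
  proof (rule ccontr)
    assume "\<not> F.mgf ?A ?t < \<infinity>"
    then have "F.mgf ?A ?t = \<infinity>" by (simp add: not_less top_unique)
    then show False using Q0 by (simp add: ln_ennreal_def)
  qed
  show ?thesis
    using Q0 unfolding ln_ennreal_real[OF F.mgf_pos fin] by (intro that[OF fin]) simp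
qed

text \<open>The supremum runs over symmetric matrices, whereas Cramer's bound asks for all tilts
  \<open>t\<close> on index pairs. Symmetrising \<open>t\<close> changes neither the pairing with
  the symmetric \<open>Q2\<close> nor that with the symmetric features.\<close>

lemma rate_l_leD:
  assumes Q2: "Q2 \<in> sym_mats d'" and a: "rate_l \<sigma> R Ms N P lam l Q2 Q1 \<le> ereal a"
    and fin: "F.mgf (some_factor d Q1) t < \<infinity>"
  shows "F.ip t (\<lambda>(a, b). Q2 $$ (a, b)) - ln (enn2real (F.mgf (some_factor d Q1) t)) \<le> a"
proof -
  let ?A = "some_factor d Q1"
  define Q0 where "Q0 = mat d' d' (\<lambda>(a, b). (t (a, b) + t (b, a)) / 2)"
  have Q0: "Q0 \<in> sym_mats d'" by (auto simp: sym_mats_def Q0_def intro!: eq_matI)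
  have ip: "F.ip (\<lambda>(a, b). Q0 $$ (a, b)) y = F.ip t y" if y: "\<And>a b. a < d' \<Longrightarrow> b < d' \<Longrightarrow> y (a, b) = y (b, a)" for y
  proof -
    have "F.ip (\<lambda>(a, b). Q0 $$ (a, b)) y = (\<Sum>a<d'. \<Sum>b<d'. t (a, b) * y (a, b) / 2 + t (b, a) * y (a, b) / 2)"
      unfolding F.ip_def sum.cartesian_product' by (intro sum.cong refl) (simp add: Q0_def field_simps)
    also have "\<dots> = (\<Sum>a<d'. \<Sum>b<d'. t (a, b) * y (a, b) / 2) + (\<Sum>a<d'. \<Sum>b<d'. t (b, a) * y (a, b) / 2)"
      by (simp only: sum.distrib)
    also have "(\<Sum>a<d'. \<Sum>b<d'. t (b, a) * y (a, b) / 2) = (\<Sum>b<d'. \<Sum>a<d'. t (b, a) * y (a, b) / 2)"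
      by (rule sum.swap)
    also have "\<dots> = (\<Sum>b<d'. \<Sum>a<d'. t (b, a) * y (b, a) / 2)"
      by (intro sum.cong refl) (simp add: y)
    finally show ?thesis unfolding F.ip_def sum.cartesian_product' by (simp add: sum_divide_distrib[symmetric])
  qed
  have Gsym: "gl z (a, b) = gl z (b, a)" if "a < d'" "b < d'" for z a b
    using that by (simp add: Gmap_def mult.commute)
  have mgf: "F.mgf ?A (\<lambda>(a, b). Q0 $$ (a, b)) = F.mgf ?A t"
  proof -
    have "F.ip (\<lambda>(a, b). Q0 $$ (a, b)) (gl z) = F.ip t (gl z)" for z by (rule ip) (rule Gsym)
    then show ?thesis unfolding F.mgf_def by (simp only:)
  qed
  have "Q2 $$ (a, b) = Q2 $$ (b, a)" if "a < d'" "b < d'" for a b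
  proof -
    have "Q2 \<in> carrier_mat d' d'" "transpose_mat Q2 = Q2" using Q2 by (auto simp: sym_mats_def)
    moreover have "transpose_mat Q2 $$ (a, b) = Q2 $$ (b, a)" using \<open>Q2 \<in> carrier_mat d' d'\<close> that by simp
    ultimately show ?thesis by simp
  qed
  then have ip2: "F.ip (\<lambda>(a, b). Q0 $$ (a, b)) (\<lambda>(a, b). Q2 $$ (a, b)) = F.ip t (\<lambda>(a, b). Q2 $$ (a, b))"
    by (intro ip) simp
  have Q2c: "Q2 \<in> carrier_mat d' d'" using Q2 by (simp add: sym_mats_def)
  have "ereal (F.ip (\<lambda>(a, b). Q0 $$ (a, b)) (\<lambda>(a, b). Q2 $$ (a, b))) - ln_ennreal (F.mgf ?A (\<lambda>(a, b). Q0 $$ (a, b)))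
      \<le> rate_l \<sigma> R Ms N P lam l Q2 Q1"
    unfolding rate_l_mgf[OF Q2c] by (rule SUP_upper[OF Q0])
  then have "ereal (F.ip t (\<lambda>(a, b). Q2 $$ (a, b))) - ln_ennreal (F.mgf ?A t) \<le> rate_l \<sigma> R Ms N P lam l Q2 Q1"
    unfolding mgf ip2 .
  then have "ereal (F.ip t (\<lambda>(a, b). Q2 $$ (a, b))) - ln_ennreal (F.mgf ?A t) \<le> ereal a" using a by (rule order_trans)
  then show ?thesis unfolding ln_ennreal_real[OF F.mgf_pos fin] by simp
qed

end

section \<open>The infinite-channel regime: local bounds and tightness for the kernel tuple\<close>

locale wide_net =
  fixes L P :: nat and N :: "nat \<Rightarrow> nat" and Cs :: "nat \<Rightarrow> nat \<Rightarrow> nat" and \<alpha> :: "nat \<Rightarrow> real" and \<sigma> :: "real \<Rightarrow> real"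
    and Ms :: "nat \<Rightarrow> 'm set" and R :: "nat \<Rightarrow> nat \<Rightarrow> (nat \<Rightarrow> real) \<Rightarrow> 'm \<Rightarrow> real"
    and lam :: "nat \<Rightarrow> real" and x :: "nat \<Rightarrow> nat \<Rightarrow> nat \<Rightarrow> real" and \<Lambda> :: "nat \<Rightarrow> real"
  assumes net: "\<And>n. conv_net L P N \<sigma> Ms R lam \<Lambda>"
    and L_pos: "1 \<le> L"
    and C_pos: "\<And>n l. 1 \<le> n \<Longrightarrow> l \<le> L \<Longrightarrow> 1 \<le> Cs n l"
    and C0_fixed: "\<And>n. 1 \<le> n \<Longrightarrow> Cs n 0 = Cs 1 0"
    and C_lim: "\<And>l. l \<in> {1..L} \<Longrightarrow> (\<lambda>n. real (Cs n l) / real n) \<longlonglongrightarrow> \<alpha> l"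
    and \<alpha>_pos: "\<And>l. l \<in> {1..L} \<Longrightarrow> 0 < \<alpha> l"
begin

sublocale net: conv_net L P N "Cs n" \<sigma> Ms R lam x \<Lambda> for n by (rule net)

abbreviation dm :: "nat \<Rightarrow> nat" where "dm l \<equiv> N l * P"

abbreviation idx :: "nat \<Rightarrow> (nat \<times> nat) set" where "idx l \<equiv> {..<dm (Suc l)} \<times> {..<dm (Suc l)}"

lemma rate_locale: "l \<in> {1..L} \<Longrightarrow> layer_rate \<sigma> R Ms N P lam l (\<Lambda> l)"
  by (intro layer_rate.intro net.feature)

definition Kone :: "real mat" where "Kone = K1 R Ms (Cs 1 0) N P lam x"

definition X :: "nat \<Rightarrow> (nat \<times> 'm \<times> nat \<times> nat \<Rightarrow> real) \<Rightarrow> real mat list" where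
  "X n W = map (\<lambda>l. Kmat \<sigma> R Ms (Cs n) N P lam x W l) [1..<Suc L]"

text \<open>Prepends the fixed first kernel, so that transition \<open>l\<close> runs uniformly from
  \<open>mt Qs (l - 1)\<close> to \<open>mt Qs l\<close>.\<close>

definition mt :: "real mat list \<Rightarrow> nat \<Rightarrow> real mat" where
  "mt Qs k = (if k = 0 then Kone else Qs ! (k - 1))"

definition ctr :: "real mat list \<Rightarrow> nat \<Rightarrow> nat \<times> nat \<Rightarrow> real" where
  "ctr Qs k = (\<lambda>(a, b). mt Qs k $$ (a, b))"

definition rt :: "real mat list \<Rightarrow> nat \<Rightarrow> ereal" where
  "rt Qs l = rate_l \<sigma> R Ms N P lam l (mt Qs l) (mt Qs (l - 1))"

abbreviation rate :: "real mat list \<Rightarrow> ereal" where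
  "rate \<equiv> rate_total \<sigma> R Ms L N P lam (Cs 1 0) \<alpha> Kone"

abbreviation \<mu> :: "nat \<Rightarrow> (nat \<times> 'm \<times> nat \<times> nat \<Rightarrow> real) measure" where
  "\<mu> n \<equiv> weight_prior L Ms (Cs n) lam"

lemma rate_sum: "rate Qs = (\<Sum>l\<in>{1..L}. ereal (\<alpha> l) * rt Qs l)"
proof -
  have "(\<Sum>l\<in>{1..L}. ereal (\<alpha> l) * rt Qs l) = ereal (\<alpha> 1) * rt Qs 1 + (\<Sum>l\<in>{2..L}. ereal (\<alpha> l) * rt Qs l)"
    using sum.atLeast_Suc_atMost[OF L_pos, of "\<lambda>l. ereal (\<alpha> l) * rt Qs l"] by (simp add: numeral_2_eq_2)
  also have "(\<Sum>l\<in>{2..L}. ereal (\<alpha> l) * rt Qs l)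
      = (\<Sum>l\<in>{2..L}. ereal (\<alpha> l) * rate_l \<sigma> R Ms N P lam l (Qs ! (l - 1)) (Qs ! (l - 2)))"
    by (intro sum.cong refl) (auto simp: rt_def mt_def numeral_2_eq_2)
  finally show ?thesis by (simp add: rate_total_def rt_def mt_def)
qed

lemma Kone_entry: "1 \<le> n \<Longrightarrow> a < dm 1 \<Longrightarrow> b < dm 1 \<Longrightarrow> net.gram n W 0 a b = Kone $$ (a, b)"
  using net.gram_0[of a b n W] C0_fixed[of n] by (simp add: Kone_def)

lemma Kone_psd: "Kone \<in> psd_mats (dm 1)"
proof -
  obtain A where A: "\<And>a b. a < dm 1 \<Longrightarrow> b < dm 1 \<Longrightarrow> cov (dm 1) A a b = net.gram 1 (\<lambda>_. 0) 0 a b"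
    using net.gram_factor[of 0 "dm 1" 1 "\<lambda>_. 0"] by auto
  have K: "Kone $$ (a, b) = cov (dm 1) A a b" if "a < dm 1" "b < dm 1" for a b
    using A[OF that] Kone_entry[of 1 a b] that by simp
  show ?thesis
    unfolding psd_mats_iff
  proof (intro conjI allI impI)
    show "Kone \<in> carrier_mat (dm 1) (dm 1)" by (simp add: Kone_def K1_def)
    show "Kone $$ (a, b) = Kone $$ (b, a)" if "a < dm 1" "b < dm 1" for a b
      using that by (simp add: K cov_def mult.commute)
    fix v :: "nat \<Rightarrow> real"
    have "(\<Sum>a<dm 1. \<Sum>b<dm 1. v a * Kone $$ (a, b) * v b) = (\<Sum>a<dm 1. \<Sum>b<dm 1. v a * v b * cov (dm 1) A a b)"
      by (intro sum.cong refl) (simp add: K)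
    also have "\<dots> = (\<Sum>k<dm 1. (\<Sum>a<dm 1. v a * A a k)\<^sup>2)" by (rule sum_square_cov[symmetric])
    finally show "0 \<le> (\<Sum>a<dm 1. \<Sum>b<dm 1. v a * Kone $$ (a, b) * v b)" by (simp add: sum_nonneg)
  qed
qed

lemma mt_psd:
  assumes "Qs \<in> tuple_space L N P" "k \<le> L"
  shows "mt Qs k \<in> psd_mats (dm (Suc k))"
proof (cases k)
  case 0
  then show ?thesis using Kone_psd by (simp add: mt_def)
next
  case (Suc j)
  then have "Qs ! j \<in> psd_mats (N (j + 2) * P)" using assms by (simp add: tuple_space_def)
  then show ?thesis using Suc by (simp add: mt_def)
qed

lemma rt_nonneg: "Qs \<in> tuple_space L N P \<Longrightarrow> l \<in> {1..L} \<Longrightarrow> 0 \<le> rt Qs l"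
  unfolding rt_def
  by (rule layer_rate.rate_l_nonneg[OF rate_locale]) (use mt_psd[of Qs l] in \<open>auto simp: psd_mats_iff\<close>)

lemma X_in: "X n W \<in> tuple_space L N P"
  unfolding tuple_space_def mem_Collect_eq
proof (intro conjI allI impI)
  fix k assume k: "k < L"
  then have "X n W ! k = Kmat \<sigma> R Ms (Cs n) N P lam x W (Suc k)" by (simp add: X_def del: upt_Suc)
  then show "X n W ! k \<in> psd_mats (N (k + 2) * P)" using net.Kmat_psd[of "Suc k" n W] k by simp
qed (simp add: X_def)

lemma entry_X:
  assumes "p \<in> tuple_index L N P"
  obtains k a b where "p = (k, a, b)" "k < L" "(a, b) \<in> idx (Suc k)" "\<And>n W. entry (X n W) p = net.Kf n (Suc k) W (a, b)"
    "\<And>Qs. entry Qs p = ctr Qs (Suc k) (a, b)"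
proof -
  obtain k a b where p: "p = (k, a, b)" "k < L" "(a, b) \<in> idx (Suc k)"
    using assms by (auto simp: tuple_index_def)
  have "entry (X n W) p = net.Kf n (Suc k) W (a, b)" for n W
    using p net.gram_Kmat[of "Suc k" a b n W] by (simp add: entry_def X_def net.Kf_def del: upt_Suc)
  moreover have "entry Qs p = ctr Qs (Suc k) (a, b)" for Qs
    using p by (simp add: entry_def ctr_def mt_def)
  ultimately show ?thesis using that p by blast
qed

lemma Kf_entry_X:
  assumes "k \<in> {1..L}" "(a, b) \<in> idx k"
  shows "(k - 1, a, b) \<in> tuple_index L N P" "net.Kf n k W (a, b) = entry (X n W) (k - 1, a, b)"
    "ctr Qs k (a, b) = entry Qs (k - 1, a, b)"
proof -
  show p: "(k - 1, a, b) \<in> tuple_index L N P" using assms by (auto simp: tuple_index_def)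
  show "ctr Qs k (a, b) = entry Qs (k - 1, a, b)" using assms by (simp add: entry_def ctr_def mt_def)
  obtain k' a' b' where "(k - 1, a, b) = (k', a', b')" "entry (X n W) (k - 1, a, b) = net.Kf n (Suc k') W (a', b')"
    using entry_X[OF p] by metis
  moreover from this(1) have "Suc k' = k" using assms(1) by auto
  ultimately show "net.Kf n k W (a, b) = entry (X n W) (k - 1, a, b)" by simp
qed

lemma \<mu>_eq: "\<mu> n = PiM (net.WI n) net.gauss"
  by (rule net.weight_prior_eq)

lemma Kf_in_space: "l \<le> L \<Longrightarrow> W \<in> space (PiM (net.WI n) net.gauss) \<Longrightarrow> net.Kf n l W \<in> space (PiM (idx l) (\<lambda>_. borel))"
  using measurable_space[OF net.Kf_meas] .

lemma X_meas:
  assumes "openin (Metric_space.mtopology (tuple_space L N P) (tuple_dist L N P)) U"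
  shows "{W \<in> space (\<mu> n). X n W \<in> U} \<in> sets (\<mu> n)"
proof (rule tuple_open_measurable[OF X_in _ assms])
  fix p assume "p \<in> tuple_index L N P"
  then obtain k a b where k: "k < L" "(a, b) \<in> idx (Suc k)" "\<And>W. entry (X n W) p = net.Kf n (Suc k) W (a, b)"
    using entry_X by metis
  have "(\<lambda>y. y (a, b)) \<in> borel_measurable (PiM (idx (Suc k)) (\<lambda>_. borel :: real measure))"
    by (rule measurable_component_singleton) (use k in auto)
  from measurable_compose[OF net.Kf_meas[where l = "Suc k" and n = n] this] k
  show "(\<lambda>W. entry (X n W) p) \<in> borel_measurable (\<mu> n)" unfolding \<mu>_eq k(3) by auto
qed

lemma prob_\<mu>: "prob_space (\<mu> n)"
  unfolding \<mu>_eq by (rule net.W.P.prob_space_axioms)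

lemma Kf_0: "1 \<le> n \<Longrightarrow> p \<in> idx 0 \<Longrightarrow> net.Kf n 0 W p = ctr Qs 0 p"
  using Kone_entry by (auto simp: net.Kf_def ctr_def mt_def)

lemma cov_factor:
  assumes "Qs \<in> tuple_space L N P" "l \<in> {1..L}" "a < dm l" "b < dm l"
  shows "cov (dm l) (some_factor (dm l) (mt Qs (l - 1))) a b = ctr Qs (l - 1) (a, b)"
proof -
  have "mt Qs (l - 1) \<in> psd_mats (dm l)" using mt_psd[OF assms(1), of "l - 1"] assms(2) by (cases l) auto
  from cov_some_factor[OF this assms(3,4)] show ?thesis by (simp add: ctr_def)
qed

lemma restrict_cov_box:
  assumes "restrict (\<lambda>(a, b). cov (dm (Suc l)) A a b) (idx l) \<in> net.box l q \<delta>" "a < dm (Suc l)" "b < dm (Suc l)"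
  shows "\<bar>cov (dm (Suc l)) A a b - q (a, b)\<bar> < \<delta>"
proof -
  have "(a, b) \<in> idx l" using assms by simp
  then have "\<bar>restrict (\<lambda>(a, b). cov (dm (Suc l)) A a b) (idx l) (a, b) - q (a, b)\<bar> < \<delta>"
    using assms(1) unfolding net.box_def by blast
  then show ?thesis using assms(2,3) by simp
qed

lemma C_ratio: "(\<lambda>n. (\<Sum>l\<in>{1..L}. real (Cs n l) * b l) / real n) \<longlonglongrightarrow> (\<Sum>l\<in>{1..L}. \<alpha> l * b l)"
proof -
  have "(\<lambda>n. \<Sum>l\<in>{1..L}. real (Cs n l) / real n * b l) \<longlonglongrightarrow> (\<Sum>l\<in>{1..L}. \<alpha> l * b l)"
    by (intro tendsto_intros C_lim)
  then show ?thesis by (simp add: sum_divide_distrib)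
qed

text \<open>One radius serves both for the conditioning neighbourhood of each kernel and for the
  target of the next, so that the one-step bounds chain over a single ball of tuples.\<close>

lemma upper_estimate:
  assumes Qs: "Qs \<in> tuple_space L N P" and a: "ereal a < rate Qs"
  shows "\<exists>\<delta>>0. \<forall>\<^sub>F n in sequentially.
    measure (\<mu> n) {W \<in> space (\<mu> n). X n W \<in> tuples.mball L N P Qs \<delta>} \<le> exp (- (real n * a))"
proof -
  obtain b where b: "\<And>l. l \<in> {1..L} \<Longrightarrow> ereal (b l) < rt Qs l" "a < (\<Sum>l\<in>{1..L}. \<alpha> l * b l)"
    using ereal_weighted_sum_less_obtain[of "{1..L}" \<alpha> "rt Qs" a] \<alpha>_pos rt_nonneg[OF Qs] a unfolding rate_sum by auto
  define ok where "ok l \<delta> \<longleftrightarrow> 0 < \<delta> \<and> (\<forall>A. (\<forall>i<dm l. \<forall>j<dm l. \<bar>cov (dm l) A i j - ctr Qs (l - 1) (i, j)\<bar> \<le> \<delta>) \<longrightarrow>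
    (\<forall>C. measure (PiM {1..C} (\<lambda>_. std_gauss (dm l))) (feature_map.near (dm l) (idx l) (net.gm l) C A (ctr Qs l) \<delta>) \<le> exp (- (C * b l))))" for l \<delta>
  have "\<forall>l\<in>{1..L}. \<exists>\<delta>. ok l \<delta>"
  proof
    fix l assume l: "l \<in> {1..L}"
    interpret F: layer_rate \<sigma> R Ms N P lam l "\<Lambda> l" by (rule rate_locale[OF l])
    have "mt Qs l \<in> carrier_mat (dm (Suc l)) (dm (Suc l))" using mt_psd[OF Qs, of l] l by (simp add: psd_mats_iff)
    from F.rate_l_greaterD[OF this b(1)[OF l, unfolded rt_def]]
    obtain t where t: "F.F.mgf (some_factor (dm l) (mt Qs (l - 1))) t < \<infinity>"
      "b l < F.F.ip t (ctr Qs l) - ln (enn2real (F.F.mgf (some_factor (dm l) (mt Qs (l - 1))) t))"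
      unfolding ctr_def by blast
    show "\<exists>\<delta>. ok l \<delta>"
      using F.F.upper_bound_near_covariance[OF t] cov_factor[OF Qs l] unfolding ok_def by simp
  qed
  then obtain \<delta> where \<delta>: "\<And>l. l \<in> {1..L} \<Longrightarrow> ok l (\<delta> l)" by metis
  define \<epsilon> where "\<epsilon> = Min (\<delta> ` {1..L})"
  have \<epsilon>: "0 < \<epsilon>" unfolding \<epsilon>_def using L_pos \<delta> by (subst Min_gr_iff) (auto simp: ok_def)
  have \<epsilon>\<delta>: "\<epsilon> \<le> \<delta> l" if "l \<in> {1..L}" for l unfolding \<epsilon>_def using that by (intro Min_le) auto
  show ?thesis
  proof (intro exI[of _ \<epsilon>] conjI \<epsilon>)
    have "\<forall>\<^sub>F n in sequentially. a < (\<Sum>l\<in>{1..L}. real (Cs n l) * b l) / real n"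
      using C_ratio b(2) by (rule order_tendstoD(1))
    then show "\<forall>\<^sub>F n in sequentially.
      measure (\<mu> n) {W \<in> space (\<mu> n). X n W \<in> tuples.mball L N P Qs \<epsilon>} \<le> exp (- (real n * a))"
      using eventually_ge_at_top[of 1]
    proof eventually_elim
      case (elim n)
      let ?B = "\<lambda>k. net.box k (ctr Qs k) \<epsilon>"
      have "measure (\<mu> n) {W \<in> space (\<mu> n). X n W \<in> tuples.mball L N P Qs \<epsilon>} \<le> net.pr n (net.all_in n L ?B)"
        unfolding \<mu>_eq
      proof (rule net.W.P.finite_measure_mono)
        show "{W \<in> space (PiM (net.WI n) net.gauss). net.all_in n L ?B W} \<in> sets (PiM (net.WI n) net.gauss)"
          by (intro net.all_in_sets net.box_sets) simp
        show "{W \<in> space (PiM (net.WI n) net.gauss). X n W \<in> tuples.mball L N P Qs \<epsilon>}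
            \<subseteq> {W \<in> space (PiM (net.WI n) net.gauss). net.all_in n L ?B W}"
        proof (intro subsetI CollectI conjI, elim CollectE conjE, assumption)
          fix W assume "W \<in> {W \<in> space (PiM (net.WI n) net.gauss). X n W \<in> tuples.mball L N P Qs \<epsilon>}"
          then have W: "W \<in> space (PiM (net.WI n) net.gauss)" "tuple_dist L N P (X n W) Qs < \<epsilon>"
            by (auto simp: tuples.commute)
          show "net.all_in n L ?B W"
            unfolding net.all_in_def
          proof (intro allI impI)
            fix k assume k: "k \<le> L"
            have "\<bar>net.Kf n k W p - ctr Qs k p\<bar> < \<epsilon>" if p: "p \<in> idx k" for p
            proof (cases "k = 0")
              case True
              then show ?thesis using Kf_0[OF elim(2), of p W Qs] p \<epsilon> by simp
            next
              case False
              obtain a b where ab: "p = (a, b)" by (cases p)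
              have k1: "k \<in> {1..L}" "(a, b) \<in> idx k" using False k p ab by auto
              show ?thesis
                using entry_diff_le_tuple_dist[OF Kf_entry_X(1)[OF k1], of "X n W" Qs] W(2)
                unfolding ab Kf_entry_X(2,3)[OF k1] by linarith
            qed
            then show "net.Kf n k W \<in> ?B k" using Kf_in_space[OF k W(1)] by (simp add: net.box_def)
          qed
        qed
      qed
      also have "\<dots> \<le> exp (- (\<Sum>k\<in>{1..L}. real (Cs n k) * b k))"
      proof (rule net.chain_upper)
        show "?B k \<in> sets (PiM (idx k) (\<lambda>_. borel))" for k by (rule net.box_sets)
        fix k A assume k: "k < L" and A: "restrict (\<lambda>(a, b). cov (dm (Suc k)) A a b) (idx k) \<in> ?B k"
        have k1: "Suc k \<in> {1..L}" using k by simp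
        interpret F: feature_map "dm (Suc k)" "idx (Suc k)" "net.gm (Suc k)" "\<Lambda> (Suc k)" by (rule net.feature[OF k1])
        have C: "1 \<le> Cs n (Suc k)" using C_pos[of n "Suc k"] elim(2) k by simp
        have "measure (F.\<Omega> (Cs n (Suc k))) (F.near (Cs n (Suc k)) A (ctr Qs (Suc k)) \<epsilon>)
            \<le> measure (F.\<Omega> (Cs n (Suc k))) (F.near (Cs n (Suc k)) A (ctr Qs (Suc k)) (\<delta> (Suc k)))"
          by (rule finite_measure.finite_measure_mono[OF prob_space.finite_measure[OF F.prob_space_\<Omega>] F.near_mono[OF \<epsilon>\<delta>[OF k1]] F.near_meas])
        also have "\<dots> \<le> exp (- (real (Cs n (Suc k)) * b (Suc k)))"
        proof -
          have "\<bar>cov (dm (Suc k)) A i j - ctr Qs (Suc k - 1) (i, j)\<bar> \<le> \<delta> (Suc k)" if "i < dm (Suc k)" "j < dm (Suc k)" for i j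
            using restrict_cov_box[OF A that] \<epsilon>\<delta>[OF k1] by simp
          then show ?thesis using \<delta>[OF k1] unfolding ok_def by blast
        qed
        finally show "net.trans n (Suc k) A (?B (Suc k)) \<le> exp (- (real (Cs n (Suc k)) * b (Suc k)))"
          unfolding net.trans_box[OF k1 C] .
      qed simp
      also have "\<dots> \<le> exp (- (real n * a))"
        using elim by (simp add: less_divide_eq mult.commute)
      finally show ?case .
    qed
  qed
qed

lemma C_at_top:
  assumes "l \<in> {1..L}" shows "\<forall>\<^sub>F n in sequentially. C0 \<le> Cs n l"
proof -
  have "filterlim (\<lambda>n. real (Cs n l) / real n * real n) at_top sequentially"
    by (rule filterlim_tendsto_pos_mult_at_top[OF C_lim[OF assms] \<alpha>_pos[OF assms] filterlim_real_sequentially])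
  then have "\<forall>\<^sub>F n in sequentially. real C0 \<le> real (Cs n l) / real n * real n"
    by (simp add: filterlim_at_top)
  then show ?thesis using eventually_ge_at_top[of 1] by eventually_elim simp
qed

text \<open>Induction for all radii at once: the radius wanted at \<open>Suc l\<close> dictates,
  through \<open>lower_bound_near_covariance\<close>, a possibly smaller one at \<open>l\<close>, so
  radii shrink backwards along the chain.\<close>

lemma lower_chain:
  assumes Qs: "Qs \<in> tuple_space L N P" and c: "\<And>l. l \<in> {1..L} \<Longrightarrow> rt Qs l = ereal (c l)"
    and b: "\<And>l. l \<in> {1..L} \<Longrightarrow> c l < b l" and "l \<le> L" "0 < \<delta>"
  shows "\<forall>\<^sub>F n in sequentially. exp (- (\<Sum>k\<in>{1..l}. real (Cs n k) * b k)) \<le> net.pr n (net.all_in n l (\<lambda>k. net.box k (ctr Qs k) \<delta>))"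
  using assms(4,5)
proof (induction l arbitrary: \<delta>)
  case 0
  show ?case using eventually_ge_at_top[of 1]
  proof eventually_elim
    case (elim n)
    have "{W \<in> space (PiM (net.WI n) net.gauss). net.all_in n 0 (\<lambda>k. net.box k (ctr Qs k) \<delta>) W} = space (PiM (net.WI n) net.gauss)"
      using Kf_in_space[of 0] Kf_0[OF elim, of _ _ Qs] 0 by (auto simp: net.all_in_def net.box_def)
    then show ?case by (simp add: net.W.P.prob_space)
  qed
next
  case (Suc l)
  have l: "Suc l \<in> {1..L}" using Suc.prems by simp
  interpret F: layer_rate \<sigma> R Ms N P lam "Suc l" "\<Lambda> (Suc l)" by (rule rate_locale[OF l])
  have "mt Qs (Suc l) \<in> sym_mats (dm (Suc (Suc l)))" using mt_psd[OF Qs, of "Suc l"] l by (simp add: psd_mats_def)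
  from F.rate_l_leD[OF this] have "F.F.ip t (ctr Qs (Suc l)) - ln (enn2real (F.F.mgf (some_factor (dm (Suc l)) (mt Qs (Suc l - 1))) t)) \<le> c (Suc l)"
    if "F.F.mgf (some_factor (dm (Suc l)) (mt Qs (Suc l - 1))) t < \<infinity>" for t
    using that c[OF l] unfolding rt_def ctr_def by simp
  from F.F.lower_bound_near_covariance[OF this b[OF l] Suc.prems(2)]
  obtain d and C0 :: nat where d: "0 < d" "\<And>C A. C0 \<le> C \<Longrightarrow>
      (\<forall>i<dm (Suc l). \<forall>j<dm (Suc l). \<bar>cov (dm (Suc l)) A i j - cov (dm (Suc l)) (some_factor (dm (Suc l)) (mt Qs (Suc l - 1))) i j\<bar> \<le> d) \<Longrightarrow>
      exp (- (real C * b (Suc l))) \<le> measure (F.F.\<Omega> C) (F.F.near C A (ctr Qs (Suc l)) \<delta>)"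
    by blast
  define \<delta>' where "\<delta>' = min \<delta> d"
  have \<delta>': "0 < \<delta>'" using d(1) Suc.prems by (simp add: \<delta>'_def)
  have "\<forall>\<^sub>F n in sequentially. exp (- (\<Sum>k\<in>{1..l}. real (Cs n k) * b k)) \<le> net.pr n (net.all_in n l (\<lambda>k. net.box k (ctr Qs k) \<delta>'))"
    using Suc.prems by (intro Suc.IH \<delta>') simp
  then show ?case using C_at_top[OF l, of C0] eventually_ge_at_top[of 1]
  proof eventually_elim
    case (elim n)
    have C: "1 \<le> Cs n (Suc l)" using C_pos[of n "Suc l"] elim(3) l by simp
    have "exp (- (\<Sum>k\<in>{1..Suc l}. real (Cs n k) * b k))
        = exp (- (real (Cs n (Suc l)) * b (Suc l))) * exp (- (\<Sum>k\<in>{1..l}. real (Cs n k) * b k))"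
      by (simp add: exp_add[symmetric])
    also have "\<dots> \<le> exp (- (real (Cs n (Suc l)) * b (Suc l))) * net.pr n (net.all_in n l (\<lambda>k. net.box k (ctr Qs k) \<delta>'))"
      using elim(1) by (intro mult_left_mono) auto
    also have "\<dots> \<le> net.pr n (net.all_in n (Suc l) (\<lambda>k. net.box k (ctr Qs k) \<delta>))"
    proof (rule net.chain_lower)
      show "net.box k (ctr Qs k) r \<in> sets (PiM (idx k) (\<lambda>_. borel))" for k r by (rule net.box_sets)
      show "net.box k (ctr Qs k) \<delta>' \<subseteq> net.box k (ctr Qs k) \<delta>" for k
        by (auto simp: net.box_def \<delta>'_def)
      fix A assume A: "restrict (\<lambda>(a, b). cov (dm (Suc l)) A a b) (idx l) \<in> net.box l (ctr Qs l) \<delta>'"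
      have "\<bar>cov (dm (Suc l)) A i j - cov (dm (Suc l)) (some_factor (dm (Suc l)) (mt Qs (Suc l - 1))) i j\<bar> \<le> d"
        if "i < dm (Suc l)" "j < dm (Suc l)" for i j
        using restrict_cov_box[OF A that] cov_factor[OF Qs l that] by (simp add: \<delta>'_def)
      then show "exp (- (real (Cs n (Suc l)) * b (Suc l))) \<le> net.trans n (Suc l) A (net.box (Suc l) (ctr Qs (Suc l)) \<delta>)"
        unfolding net.trans_box[OF l C] using elim(2) by (intro d(2)) auto
    qed (use l in \<open>auto intro: net.box_sets\<close>)
    finally show ?case .
  qed
qed

lemma lower_estimate:
  assumes Qs: "Qs \<in> tuple_space L N P" and \<delta>: "0 < \<delta>" and a: "rate Qs < ereal a"
  shows "\<forall>\<^sub>F n in sequentially. exp (- (real n * a)) \<le> measure (\<mu> n) {W \<in> space (\<mu> n). X n W \<in> tuples.mball L N P Qs \<delta>}"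
proof -
  obtain c b where c: "\<And>l. l \<in> {1..L} \<Longrightarrow> rt Qs l = ereal (c l)" and b: "\<And>l. l \<in> {1..L} \<Longrightarrow> c l < b l" "(\<Sum>l\<in>{1..L}. \<alpha> l * b l) < a"
    using ereal_weighted_sum_greater_obtain[of "{1..L}" \<alpha> "rt Qs" a] \<alpha>_pos rt_nonneg[OF Qs] a unfolding rate_sum by auto
  \<comment> \<open>Tuples whose entries are all within this distance of \<open>Qs\<close> lie
    inside the metric ball of radius \<open>\<delta>\<close>, by
    \<open>tuple_dist_less\<close>.\<close>
  define \<epsilon> where "\<epsilon> = \<delta> / (real (card (tuple_index L N P)) + 1)"
  have \<epsilon>: "0 < \<epsilon>" unfolding \<epsilon>_def using \<delta> by (intro divide_pos_pos) auto
  have "\<forall>\<^sub>F n in sequentially. (\<Sum>l\<in>{1..L}. real (Cs n l) * b l) / real n < a"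
    using C_ratio b(2) by (rule order_tendstoD(2))
  moreover have "\<forall>\<^sub>F n in sequentially. exp (- (\<Sum>k\<in>{1..L}. real (Cs n k) * b k))
      \<le> net.pr n (net.all_in n L (\<lambda>k. net.box k (ctr Qs k) \<epsilon>))"
    by (rule lower_chain[OF Qs c b(1) order_refl \<epsilon>])
  ultimately show ?thesis
    using eventually_ge_at_top[of 1]
  proof eventually_elim
    case (elim n)
    let ?B = "\<lambda>k. net.box k (ctr Qs k) \<epsilon>"
    have "exp (- (real n * a)) \<le> exp (- (\<Sum>l\<in>{1..L}. real (Cs n l) * b l))"
      using elim(1,3) by (simp add: divide_less_eq mult.commute)
    also have "\<dots> \<le> net.pr n (net.all_in n L ?B)" by (rule elim(2))
    also have "\<dots> \<le> measure (\<mu> n) {W \<in> space (\<mu> n). X n W \<in> tuples.mball L N P Qs \<delta>}"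
      unfolding \<mu>_eq
    proof (rule net.W.P.finite_measure_mono)
      show "{W \<in> space (PiM (net.WI n) net.gauss). X n W \<in> tuples.mball L N P Qs \<delta>} \<in> sets (PiM (net.WI n) net.gauss)"
        using X_meas[OF tuples.openin_mball] unfolding \<mu>_eq .
      show "{W \<in> space (PiM (net.WI n) net.gauss). net.all_in n L ?B W}
          \<subseteq> {W \<in> space (PiM (net.WI n) net.gauss). X n W \<in> tuples.mball L N P Qs \<delta>}"
      proof (intro subsetI, elim CollectE conjE, intro CollectI conjI)
        fix W assume W: "net.all_in n L ?B W"
        have "tuple_dist L N P (X n W) Qs < \<delta>"
        proof (rule tuple_dist_less[OF \<delta>])
          fix p assume "p \<in> tuple_index L N P"
          then obtain k a b where k: "k < L" "(a, b) \<in> idx (Suc k)" "entry (X n W) p = net.Kf n (Suc k) W (a, b)" "entry Qs p = ctr Qs (Suc k) (a, b)"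
            using entry_X by metis
          have "net.Kf n (Suc k) W \<in> ?B (Suc k)" using W k(1) by (simp add: net.all_in_def Suc_le_eq)
          then have "\<bar>net.Kf n (Suc k) W (a, b) - ctr Qs (Suc k) (a, b)\<bar> < \<epsilon>" using k(2) unfolding net.box_def by blast
          then show "\<bar>entry (X n W) p - entry Qs p\<bar> \<le> \<delta> / (real (card (tuple_index L N P)) + 1)"
            unfolding k(3,4) \<epsilon>_def[symmetric] by simp
        qed
        then show "X n W \<in> tuples.mball L N P Qs \<delta>" using Qs X_in by (simp add: tuples.commute)
      qed
    qed
    finally show ?case .
  qed
qed

text \<open>The box for one kernel bounds the rows of its factors and hence, by
  \<open>exponential_tightness\<close>, yields the box for the next kernel. Each transition adds one
  exponential term, which accounts for the factor \<open>l\<close>.\<close>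

lemma tight_chain:
  assumes "l \<le> L"
  shows "\<exists>r\<ge>0. \<forall>\<^sub>F n in sequentially. net.pr n (\<lambda>W. \<not> net.all_in n l (net.bdd r) W) \<le> real l * exp (- (real n * a))"
  using assms
proof (induction l)
  case 0
  \<comment> \<open>Position 0 of \<open>ctr\<close> is the fixed first kernel whatever the tuple,
    so the empty list may stand for it.\<close>
  define r where "r = (\<Sum>p\<in>idx 0. \<bar>ctr [] 0 p\<bar>)"
  have r: "0 \<le> r" "\<And>p. p \<in> idx 0 \<Longrightarrow> \<bar>ctr [] 0 p\<bar> \<le> r"
    unfolding r_def by (auto intro!: sum_nonneg member_le_sum[of _ _ "\<lambda>p. \<bar>ctr [] 0 p\<bar>"])
  have "\<forall>\<^sub>F n in sequentially. net.pr n (\<lambda>W. \<not> net.all_in n 0 (net.bdd r) W) \<le> real 0 * exp (- (real n * a))"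
    using eventually_ge_at_top[of 1]
  proof eventually_elim
    case (elim n)
    have "{W \<in> space (PiM (net.WI n) net.gauss). \<not> net.all_in n 0 (net.bdd r) W} = {}"
      using Kf_in_space[of 0 _ n] Kf_0[OF elim, of _ _ "[]"] r(2) by (auto simp: net.all_in_def net.bdd_def)
    then show ?case by (simp only: measure_empty)
  qed
  then show ?case using r(1) by blast
next
  case (Suc l)
  have l: "Suc l \<in> {1..L}" using Suc.prems by simp
  interpret F: feature_map "dm (Suc l)" "idx (Suc l)" "net.gm (Suc l)" "\<Lambda> (Suc l)" by (rule net.feature[OF l])
  obtain r where r: "0 \<le> r" "\<forall>\<^sub>F n in sequentially. net.pr n (\<lambda>W. \<not> net.all_in n l (net.bdd r) W) \<le> real l * exp (- (real n * a))"
    using Suc by auto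
  \<comment> \<open>Converts the speed: eventually \<open>Cs n (Suc l)\<close> exceeds
    \<open>n * \<alpha> (Suc l) / 2\<close>, so decay at rate \<open>a'\<close> in the channels is
    decay at rate at least \<open>a\<close> in \<open>n\<close>.\<close>
  define a' where "a' = 2 * \<bar>a\<bar> / \<alpha> (Suc l)"
  have a': "0 \<le> a'" using \<alpha>_pos[OF l] by (simp add: a'_def)
  obtain s where s: "\<And>C A. \<forall>i<dm (Suc l). (\<Sum>k<dm (Suc l). (A i k)\<^sup>2) \<le> r \<Longrightarrow>
    measure (F.\<Omega> C) {\<omega> \<in> space (F.\<Omega> C). \<exists>j\<in>idx (Suc l). real C * s < \<bar>\<Sum>c\<in>{1..C}. net.gm (Suc l) (lin (dm (Suc l)) A (\<omega> c)) j\<bar>} \<le> exp (- (real C * a'))"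
    using F.exponential_tightness[of r a'] by blast
  define r' where "r' = max r s"
  have "\<forall>\<^sub>F n in sequentially. \<alpha> (Suc l) / 2 < real (Cs n (Suc l)) / real n"
    using \<alpha>_pos[OF l] by (intro order_tendstoD(1)[OF C_lim[OF l]]) simp
  then have "\<forall>\<^sub>F n in sequentially. net.pr n (\<lambda>W. \<not> net.all_in n (Suc l) (net.bdd r') W) \<le> real (Suc l) * exp (- (real n * a))"
    using r(2) eventually_ge_at_top[of 1]
  proof eventually_elim
    case (elim n)
    let ?C = "Cs n (Suc l)"
    have C: "1 \<le> ?C" using C_pos[of n "Suc l"] elim(3) l by simp
    have "net.pr n (\<lambda>W. \<not> net.all_in n (Suc l) (net.bdd r') W)
        \<le> net.pr n (\<lambda>W. \<not> net.all_in n l (net.bdd r) W) + exp (- (real ?C * a'))"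
    proof (rule net.chain_tight)
      fix A assume A: "\<And>a b. (a, b) \<in> idx l \<Longrightarrow> \<bar>cov (dm (Suc l)) A a b\<bar> \<le> r"
      have "\<forall>i<dm (Suc l). (\<Sum>k<dm (Suc l). (A i k)\<^sup>2) \<le> r"
      proof (intro allI impI)
        fix i assume "i < dm (Suc l)"
        then have "\<bar>cov (dm (Suc l)) A i i\<bar> \<le> r" by (intro A) simp
        then show "(\<Sum>k<dm (Suc l). (A i k)\<^sup>2) \<le> r" by (simp add: cov_def power2_eq_square)
      qed
      note bound = s[OF this, of ?C]
      have "measure (F.\<Omega> ?C) {\<omega> \<in> space (F.\<Omega> ?C). \<exists>p\<in>idx (Suc l). real ?C * r' < \<bar>\<Sum>c\<in>{1..?C}. net.gm (Suc l) (lin (dm (Suc l)) A (\<omega> c)) p\<bar>}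
          \<le> measure (F.\<Omega> ?C) {\<omega> \<in> space (F.\<Omega> ?C). \<exists>p\<in>idx (Suc l). real ?C * s < \<bar>\<Sum>c\<in>{1..?C}. net.gm (Suc l) (lin (dm (Suc l)) A (\<omega> c)) p\<bar>}"
      proof (rule finite_measure.finite_measure_mono[OF prob_space.finite_measure[OF F.prob_space_\<Omega>]])
        have "real ?C * s \<le> real ?C * r'" by (intro mult_left_mono) (auto simp: r'_def)
        then show "{\<omega> \<in> space (F.\<Omega> ?C). \<exists>p\<in>idx (Suc l). real ?C * r' < \<bar>\<Sum>c\<in>{1..?C}. net.gm (Suc l) (lin (dm (Suc l)) A (\<omega> c)) p\<bar>}
          \<subseteq> {\<omega> \<in> space (F.\<Omega> ?C). \<exists>p\<in>idx (Suc l). real ?C * s < \<bar>\<Sum>c\<in>{1..?C}. net.gm (Suc l) (lin (dm (Suc l)) A (\<omega> c)) p\<bar>}"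
          by (blast intro: le_less_trans)
        have "(\<lambda>\<omega>. \<bar>\<Sum>c\<in>{1..?C}. net.gm (Suc l) (lin (dm (Suc l)) A (\<omega> c)) p\<bar>) \<in> borel_measurable (F.\<Omega> ?C)" if "p \<in> idx (Suc l)" for p
          using F.g_\<omega>_meas[OF that] by (intro borel_measurable_abs borel_measurable_sum)
        then show "{\<omega> \<in> space (F.\<Omega> ?C). \<exists>p\<in>idx (Suc l). real ?C * s < \<bar>\<Sum>c\<in>{1..?C}. net.gm (Suc l) (lin (dm (Suc l)) A (\<omega> c)) p\<bar>} \<in> sets (F.\<Omega> ?C)"
          by (intro sets.sets_Collect_finite_Ex borel_measurable_less borel_measurable_const) auto
      qed
      with bound show "net.trans n (Suc l) A (space (PiM (idx (Suc l)) (\<lambda>_. borel)) - net.bdd r' (Suc l)) \<le> exp (- (real ?C * a'))"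
        unfolding net.trans_unbounded[OF l C] by (rule order_trans[rotated])
    qed (use l in \<open>auto simp: r'_def\<close>)
    also have "exp (- (real ?C * a')) \<le> exp (- (real n * a))"
    proof -
      have "real n * (\<alpha> (Suc l) / 2) \<le> real ?C" using elim(1,3) by (simp add: field_simps)
      then have "real n * (\<alpha> (Suc l) / 2) * a' \<le> real ?C * a'" using a' by (intro mult_right_mono)
      moreover have "real n * (\<alpha> (Suc l) / 2) * a' = real n * \<bar>a\<bar>" using \<alpha>_pos[OF l] by (simp add: a'_def)
      moreover have "real n * a \<le> real n * \<bar>a\<bar>" by (intro mult_left_mono) auto
      ultimately have "real n * a \<le> real ?C * a'" by linarith
      then show ?thesis by simp
    qed
    finally show ?case using elim(2) by (simp add: algebra_simps)
  qed
  moreover have "0 \<le> r'" using r(1) by (simp add: r'_def)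
  ultimately show ?case by blast
qed

lemma tight_estimate:
  "\<exists>K. compactin (Metric_space.mtopology (tuple_space L N P) (tuple_dist L N P)) K \<and>
    (\<forall>\<^sub>F n in sequentially. measure (\<mu> n) {W \<in> space (\<mu> n). X n W \<notin> K} \<le> exp (- (real n * a)))"
proof -
  \<comment> \<open>The surplus 1 in the level absorbs the factor \<open>L\<close>, which is at most
    \<open>exp n\<close> once \<open>L \<le> n\<close>.\<close>
  obtain r where r: "\<forall>\<^sub>F n in sequentially. net.pr n (\<lambda>W. \<not> net.all_in n L (net.bdd r) W) \<le> real L * exp (- (real n * (a + 1)))"
    using tight_chain[OF order_refl, of "a + 1"] by blast
  let ?K = "{Qs \<in> tuple_space L N P. \<forall>p\<in>tuple_index L N P. \<bar>entry Qs p\<bar> \<le> r}"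
  have "\<forall>\<^sub>F n in sequentially. measure (\<mu> n) {W \<in> space (\<mu> n). X n W \<notin> ?K} \<le> exp (- (real n * a))"
    using r eventually_ge_at_top[of L]
  proof eventually_elim
    case (elim n)
    have "measure (\<mu> n) {W \<in> space (\<mu> n). X n W \<notin> ?K} \<le> net.pr n (\<lambda>W. \<not> net.all_in n L (net.bdd r) W)"
      unfolding \<mu>_eq
    proof (rule net.W.P.finite_measure_mono)
      have "{W \<in> space (PiM (net.WI n) net.gauss). net.all_in n L (net.bdd r) W} \<in> sets (PiM (net.WI n) net.gauss)"
        unfolding net.bdd_def by (intro net.all_in_sets net.cbox_sets) simp
      moreover have "{W \<in> space (PiM (net.WI n) net.gauss). \<not> net.all_in n L (net.bdd r) W}
          = space (PiM (net.WI n) net.gauss) - {W \<in> space (PiM (net.WI n) net.gauss). net.all_in n L (net.bdd r) W}" by auto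
      ultimately show "{W \<in> space (PiM (net.WI n) net.gauss). \<not> net.all_in n L (net.bdd r) W} \<in> sets (PiM (net.WI n) net.gauss)"
        by (simp only: sets.compl_sets)
      show "{W \<in> space (PiM (net.WI n) net.gauss). X n W \<notin> ?K} \<subseteq> {W \<in> space (PiM (net.WI n) net.gauss). \<not> net.all_in n L (net.bdd r) W}"
      proof (intro subsetI, elim CollectE conjE, intro CollectI conjI notI)
        fix W assume W: "X n W \<notin> ?K" "net.all_in n L (net.bdd r) W"
        have "\<bar>entry (X n W) p\<bar> \<le> r" if p: "p \<in> tuple_index L N P" for p
        proof -
          obtain k a b where k: "k < L" "(a, b) \<in> idx (Suc k)" "entry (X n W) p = net.Kf n (Suc k) W (a, b)"
            using entry_X[OF p] by metis
          have "net.Kf n (Suc k) W \<in> net.bdd r (Suc k)" using W(2) k(1) by (simp add: net.all_in_def Suc_le_eq)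
          then show ?thesis using k(2,3) unfolding net.bdd_def by simp
        qed
        then show False using W(1) X_in by blast
      qed
    qed
    also have "\<dots> \<le> real L * exp (- (real n * (a + 1)))" by (rule elim(1))
    also have "\<dots> \<le> exp (real n) * exp (- (real n * (a + 1)))"
    proof (rule mult_right_mono)
      have "real L \<le> 1 + real n" using elim(2) by simp
      also have "\<dots> \<le> exp (real n)" by (rule exp_ge_add_one_self)
      finally show "real L \<le> exp (real n)" .
    qed simp
    also have "\<dots> = exp (- (real n * a))" by (simp add: exp_add[symmetric] algebra_simps)
    finally show ?case .
  qed
  then show ?thesis using compact_tuple_box[of L N P r] by blast
qed

theorem kernel_good_LDP: "good_LDP (tuple_topology L N P) \<mu> X rate"
proof -
  interpret E: local_estimates "tuple_space L N P" "tuple_dist L N P" \<mu> X rate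
  proof (intro local_estimates.intro local_estimates_axioms.intro tuples.Metric_space_axioms)
  qed (rule prob_\<mu> X_in X_meas upper_estimate lower_estimate tight_estimate; assumption)+
  show ?thesis unfolding tuple_topology_def by (rule E.good_LDP_from_local_estimates)
qed

end

theorem mainTheorem4:
  fixes L P :: nat
    and N :: "nat \<Rightarrow> nat"
    and Cs :: "nat \<Rightarrow> nat \<Rightarrow> nat"
    and \<alpha> :: "nat \<Rightarrow> real"
    and \<sigma> :: "real \<Rightarrow> real"
    and Ms :: "nat \<Rightarrow> 'm set"
    and R :: "nat \<Rightarrow> nat \<Rightarrow> (nat \<Rightarrow> real) \<Rightarrow> 'm \<Rightarrow> real"
    and lam :: "nat \<Rightarrow> real"
    and x :: "nat \<Rightarrow> nat \<Rightarrow> nat \<Rightarrow> real"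
    and L\<sigma> LR :: real
    and \<rho>\<sigma> :: "real \<Rightarrow> real"
    and \<rho>R :: "nat \<Rightarrow> (nat \<Rightarrow> real) \<Rightarrow> real"
  assumes L_pos: "1 \<le> L" and P_pos: "1 \<le> P"
    and N_pos: "\<forall>l \<le> Suc L. 1 \<le> N l"
    and C_pos: "\<forall>n \<ge> 1. \<forall>l \<le> Suc L. 1 \<le> Cs n l"
    and C0_fixed: "\<forall>n \<ge> 1. Cs n 0 = Cs 1 0"
    and CL_fixed: "\<forall>n \<ge> 1. Cs n (Suc L) = Cs 1 (Suc L)"
    and C_lim: "\<forall>l \<in> {1..L}. (\<lambda>n. real (Cs n l) / real n) \<longlonglongrightarrow> \<alpha> l"
    and \<alpha>_pos: "\<forall>l \<in> {1..L}. 0 < \<alpha> l"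
    and Ms_fin: "\<forall>l \<le> L. finite (Ms l) \<and> Ms l \<noteq> {}"
    and lam_pos: "\<forall>l \<le> L. 0 < lam l"
    and \<sigma>_cont: "continuous_on UNIV \<sigma>"
    and \<sigma>_lip: "\<forall>s t. \<bar>\<sigma> s - \<sigma> t\<bar> \<le> L\<sigma> * \<bar>s - t\<bar> + \<rho>\<sigma> s + \<rho>\<sigma> t"
    and L\<sigma>_nonneg: "0 \<le> L\<sigma>"
    and \<rho>\<sigma>_locbdd: "\<forall>r. \<exists>B. \<forall>s. \<bar>s\<bar> \<le> r \<longrightarrow> \<bar>\<rho>\<sigma> s\<bar> \<le> B"
    and \<rho>\<sigma>_small: "\<rho>\<sigma> \<in> o[at_infinity](\<lambda>s. s)"
    and R_cont: "\<forall>l \<in> {1..L}. \<forall>i \<in> {1..N (Suc l)}. \<forall>z. \<forall>e>0. \<exists>d>0. \<forall>z'.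
         vnorm (N l) (\<lambda>j. z' j - z j) < d \<longrightarrow>
         pnorm (Ms l) (\<lambda>m. R l i (vrest (N l) z') m - R l i (vrest (N l) z) m) < e"
    and R_lip: "\<forall>l \<in> {1..L}. \<forall>i \<in> {1..N (Suc l)}. \<forall>z z'.
         pnorm (Ms l) (\<lambda>m. R l i (vrest (N l) z) m - R l i (vrest (N l) z') m)
           \<le> LR * vnorm (N l) (\<lambda>j. z j - z' j) + \<rho>R l (vrest (N l) z) + \<rho>R l (vrest (N l) z')"
    and LR_nonneg: "0 \<le> LR"
    and \<rho>R_locbdd: "\<forall>l \<in> {1..L}. \<forall>r. \<exists>B. \<forall>z. vnorm (N l) z \<le> r \<longrightarrow> \<bar>\<rho>R l (vrest (N l) z)\<bar> \<le> B"
    and \<rho>R_small: "\<forall>l \<in> {1..L}. \<forall>e>0. \<exists>r. \<forall>z. r \<le> vnorm (N l) z \<longrightarrow>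
         \<bar>\<rho>R l (vrest (N l) z)\<bar> \<le> e * vnorm (N l) z"
  shows "good_LDP (tuple_topology L N P)
           (\<lambda>n. weight_prior L Ms (Cs n) lam)
           (\<lambda>n W. map (\<lambda>l. Kmat \<sigma> R Ms (Cs n) N P lam x W l) [1..<Suc L])
           (rate_total \<sigma> R Ms L N P lam (Cs 1 0) \<alpha> (K1 R Ms (Cs 1 0) N P lam x))"
proof -
  have layer: "layer_map P N \<sigma> Ms R lam L\<sigma> LR \<rho>\<sigma> \<rho>R l" if l: "l \<in> {1..L}" for l
  proof
    have "l \<le> L" using l by simp
    then show "finite (Ms l)" "Ms l \<noteq> {}" "0 < lam l" using Ms_fin lam_pos by auto
  qed (rule P_pos \<sigma>_cont L\<sigma>_nonneg \<rho>\<sigma>_small LR_nonneg \<sigma>_lip[rule_format] \<rho>\<sigma>_locbdd[rule_format]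
      R_cont[rule_format, OF l] R_lip[rule_format, OF l] \<rho>R_locbdd[rule_format, OF l] \<rho>R_small[rule_format, OF l]; assumption)+
  have "\<forall>l\<in>{1..L}. \<exists>\<Lambda>. feature_map (N l * P) ({..<N (Suc l) * P} \<times> {..<N (Suc l) * P})
      (\<lambda>z (a, b). Gmap \<sigma> R Ms N P lam l z $$ (a, b)) \<Lambda>"
    using layer_map.feature_map_Gmap[OF layer] by blast
  then obtain \<Lambda> where \<Lambda>: "\<And>l. l \<in> {1..L} \<Longrightarrow> feature_map (N l * P) ({..<N (Suc l) * P} \<times> {..<N (Suc l) * P})
      (\<lambda>z (a, b). Gmap \<sigma> R Ms N P lam l z $$ (a, b)) (\<Lambda> l)" by metis
  have net: "conv_net L P N \<sigma> Ms R lam \<Lambda>"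
  proof (rule conv_net.intro)
    show "(\<lambda>z. \<sigma> (R l i (vrest (N l) z) m)) \<in> borel_measurable borel"
      if "l \<in> {1..L}" "i \<in> {1..N (Suc l)}" "m \<in> Ms l" for l i m
      using layer_map.feature_continuous[OF layer[OF that(1)] that(2,3)] by (rule borel_measurable_continuous_onI)
  qed (erule \<Lambda> | use P_pos Ms_fin lam_pos in simp)+
  interpret wide_net L P N Cs \<alpha> \<sigma> Ms R lam x \<Lambda>
  proof (intro wide_net.intro net)
    show "Cs n 0 = Cs 1 0" if "1 \<le> n" for n using C0_fixed that by blast
  qed (use L_pos C_pos C_lim \<alpha>_pos in auto)
  show ?thesis using kernel_good_LDP unfolding X_def Kone_def .
qed

end
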